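(* Let $R=\Bbbk[z][x,y;\sigma,a]$ be a classical generalized Weyl algebra with $\sigma(z)=z-1$, where $a\in\Bbbk[z]$ is monic with $0$ as a root and $n=\deg_z(a)>2$. If $a$ is not reflective, then the group $\operatorname{Aut}_{\mathrm{fl}}(R)$ of filtered automorphisms of $R$ is generated by the maps $\Theta_\lambda$, $\lambda\in\Bbbk^\times$. If $a$ is reflective, then $\operatorname{Aut}_{\mathrm{fl}}(R)$ is generated by $\Omega$ and the maps $\Theta_\lambda$, $\lambda\in\Bbbk^\times$. Moreover, $\operatorname{hdet}(g)=1$ for all $g\in\operatorname{Aut}_{\mathrm{fl}}(R)$.
   Context: $\Bbbk$ is an algebraically closed field of characteristic zero; all algebras are $\Bbbk$-algebras. Classical GWA: $R=\Bbbk[z][x,y;\sigma,a]$, with $\sigma(z)=z-1$, is the ring obtained by adjoining to $\Bbbk[z]$ the variables $x,y$ subject to $xy=\sigma(a)$, $yx=a$, $xd=\sigma(d)x$, $yd=\sigma^{-1}(d)y$ for all $d\in\Bbbk[z]$. Standard filtration: the filtration on $R$ defined by $\deg x=\deg y=n$, $\deg z=2$; its associated graded ring is $\operatorname{gr}R\cong\Bbbk[x,y,z]/(yx-z^n)$. A filtered automorphism is a $\Bbbk$-algebra automorphism $\phi$ with $\deg(\phi(r))=\deg(r)$ for all $r\in R$. Reflective: $a$ is reflective if there is $\rho\in\Bbbk$ with $a(\rho-z)=(-1)^n a(z)$. Maps: $\Theta_\lambda$ ($\lambda\in\Bbbk^\times$) is the automorphism $x\mapsto\lambda x$, $y\mapsto\lambda^{-1}y$,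 $z\mapsto z$. If $a$ is reflective, $\Omega$ is the automorphism $x\mapsto y$, $y\mapsto(-1)^n x$, $z\mapsto 1+\rho-z$. Homological determinant: for a noetherian connected graded AS-Gorenstein algebra $A$ of injective dimension $d$ with graded maximal ideal $\mathfrak m$, one has $H^d_{\mathfrak m}(A)\cong A'(\ell)$, where $A'$ is the graded $\Bbbk$-dual of $A$ and $(\ell)$ a degree shift. A graded automorphism $g$ of $A$ induces a $g$-linear map on $H^d_{\mathfrak m}(A)$, which under this identification equals $c\,(g^{-1})'$ for some $c\in\Bbbk^\times$; one sets $\operatorname{hdet}_A(g)=c^{-1}$. For a filtered automorphism $g$ of a filtered algebra $R$ with $\operatorname{gr}R$ noetherian AS-Gorenstein, $\operatorname{hdet}_R(g):=\operatorname{hdet}_{\operatorname{gr}R}(\operatorname{gr}g)$, where $\operatorname{gr}g$ is the induced graded automorphism. *)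

theory Defs
  imports
    "HOL-Computational_Algebra.Polynomial"
    "HOL-Algebra.QuotRing"
    "HOL-Algebra.Generated_Groups"
    "HOL-Algebra.Bij"
    "HOL-Algebra.Module"
begin

hide_const (open) Polynomial.smult

text \<open>
  A \<open>'k\<close>-algebra is a record of type \<open>('k, 'r) module\<close>: a (noncommutative) ring together with a
  scalar multiplication by the field \<open>'k\<close>. The locale \<open>algebra\<close> of HOL-Algebra is not used because
  it requires commutative rings.
\<close>

section \<open>Algebras given by generators and relations\<close>

text \<open>
  The free algebra on a type of generators: finitely supported functions on words, with
  convolution product.
\<close>

definition free_alg :: "('k::field, 'g list \<Rightarrow> 'k) module" where
  "free_alg =
    \<lparr>carrier = {f. finite {w. f w \<noteq> 0}},
     mult = (\<lambda>f g w. \<Sum>i\<le>length w. f (take i w) * g (drop i w)),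
     one = (\<lambda>w. if w = [] then 1 else 0),
     zero = (\<lambda>w. 0),
     add = (\<lambda>f g w. f w + g w),
     smult = (\<lambda>c f w. c * f w)\<rparr>"

definition free_gen :: "'g \<Rightarrow> 'g list \<Rightarrow> 'k::field" where
  "free_gen v = (\<lambda>w. if w = [v] then 1 else 0)"

definition free_eval :: "('k::field, 'r) module \<Rightarrow> ('g \<Rightarrow> 'r) \<Rightarrow> ('g list \<Rightarrow> 'k) \<Rightarrow> 'r" where
  "free_eval A h f =
    (\<Oplus>\<^bsub>A\<^esub>w\<in>{w. f w \<noteq> 0}. f w \<odot>\<^bsub>A\<^esub> foldr (mult A) (map h w) \<one>\<^bsub>A\<^esub>)"

definition quot_alg :: "('k, 'r) module \<Rightarrow> 'r set \<Rightarrow> ('k, 'r set) module" where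
  "quot_alg A I =
    \<lparr>carrier = carrier (A Quot I),
     mult = mult (A Quot I),
     one = one (A Quot I),
     zero = zero (A Quot I),
     add = add (A Quot I),
     smult = (\<lambda>c C. \<Union>r\<in>C. I +>\<^bsub>A\<^esub> (c \<odot>\<^bsub>A\<^esub> r))\<rparr>"

lemma ring_free_alg: "ring (free_alg :: ('k::field, 'g list \<Rightarrow> 'k) module)"
proof (rule ringI)
  show "abelian_group (free_alg :: ('k, 'g list \<Rightarrow> 'k) module)"
  proof (rule abelian_groupI)
    fix f g :: "'g list \<Rightarrow> 'k"
    assume "f \<in> carrier free_alg" "g \<in> carrier free_alg"
    then have fin: "finite ({w. f w \<noteq> 0} \<union> {w. g w \<noteq> 0})"
      by (simp add: free_alg_def)
    have "{w. f w + g w \<noteq> 0} \<subseteq> {w. f w \<noteq> 0} \<union> {w. g w \<noteq> 0}"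
      by auto
    from finite_subset[OF this fin] show "f \<oplus>\<^bsub>free_alg\<^esub> g \<in> carrier free_alg"
      by (simp add: free_alg_def)
  next
    fix f :: "'g list \<Rightarrow> 'k"
    assume "f \<in> carrier free_alg"
    then show "\<exists>g\<in>carrier free_alg. g \<oplus>\<^bsub>free_alg\<^esub> f = \<zero>\<^bsub>free_alg\<^esub>"
      by (intro bexI[of _ "\<lambda>w. - f w"]) (auto simp: free_alg_def)
  qed (auto simp: free_alg_def algebra_simps)
next
  show "monoid (free_alg :: ('k, 'g list \<Rightarrow> 'k) module)"
  proof (rule monoidI)
    fix f g :: "'g list \<Rightarrow> 'k"
    assume "f \<in> carrier free_alg" "g \<in> carrier free_alg"
    then have fin: "finite ((\<lambda>(u, v). u @ v) ` ({w. f w \<noteq> 0} \<times> {w. g w \<noteq> 0}))"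
      by (simp add: free_alg_def)
    have "{w. (\<Sum>i\<le>length w. f (take i w) * g (drop i w)) \<noteq> 0} \<subseteq>
      (\<lambda>(u, v). u @ v) ` ({w. f w \<noteq> 0} \<times> {w. g w \<noteq> 0})"
    proof
      fix w assume "w \<in> {w. (\<Sum>i\<le>length w. f (take i w) * g (drop i w)) \<noteq> 0}"
      then obtain i where "f (take i w) * g (drop i w) \<noteq> 0"
        by (auto elim: sum.not_neutral_contains_not_neutral)
      then show "w \<in> (\<lambda>(u, v). u @ v) ` ({w. f w \<noteq> 0} \<times> {w. g w \<noteq> 0})"
        by (intro image_eqI[of _ _ "(take i w, drop i w)"]) auto
    qed
    with fin show "f \<otimes>\<^bsub>free_alg\<^esub> g \<in> carrier free_alg"
      by (simp add: free_alg_def finite_subset)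
  next
    show "\<one>\<^bsub>free_alg\<^esub> \<in> carrier (free_alg :: ('k, 'g list \<Rightarrow> 'k) module)"
      by (simp add: free_alg_def)
  next
    fix f g h :: "'g list \<Rightarrow> 'k"
    show "f \<otimes>\<^bsub>free_alg\<^esub> g \<otimes>\<^bsub>free_alg\<^esub> h = f \<otimes>\<^bsub>free_alg\<^esub> (g \<otimes>\<^bsub>free_alg\<^esub> h)"
    proof
      fix w :: "'g list"
      have "(f \<otimes>\<^bsub>free_alg\<^esub> g \<otimes>\<^bsub>free_alg\<^esub> h) w =
        (\<Sum>i\<le>length w. \<Sum>k\<le>i. f (take k w) * g (drop k (take i w)) * h (drop i w))"
        by (auto simp: free_alg_def sum_distrib_right min_def intro!: sum.cong)
      also have "(\<Sum>i\<le>length w. \<Sum>k\<le>i. f (take k w) * g (drop k (take i w)) * h (drop i w)) =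
        (\<Sum>k\<le>length w. \<Sum>i\<le>length w - k. f (take k w) * g (take i (drop k w)) * h (drop (i + k) w))"
        unfolding sum.Sigma[OF finite_atMost ballI[OF finite_atMost]]
        by (rule sum.reindex_bij_witness[where i = "\<lambda>(k, i). (i + k, k)" and j = "\<lambda>(i, k). (k, i - k)"])
          (auto simp: drop_take)
      also have "\<dots> = (f \<otimes>\<^bsub>free_alg\<^esub> (g \<otimes>\<^bsub>free_alg\<^esub> h)) w"
        by (auto simp: free_alg_def sum_distrib_left mult.assoc intro!: sum.cong)
      finally show "(f \<otimes>\<^bsub>free_alg\<^esub> g \<otimes>\<^bsub>free_alg\<^esub> h) w = (f \<otimes>\<^bsub>free_alg\<^esub> (g \<otimes>\<^bsub>free_alg\<^esub> h)) w" .
    qed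
  next
    fix f :: "'g list \<Rightarrow> 'k"
    have "(\<Sum>i\<le>length w. (if take i w = [] then 1 else 0) * f (drop i w)) =
      (\<Sum>i\<le>length w. if i = 0 then f w else 0)" for w
      by (rule sum.cong) auto
    then show "\<one>\<^bsub>free_alg\<^esub> \<otimes>\<^bsub>free_alg\<^esub> f = f"
      by (simp add: free_alg_def)
    have "(\<Sum>i\<le>length w. f (take i w) * (if drop i w = [] then 1 else 0)) =
      (\<Sum>i\<le>length w. if i = length w then f w else 0)" for w
      by (rule sum.cong) auto
    then show "f \<otimes>\<^bsub>free_alg\<^esub> \<one>\<^bsub>free_alg\<^esub> = f"
      by (simp add: free_alg_def)
  qed
qed (auto simp: free_alg_def algebra_simps sum.distrib)

section \<open>The classical generalized Weyl algebra\<close>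

datatype gen = X | Y | Z

text \<open>The inclusion of \<open>\<Bbbk>[z]\<close> into the free algebra on \<open>x, y, z\<close>.\<close>

definition zpoly :: "'k::field poly \<Rightarrow> gen list \<Rightarrow> 'k" where
  "zpoly p = (\<lambda>w. if set w \<subseteq> {Z} then poly.coeff p (length w) else 0)"

definition sigma :: "'k::field poly \<Rightarrow> 'k poly" where
  "sigma p = p \<circ>\<^sub>p [:-1, 1:]"

definition sigma_inv :: "'k::field poly \<Rightarrow> 'k poly" where
  "sigma_inv p = p \<circ>\<^sub>p [:1, 1:]"

definition gwa_relations :: "'k::field poly \<Rightarrow> (gen list \<Rightarrow> 'k) set" where
  "gwa_relations a = (let A = free_alg; x = free_gen X; y = free_gen Y in
     {(x \<otimes>\<^bsub>A\<^esub> y) \<ominus>\<^bsub>A\<^esub> zpoly (sigma a), (y \<otimes>\<^bsub>A\<^esub> x) \<ominus>\<^bsub>A\<^esub> zpoly a}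
     \<union> (\<Union>d. {(x \<otimes>\<^bsub>A\<^esub> zpoly d) \<ominus>\<^bsub>A\<^esub> (zpoly (sigma d) \<otimes>\<^bsub>A\<^esub> x),
              (y \<otimes>\<^bsub>A\<^esub> zpoly d) \<ominus>\<^bsub>A\<^esub> (zpoly (sigma_inv d) \<otimes>\<^bsub>A\<^esub> y)}))"

definition gwa_ideal :: "'k::field poly \<Rightarrow> (gen list \<Rightarrow> 'k) set" where
  "gwa_ideal a = Idl\<^bsub>free_alg\<^esub> (gwa_relations a)"

definition gwa :: "'k::field poly \<Rightarrow> ('k, (gen list \<Rightarrow> 'k) set) module" where
  "gwa a = quot_alg free_alg (gwa_ideal a)"

definition gwa_gen :: "'k::field poly \<Rightarrow> gen \<Rightarrow> (gen list \<Rightarrow> 'k) set" where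
  "gwa_gen a v = gwa_ideal a +>\<^bsub>free_alg\<^esub> free_gen v"

text \<open>
  The endomorphism of the generalized Weyl algebra induced by an assignment of the generators
  that respects the relations.
\<close>

definition gwa_map :: "'k::field poly \<Rightarrow> (gen \<Rightarrow> (gen list \<Rightarrow> 'k) set)
    \<Rightarrow> (gen list \<Rightarrow> 'k) set \<Rightarrow> (gen list \<Rightarrow> 'k) set" where
  "gwa_map a h = (\<lambda>C\<in>carrier (gwa a). the_elem (free_eval (gwa a) h ` C))"

definition Theta :: "'k::field poly \<Rightarrow> 'k \<Rightarrow> (gen list \<Rightarrow> 'k) set \<Rightarrow> (gen list \<Rightarrow> 'k) set" where
  "Theta a l = gwa_map a (\<lambda>v. case v of
       X \<Rightarrow> l \<odot>\<^bsub>gwa a\<^esub> gwa_gen a X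
     | Y \<Rightarrow> inverse l \<odot>\<^bsub>gwa a\<^esub> gwa_gen a Y
     | Z \<Rightarrow> gwa_gen a Z)"

definition reflective_at :: "'k::field poly \<Rightarrow> 'k \<Rightarrow> bool" where
  "reflective_at a \<rho> \<longleftrightarrow> a \<circ>\<^sub>p [:\<rho>, -1:] = Polynomial.smult ((-1) ^ Polynomial.degree a) a"

definition reflective :: "'k::field poly \<Rightarrow> bool" where
  "reflective a \<longleftrightarrow> (\<exists>\<rho>. reflective_at a \<rho>)"

definition Omega :: "'k::field poly \<Rightarrow> 'k \<Rightarrow> (gen list \<Rightarrow> 'k) set \<Rightarrow> (gen list \<Rightarrow> 'k) set" where
  "Omega a \<rho> = gwa_map a (\<lambda>v. case v of
       X \<Rightarrow> gwa_gen a Y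
     | Y \<Rightarrow> ((-1) ^ Polynomial.degree a) \<odot>\<^bsub>gwa a\<^esub> gwa_gen a X
     | Z \<Rightarrow> ((1 + \<rho>) \<odot>\<^bsub>gwa a\<^esub> \<one>\<^bsub>gwa a\<^esub>) \<ominus>\<^bsub>gwa a\<^esub> gwa_gen a Z)"

section \<open>Filtered algebras\<close>

text \<open>
  Filtrations and gradings are indexed by the integers so that degree shifts need no case
  distinctions; all filtrations considered are zero in negative degrees.
\<close>

fun gen_weight :: "nat \<Rightarrow> gen \<Rightarrow> nat" where
  "gen_weight n X = n"
| "gen_weight n Y = n"
| "gen_weight n Z = 2"

definition std_filtration :: "'k::field poly \<Rightarrow> int \<Rightarrow> (gen list \<Rightarrow> 'k) set set" where
  "std_filtration a i =
    {gwa_ideal a +>\<^bsub>free_alg\<^esub> f | f. f \<in> carrier free_alg \<and>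
       (\<forall>w. f w \<noteq> 0 \<longrightarrow> int (sum_list (map (gen_weight (Polynomial.degree a)) w)) \<le> i)}"

text \<open>
  With this definition zero has degree 0; this is harmless below, since an automorphism
  preserves both zero and the nonzero elements.
\<close>

definition fdeg :: "(int \<Rightarrow> 'r set) \<Rightarrow> 'r \<Rightarrow> nat" where
  "fdeg F r = (LEAST i. r \<in> F (int i))"

definition alg_aut :: "('k, 'r) module \<Rightarrow> ('r \<Rightarrow> 'r) set" where
  "alg_aut A = {\<phi> \<in> Bij (carrier A). \<phi> \<in> ring_hom A A \<and>
     (\<forall>c. \<forall>r\<in>carrier A. \<phi> (c \<odot>\<^bsub>A\<^esub> r) = c \<odot>\<^bsub>A\<^esub> \<phi> r)}"

definition Aut_fl :: "('k, 'r) module \<Rightarrow> (int \<Rightarrow> 'r set) \<Rightarrow> ('r \<Rightarrow> 'r) monoid" where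
  "Aut_fl A F = (BijGroup (carrier A))
     \<lparr>carrier := {\<phi> \<in> alg_aut A. \<forall>r\<in>carrier A. fdeg F (\<phi> r) = fdeg F r}\<rparr>"

text \<open>
  The associated graded algebra: its elements are the finitely supported families of cosets
  in \<open>F i / F (i - 1)\<close>.
\<close>

definition gr_alg :: "('k, 'r) module \<Rightarrow> (int \<Rightarrow> 'r set) \<Rightarrow> ('k, int \<Rightarrow> 'r set) module" where
  "gr_alg A F =
    \<lparr>carrier = {u. (\<forall>i. \<exists>r\<in>F i. u i = F (i - 1) +>\<^bsub>A\<^esub> r) \<and> finite {i. u i \<noteq> F (i - 1)}},
     mult = (\<lambda>u v m. \<Union>{F (m - 1) +>\<^bsub>A\<^esub> (\<Oplus>\<^bsub>A\<^esub>i\<in>{0..m}. s i \<otimes>\<^bsub>A\<^esub> t (m - i)) | s t.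
                       (\<forall>i. s i \<in> u i) \<and> (\<forall>i. t i \<in> v i)}),
     one = (\<lambda>i. F (i - 1) +>\<^bsub>A\<^esub> (if i = 0 then \<one>\<^bsub>A\<^esub> else \<zero>\<^bsub>A\<^esub>)),
     zero = (\<lambda>i. F (i - 1)),
     add = (\<lambda>u v i. u i <+>\<^bsub>A\<^esub> v i),
     smult = (\<lambda>c u i. \<Union>r\<in>u i. F (i - 1) +>\<^bsub>A\<^esub> (c \<odot>\<^bsub>A\<^esub> r))\<rparr>"

definition gr_comp :: "('k, 'r) module \<Rightarrow> (int \<Rightarrow> 'r set) \<Rightarrow> int \<Rightarrow> (int \<Rightarrow> 'r set) set" where
  "gr_comp A F i = {u \<in> carrier (gr_alg A F). \<forall>m. m \<noteq> i \<longrightarrow> u m = F (m - 1)}"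

definition gr_map :: "('k, 'r) module \<Rightarrow> (int \<Rightarrow> 'r set) \<Rightarrow> ('r \<Rightarrow> 'r)
    \<Rightarrow> (int \<Rightarrow> 'r set) \<Rightarrow> int \<Rightarrow> 'r set" where
  "gr_map A F g = (\<lambda>u\<in>carrier (gr_alg A F). \<lambda>i. g ` u i)"

section \<open>Graded Ext and local cohomology\<close>

text \<open>
  Let \<open>A\<close> be a graded algebra with components \<open>G i\<close> and let \<open>I\<close> be a graded left ideal. The graded
  group \<open>Ext\<^sup>p(A/I, A)\<close> of left modules is computed by the bar resolution of \<open>A/I\<close>. A \<open>p\<close>-cochain is
  a multilinear map on \<open>p\<close> copies of \<open>A\<close> followed by one copy of \<open>A/I\<close>, with values in \<open>A\<close>;
  it is written as a function on lists of \<open>p + 1\<close> elements of \<open>A\<close> that vanishes when the last entry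
  lies in \<open>I\<close>, and it is set to zero on all other lists. The index \<open>j\<close> is the internal degree.
\<close>

definition tuples :: "('k, 'r) module \<Rightarrow> nat \<Rightarrow> 'r list set" where
  "tuples A p = {as. set as \<subseteq> carrier A \<and> length as = p}"

definition cochains :: "('k, 'r) module \<Rightarrow> (int \<Rightarrow> 'r set) \<Rightarrow> 'r set \<Rightarrow> nat \<Rightarrow> int \<Rightarrow> ('r list \<Rightarrow> 'r) set"
  where
  "cochains A G I p j = {f.
     (\<forall>as\<in>tuples A (Suc p). f as \<in> carrier A) \<and>
     (\<forall>as. as \<notin> tuples A (Suc p) \<longrightarrow> f as = \<zero>\<^bsub>A\<^esub>) \<and>
     (\<forall>as\<in>tuples A (Suc p). \<forall>q\<le>p. \<forall>u\<in>carrier A. \<forall>v\<in>carrier A.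
        f (as[q := u \<oplus>\<^bsub>A\<^esub> v]) = f (as[q := u]) \<oplus>\<^bsub>A\<^esub> f (as[q := v])) \<and>
     (\<forall>as\<in>tuples A (Suc p). \<forall>q\<le>p. \<forall>u\<in>carrier A. \<forall>c.
        f (as[q := c \<odot>\<^bsub>A\<^esub> u]) = c \<odot>\<^bsub>A\<^esub> f (as[q := u])) \<and>
     (\<forall>as\<in>tuples A (Suc p). \<forall>es. list_all2 (\<lambda>r e. r \<in> G e) as es \<longrightarrow> f as \<in> G (sum_list es + j)) \<and>
     (\<forall>as\<in>tuples A (Suc p). last as \<in> I \<longrightarrow> f as = \<zero>\<^bsub>A\<^esub>)}"

definition bar_diff :: "('k::field, 'r) module \<Rightarrow> nat \<Rightarrow> ('r list \<Rightarrow> 'r) \<Rightarrow> 'r list \<Rightarrow> 'r" where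
  "bar_diff A p f = (\<lambda>as. if as \<in> tuples A (p + 2) then
     (hd as \<otimes>\<^bsub>A\<^esub> f (tl as)) \<oplus>\<^bsub>A\<^esub>
     (\<Oplus>\<^bsub>A\<^esub>q\<in>{0..p}. (-1) ^ Suc q \<odot>\<^bsub>A\<^esub>
        f (take q as @ [as ! q \<otimes>\<^bsub>A\<^esub> as ! Suc q] @ drop (q + 2) as))
     else \<zero>\<^bsub>A\<^esub>)"

definition cocycles :: "('k::field, 'r) module \<Rightarrow> (int \<Rightarrow> 'r set) \<Rightarrow> 'r set \<Rightarrow> nat \<Rightarrow> int \<Rightarrow> ('r list \<Rightarrow> 'r) set"
  where
  "cocycles A G I p j = {f \<in> cochains A G I p j. bar_diff A p f = (\<lambda>as. \<zero>\<^bsub>A\<^esub>)}"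

definition coboundaries :: "('k::field, 'r) module \<Rightarrow> (int \<Rightarrow> 'r set) \<Rightarrow> 'r set \<Rightarrow> nat \<Rightarrow> int \<Rightarrow> ('r list \<Rightarrow> 'r) set"
  where
  "coboundaries A G I p j =
     (case p of 0 \<Rightarrow> {\<lambda>as. \<zero>\<^bsub>A\<^esub>} | Suc q \<Rightarrow> bar_diff A q ` cochains A G I q j)"

definition graded_left_ideal :: "('k, 'r) module \<Rightarrow> (int \<Rightarrow> 'r set) \<Rightarrow> 'r set \<Rightarrow> bool" where
  "graded_left_ideal A G I \<longleftrightarrow>
     additive_subgroup I A \<and>
     (\<forall>r\<in>carrier A. \<forall>s\<in>I. r \<otimes>\<^bsub>A\<^esub> s \<in> I) \<and>
     I = generate (add_monoid A) (\<Union>i. I \<inter> G i)"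

text \<open>
  The (graded) injective dimension of \<open>A\<close> as a left module over itself. By Baer's criterion
  it suffices to test cyclic modules; quantifying over all modules is not possible in HOL.
\<close>

definition inj_dim_le :: "('k::field, 'r) module \<Rightarrow> (int \<Rightarrow> 'r set) \<Rightarrow> nat \<Rightarrow> bool" where
  "inj_dim_le A G d \<longleftrightarrow>
     (\<forall>I p j. graded_left_ideal A G I \<and> d < p \<longrightarrow> cocycles A G I p j \<subseteq> coboundaries A G I p j)"

definition has_inj_dim :: "('k::field, 'r) module \<Rightarrow> (int \<Rightarrow> 'r set) \<Rightarrow> nat \<Rightarrow> bool" where
  "has_inj_dim A G d \<longleftrightarrow> inj_dim_le A G d \<and> (\<forall>d'<d. \<not> inj_dim_le A G d')"

definition trunc :: "('k, 'r) module \<Rightarrow> (int \<Rightarrow> 'r set) \<Rightarrow> nat \<Rightarrow> 'r set" where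
  "trunc A G k = generate (add_monoid A) (\<Union>i\<in>{int k..}. G i)"

text \<open>
  The local cohomology of \<open>A\<close> at its graded maximal ideal is the direct limit over \<open>k\<close> of the groups
  \<open>Ext\<^sup>d(A/A\<^bsub>\<ge>k\<^esub>, A)\<close>. The transition maps are induced by the projections of the modules \<open>A/A\<^bsub>\<ge>k\<^esub>\<close>;
  on cochains, written as functions on lists over \<open>A\<close>, they are inclusions. So an element of the
  limit is represented by a cocycle for some \<open>k\<close>, and two cocycles represent the same element iff
  they differ by a coboundary for some \<open>k\<close>.
\<close>

definition lc_cocycles :: "('k::field, 'r) module \<Rightarrow> (int \<Rightarrow> 'r set) \<Rightarrow> nat \<Rightarrow> int \<Rightarrow> ('r list \<Rightarrow> 'r) set"
  where
  "lc_cocycles A G d j = (\<Union>k. cocycles A G (trunc A G k) d j)"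

definition lc_class :: "('k::field, 'r) module \<Rightarrow> (int \<Rightarrow> 'r set) \<Rightarrow> nat \<Rightarrow> int
    \<Rightarrow> ('r list \<Rightarrow> 'r) \<Rightarrow> ('r list \<Rightarrow> 'r) set" where
  "lc_class A G d j f = {f' \<in> lc_cocycles A G d j.
     \<exists>k. (\<lambda>as. f' as \<ominus>\<^bsub>A\<^esub> f as) \<in> coboundaries A G (trunc A G k) d j}"

definition local_cohomology :: "('k::field, 'r) module \<Rightarrow> (int \<Rightarrow> 'r set) \<Rightarrow> nat \<Rightarrow> int
    \<Rightarrow> ('r list \<Rightarrow> 'r) set set" where
  "local_cohomology A G d j = lc_class A G d j ` lc_cocycles A G d j"

section \<open>The homological determinant\<close>

text \<open>
  The component of degree \<open>i\<close> of the graded dual \<open>A'\<close>: linear functionals that vanish on all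
  components of \<open>A\<close> except the one of degree \<open>-i\<close> (and, by convention, outside the carrier).
\<close>

definition graded_dual :: "('k::field, 'r) module \<Rightarrow> (int \<Rightarrow> 'r set) \<Rightarrow> int \<Rightarrow> ('r \<Rightarrow> 'k) set" where
  "graded_dual A G i = {\<theta>.
     (\<forall>r\<in>carrier A. \<forall>s\<in>carrier A. \<theta> (r \<oplus>\<^bsub>A\<^esub> s) = \<theta> r + \<theta> s) \<and>
     (\<forall>c. \<forall>r\<in>carrier A. \<theta> (c \<odot>\<^bsub>A\<^esub> r) = c * \<theta> r) \<and>
     (\<forall>r. r \<notin> carrier A \<longrightarrow> \<theta> r = 0) \<and>
     (\<forall>e. e \<noteq> - i \<longrightarrow> (\<forall>r\<in>G e. \<theta> r = 0))}"

text \<open>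
  Isomorphisms of graded right modules from the \<open>d\<close>-th local cohomology to \<open>A'(l)\<close>. The right module
  structures come from right multiplication on the values of cochains, respectively from left
  multiplication on the arguments of functionals.
\<close>

definition lc_dual_iso :: "('k::field, 'r) module \<Rightarrow> (int \<Rightarrow> 'r set) \<Rightarrow> nat \<Rightarrow> int
    \<Rightarrow> (int \<Rightarrow> ('r list \<Rightarrow> 'r) set \<Rightarrow> 'r \<Rightarrow> 'k) \<Rightarrow> bool" where
  "lc_dual_iso A G d l \<phi> \<longleftrightarrow>
     (\<forall>j. bij_betw (\<phi> j) (local_cohomology A G d j) (graded_dual A G (j + l))) \<and>
     (\<forall>j. \<forall>f\<in>lc_cocycles A G d j. \<forall>f'\<in>lc_cocycles A G d j.
        \<phi> j (lc_class A G d j (\<lambda>as. f as \<oplus>\<^bsub>A\<^esub> f' as)) =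
        (\<lambda>r. \<phi> j (lc_class A G d j f) r + \<phi> j (lc_class A G d j f') r)) \<and>
     (\<forall>j e. \<forall>b\<in>G e. \<forall>f\<in>lc_cocycles A G d j.
        \<phi> (j + e) (lc_class A G d (j + e) (\<lambda>as. f as \<otimes>\<^bsub>A\<^esub> b)) =
        (\<lambda>r. if r \<in> carrier A then \<phi> j (lc_class A G d j f) (b \<otimes>\<^bsub>A\<^esub> r) else 0))"

text \<open>
  The map on cochains induced by a graded automorphism \<open>g\<close>, viewed as an isomorphism from \<open>A\<close>
  to its twist along \<open>g\<close>.
\<close>

definition cochain_act :: "('k, 'r) module \<Rightarrow> nat \<Rightarrow> ('r \<Rightarrow> 'r) \<Rightarrow> ('r list \<Rightarrow> 'r) \<Rightarrow> 'r list \<Rightarrow> 'r" where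
  "cochain_act A d g f = (\<lambda>as. if as \<in> tuples A (Suc d)
     then g (f (map (inv_into (carrier A) g) as)) else \<zero>\<^bsub>A\<^esub>)"

text \<open>
  The map induced by \<open>g\<close> on local cohomology corresponds to \<open>c (g\<^sup>-\<^sup>1)'\<close>, and the
  homological determinant is the inverse of \<open>c\<close>.
\<close>

definition has_hdet :: "('k::field, 'r) module \<Rightarrow> (int \<Rightarrow> 'r set) \<Rightarrow> ('r \<Rightarrow> 'r) \<Rightarrow> 'k \<Rightarrow> bool" where
  "has_hdet A G g h \<longleftrightarrow> (\<exists>d l \<phi> c.
     has_inj_dim A G d \<and> lc_dual_iso A G d l \<phi> \<and> c \<noteq> 0 \<and>
     (\<forall>j. \<forall>f\<in>lc_cocycles A G d j.
        \<phi> j (lc_class A G d j (cochain_act A d g f)) =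
        (\<lambda>r. if r \<in> carrier A
          then c * \<phi> j (lc_class A G d j f) (inv_into (carrier A) g r) else 0)) \<and>
     h = inverse c)"

definition hdet :: "('k::field, 'r) module \<Rightarrow> (int \<Rightarrow> 'r set) \<Rightarrow> ('r \<Rightarrow> 'r) \<Rightarrow> 'k" where
  "hdet A G g = (THE h. has_hdet A G g h)"

definition hdet_fl :: "('k::field, 'r) module \<Rightarrow> (int \<Rightarrow> 'r set) \<Rightarrow> ('r \<Rightarrow> 'r) \<Rightarrow> 'k" where
  "hdet_fl A F g = hdet (gr_alg A F) (gr_comp A F) (gr_map A F g)"

end

theory Submission
  imports Defs "HOL-Library.Poly_Mapping" "HOL-Library.Product_Plus"
begin

text \<open>
  The algebra \<open>R\<close> acts faithfully on sequences of polynomials indexed by the integers: \<open>x\<close> shifts, \<open>z\<close> acts by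
  \<open>z + i\<close> at place \<open>i\<close>, and \<open>y\<close> shifts back with a factor \<open>a(z + i)\<close>. In this representation the standard
  filtration is the filtration by weights (\<open>F_wle\<close>, \<open>wle_F\<close>), and on top weights every element acts by
  multiplication with its symbol (\<open>F_mulp\<close>). This gives normal forms and the isomorphism of \<open>gr R\<close> with
  \<open>\<Bbbk>[x, y, z] / (y x - z\<^sup>n)\<close> (\<open>gr_sing_algebra\<close>).

  The automorphisms are found directly (\<open>classification\<close>). A filtered automorphism \<open>\<phi>\<close> maps \<open>z\<close> to
  \<open>\<alpha> z + \<beta>\<close>, because \<open>n > 2\<close> leaves nothing else in degree two. The relations of \<open>z\<close> with \<open>x\<close> and \<open>y\<close>
  make \<open>\<phi>(x)\<close> and \<open>\<phi>(y)\<close> eigenvectors for the commutator with \<open>\<phi>(z)\<close>, so that either \<open>\<alpha> = 1\<close> and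
  \<open>x\<close>, \<open>y\<close> are scaled, or \<open>\<alpha> = -1\<close> and they are exchanged (\<open>eigen_form\<close>). The relation \<open>y x = a\<close> then
  says that \<open>a\<close> is invariant under the translation by \<open>\<beta>\<close>, which forces \<open>\<beta> = 0\<close> in characteristic zero
  (\<open>shift_invariant\<close>), or that \<open>a\<close> is reflective. Hence \<open>\<phi>\<close> is some \<open>\<Theta>\<^sub>\<lambda>\<close> or some \<open>\<Omega> \<Theta>\<^sub>\<lambda>\<close>.

  For the homological determinant, the graded ring is written as the ring of invariants \<open>sing n\<close> inside
  a polynomial ring \<open>\<Bbbk>[u, v]\<close>. It is free over \<open>\<Bbbk>[x, y]\<close> with a Frobenius form, and a Koszul argument
  in the bar complex shows that \<open>Ext\<^sup>p(-, T)\<close> vanishes for \<open>p > 2\<close> (\<open>ext_vanishes\<close>) and that the second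
  local cohomology is the graded dual shifted by two, through an explicit residue pairing
  (\<open>theta_coboundary\<close>, \<open>theta_injective\<close>, \<open>theta_surjective\<close>, \<open>lc_dual\<close>). The maps \<open>\<Theta>\<^sub>\<lambda>\<close> and \<open>\<Omega>\<close> induce
  monomial automorphisms. The residue pairing changes by the scalar through which such a map acts on
  \<open>z\<close> and by a sign if \<open>x\<close> and \<open>y\<close> are exchanged (\<open>theta_twist\<close>). For \<open>\<Theta>\<^sub>\<lambda>\<close> both are trivial; for
  \<open>\<Omega>\<close>, which sends \<open>z\<close> to \<open>- z\<close> up to lower terms, the two signs cancel. So the determinant is one.
\<close>

section \<open>Laurent polynomials in two variables\<close>

type_synonym 'k laurent = "(int \<times> int) \<Rightarrow>\<^sub>0 'k"

abbreviation lcoeff :: "'k::zero laurent \<Rightarrow> int \<times> int \<Rightarrow> 'k"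
  where "lcoeff \<equiv> Poly_Mapping.lookup"

abbreviation lterm :: "int \<times> int \<Rightarrow> 'k::zero \<Rightarrow> 'k laurent"
  where "lterm \<equiv> Poly_Mapping.single"

lemma laurent_eqI: "(\<And>p q. lcoeff f (p, q) = lcoeff g (p, q)) \<Longrightarrow> f = g"
  by (rule poly_mapping_eqI) auto

lemma lcoeff_term_mult:
  fixes f :: "'k::field laurent"
  shows "lcoeff (lterm k c * f) m = c * lcoeff f (m - k)"
proof -
  have eq: "(m = k + q) = (q = m - k)" for q
    by (auto simp: algebra_simps)
  have "lcoeff (lterm k c * f) m
      = (\<Sum>l. (c when l = k) * (\<Sum>q. lcoeff f q when m = l + q))"
    unfolding times_poly_mapping.rep_eq prod_fun_def
    by (intro Sum_any.cong) (auto simp: lookup_single when_def)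
  also have "\<dots> = (\<Sum>l. (c * (\<Sum>q. lcoeff f q when m = k + q)) when l = k)"
    by (intro Sum_any.cong) (auto simp: when_def)
  also have "\<dots> = c * lcoeff f (m - k)"
    by (simp add: eq)
  finally show ?thesis .
qed

lemma laurent_sum_terms: "(\<Sum>k\<in>Poly_Mapping.keys f. lterm k (lcoeff f k)) = f"
proof (rule poly_mapping_eqI)
  fix m
  show "lcoeff (\<Sum>k\<in>Poly_Mapping.keys f. lterm k (lcoeff f k)) m = lcoeff f m"
    by (auto simp: lookup_sum lookup_single when_def sum.delta' in_keys_iff
        intro: not_in_keys_iff_lookup_eq_zero[THEN iffD1])
qed

lemma lcoeff_mult:
  fixes f g :: "'k::field laurent"
  shows "lcoeff (f * g) m = (\<Sum>k\<in>Poly_Mapping.keys f. lcoeff f k * lcoeff g (m - k))"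
proof -
  have "f * g = (\<Sum>k\<in>Poly_Mapping.keys f. lterm k (lcoeff f k) * g)"
    by (subst (1) laurent_sum_terms[of f, symmetric]) (simp add: sum_distrib_right)
  then show ?thesis
    by (simp add: lookup_sum lcoeff_term_mult)
qed

definition part :: "(int \<times> int) set \<Rightarrow> 'k::zero laurent \<Rightarrow> 'k laurent"
  where "part K f = Abs_poly_mapping (\<lambda>k. if k \<in> K then lcoeff f k else 0)"

lemma lcoeff_part [simp]: "lcoeff (part K f) k = (if k \<in> K then lcoeff f k else 0)"
proof -
  have "finite {k. (if k \<in> K then lcoeff f k else 0) \<noteq> 0}"
    by (rule finite_subset[OF _ finite_lookup[of f]]) auto
  then show ?thesis
    by (simp add: part_def)
qed

abbreviation scale :: "'k::field \<Rightarrow> 'k laurent \<Rightarrow> 'k laurent"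
  where "scale c f \<equiv> lterm 0 c * f"

lemma lcoeff_scale [simp]: "lcoeff (scale c f) k = c * lcoeff f k"
  by (simp add: lcoeff_term_mult)

lemma part_add: "part K (f + g) = part K f + part K (g :: 'k::field laurent)"
  by (rule poly_mapping_eqI) (simp add: lookup_add)

lemma part_diff: "part K (f - g) = part K f - part K (g :: 'k::field laurent)"
  by (rule poly_mapping_eqI) (simp add: lookup_minus)

lemma part_zero [simp]: "part K 0 = (0 :: 'k::field laurent)"
  by (rule poly_mapping_eqI) simp

lemma part_scale: "part K (scale c f) = scale c (part K f)"
  by (rule poly_mapping_eqI) simp

lemma part_sum: "part K (\<Sum>i\<in>I. f i) = (\<Sum>i\<in>I. part K (f i :: 'k::field laurent))"
  by (rule poly_mapping_eqI) (simp add: lookup_sum)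

definition linear_op :: "('k::field laurent \<Rightarrow> 'k laurent) \<Rightarrow> bool"
  where "linear_op \<beta> \<longleftrightarrow> (\<forall>u v. \<beta> (u + v) = \<beta> u + \<beta> v) \<and> (\<forall>c u. \<beta> (scale c u) = scale c (\<beta> u))"

lemma linear_op_mult: "linear_op ((*) c)"
  by (simp add: linear_op_def algebra_simps)

lemma linear_op_part: "linear_op (part K)"
  by (simp add: linear_op_def part_add part_scale)

lemma linear_op_comp: "linear_op \<beta> \<Longrightarrow> linear_op \<gamma> \<Longrightarrow> linear_op (\<lambda>u. \<beta> (\<gamma> u))"
  by (simp add: linear_op_def)

lemma linear_opD:
  assumes "linear_op \<beta>"
  shows "\<beta> (u + v) = \<beta> u + \<beta> v" "\<beta> (scale c u) = scale c (\<beta> u)" "\<beta> 0 = 0"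
    "\<beta> (u - v) = \<beta> u - \<beta> v" "\<beta> (- u) = - \<beta> u"
proof -
  show 1: "\<beta> (u + v) = \<beta> u + \<beta> v" "\<beta> (scale c u) = scale c (\<beta> u)" for u v
    using assms by (auto simp: linear_op_def)
  show 2: "\<beta> 0 = 0"
    using 1(1)[of 0 0] by simp
  show 3: "\<beta> (u - v) = \<beta> u - \<beta> v" for u v
    using 1(1)[of "u - v" v] by (simp add: algebra_simps)
  show "\<beta> (- u) = - \<beta> u"
    using 3[of 0 u] 2 by simp
qed

definition homog :: "int \<Rightarrow> 'k::zero laurent set"
  where "homog d = {f. \<forall>p q. lcoeff f (p, q) \<noteq> 0 \<longrightarrow> p + q = d}"

lemma homog_zero [simp]: "0 \<in> homog d"
  by (simp add: homog_def)

lemma homog_add: "f \<in> homog d \<Longrightarrow> g \<in> homog d \<Longrightarrow> f + g \<in> homog (d :: int)"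
  for f g :: "'k::field laurent"
  unfolding homog_def mem_Collect_eq lookup_add by (metis add.right_neutral)

lemma homog_uminus: "f \<in> homog d \<Longrightarrow> - f \<in> homog d" for f :: "'k::field laurent"
  by (auto simp: homog_def)

lemma homog_diff: "f \<in> homog d \<Longrightarrow> g \<in> homog d \<Longrightarrow> f - g \<in> homog d"
  for f g :: "'k::field laurent"
  by (metis diff_conv_add_uminus homog_add homog_uminus)

lemma homog_sum: "(\<And>i. i \<in> I \<Longrightarrow> f i \<in> homog d) \<Longrightarrow> (\<Sum>i\<in>I. f i) \<in> homog d"
  for f :: "'i \<Rightarrow> 'k::field laurent"
  by (induction I rule: infinite_finite_induct) (auto intro: homog_add)

lemma homog_term: "p + q = d \<Longrightarrow> lterm (p, q) c \<in> homog d"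
  by (auto simp: homog_def lookup_single when_def split: if_splits)

lemma homog_mult:
  fixes f g :: "'k::field laurent"
  assumes "f \<in> homog d" "g \<in> homog e"
  shows "f * g \<in> homog (d + e)"
  unfolding homog_def
proof safe
  fix p q
  assume "lcoeff (f * g) (p, q) \<noteq> 0"
  then obtain k where "lcoeff f k * lcoeff g ((p, q) - k) \<noteq> 0"
    unfolding lcoeff_mult by (auto elim: sum.not_neutral_contains_not_neutral)
  then show "p + q = d + e"
    using assms by (cases k) (auto simp: homog_def, fastforce)
qed

lemma homog_part: "f \<in> homog d \<Longrightarrow> part K f \<in> homog d"
  by (auto simp: homog_def split: if_splits)

section \<open>The graded ring of a type A singularity\<close>

text \<open>
  Exponents of the monomials \<open>u\<^sup>p v\<^sup>q\<close> fixed by the cyclic group of order \<open>n\<close> that acts on the plane with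
  opposite weights. The ring \<open>sing n\<close> they span is \<open>\<Bbbk>[x, y, z] / (y x - z\<^sup>n)\<close> with \<open>x = v\<^sup>n\<close>, \<open>y = u\<^sup>n\<close> and
  \<open>z = u v\<close>, and the total degree \<open>p + q\<close> gives \<open>x\<close>, \<open>y\<close>, \<open>z\<close> the degrees \<open>n\<close>, \<open>n\<close>, \<open>2\<close>. Having one
  monomial basis inside a Laurent polynomial ring makes division by \<open>x\<close> and \<open>y\<close>, and residues, explicit.
\<close>

definition cone :: "nat \<Rightarrow> (int \<times> int) set"
  where "cone n = {(p, q). 0 \<le> p \<and> 0 \<le> q \<and> int n dvd q - p}"

definition sing :: "nat \<Rightarrow> 'k::zero laurent set"
  where "sing n = {f. \<forall>k. lcoeff f k \<noteq> 0 \<longrightarrow> k \<in> cone n}"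

lemma zero_in_cone [simp]: "0 \<in> cone n"
  by (simp add: cone_def zero_prod_def)

lemma cone_add: "k \<in> cone n \<Longrightarrow> l \<in> cone n \<Longrightarrow> k + l \<in> cone n"
proof -
  assume "k \<in> cone n" "l \<in> cone n"
  then have "int n dvd (snd k - fst k) + (snd l - fst l)" "0 \<le> fst k" "0 \<le> snd k" "0 \<le> fst l" "0 \<le> snd l"
    by (auto simp: cone_def)
  then show ?thesis
    by (cases k; cases l) (simp add: cone_def algebra_simps)
qed

lemma singD: "f \<in> sing n \<Longrightarrow> lcoeff f k \<noteq> 0 \<Longrightarrow> k \<in> cone n"
  unfolding sing_def by blast

lemma sing_zero [simp]: "0 \<in> sing n"
  by (simp add: sing_def)

lemma sing_term: "k \<in> cone n \<Longrightarrow> lterm k c \<in> sing n"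
  by (auto simp: sing_def lookup_single when_def split: if_splits)

lemma sing_one [simp]: "1 \<in> sing n"
  using sing_term[of 0 n 1] by (simp add: cone_def zero_prod_def flip: single_one)

lemma sing_add: "f \<in> sing n \<Longrightarrow> g \<in> sing n \<Longrightarrow> f + g \<in> sing n" for f g :: "'k::field laurent"
  unfolding sing_def mem_Collect_eq lookup_add by (metis add.right_neutral)

lemma sing_uminus: "f \<in> sing n \<Longrightarrow> - f \<in> sing n" for f :: "'k::field laurent"
  by (simp add: sing_def)

lemma sing_diff: "f \<in> sing n \<Longrightarrow> g \<in> sing n \<Longrightarrow> f - g \<in> sing n"
  for f g :: "'k::field laurent"
  by (metis diff_conv_add_uminus sing_add sing_uminus)

lemma sing_sum: "(\<And>i. i \<in> I \<Longrightarrow> f i \<in> sing n) \<Longrightarrow> (\<Sum>i\<in>I. f i) \<in> sing n"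
  for f :: "'i \<Rightarrow> 'k::field laurent"
  by (induction I rule: infinite_finite_induct) (auto intro: sing_add)

lemma sing_mult:
  fixes f g :: "'k::field laurent"
  assumes "f \<in> sing n" "g \<in> sing n"
  shows "f * g \<in> sing n"
  unfolding sing_def
proof safe
  fix m
  assume "lcoeff (f * g) m \<noteq> 0"
  then obtain k where "lcoeff f k * lcoeff g (m - k) \<noteq> 0"
    unfolding lcoeff_mult by (auto elim: sum.not_neutral_contains_not_neutral)
  then have "k \<in> cone n" "m - k \<in> cone n"
    using assms by (auto intro: singD)
  then show "m \<in> cone n"
    using cone_add[of k n "m - k"] by simp
qed

lemma sing_scale: "f \<in> sing n \<Longrightarrow> scale c f \<in> sing n"
  by (auto simp: sing_def)

lemma sing_power: "f \<in> sing n \<Longrightarrow> f ^ i \<in> sing n" for f :: "'k::field laurent"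
  by (induction i) (auto intro: sing_mult)

lemma sing_induct [consumes 1, case_names zero add monomial]:
  fixes f :: "'k::field laurent"
  assumes "f \<in> sing n" "P 0" "\<And>f g. f \<in> sing n \<Longrightarrow> g \<in> sing n \<Longrightarrow> P f \<Longrightarrow> P g \<Longrightarrow> P (f + g)"
    "\<And>p q c. (p, q) \<in> cone n \<Longrightarrow> P (lterm (p, q) c)"
  shows "P f"
proof -
  have "P (\<Sum>k\<in>K. lterm k (lcoeff f k)) \<and> (\<Sum>k\<in>K. lterm k (lcoeff f k)) \<in> sing n"
    if "finite K" "K \<subseteq> Poly_Mapping.keys f" for K
    using that
  proof (induction K)
    case empty
    then show ?case using assms(2) by simp
  next
    case (insert k K)
    then have "k \<in> cone n"
      by (intro singD[OF assms(1)]) (auto simp: in_keys_iff)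
    then show ?case
      using insert assms(3)[of "lterm k (lcoeff f k)"] assms(4)[of "fst k" "snd k"] sing_term[of k n]
      by (auto intro: sing_add)
  qed
  from this[of "Poly_Mapping.keys f"] show ?thesis
    by (simp add: laurent_sum_terms)
qed

definition gx :: "nat \<Rightarrow> 'k::field laurent" where "gx n = lterm (0, int n) 1"
definition gy :: "nat \<Rightarrow> 'k::field laurent" where "gy n = lterm (int n, 0) 1"
definition gz :: "'k::field laurent" where "gz = lterm (1, 1) 1"

lemma gx_sing [simp]: "gx n \<in> sing n" and gy_sing [simp]: "gy n \<in> sing n" and gz_sing [simp]: "gz \<in> sing n"
  by (auto simp: gx_def gy_def gz_def intro!: sing_term) (auto simp: cone_def)

lemma gx_homog: "gx n \<in> homog (int n)" and gy_homog: "gy n \<in> homog (int n)" and gz_homog: "gz \<in> homog 2"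
  by (auto simp: gx_def gy_def gz_def intro!: homog_term)

lemma term_power: "(lterm k 1 :: 'k::field laurent) ^ i = lterm (of_nat i * fst k, of_nat i * snd k) 1"
  by (cases k, induction i) (auto simp: mult_single algebra_simps simp flip: zero_prod_def single_one)

lemma gx_power: "gx n ^ i = (lterm (0, int i * int n) 1 :: 'k::field laurent)"
  and gy_power: "gy n ^ i = (lterm (int i * int n, 0) 1 :: 'k::field laurent)"
  and gz_power: "gz ^ i = (lterm (int i, int i) 1 :: 'k::field laurent)"
  by (simp_all add: gx_def gy_def gz_def term_power)

lemma gz_power_n: "gz ^ n = (gx n * gy n :: 'k::field laurent)"
  by (simp add: gz_power gx_def gy_def mult_single)

lemma cone_monomial:
  assumes "(p, q) \<in> cone n" "n > 0"
  obtains i j k where "k < n" "p = int (n * j + k)" "q = int (n * i + k)"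
    "(lterm (p, q) 1 :: 'k::field laurent) = gx n ^ i * gy n ^ j * gz ^ k"
proof -
  define i j k where "i = nat (q div int n)" and "j = nat (p div int n)" and "k = nat (p mod int n)"
  have pq: "0 \<le> p" "0 \<le> q" and dv: "q mod int n = p mod int n"
    using assms by (auto simp: cone_def mod_eq_dvd_iff)
  have k: "int k = p mod int n" "int j = p div int n" "int i = q div int n"
    using assms(2) pq by (auto simp: i_def j_def k_def pos_imp_zdiv_nonneg_iff)
  have "p = int n * int j + int k" "q = int n * int i + int k"
    unfolding k dv[symmetric] by simp_all (simp add: dv)
  moreover have "k < n"
    using assms(2) by (simp add: k_def nat_less_iff)
  ultimately show ?thesis
    by (intro that[of k j i]) (auto simp: gx_power gy_power gz_power mult_single algebra_simps)
qed

lemma sing_generated [consumes 2, case_names scalar x y z add mult]: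
  fixes f :: "'k::field laurent"
  assumes "f \<in> sing n" "n > 0"
    and "\<And>c. P (lterm 0 c)" "P (gx n)" "P (gy n)" "P gz"
    and add: "\<And>f g. f \<in> sing n \<Longrightarrow> g \<in> sing n \<Longrightarrow> P f \<Longrightarrow> P g \<Longrightarrow> P (f + g)"
    and mult: "\<And>f g. f \<in> sing n \<Longrightarrow> g \<in> sing n \<Longrightarrow> P f \<Longrightarrow> P g \<Longrightarrow> P (f * g)"
  shows "P f"
proof -
  have power: "P (g ^ i)" if "g \<in> sing n" "P g" for g i
  proof (induction i)
    case 0
    then show ?case using assms(3)[of 1] by simp
  qed (use that mult in \<open>auto intro: sing_power\<close>)
  from assms(1) show ?thesis
  proof (induction rule: sing_induct)
    case zero
    then show ?case using assms(3)[of 0] by simp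
  next
    case (monomial p q c)
    then obtain i j k where "(lterm (p, q) 1 :: 'k laurent) = gx n ^ i * gy n ^ j * gz ^ k"
      using assms(2) by (elim cone_monomial)
    moreover have "lterm (p, q) c = lterm 0 c * lterm (p, q) 1"
      by (simp add: mult_single)
    moreover have "P (gx n ^ i * gy n ^ j * gz ^ k)"
      by (intro mult power sing_mult sing_power gx_sing gy_sing gz_sing assms(4-6))
    moreover have "P (lterm 0 c * (gx n ^ i * gy n ^ j * gz ^ k))"
      by (intro mult assms(3) sing_mult sing_power sing_term gx_sing gy_sing gz_sing zero_in_cone
          \<open>P (gx n ^ i * gy n ^ j * gz ^ k)\<close>)
    ultimately show ?case
      by simp
  qed (auto intro: add)
qed

section \<open>The bar complex\<close>

text \<open>
  The part of the bar differential that multiplies neighbouring entries, with alternating signs. It is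
  separated from the leading term \<open>a\<^sub>0 f(a\<^sub>1, \<dots>)\<close> because on its own it has a contracting homotopy.
\<close>

fun bd :: "('a::comm_ring_1 list \<Rightarrow> 'a) \<Rightarrow> 'a list \<Rightarrow> 'a" where
  "bd G (a # b # r) = G (a * b # r) - bd (\<lambda>l. G (a # l)) (b # r)"
| "bd G _ = 0"

text \<open>
  Inserting a unit in front contracts \<open>bd\<close>, see \<open>bd_sg\<close>; what is lost is linearity in the first entry.
\<close>

definition sg :: "('a::comm_ring_1 list \<Rightarrow> 'a) \<Rightarrow> 'a list \<Rightarrow> 'a"
  where "sg G as = G (1 # as)"

text \<open>The failure of \<open>G\<close> to be linear over \<open>c\<close> in its first entry.\<close>

definition comm :: "'a::comm_ring_1 \<Rightarrow> ('a list \<Rightarrow> 'a) \<Rightarrow> 'a list \<Rightarrow> 'a"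
  where "comm c G as = c * G as - G (c * hd as # tl as)"

lemma bd_additive:
  assumes "\<And>u v. \<beta> (u - v) = \<beta> u - \<beta> v"
  shows "bd (\<lambda>l. \<beta> (G l)) as = \<beta> (bd G as)"
proof (induction G as rule: bd.induct)
  case (1 G a b r)
  then show ?case by (simp add: assms)
qed (use assms[of 0 0] in simp_all)

lemma bd_diff: "bd (\<lambda>l. G l - H l) as = bd G as - bd H as"
  by (induction G as arbitrary: H rule: bd.induct) simp_all

lemma bd_add: "bd (\<lambda>l. G l + H l) as = bd G as + bd H as"
  by (induction G as arbitrary: H rule: bd.induct) simp_all

lemma bd_sum: "bd (\<lambda>l. \<Sum>i\<in>S. G i l) as = (\<Sum>i\<in>S. bd (G i) as)"
proof (induction S rule: infinite_finite_induct)
  case empty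
  have "bd (\<lambda>l. 0 :: 'a) as = 0"
    using bd_diff[of "\<lambda>_. 0" "\<lambda>_. 0"] by simp
  then show ?case by simp
next
  case (infinite S)
  have "bd (\<lambda>l. 0 :: 'a) as = 0"
    using bd_diff[of "\<lambda>_. 0" "\<lambda>_. 0"] by simp
  with infinite show ?case by simp
qed (simp add: bd_add)

lemma bd_mult: "bd (\<lambda>l. c * G l) as = c * bd G as"
  by (rule bd_additive) (simp add: algebra_simps)

lemma bd_head: "as \<noteq> [] \<Longrightarrow> bd (\<lambda>l. G (c * hd l # tl l)) as = bd G (c * hd as # tl as)"
  by (cases "(G, as)" rule: bd.cases) (simp_all add: mult.assoc)

lemma bd_sg: "as \<noteq> [] \<Longrightarrow> bd (sg G) as = G as - sg (bd G) as"
  by (cases as) (simp_all add: sg_def[abs_def])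

lemma bd_comm: "as \<noteq> [] \<Longrightarrow> bd (comm c G) as = comm c (bd G) as"
  by (simp add: comm_def[abs_def] bd_diff bd_mult bd_head)

lemma bd_bd: "bd (bd G) as = 0"
proof (induction as arbitrary: G rule: length_induct)
  case (1 as)
  show ?case
  proof (cases "(G, as)" rule: bd.cases)
    case (1 G' a b r)
    show ?thesis
    proof (cases r)
      case Nil
      then show ?thesis using 1 by simp
    next
      case (Cons c s)
      have "bd (\<lambda>l. bd G (a # l)) (b # r) = bd (\<lambda>l. G (a * hd l # tl l) - bd (\<lambda>l. G (a # l)) l) (b # r)"
        using Cons by simp
      also have "\<dots> = bd G (a * b # r) - bd (bd (\<lambda>l. G (a # l))) (b # r)"
        by (simp only: bd_diff) (simp add: bd_head)
      finally show ?thesis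
        using 1 \<open>\<forall>ys. length ys < length as \<longrightarrow> (\<forall>G. bd (bd G) ys = 0)\<close> by simp
    qed
  qed simp_all
qed

definition Ls :: "nat \<Rightarrow> nat \<Rightarrow> 'k::field laurent list set"
  where "Ls n m = {as. length as = m \<and> set as \<subseteq> sing n}"

lemma Ls_Cons [simp]: "a # as \<in> Ls n (Suc m) \<longleftrightarrow> a \<in> sing n \<and> as \<in> Ls n m"
  by (auto simp: Ls_def)

lemma Ls_Nil [simp]: "[] \<in> Ls n m \<longleftrightarrow> m = 0"
  by (auto simp: Ls_def)

lemma Ls_0 [simp]: "as \<in> Ls n 0 \<longleftrightarrow> as = []"
  by (auto simp: Ls_def)

lemma Ls_SucE:
  assumes "as \<in> Ls n (Suc m)"
  obtains a r where "as = a # r" "a \<in> sing n" "r \<in> Ls n m"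
  using assms by (cases as) (auto simp: Ls_def)

lemma bd_cong:
  assumes "\<And>l. l \<in> Ls n m \<Longrightarrow> G l = H l" "as \<in> Ls n (Suc m)"
  shows "bd G as = bd H as"
  using assms
proof (induction m arbitrary: G H as)
  case 0
  then show ?case by (auto simp: Ls_def length_Suc_conv)
next
  case (Suc m)
  then obtain a b r where as: "as = a # b # r" "a \<in> sing n" "b \<in> sing n" "r \<in> Ls n m"
    by (metis Ls_SucE)
  have "bd (\<lambda>l. G (a # l)) (b # r) = bd (\<lambda>l. H (a # l)) (b # r)"
    by (rule Suc.IH) (use as Suc.prems in auto)
  then show ?case
    using as Suc.prems(1) by (simp add: sing_mult)
qed

text \<open>
  Multilinear maps on \<open>m\<close> entries whose last entry is taken modulo \<open>I\<close>. The recursion peels off the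
  first entry, which is the form in which inductions over the bar complex use multilinearity.
\<close>

fun mlin :: "nat \<Rightarrow> 'k::field laurent set \<Rightarrow> nat \<Rightarrow> ('k laurent list \<Rightarrow> 'k laurent) \<Rightarrow> bool" where
  "mlin n I 0 f = True"
| "mlin n I (Suc m) f \<longleftrightarrow>
     (\<forall>r\<in>Ls n m. (\<forall>u\<in>sing n. \<forall>v\<in>sing n. f ((u + v) # r) = f (u # r) + f (v # r)) \<and>
        (\<forall>u\<in>sing n. \<forall>c. f (scale c u # r) = scale c (f (u # r))) \<and>
        (\<forall>u\<in>sing n. f (u # r) \<in> sing n)) \<and>
     (if m = 0 then \<forall>u\<in>I. f [u] = 0 else \<forall>a\<in>sing n. mlin n I m (\<lambda>l. f (a # l)))"

fun grd :: "nat \<Rightarrow> nat \<Rightarrow> int \<Rightarrow> ('k::field laurent list \<Rightarrow> 'k laurent) \<Rightarrow> bool" where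
  "grd n 0 j f \<longleftrightarrow> f [] \<in> homog j"
| "grd n (Suc m) j f \<longleftrightarrow> (\<forall>e. \<forall>a\<in>sing n \<inter> homog e. grd n m (j + e) (\<lambda>l. f (a # l)))"

definition coch :: "nat \<Rightarrow> 'k::field laurent set \<Rightarrow> nat \<Rightarrow> int \<Rightarrow> ('k laurent list \<Rightarrow> 'k laurent) \<Rightarrow> bool"
  where "coch n I m j f \<longleftrightarrow> mlin n I m f \<and> grd n m j f"

lemma mlinD:
  assumes "mlin n I (Suc m) f" "r \<in> Ls n m" "u \<in> sing n" "v \<in> sing n"
  shows "f ((u + v) # r) = f (u # r) + f (v # r)" "f (scale c u # r) = scale c (f (u # r))"
    "f (u # r) \<in> sing n" "f (0 # r) = 0" "f ((u - v) # r) = f (u # r) - f (v # r)"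
proof -
  have 1: "f ((u + v) # r) = f (u # r) + f (v # r)" if "u \<in> sing n" "v \<in> sing n" for u v
    using assms(1,2) that by simp
  show "f ((u + v) # r) = f (u # r) + f (v # r)"
    using 1 assms(3,4) .
  show "f (scale c u # r) = scale c (f (u # r))" "f (u # r) \<in> sing n"
    using assms by simp_all
  show "f (0 # r) = 0"
    using 1[of 0 0] by simp
  show "f ((u - v) # r) = f (u # r) - f (v # r)"
    using 1[of "u - v" v] assms by (simp add: sing_diff algebra_simps)
qed

lemma mlin_value: "mlin n I (Suc m) f \<Longrightarrow> as \<in> Ls n (Suc m) \<Longrightarrow> f as \<in> sing n"
  by (auto elim!: Ls_SucE)

lemma mlin_slice: "mlin n I (Suc (Suc m)) f \<Longrightarrow> a \<in> sing n \<Longrightarrow> mlin n I (Suc m) (\<lambda>l. f (a # l))"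
  by simp

lemma mlin_cong:
  assumes "\<And>l. l \<in> Ls n m \<Longrightarrow> G l = H l" "I \<subseteq> sing n"
  shows "mlin n I m G = mlin n I m H"
  using assms
proof (induction m arbitrary: G H)
  case (Suc m)
  have "mlin n I m (\<lambda>l. G (a # l)) = mlin n I m (\<lambda>l. H (a # l))" if "a \<in> sing n" for a
    by (rule Suc.IH) (use that Suc.prems in auto)
  moreover have "G (u # r) = H (u # r)" if "u \<in> sing n" "r \<in> Ls n m" for u r
    using that Suc.prems by simp
  moreover have "G [u] = H [u]" if "u \<in> I" "m = 0" for u
    using that Suc.prems by (auto simp: subset_iff)
  ultimately show ?case
    by (simp add: sing_add sing_scale)
qed simp

lemma grd_cong:
  assumes "\<And>l. l \<in> Ls n m \<Longrightarrow> G l = H l"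
  shows "grd n m j G = grd n m j H"
  using assms
proof (induction m arbitrary: G H j)
  case (Suc m)
  have "grd n m (j + e) (\<lambda>l. G (a # l)) = grd n m (j + e) (\<lambda>l. H (a # l))" if "a \<in> sing n" for a e
    by (rule Suc.IH) (use that Suc.prems in auto)
  then show ?case by simp
qed simp

lemma coch_cong:
  "(\<And>l. l \<in> Ls n m \<Longrightarrow> G l = H l) \<Longrightarrow> I \<subseteq> sing n \<Longrightarrow> coch n I m j G = coch n I m j H"
  using mlin_cong[of n m G H I] grd_cong[of n m G H j] by (simp add: coch_def)

lemma coch_add: "coch n I m j f \<Longrightarrow> coch n I m j g \<Longrightarrow> coch n I m j (\<lambda>l. f l + g l)"
proof -
  have "mlin n I m f \<Longrightarrow> mlin n I m g \<Longrightarrow> mlin n I m (\<lambda>l. f l + g l)"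
    by (induction m arbitrary: f g) (auto simp: algebra_simps sing_add)
  moreover have "grd n m j f \<Longrightarrow> grd n m j g \<Longrightarrow> grd n m j (\<lambda>l. f l + g l)"
    by (induction m arbitrary: f g j) (auto simp: homog_add)
  ultimately show "coch n I m j f \<Longrightarrow> coch n I m j g \<Longrightarrow> ?thesis"
    by (simp add: coch_def)
qed

lemma mlin_post:
  assumes "mlin n I m f" "linear_op \<beta>" "\<And>u. u \<in> sing n \<Longrightarrow> \<beta> u \<in> sing n"
  shows "mlin n I m (\<lambda>l. \<beta> (f l))"
  using assms(1) by (induction m arbitrary: f) (auto simp: linear_opD[OF assms(2)] assms(3))

lemma grd_post:
  fixes f :: "'k::field laurent list \<Rightarrow> 'k laurent"
  assumes "grd n m j f" "\<And>u d. u \<in> homog d \<Longrightarrow> \<beta> u \<in> homog (d + e)"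
  shows "grd n m (j + e) (\<lambda>l. \<beta> (f l))"
  using assms(1)
proof (induction m arbitrary: f j)
  case (Suc m)
  show ?case
    unfolding grd.simps
  proof (intro allI ballI)
    fix d and a :: "'k laurent" assume "a \<in> sing n \<inter> homog d"
    then have "grd n m (j + d + e) (\<lambda>l. \<beta> (f (a # l)))"
      using Suc by simp
    then show "grd n m (j + e + d) (\<lambda>l. \<beta> (f (a # l)))"
      by (simp add: algebra_simps)
  qed
qed (simp add: assms(2))

lemma coch_post:
  assumes "coch n I m j f" "linear_op \<beta>" "\<And>u. u \<in> sing n \<Longrightarrow> \<beta> u \<in> sing n"
    "\<And>u d. u \<in> homog d \<Longrightarrow> \<beta> u \<in> homog (d + e)"
  shows "coch n I m (j + e) (\<lambda>l. \<beta> (f l))"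
  using mlin_post[of n I m f \<beta>] grd_post[of n m j f \<beta> e] assms by (simp add: coch_def)

lemma coch_uminus: "coch n I m j f \<Longrightarrow> coch n I m j (\<lambda>l. - f l)"
  using coch_post[of n I m j f uminus 0]
  by (simp add: linear_op_def sing_uminus homog_uminus)

lemma coch_diff: "coch n I m j f \<Longrightarrow> coch n I m j g \<Longrightarrow> coch n I m j (\<lambda>l. f l - g l)"
  using coch_add[of n I m j f "\<lambda>l. - g l"] coch_uminus[of n I m j g] by simp

lemma coch_zero: "coch n I m j (\<lambda>l. 0)"
proof -
  have "mlin n I m (\<lambda>l. 0)" by (induction m) auto
  moreover have "grd n m j (\<lambda>l. 0)" by (induction m arbitrary: j) auto
  ultimately show ?thesis by (simp add: coch_def)
qed

lemma coch_sum: "(\<And>i. i \<in> S \<Longrightarrow> coch n I m j (f i)) \<Longrightarrow> coch n I m j (\<lambda>l. \<Sum>i\<in>S. f i l)"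
proof (induction S rule: infinite_finite_induct)
  case (insert x F)
  then show ?case using coch_add[of n I m j "f x" "\<lambda>l. \<Sum>i\<in>F. f i l"] by simp
qed (simp_all add: coch_zero)

lemma coch_mult:
  "coch n I m j f \<Longrightarrow> c \<in> sing n \<Longrightarrow> c \<in> homog e \<Longrightarrow> coch n I m (j + e) (\<lambda>l. c * f l)"
  by (rule coch_post) (auto simp: linear_op_mult sing_mult homog_mult add.commute[of _ e])

text \<open>
  Changing the first entry by a linear map keeps a cochain a cochain, except that for a single entry
  the map has to respect \<open>I\<close>, since that entry is also the last one.
\<close>

lemma coch_head:
  assumes "coch n I (Suc m) j f" "linear_op \<alpha>" "\<And>u. u \<in> sing n \<Longrightarrow> \<alpha> u \<in> sing n"
    "\<And>u d. u \<in> homog d \<Longrightarrow> \<alpha> u \<in> homog (d + e)"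
    "m = 0 \<Longrightarrow> (\<And>u. u \<in> I \<Longrightarrow> \<alpha> u \<in> I)"
  shows "coch n I (Suc m) (j + e) (\<lambda>l. f (\<alpha> (hd l) # tl l))"
proof -
  have "mlin n I (Suc m) (\<lambda>l. f (\<alpha> (hd l) # tl l))"
    using assms by (auto simp: coch_def linear_opD)
  moreover have "grd n (Suc m) (j + e) (\<lambda>l. f (\<alpha> (hd l) # tl l))"
  proof -
    have "grd n m (j + (e + d)) (\<lambda>l. f (\<alpha> a # l))" if "a \<in> sing n" "a \<in> homog d" for a d
      using assms(1,3) assms(4)[OF that(2)] that(1) by (simp add: coch_def add.commute[of e d])
    then show ?thesis by (simp add: add.assoc)
  qed
  ultimately show ?thesis by (simp only: coch_def)
qed

lemma coch_comm:
  assumes "coch n I (Suc m) j f" "c \<in> sing n" "c \<in> homog e" "\<And>a u. a \<in> sing n \<Longrightarrow> u \<in> I \<Longrightarrow> a * u \<in> I"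
  shows "coch n I (Suc m) (j + e) (comm c f)"
  unfolding comm_def[abs_def]
  by (intro coch_diff coch_mult coch_head assms linear_op_mult)
    (use assms in \<open>auto simp: sing_mult homog_mult add.commute[of _ e]\<close>)

lemma coch_sg: "coch n I (Suc (Suc m)) j f \<Longrightarrow> coch n I (Suc m) j (sg f)"
proof -
  assume f: "coch n I (Suc (Suc m)) j f"
  have "(1 :: 'a laurent) \<in> homog 0"
    using homog_term[of 0 0 0 "1::'a"] by (simp flip: single_one zero_prod_def)
  then have "grd n (Suc m) (j + 0) (\<lambda>l. f (1 # l))"
    using f sing_one unfolding coch_def grd.simps(2)[of n "Suc m"] by blast
  then show ?thesis
    using f mlin_slice[of n I m f 1] by (simp add: coch_def sg_def[abs_def] del: grd.simps mlin.simps)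
qed

lemma coch_slice: "coch n I (Suc (Suc m)) j f \<Longrightarrow> a \<in> sing n \<Longrightarrow> a \<in> homog e \<Longrightarrow>
    coch n I (Suc m) (j + e) (\<lambda>l. f (a # l))"
  unfolding coch_def using mlin_slice[of n I m f a] by (auto simp only: grd.simps(2)[of n "Suc m"])

lemma mlin_bd:
  assumes I: "\<And>a u. a \<in> sing n \<Longrightarrow> u \<in> I \<Longrightarrow> a * u \<in> I" "I \<subseteq> sing n"
  shows "mlin n I (Suc m) f \<Longrightarrow> mlin n I (Suc (Suc m)) (bd f)"
proof (induction m arbitrary: f)
  case 0
  have val: "f [u * v] \<in> sing n" if "u \<in> sing n" "v \<in> sing n" for u v
    using mlinD(3)[OF 0, of "[]" "u * v" "u * v"] that by (simp add: sing_mult)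
  have add: "f [u * v + w * x] = f [u * v] + f [w * x]"
    if "u \<in> sing n" "v \<in> sing n" "w \<in> sing n" "x \<in> sing n" for u v w x
    using mlinD(1)[OF 0, of "[]" "u * v" "w * x"] that by (simp add: sing_mult)
  have sc: "f [scale c (u * v)] = scale c (f [u * v])" if "u \<in> sing n" "v \<in> sing n" for u v c
    using mlinD(2)[OF 0, of "[]" "u * v" "u * v"] that by (simp add: sing_mult)
  have "f [(u + w) * v] = f [u * v] + f [w * v]" "f [v * (u + w)] = f [v * u] + f [v * w]"
    if "u \<in> sing n" "v \<in> sing n" "w \<in> sing n" for u v w
    using add that by (simp_all add: distrib_right distrib_left)
  moreover have "f [scale c u * v] = scale c (f [u * v])" "f [u * scale c v] = scale c (f [u * v])"
    if "u \<in> sing n" "v \<in> sing n" for u v c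
    using sc[OF that, of c] by (simp_all only: mult.assoc mult.left_commute[of u "Poly_Mapping.single 0 c" v])
  moreover have "f [a * u] = 0" if "a \<in> sing n" "u \<in> I" for a u
    using 0 I that by simp
  ultimately show ?case
    using val by (auto elim!: Ls_SucE)
next
  case (Suc m)
  note f = Suc.prems
  note fa = mlin_slice[OF f]
  have IH: "mlin n I (Suc (Suc m)) (bd (\<lambda>l. f (a # l)))" if "a \<in> sing n" for a
    by (rule Suc.IH) (rule fa[OF that])
  have add: "bd f ((u + v) # r) = bd f (u # r) + bd f (v # r)"
    and sc: "bd f (scale c u # r) = scale c (bd f (u # r))"
    and val: "bd f (u # r) \<in> sing n"
    if r: "r \<in> Ls n (Suc (Suc m))" and uv: "u \<in> sing n" "v \<in> sing n" for u v r c
  proof -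
    from r obtain b s where bs: "r = b # s" "b \<in> sing n" "s \<in> Ls n (Suc m)"
      by (rule Ls_SucE)
    have "bd (\<lambda>l. f ((u + v) # l)) r = bd (\<lambda>l. f (u # l) + f (v # l)) r"
      by (rule bd_cong[OF _ r]) (rule mlinD(1)[OF f _ uv])
    then show "bd f ((u + v) # r) = bd f (u # r) + bd f (v # r)"
      using mlinD(1)[OF f bs(3), of "u * b" "v * b"] uv bs by (simp add: bd_add sing_mult distrib_right)
    have "bd (\<lambda>l. f (scale c u # l)) r = bd (\<lambda>l. scale c (f (u # l))) r"
      by (rule bd_cong[OF _ r]) (rule mlinD(2)[OF f _ uv])
    then show "bd f (scale c u # r) = scale c (bd f (u # r))"
      using mlinD(2)[OF f bs(3), of "u * b" "u * b" c] uv bs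
      by (simp add: bd_mult sing_mult mult.assoc right_diff_distrib)
    show "bd f (u # r) \<in> sing n"
      using mlinD(3)[OF f bs(3), of "u * b" "u * b"] mlin_value[OF IH[OF uv(1)] r] bs uv
      by (simp add: sing_mult sing_diff)
  qed
  have slice: "mlin n I (Suc (Suc m)) (\<lambda>l. bd f (a # l))" if a: "a \<in> sing n" for a
  proof -
    have "mlin n I (Suc (Suc m)) (\<lambda>l. f (a * hd l # tl l))"
      using f a by (auto simp: sing_mult distrib_left mult.left_commute[of a])
    moreover have "mlin n I (Suc (Suc m)) G \<Longrightarrow> mlin n I (Suc (Suc m)) H \<Longrightarrow> mlin n I (Suc (Suc m)) (\<lambda>l. G l - H l)" for G H
    proof -
      have "mlin n I k G \<Longrightarrow> mlin n I k H \<Longrightarrow> mlin n I k (\<lambda>l. G l - H l)" for k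
        by (induction k arbitrary: G H) (auto simp: algebra_simps sing_diff)
      then show "mlin n I (Suc (Suc m)) G \<Longrightarrow> mlin n I (Suc (Suc m)) H \<Longrightarrow> mlin n I (Suc (Suc m)) (\<lambda>l. G l - H l)" .
    qed
    ultimately have "mlin n I (Suc (Suc m)) (\<lambda>l. f (a * hd l # tl l) - bd (\<lambda>l. f (a # l)) l)"
      using IH[OF a] by blast
    then show ?thesis
      by (rule iffD1[OF mlin_cong[OF _ I(2)], rotated]) (auto elim!: Ls_SucE)
  qed
  show ?case
    unfolding mlin.simps(2)[of n I "Suc (Suc m)"] using add sc val slice by (simp del: bd.simps mlin.simps)
qed

lemma grd_bd: "grd n (Suc m) j f \<Longrightarrow> grd n (Suc (Suc m)) j (bd f)"
proof (induction m arbitrary: f j)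
  case 0
  have "f [a * b] \<in> homog (j + d + e)" if "a \<in> sing n" "a \<in> homog d" "b \<in> sing n" "b \<in> homog e" for a b d e
    using 0 sing_mult[OF that(1,3)] homog_mult[OF that(2,4)] by (auto simp: add.assoc)
  then show ?case by simp
next
  case (Suc m)
  have "grd n (Suc (Suc m)) (j + d) (\<lambda>l. bd f (a # l))" if a: "a \<in> sing n" "a \<in> homog d" for a d
  proof -
    have 1: "grd n (Suc (Suc m)) (j + d) (bd (\<lambda>l. f (a # l)))"
      using Suc.prems a by (intro Suc.IH) (auto simp del: grd.simps simp add: grd.simps(2)[of n "Suc m"])
    have 2: "grd n (Suc (Suc m)) (j + d) (\<lambda>l. f (a * hd l # tl l))"
    proof -
      have "grd n (Suc m) (j + (d + e)) (\<lambda>l. f (a * b # l))" if "b \<in> sing n" "b \<in> homog e" for b e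
        using Suc.prems sing_mult[OF a(1) that(1)] homog_mult[OF a(2) that(2)]
        unfolding grd.simps(2)[of n "Suc m"] by blast
      then show ?thesis
        unfolding grd.simps(2)[of n "Suc m"] by (simp add: add.assoc)
    qed
    have "grd n k i G \<Longrightarrow> grd n k i H \<Longrightarrow> grd n k i (\<lambda>l. G l - H l)" for k i G H
      by (induction k arbitrary: G H i) (auto simp: homog_diff)
    from this[OF 2 1] show ?thesis
      by (rule iffD1[OF grd_cong, rotated]) (auto elim!: Ls_SucE)
  qed
  then show ?case
    unfolding grd.simps(2)[of n "Suc (Suc m)"] by blast
qed

lemma coch_bd:
  assumes "\<And>a u. a \<in> sing n \<Longrightarrow> u \<in> I \<Longrightarrow> a * u \<in> I" "I \<subseteq> sing n" "coch n I (Suc m) j f"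
  shows "coch n I (Suc (Suc m)) j (bd f)"
  using mlin_bd[OF assms(1,2), of m f] grd_bd[of n m j f] assms(3) unfolding coch_def by blast

text \<open>
  Some constructions below are infinite sums that become finite on each list of arguments; the number
  of terms depends on the list, so they are limits of multilinear maps that are eventually constant.
\<close>

lemma mlin_limit:
  fixes g :: "nat \<Rightarrow> 'k::field laurent list \<Rightarrow> 'k laurent"
  assumes "\<And>N. mlin n I m (g N)" "\<And>as. as \<in> Ls n m \<Longrightarrow> \<exists>N0. \<forall>N\<ge>N0. f as = g N as" "I \<subseteq> sing n"
  shows "mlin n I m f"
  using assms
proof (induction m arbitrary: f g)
  case (Suc m)
  have ex: "\<exists>N. f (u # r) = g N (u # r) \<and> f (v # r) = g N (v # r) \<and> f (w # r) = g N (w # r)"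
    if "r \<in> Ls n m" "u \<in> sing n" "v \<in> sing n" "w \<in> sing n" for u v w r
  proof -
    have "u # r \<in> Ls n (Suc m)" "v # r \<in> Ls n (Suc m)" "w # r \<in> Ls n (Suc m)"
      using that by simp_all
    note ex = this[THEN Suc.prems(2)]
    from ex(1) obtain N1 where 1: "\<forall>N\<ge>N1. f (u # r) = g N (u # r)" ..
    from ex(2) obtain N2 where 2: "\<forall>N\<ge>N2. f (v # r) = g N (v # r)" ..
    from ex(3) obtain N3 where 3: "\<forall>N\<ge>N3. f (w # r) = g N (w # r)" ..
    have "N1 \<le> N1 + N2 + N3" "N2 \<le> N1 + N2 + N3" "N3 \<le> N1 + N2 + N3"
      by simp_all
    then show ?thesis
      using 1[rule_format] 2[rule_format] 3[rule_format] by (intro exI conjI)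
  qed
  have lin: "f ((u + v) # r) = f (u # r) + f (v # r)" "f (scale c u # r) = scale c (f (u # r))" "f (u # r) \<in> sing n"
    if ruv: "r \<in> Ls n m" "u \<in> sing n" "v \<in> sing n" for u v r c
  proof -
    note g = mlinD[OF Suc.prems(1) ruv]
    have uv: "u + v \<in> sing n" "scale c u \<in> sing n"
      using ruv by (auto intro: sing_add sing_scale)
    obtain N where "f (u # r) = g N (u # r)" "f (v # r) = g N (v # r)" "f ((u + v) # r) = g N ((u + v) # r)"
      using ex[OF ruv uv(1)] by blast
    then show "f ((u + v) # r) = f (u # r) + f (v # r)"
      using g(1) by (simp only:)
    obtain N where N: "f (u # r) = g N (u # r)" "f (scale c u # r) = g N (scale c u # r)"
      using ex[OF ruv uv(2)] by blast
    then show "f (scale c u # r) = scale c (f (u # r))"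
      using g(2) by (simp only:)
    show "f (u # r) \<in> sing n"
      using g(3) N(1) by (simp only:)
  qed
  have sc: "f (scale c u # r) = scale c (f (u # r))" and val: "f (u # r) \<in> sing n"
    if "r \<in> Ls n m" "u \<in> sing n" for u r c
    using lin(2,3)[OF that that(2)] .
  have ideal: "f [u] = 0" if "u \<in> I" "m = 0" for u
  proof -
    have "u \<in> sing n" "[] \<in> Ls n m"
      using that Suc.prems(3) by auto
    from ex[OF this(2,1,1,1)] obtain N where "f [u] = g N [u]"
      by blast
    then show ?thesis
      using Suc.prems(1)[of N] that by simp
  qed
  have slice: "mlin n I m (\<lambda>l. f (a # l))" if a: "a \<in> sing n" "m \<noteq> 0" for a
  proof (rule Suc.IH[of "\<lambda>N l. g N (a # l)"])
    show "mlin n I m (\<lambda>l. g N (a # l))" for N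
      using Suc.prems(1)[of N] a by simp
    show "\<exists>N0. \<forall>N\<ge>N0. f (a # as) = g N (a # as)" if "as \<in> Ls n m" for as
      using Suc.prems(2)[of "a # as"] that a by simp
  qed (rule Suc.prems(3))
  have tail: "if m = 0 then \<forall>u\<in>I. f [u] = 0 else \<forall>a\<in>sing n. mlin n I m (\<lambda>l. f (a # l))"
  proof (cases "m = 0")
    case True
    then have "\<forall>u\<in>I. f [u] = 0"
      using ideal by blast
    with True show ?thesis
      by simp
  next
    case False
    then have "\<forall>a\<in>sing n. mlin n I m (\<lambda>l. f (a # l))"
      using slice by blast
    with False show ?thesis
      by (simp only: if_False)
  qed
  show ?case
    unfolding mlin.simps(2)
  proof (rule conjI[OF _ tail], intro ballI conjI allI)
    fix r :: "'k laurent list" and u v :: "'k laurent" assume "r \<in> Ls n m" "u \<in> sing n" "v \<in> sing n"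
    then show "f ((u + v) # r) = f (u # r) + f (v # r)"
      by (rule lin(1))
  next
    fix r :: "'k laurent list" and u :: "'k laurent" and c assume "r \<in> Ls n m" "u \<in> sing n"
    then show "f (scale c u # r) = scale c (f (u # r))"
      by (rule sc)
  next
    fix r :: "'k laurent list" and u :: "'k laurent" assume "r \<in> Ls n m" "u \<in> sing n"
    then show "f (u # r) \<in> sing n"
      by (rule val)
  qed
qed simp

lemma grd_limit:
  fixes g :: "nat \<Rightarrow> 'k::field laurent list \<Rightarrow> 'k laurent"
  assumes "\<And>N. grd n m j (g N)" "\<And>as. as \<in> Ls n m \<Longrightarrow> \<exists>N0. \<forall>N\<ge>N0. f as = g N as"
  shows "grd n m j f"
  using assms
proof (induction m arbitrary: f g j)
  case 0
  then obtain N where "f [] = g N []" by fastforce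
  then show ?case using 0(1)[of N] by simp
next
  case (Suc m)
  have "grd n m (j + e) (\<lambda>l. f (a # l))" if "a \<in> sing n" "a \<in> homog e" for a e
    by (rule Suc.IH[of _ "\<lambda>N l. g N (a # l)"]) (use Suc.prems that in auto)
  then show ?case by simp
qed

lemma coch_limit:
  fixes g :: "nat \<Rightarrow> 'k::field laurent list \<Rightarrow> 'k laurent"
  assumes "\<And>N. coch n I m j (g N)" "\<And>as. as \<in> Ls n m \<Longrightarrow> \<exists>N0. \<forall>N\<ge>N0. f as = g N as" "I \<subseteq> sing n"
  shows "coch n I m j f"
proof -
  have "mlin n I m f"
    by (rule mlin_limit[of n I m g]) (use assms in \<open>auto simp: coch_def\<close>)
  moreover have "grd n m j f"
    by (rule grd_limit[of n m j g]) (use assms in \<open>auto simp: coch_def\<close>)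
  ultimately show ?thesis
    by (simp add: coch_def)
qed

lemma coch_cons:
  assumes "coch n I (Suc m) j f"
  shows "coch n I (Suc (Suc m)) j (\<lambda>l. hd l * f (tl l))"
proof -
  have f: "mlin n I (Suc m) f" "grd n (Suc m) j f"
    using assms by (auto simp: coch_def simp del: mlin.simps grd.simps)
  have "mlin n I (Suc m) (\<lambda>l. a * f l)" if "a \<in> sing n" for a
    by (rule mlin_post[OF f(1) linear_op_mult]) (rule sing_mult[OF that])
  then have "mlin n I (Suc (Suc m)) (\<lambda>l. hd l * f (tl l))"
    using mlin_value[OF f(1)] unfolding mlin.simps(2)[of n I "Suc m"]
    by (simp add: distrib_right sing_mult mult.assoc del: mlin.simps)
  moreover have "grd n (Suc m) (j + e) (\<lambda>l. a * f l)" if "a \<in> homog e" for a e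
    by (rule grd_post[OF f(2)]) (use homog_mult[OF that] in \<open>simp add: add.commute\<close>)
  then have "grd n (Suc (Suc m)) j (\<lambda>l. hd l * f (tl l))"
    unfolding grd.simps(2)[of n "Suc m"] by simp
  ultimately show ?thesis
    by (simp only: coch_def)
qed

lemma coch_1I:
  assumes "\<And>u v. u \<in> sing n \<Longrightarrow> v \<in> sing n \<Longrightarrow> A (u + v) = A u + A v"
    "\<And>u c. u \<in> sing n \<Longrightarrow> A (scale c u) = scale c (A u)"
    "\<And>u. u \<in> sing n \<Longrightarrow> A u \<in> sing n" "\<And>u. u \<in> I \<Longrightarrow> A u = 0"
    "\<And>u e. u \<in> sing n \<Longrightarrow> u \<in> homog e \<Longrightarrow> A u \<in> homog (j + e)"
  shows "coch n I (Suc 0) j (\<lambda>l. A (hd l))"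
  using assms by (simp add: coch_def)

lemma coch_1D:
  assumes "coch n I (Suc 0) j L"
  shows "u \<in> sing n \<Longrightarrow> v \<in> sing n \<Longrightarrow> L [u + v] = L [u] + L [v]"
    "u \<in> sing n \<Longrightarrow> L [scale c u] = scale c (L [u])"
    "u \<in> sing n \<Longrightarrow> L [u] \<in> sing n" "u \<in> I \<Longrightarrow> L [u] = 0"
    "u \<in> sing n \<Longrightarrow> u \<in> homog e \<Longrightarrow> L [u] \<in> homog (j + e)"
  using assms by (auto simp: coch_def)

text \<open>
  The bar differential of maps from \<open>T\<close>-modules to \<open>T\<close>: the value on \<open>a # as\<close> involves \<open>a f(as)\<close>.
\<close>

definition bardiff :: "('a::comm_ring_1 list \<Rightarrow> 'a) \<Rightarrow> 'a list \<Rightarrow> 'a"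
  where "bardiff f as = hd as * f (tl as) - bd f as"

lemma bd_cons: "bd (\<lambda>l. hd l * f (tl l)) (a # as) = a * bardiff f as" if "as \<noteq> []"
  using that by (cases as) (simp_all add: bardiff_def bd_mult[of a f] algebra_simps)

section \<open>Vanishing of Ext in degrees above two\<close>

text \<open>The exponents of the two parameters \<open>x\<close> and \<open>y\<close>.\<close>

definition axis :: "nat \<Rightarrow> int \<times> int \<Rightarrow> bool"
  where "axis n k \<longleftrightarrow> n > 0 \<and> (k = (0, int n) \<or> k = (int n, 0))"

definition quad :: "(int \<times> int) set"
  where "quad = {(p, q). 0 \<le> p \<and> 0 \<le> q}"

text \<open>
  Division by the \<open>l\<close>-th power of a parameter, dropping the monomials that are not divisible.
\<close>

definition down :: "int \<times> int \<Rightarrow> nat \<Rightarrow> 'k::field laurent \<Rightarrow> 'k laurent"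
  where "down k l b = part quad (lterm (- (int l * fst k), - (int l * snd k)) 1 * b)"

lemma lcoeff_down:
  "lcoeff (down k l b) (p, q)
    = (if 0 \<le> p \<and> 0 \<le> q then lcoeff b (p + int l * fst k, q + int l * snd k) else 0)"
  by (simp add: down_def quad_def lcoeff_term_mult)

lemma linear_op_down: "linear_op (down k l)"
  unfolding down_def by (rule linear_op_comp[OF linear_op_part linear_op_mult])

lemma sing_quad:
  assumes "f \<in> sing n" "p < 0 \<or> q < 0"
  shows "lcoeff f (p, q) = 0"
proof (rule ccontr)
  assume "lcoeff f (p, q) \<noteq> 0"
  from singD[OF assms(1) this] assms(2) show False
    by (auto simp: cone_def)
qed

lemma down_sing:
  assumes "axis n k" "b \<in> sing n"
  shows "down k l b \<in> sing n"
  unfolding sing_def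
proof safe
  fix p q
  assume nz: "lcoeff (down k l b) (p, q) \<noteq> 0"
  then have pq: "0 \<le> p" "0 \<le> q" and "lcoeff b (p + int l * fst k, q + int l * snd k) \<noteq> 0"
    by (simp_all add: lcoeff_down split: if_splits)
  then have "(p + int l * fst k, q + int l * snd k) \<in> cone n"
    by (intro singD[OF assms(2)])
  then have 1: "int n dvd (q + int l * snd k) - (p + int l * fst k)"
    by (simp add: cone_def)
  have 2: "int n dvd int l * snd k - int l * fst k"
    using assms(1) unfolding axis_def by (elim conjE disjE) simp_all
  have "q - p = (q + int l * snd k - (p + int l * fst k)) - (int l * snd k - int l * fst k)"
    by simp
  with dvd_diff[OF 1 2] have "int n dvd q - p"
    by (simp only:)
  with pq show "(p, q) \<in> cone n"
    by (simp add: cone_def)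
qed

lemma down_homog:
  assumes "axis n k" "b \<in> homog d"
  shows "down k l b \<in> homog (d - int l * int n)"
  unfolding homog_def
proof safe
  fix p q
  assume "lcoeff (down k l b) (p, q) \<noteq> 0"
  then have "p + int l * fst k + (q + int l * snd k) = d"
    using assms(2) unfolding homog_def lcoeff_down by (metis (mono_tags, lifting) mem_Collect_eq)
  then show "p + q = d - int l * int n"
    using assms(1) by (auto simp: axis_def)
qed

lemma down_Suc_mult: "b \<in> sing n \<Longrightarrow> down k (Suc l) (lterm k 1 * b) = down k l b"
proof (rule laurent_eqI)
  fix p q
  have "(p + int (Suc l) * fst k, q + int (Suc l) * snd k) - k = (p + int l * fst k, q + int l * snd k)"
    by (cases k) (simp add: algebra_simps)
  then show "lcoeff (down k (Suc l) (lterm k 1 * b)) (p, q) = lcoeff (down k l b) (p, q)"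
    by (simp add: lcoeff_down lcoeff_term_mult)
qed

lemma down_zero: "b \<in> sing n \<Longrightarrow> down k 0 b = b"
  by (rule laurent_eqI) (auto simp: lcoeff_down sing_quad)

lemma down_mult_other:
  assumes "axis n k" "axis n k'" "k \<noteq> k'" "b \<in> sing n"
  shows "down k l (lterm k' 1 * b) = lterm k' 1 * down k l b"
proof (rule laurent_eqI)
  fix p q
  show "lcoeff (down k l (lterm k' 1 * b)) (p, q) = lcoeff (lterm k' 1 * down k l b) (p, q)"
    using assms(1-3) sing_quad[OF assms(4), of "p - int n" "q + int l * int n"]
      sing_quad[OF assms(4), of "p + int l * int n" "q - int n"]
    by (auto simp: axis_def lcoeff_down lcoeff_term_mult split: if_splits)
qed

lemma down_eventually_zero:
  assumes "axis n k"
  shows "\<exists>N. \<forall>l\<ge>N. down k l b = 0"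
proof -
  define N where "N = Suc (\<Sum>k\<in>Poly_Mapping.keys b. nat \<bar>fst k\<bar> + nat \<bar>snd k\<bar>)"
  have "down k l b = 0" if "l \<ge> N" for l
  proof (rule laurent_eqI)
    fix p q
    have "lcoeff b (p', q') = 0" if "p' \<ge> int l \<or> q' \<ge> int l" for p' q'
    proof (rule ccontr)
      assume "lcoeff b (p', q') \<noteq> 0"
      then have "(p', q') \<in> Poly_Mapping.keys b"
        by (simp add: in_keys_iff)
      then have "nat \<bar>p'\<bar> + nat \<bar>q'\<bar> < N"
        using member_le_sum[of "(p', q')" "Poly_Mapping.keys b" "\<lambda>k. nat \<bar>fst k\<bar> + nat \<bar>snd k\<bar>"]
        by (simp add: N_def)
      with that \<open>l \<ge> N\<close> show False by linarith
    qed
    moreover have "int l \<le> int l * int n"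
      using assms mult_left_mono[of 1 "int n" "int l"] by (auto simp: axis_def)
    moreover have "(fst k = 0 \<and> snd k = int n) \<or> (fst k = int n \<and> snd k = 0)"
      using assms by (auto simp: axis_def)
    ultimately have "lcoeff b (p + int l * fst k, q + int l * snd k) = 0" if "0 \<le> p" "0 \<le> q"
      using that by (elim disjE conjE) simp_all
    then show "lcoeff (down k l b) (p, q) = lcoeff 0 (p, q)"
      by (simp add: lcoeff_down)
  qed
  then show ?thesis by (intro exI allI impI)
qed

text \<open>
  A right inverse of \<open>comm x\<close>: the equation \<open>x H(a) - H(x a) = G(a)\<close> is solved by
  \<open>H(a) = - \<Sum>\<^sub>l x\<^sup>l G(a / x\<^bsup>l + 1\<^esup>)\<close>, a finite sum because \<open>a\<close> is divisible only finitely often.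
\<close>

definition cinv :: "int \<times> int \<Rightarrow> ('k::field laurent list \<Rightarrow> 'k laurent) \<Rightarrow> 'k laurent list \<Rightarrow> 'k laurent"
  where "cinv k G as = - (\<Sum>l | down k (Suc l) (hd as) \<noteq> 0.
    lterm k 1 ^ l * G (down k (Suc l) (hd as) # tl as))"

lemma cinv_eq:
  assumes "G (0 # r) = 0" "\<And>l. l \<ge> N \<Longrightarrow> down k (Suc l) a = 0"
  shows "cinv k G (a # r) = - (\<Sum>l<N. lterm k 1 ^ l * G (down k (Suc l) a # r))"
proof -
  have "{l. down k (Suc l) a \<noteq> 0} \<subseteq> {..<N}"
    using assms(2) by (metis (mono_tags, lifting) lessThan_iff mem_Collect_eq not_le_imp_less subsetI)
  then have "(\<Sum>l | down k (Suc l) a \<noteq> 0. lterm k 1 ^ l * G (down k (Suc l) a # r))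
      = (\<Sum>l<N. lterm k 1 ^ l * G (down k (Suc l) a # r))"
    by (rule sum.mono_neutral_left[OF finite_lessThan]) (simp add: assms(1))
  then show ?thesis
    by (simp add: cinv_def)
qed

lemma cinv_cong:
  assumes "\<And>l. l \<in> Ls n (Suc m) \<Longrightarrow> G l = H l" "as \<in> Ls n (Suc m)" "axis n k"
  shows "cinv k G as = cinv k H as"
proof -
  obtain a r where as: "as = a # r" "a \<in> sing n" "r \<in> Ls n m"
    using assms(2) by (rule Ls_SucE)
  have "G (down k (Suc l) a # r) = H (down k (Suc l) a # r)" for l
    by (rule assms(1)) (simp add: as down_sing[OF assms(3)])
  then show ?thesis
    by (simp add: as(1) cinv_def)
qed

lemma comm_cinv:
  assumes k: "axis n k" and G: "mlin n I (Suc m) G" and as: "as \<in> Ls n (Suc m)"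
  shows "comm (lterm k 1) (cinv k G) as = G as"
proof -
  obtain a r where as: "as = a # r" "a \<in> sing n" "r \<in> Ls n m"
    using as by (rule Ls_SucE)
  obtain N where N: "\<forall>l\<ge>N. down k l a = 0"
    using down_eventually_zero[OF k] ..
  have 0: "G (0 # r) = 0"
    using mlinD(4)[OF G as(3)] as(2) by blast
  define g where "g l = lterm k 1 ^ l * G (down k l a # r)" for l
  have "cinv k G (a # r) = - (\<Sum>l<N. lterm k 1 ^ l * G (down k (Suc l) a # r))"
    using N by (intro cinv_eq[of G, OF 0]) simp
  moreover have "cinv k G (lterm k 1 * a # r) = - (\<Sum>l<N. g l)"
    unfolding g_def by (subst cinv_eq[of G _ N, OF 0]) (use N in \<open>simp_all add: down_Suc_mult[OF as(2)]\<close>)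
  ultimately have "comm (lterm k 1) (cinv k G) (a # r) = (\<Sum>l<N. g l) - (\<Sum>l<N. g (Suc l))"
    by (simp add: comm_def g_def sum_distrib_left mult.assoc)
  also have "\<dots> = g 0 - g N"
    by (simp add: sum_lessThan_telescope' flip: sum_subtractf)
  also have "\<dots> = G as"
    using N by (simp add: g_def down_zero[OF as(2)] 0 as)
  finally show ?thesis
    by (simp add: as)
qed

text \<open>
  Dividing by one parameter commutes with multiplying by the other. This makes the two commutators
  behave like a regular sequence and drives the Koszul argument below.
\<close>

lemma comm_cinv_other:
  assumes k: "axis n k" "axis n k'" "k \<noteq> k'" and G: "mlin n I (Suc m) G" and as: "as \<in> Ls n (Suc m)"
  shows "comm (lterm k' 1) (cinv k G) as = cinv k (comm (lterm k' 1) G) as"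
proof -
  obtain a r where as: "as = a # r" "a \<in> sing n" "r \<in> Ls n m"
    using as by (rule Ls_SucE)
  obtain N where N: "\<forall>l\<ge>N. down k l a = 0"
    using down_eventually_zero[OF k(1)] ..
  have 0: "G (0 # r) = 0"
    using mlinD(4)[OF G as(3)] as(2) by blast
  have "cinv k G (a # r) = - (\<Sum>l<N. lterm k 1 ^ l * G (down k (Suc l) a # r))"
    using N by (intro cinv_eq[of G, OF 0]) simp
  moreover have "cinv k G (lterm k' 1 * a # r)
      = - (\<Sum>l<N. lterm k 1 ^ l * G (lterm k' 1 * down k (Suc l) a # r))"
    by (subst cinv_eq[of G _ N, OF 0]) (use N in \<open>simp_all add: down_mult_other[OF k as(2)]\<close>)
  moreover have "cinv k (comm (lterm k' 1) G) (a # r)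
      = - (\<Sum>l<N. lterm k 1 ^ l * comm (lterm k' 1) G (down k (Suc l) a # r))"
    using N by (intro cinv_eq) (simp_all add: comm_def 0)
  ultimately show ?thesis
    by (simp add: as comm_def sum_distrib_left right_diff_distrib sum_subtractf mult.left_commute)
qed

lemma axis_homog: "axis n k \<Longrightarrow> (lterm k 1 :: 'k::field laurent) ^ l \<in> homog (int l * int n)"
  and axis_sing: "axis n k \<Longrightarrow> lterm k 1 \<in> sing n"
  by (auto simp: axis_def term_power cone_def intro!: homog_term sing_term)

lemma coch_cinv:
  fixes G :: "'k::field laurent list \<Rightarrow> 'k laurent"
  assumes k: "axis n k" and G: "coch n I (Suc (Suc m)) j G" and I: "I \<subseteq> sing n"
  shows "coch n I (Suc (Suc m)) (j - int n) (cinv k G)"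
proof (rule coch_limit[where g = "\<lambda>N as. - (\<Sum>l<N. lterm k 1 ^ l * G (down k (Suc l) (hd as) # tl as))"])
  fix N
  have "coch n I (Suc (Suc m)) (j - int n) (\<lambda>as. lterm k 1 ^ l * G (down k (Suc l) (hd as) # tl as))" for l
  proof -
    have "coch n I (Suc (Suc m)) (j + - (int (Suc l) * int n)) (\<lambda>as. G (down k (Suc l) (hd as) # tl as))"
    proof (rule coch_head[OF G linear_op_down])
      show "down k (Suc l) u \<in> sing n" if "u \<in> sing n" for u :: "'k laurent"
        by (rule down_sing[OF k that])
      show "down k (Suc l) u \<in> homog (d + - (int (Suc l) * int n))" if "u \<in> homog d" for u :: "'k laurent" and d
        using down_homog[OF k that, of "Suc l"] by (simp only: diff_conv_add_uminus)
    qed simp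
    then have "coch n I (Suc (Suc m)) (j + - (int (Suc l) * int n) + int l * int n)
        (\<lambda>as. lterm k 1 ^ l * G (down k (Suc l) (hd as) # tl as))"
      by (intro coch_mult sing_power axis_sing axis_homog k)
    then show ?thesis
      by (simp add: algebra_simps)
  qed
  then show "coch n I (Suc (Suc m)) (j - int n)
      (\<lambda>as. - (\<Sum>l<N. lterm k 1 ^ l * G (down k (Suc l) (hd as) # tl as)))"
    by (intro coch_uminus coch_sum)
next
  fix as :: "'k laurent list" assume "as \<in> Ls n (Suc (Suc m))"
  then obtain a r where as: "as = a # r" "a \<in> sing n" "r \<in> Ls n (Suc m)"
    by (rule Ls_SucE)
  obtain N where N: "\<forall>l\<ge>N. down k l a = 0"
    using down_eventually_zero[OF k] ..
  have 0: "G (0 # r) = 0"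
    using mlinD(4)[of n I "Suc m" G r a a] G as by (auto simp: coch_def simp del: mlin.simps)
  show "\<exists>N0. \<forall>N\<ge>N0. cinv k G as = - (\<Sum>l<N. lterm k 1 ^ l * G (down k (Suc l) (hd as) # tl as))"
    unfolding as(1) list.sel
    by (rule exI[of _ N], intro allI impI cinv_eq[of G, OF 0]) (use N in auto)
qed (rule I)

lemma comm_commute: "as \<noteq> [] \<Longrightarrow> comm c (comm d G) as = comm d (comm c G) as"
  by (cases as) (simp_all add: comm_def algebra_simps)

lemma comm_cong:
  assumes "\<And>l. l \<in> Ls n (Suc m) \<Longrightarrow> G l = H l" "as \<in> Ls n (Suc m)" "c \<in> sing n"
  shows "comm c G as = comm c H as"
proof -
  obtain a r where as: "as = a # r" "a \<in> sing n" "r \<in> Ls n m"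
    using assms(2) by (rule Ls_SucE)
  have "G (a # r) = H (a # r)" "G (c * a # r) = H (c * a # r)"
    by (rule assms(1), simp add: as assms(3) sing_mult)+
  then show ?thesis
    by (simp add: as(1) comm_def)
qed

lemma comm_diff: "comm c (\<lambda>l. G l - H l) as = comm c G as - comm c H as"
  and comm_add: "comm c (\<lambda>l. G l + H l) as = comm c G as + comm c H as"
  by (simp_all add: comm_def algebra_simps)

lemma Ls_Suc_ne: "as \<in> Ls n (Suc m) \<Longrightarrow> as \<noteq> []"
  by auto

definition kfun :: "nat \<Rightarrow> ('k::field laurent list \<Rightarrow> 'k laurent) \<Rightarrow> 'k laurent list \<Rightarrow> 'k laurent"
  where "kfun n F = sg (\<lambda>as. comm (gx n) (sg (comm (gy n) (sg F))) as
    - comm (gy n) (sg (comm (gx n) (sg F))) as)"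

text \<open>
  The compatibility condition is the Koszul relation for the commuting operators \<open>comm x\<close> and
  \<open>comm y\<close>. It is sufficient because \<open>comm x\<close> has a right inverse that commutes with \<open>comm y\<close>.
\<close>

lemma koszul_solve:
  fixes K1 K2 :: "'k::field laurent list \<Rightarrow> 'k laurent"
  assumes "n > 0" "I \<subseteq> sing n" and I: "\<And>a u. a \<in> sing n \<Longrightarrow> u \<in> I \<Longrightarrow> a * u \<in> I"
    and K: "coch n I (Suc (Suc m)) (d + int n) K1" "coch n I (Suc (Suc m)) (d + int n) K2"
    and eq: "\<And>as. as \<in> Ls n (Suc (Suc m)) \<Longrightarrow> comm (gx n) K2 as = comm (gy n) K1 as"
  shows "\<exists>H. coch n I (Suc (Suc m)) d H \<and>
    (\<forall>as\<in>Ls n (Suc (Suc m)). comm (gx n) H as = K1 as \<and> comm (gy n) H as = K2 as)"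
proof -
  let ?M = "Suc (Suc m)"
  define a b :: "int \<times> int" where "a = (0, int n)" and "b = (int n, 0)"
  have ab: "axis n a" "axis n b" "a \<noteq> b" "b \<noteq> a"
    using \<open>n > 0\<close> by (auto simp: axis_def a_def b_def)
  have x: "gx n = (lterm a 1 :: 'k laurent)" and y: "gy n = (lterm b 1 :: 'k laurent)"
    by (simp_all add: gx_def gy_def a_def b_def)
  define C where "C = cinv a K1"
  define W where "W l = K2 l - comm (gy n) C l" for l
  define E where "E = cinv b W"
  have C: "coch n I ?M d C"
    using coch_cinv[OF ab(1) K(1) \<open>I \<subseteq> sing n\<close>] by (simp add: C_def)
  have yC: "coch n I ?M (d + int n) (comm (gy n) C)"
    by (rule coch_comm[OF C gy_sing gy_homog I])
  have W: "coch n I ?M (d + int n) W"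
    unfolding W_def[abs_def] by (rule coch_diff[OF K(2) yC])
  have E: "coch n I ?M d E"
    using coch_cinv[OF ab(2) W \<open>I \<subseteq> sing n\<close>] by (simp add: E_def)
  have mK: "mlin n I ?M K1" and mW: "mlin n I ?M W"
    using K W by (simp_all only: coch_def)
  have xC: "comm (gx n) C as = K1 as" if "as \<in> Ls n ?M" for as
    using comm_cinv[OF ab(1) mK that] by (simp add: C_def x)
  have xW: "comm (gx n) W as = 0" if "as \<in> Ls n ?M" for as
  proof -
    have "comm (gx n) (comm (gy n) C) as = comm (gy n) (comm (gx n) C) as"
      by (rule comm_commute[OF Ls_Suc_ne[OF that]])
    also have "\<dots> = comm (gy n) K1 as"
      by (rule comm_cong[OF xC that gy_sing])
    finally show ?thesis
      using eq[OF that] by (simp add: W_def[abs_def] comm_diff)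
  qed
  have xE: "comm (gx n) E as = 0" if "as \<in> Ls n ?M" for as
  proof -
    have "comm (gx n) E as = cinv b (comm (gx n) W) as"
      using comm_cinv_other[OF ab(2,1,4) mW that] by (simp add: E_def x)
    also have "\<dots> = cinv b (\<lambda>_. 0) as"
      by (rule cinv_cong[OF xW that ab(2)])
    finally show ?thesis by (simp add: cinv_def)
  qed
  have yE: "comm (gy n) E as = W as" if "as \<in> Ls n ?M" for as
    using comm_cinv[OF ab(2) mW that] by (simp add: E_def y)
  show ?thesis
    by (rule exI[of _ "\<lambda>l. C l + E l"])
      (auto simp: comm_add xC xE yE W_def intro!: coch_add C E)
qed

text \<open>
  A \<open>bd\<close>-cocycle that is linear over \<open>\<Bbbk>[x, y]\<close> bounds a cochain with the same linearity. Its contraction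
  \<open>sg F\<close> bounds it but need not be linear; the defects under \<open>x\<close> and \<open>y\<close>, contracted once more, are
  compared by \<open>kfun\<close>, and as soon as that obstruction is a Koszul boundary the contraction can be
  corrected by \<open>koszul_solve\<close>.
\<close>

lemma bar_extension:
  fixes F :: "'k::field laurent list \<Rightarrow> 'k laurent"
  assumes "n > 0" "I \<subseteq> sing n" and I: "\<And>a u. a \<in> sing n \<Longrightarrow> u \<in> I \<Longrightarrow> a * u \<in> I"
    and F: "coch n I (Suc (Suc (Suc (Suc m)))) d F"
    and xF: "\<And>as. as \<in> Ls n (Suc (Suc (Suc (Suc m)))) \<Longrightarrow> comm (gx n) F as = 0"
    and yF: "\<And>as. as \<in> Ls n (Suc (Suc (Suc (Suc m)))) \<Longrightarrow> comm (gy n) F as = 0"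
    and bdF: "\<And>as. as \<in> Ls n (Suc (Suc (Suc (Suc (Suc m))))) \<Longrightarrow> bd F as = 0"
    and A: "coch n I (Suc m) (d + int n) A1" "coch n I (Suc m) (d + int n) A2"
    and L: "\<And>as. as \<in> Ls n (Suc m) \<Longrightarrow> kfun n F as = comm (gx n) A2 as - comm (gy n) A1 as"
  shows "\<exists>H. coch n I (Suc (Suc (Suc m))) d H \<and>
    (\<forall>as\<in>Ls n (Suc (Suc (Suc m))). comm (gx n) H as = 0 \<and> comm (gy n) H as = 0) \<and>
    (\<forall>as\<in>Ls n (Suc (Suc (Suc (Suc m)))). bd H as = F as)"
proof -
  let ?x = "gx n :: 'k laurent" and ?y = "gy n :: 'k laurent"
  define H0 where "H0 = sg F"
  define Kx where "Kx = sg (comm ?x H0)"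
  define Ky where "Ky = sg (comm ?y H0)"
  note cI = coch_comm[OF _ gx_sing gx_homog I] coch_comm[OF _ gy_sing gy_homog I]
  have H0: "coch n I (Suc (Suc (Suc m))) d H0"
    unfolding H0_def by (rule coch_sg[OF F])
  have K: "coch n I (Suc (Suc m)) (d + int n) Kx" "coch n I (Suc (Suc m)) (d + int n) Ky"
    using coch_sg[OF cI(1)[OF H0]] coch_sg[OF cI(2)[OF H0]] by (simp_all only: Kx_def Ky_def)
  have bdH0: "bd H0 as = F as" if "as \<in> Ls n (Suc (Suc (Suc (Suc m))))" for as
    using bd_sg[OF Ls_Suc_ne[OF that], of F] bdF[of "1 # as"] that by (simp add: H0_def sg_def)
  have bdK: "bd (sg (comm c H0)) as = comm c H0 as"
    if cF: "\<And>as. as \<in> Ls n (Suc (Suc (Suc (Suc m)))) \<Longrightarrow> comm c F as = 0"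
      and as: "as \<in> Ls n (Suc (Suc (Suc m)))" and c: "c \<in> sing n" for c as
  proof -
    have 1: "1 # as \<in> Ls n (Suc (Suc (Suc (Suc m))))"
      using as by simp
    have "bd (comm c H0) (1 # as) = comm c (bd H0) (1 # as)"
      by (rule bd_comm) simp
    also have "\<dots> = comm c F (1 # as)"
      by (rule comm_cong[OF bdH0 1 c])
    also have "\<dots> = 0"
      by (rule cF[OF 1])
    finally show ?thesis
      using bd_sg[OF Ls_Suc_ne[OF as], of "comm c H0"] by (simp add: sg_def)
  qed
  have bdKx: "bd Kx as = comm ?x H0 as" and bdKy: "bd Ky as = comm ?y H0 as"
    if "as \<in> Ls n (Suc (Suc (Suc m)))" for as
    using bdK[OF xF that] bdK[OF yF that] by (simp_all add: Kx_def Ky_def)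
  define P where "P as = comm ?x Ky as - comm ?y Kx as" for as
  have kfun: "kfun n F = sg P"
    by (simp add: kfun_def P_def[abs_def] Kx_def Ky_def H0_def)
  have bdP: "bd P as = 0" if as: "as \<in> Ls n (Suc (Suc (Suc m)))" for as
  proof -
    have "bd P as = comm ?x (bd Ky) as - comm ?y (bd Kx) as"
      using as by (simp add: P_def[abs_def] bd_diff bd_comm Ls_Suc_ne)
    also have "\<dots> = comm ?x (comm ?y H0) as - comm ?y (comm ?x H0) as"
      using comm_cong[OF bdKy as gx_sing] comm_cong[OF bdKx as gy_sing] by simp
    also have "\<dots> = 0"
      using comm_commute[of as ?x ?y H0] as by (simp add: Ls_Suc_ne)
    finally show ?thesis .
  qed
  have PL: "P as = bd (kfun n F) as" if as: "as \<in> Ls n (Suc (Suc m))" for as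
    using bd_sg[OF Ls_Suc_ne[OF as], of P] bdP[of "1 # as"] as by (simp add: kfun sg_def)
  have "P as = comm ?x (bd A2) as - comm ?y (bd A1) as" if as: "as \<in> Ls n (Suc (Suc m))" for as
    using PL[OF as] bd_cong[OF L as] as by (simp add: bd_diff bd_comm Ls_Suc_ne)
  then have eq: "comm ?x (\<lambda>l. Ky l - bd A2 l) as = comm ?y (\<lambda>l. Kx l - bd A1 l) as"
    if "as \<in> Ls n (Suc (Suc m))" for as
    using that by (simp add: comm_diff P_def algebra_simps)
  have bdA: "coch n I (Suc (Suc m)) (d + int n) (bd A1)" "coch n I (Suc (Suc m)) (d + int n) (bd A2)"
    using coch_bd[OF I \<open>I \<subseteq> sing n\<close> A(1)] coch_bd[OF I \<open>I \<subseteq> sing n\<close> A(2)] by simp_all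
  obtain H' where H': "coch n I (Suc (Suc m)) d H'"
    "\<And>as. as \<in> Ls n (Suc (Suc m)) \<Longrightarrow> comm ?x H' as = Kx as - bd A1 as"
    "\<And>as. as \<in> Ls n (Suc (Suc m)) \<Longrightarrow> comm ?y H' as = Ky as - bd A2 as"
    using koszul_solve[OF \<open>n > 0\<close> \<open>I \<subseteq> sing n\<close> I coch_diff[OF K(1) bdA(1)] coch_diff[OF K(2) bdA(2)] eq]
    by auto
  define H1 where "H1 l = H0 l - bd H' l" for l
  have bdH': "coch n I (Suc (Suc (Suc m))) d (bd H')"
    by (rule coch_bd[OF I \<open>I \<subseteq> sing n\<close> H'(1)])
  have H1: "coch n I (Suc (Suc (Suc m))) d H1"
    unfolding H1_def[abs_def] by (rule coch_diff[OF H0 bdH'])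
  have "comm ?x H1 as = 0 \<and> comm ?y H1 as = 0" if as: "as \<in> Ls n (Suc (Suc (Suc m)))" for as
  proof -
    have "comm ?x (bd H') as = bd (\<lambda>l. Kx l - bd A1 l) as" "comm ?y (bd H') as = bd (\<lambda>l. Ky l - bd A2 l) as"
      using bd_cong[of n "Suc (Suc m)" "comm ?x H'" "\<lambda>l. Kx l - bd A1 l", OF H'(2) as]
        bd_cong[of n "Suc (Suc m)" "comm ?y H'" "\<lambda>l. Ky l - bd A2 l", OF H'(3) as]
        bd_comm[OF Ls_Suc_ne[OF as], of _ H'] by simp_all
    then show ?thesis
      using bdKx[OF as] bdKy[OF as] by (simp add: H1_def[abs_def] comm_diff bd_diff bd_bd)
  qed
  moreover have "bd H1 as = F as" if "as \<in> Ls n (Suc (Suc (Suc (Suc m))))" for as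
    using bdH0[OF that] by (simp add: H1_def[abs_def] bd_diff bd_bd)
  ultimately show ?thesis
    using H1 by blast
qed

section \<open>From the subring of parameters to the whole ring\<close>

text \<open>
  The ring \<open>sing n\<close> is free over \<open>\<Bbbk>[x, y]\<close> on \<open>1, z, \<dots>, z\<^bsup>n - 1\<^esup>\<close>; \<open>tau\<close> takes the coefficient of \<open>z\<^bsup>n - 1\<^esup>\<close>.
  It is a Frobenius form for this extension.
\<close>

definition tau :: "nat \<Rightarrow> 'k::field laurent \<Rightarrow> 'k laurent"
  where "tau n f = part {(p, q). 0 \<le> p \<and> 0 \<le> q \<and> int n dvd p \<and> int n dvd q}
    (lterm (- (int n - 1), - (int n - 1)) 1 * f)"

lemma lcoeff_tau:
  "lcoeff (tau n f) (p, q) = (if 0 \<le> p \<and> 0 \<le> q \<and> int n dvd p \<and> int n dvd q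
    then lcoeff f (p + int n - 1, q + int n - 1) else 0)"
proof -
  have "p - (1 - int n) = p + int n - 1" "q - (1 - int n) = q + int n - 1"
    by simp_all
  then show ?thesis
    unfolding tau_def lcoeff_part lcoeff_term_mult by (simp add: diff_diff_eq2)
qed

lemma linear_op_tau: "linear_op (tau n)"
  unfolding tau_def by (rule linear_op_comp[OF linear_op_part linear_op_mult])

lemma tau_sing: "tau n f \<in> sing n"
  unfolding sing_def cone_def by (auto simp: lcoeff_tau split: if_splits intro: dvd_diff)

lemma tau_homog: 
  assumes "f \<in> homog d"
  shows "tau n f \<in> homog (d + - (2 * (int n - 1)))"
  unfolding homog_def
proof safe
  fix p q
  assume "lcoeff (tau n f) (p, q) \<noteq> 0"
  then have "lcoeff f (p + int n - 1, q + int n - 1) \<noteq> 0"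
    by (simp add: lcoeff_tau split: if_splits)
  then have "p + int n - 1 + (q + int n - 1) = d"
    using assms unfolding homog_def by blast
  then show "p + q = d + - (2 * (int n - 1))"
    by simp
qed

lemma tau_param:
  fixes f :: "'k::field laurent"
  assumes "n > 0" "f \<in> sing n"
  shows "tau n (gx n * f) = gx n * tau n f" "tau n (gy n * f) = gy n * tau n f"
proof -
  have z: "lcoeff f (p, q - 1) = 0" "lcoeff f (q - 1, p) = 0" if "int n dvd q" "q - int n < 0" for p q
  proof -
    have "q \<le> 0"
      using that assms(1) zdvd_imp_le[of "int n" q] by linarith
    then show "lcoeff f (p, q - 1) = 0" "lcoeff f (q - 1, p) = 0"
      by (auto intro!: sing_quad[OF assms(2)])
  qed
  have dvd_diff_right_iff': "int n dvd p - int n \<longleftrightarrow> int n dvd p" for p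
    by (metis dvd_diff_commute dvd_diff_right_iff dvd_refl dvd_minus_iff diff_0_right dvd_add_right_iff diff_add_cancel)
  show "tau n (gx n * f) = gx n * tau n f"
  proof (rule laurent_eqI)
    fix p q
    show "lcoeff (tau n (gx n * f)) (p, q) = lcoeff (gx n * tau n f) (p, q)"
      using z(1)[of q "p + int n - 1"] dvd_diff_right_iff'[of q]
      by (auto simp: lcoeff_tau gx_def lcoeff_term_mult)
  qed
  show "tau n (gy n * f) = gy n * tau n f"
  proof (rule laurent_eqI)
    fix p q
    show "lcoeff (tau n (gy n * f)) (p, q) = lcoeff (gy n * tau n f) (p, q)"
      using z(2)[of p "q + int n - 1"] dvd_diff_right_iff'[of p]
      by (auto simp: lcoeff_tau gy_def lcoeff_term_mult)
  qed
qed

text \<open>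
  The bases \<open>z\<^sup>k\<close> and \<open>z\<^bsup>n - 1 - k\<^esup>\<close> are dual for the form \<open>tau\<close>. This identity turns a homotopy that is
  linear over \<open>\<Bbbk>[x, y]\<close> into one that is linear over the whole ring.
\<close>

lemma casimir:
  fixes f :: "'k::field laurent"
  assumes "n > 0" "f \<in> sing n"
  shows "(\<Sum>k<n. gz ^ k * tau n (gz ^ (n - 1 - k) * f)) = f"
proof (rule laurent_eqI)
  fix p q
  show "lcoeff (\<Sum>k<n. gz ^ k * tau n (gz ^ (n - 1 - k) * f)) (p, q) = lcoeff f (p, q)"
  proof (cases "lcoeff f (p, q) = 0")
    case True
    then show ?thesis
      by (auto simp: lookup_sum gz_power lcoeff_term_mult lcoeff_tau of_nat_diff intro!: sum.neutral)
  next
    case False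
    then have pq: "0 \<le> p" "0 \<le> q" "int n dvd q - p"
      using singD[OF assms(2) False] by (auto simp: cone_def)
    define r where "r = nat (p mod int n)"
    have r: "int r = p mod int n" "r < n"
      using assms(1) by (auto simp: r_def nat_less_iff)
    have q: "q mod int n = p mod int n"
      using pq(3) by (simp add: mod_eq_dvd_iff)
    have k_iff: "(int k \<le> p \<and> int k \<le> q \<and> int n dvd p - int k \<and> int n dvd q - int k) \<longleftrightarrow> k = r"
      if "k < n" for k
    proof
      assume "int k \<le> p \<and> int k \<le> q \<and> int n dvd p - int k \<and> int n dvd q - int k"
      then have "p mod int n = int k"
        using that by (simp add: mod_eq_dvd_iff[symmetric])
      then show "k = r" using r by simp
    next
      assume "k = r"
      then show "int k \<le> p \<and> int k \<le> q \<and> int n dvd p - int k \<and> int n dvd q - int k"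
        using r q pq zmod_le_nonneg_dividend[of p "int n"] zmod_le_nonneg_dividend[of q "int n"]
        by (simp add: mod_eq_dvd_iff[symmetric])
    qed
    have "lcoeff (gz ^ k * tau n (gz ^ (n - 1 - k) * f)) (p, q) = (if k = r then lcoeff f (p, q) else 0)"
      if "k < n" for k
      using k_iff[OF that] that by (simp add: gz_power lcoeff_term_mult lcoeff_tau of_nat_diff)
    then have "lcoeff (\<Sum>k<n. gz ^ k * tau n (gz ^ (n - 1 - k) * f)) (p, q)
        = (\<Sum>k<n. if k = r then lcoeff f (p, q) else 0)"
      by (simp add: lookup_sum)
    then show ?thesis
      using r by simp
  qed
qed

lemma Ls_hd: "a # r \<in> Ls n (Suc m) \<Longrightarrow> c \<in> sing n \<Longrightarrow> c * a # r \<in> Ls n (Suc m)"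
  by (simp add: sing_mult)

lemma gz_homog_power: "gz ^ k \<in> homog (2 * int k)"
  unfolding gz_power by (rule homog_term) simp

text \<open>
  Composing with \<open>tau\<close> gives a cocycle with values in \<open>\<Bbbk>[x, y]\<close>, to which \<open>bar_extension\<close> applies, and
  \<open>casimir\<close> reassembles the result. The only obstruction is the Koszul class, here assumed to be a
  boundary.
\<close>

lemma bar_exact:
  fixes f :: "'k::field laurent list \<Rightarrow> 'k laurent"
  assumes n: "n > 0" "I \<subseteq> sing n" and I: "\<And>a u. a \<in> sing n \<Longrightarrow> u \<in> I \<Longrightarrow> a * u \<in> I"
    and f: "coch n I (Suc (Suc (Suc m))) j f"
    and cocycle: "\<And>as. as \<in> Ls n (Suc (Suc (Suc (Suc m)))) \<Longrightarrow> bardiff f as = 0"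
    and d: "d = j + - (2 * (int n - 1))"
    and A: "coch n I (Suc m) (d + int n) A1" "coch n I (Suc m) (d + int n) A2"
    and L: "\<And>as. as \<in> Ls n (Suc m) \<Longrightarrow>
      kfun n (\<lambda>l. tau n (hd l * f (tl l))) as = comm (gx n) A2 as - comm (gy n) A1 as"
  shows "\<exists>h. coch n I (Suc (Suc m)) j h \<and> (\<forall>as\<in>Ls n (Suc (Suc (Suc m))). bardiff h as = f as)"
proof -
  define F where "F l = tau n (hd l * f (tl l))" for l
  have mf: "mlin n I (Suc (Suc (Suc m))) f"
    using f by (simp only: coch_def)
  have F: "coch n I (Suc (Suc (Suc (Suc m)))) d F"
    unfolding F_def[abs_def] d
    by (rule coch_post[OF coch_cons[OF f] linear_op_tau tau_sing tau_homog])
  have val: "a * f r \<in> sing n" if "a # r \<in> Ls n (Suc (Suc (Suc (Suc m))))" for a r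
    using that mlin_value[OF mf, of r] by (simp add: sing_mult)
  have bdF: "bd F as = 0" if l: "as \<in> Ls n (Suc (Suc (Suc (Suc (Suc m)))))" for as
  proof -
    obtain a r where as: "as = a # r" "a \<in> sing n" "r \<in> Ls n (Suc (Suc (Suc (Suc m))))"
      using l by (rule Ls_SucE)
    have "bd F as = tau n (bd (\<lambda>l. hd l * f (tl l)) as)"
      unfolding F_def by (rule bd_additive) (rule linear_opD(4)[OF linear_op_tau])
    also have "\<dots> = tau n 0"
      using as cocycle[of r] by (simp add: bd_cons Ls_Suc_ne)
    finally show ?thesis
      by (simp add: linear_opD(3)[OF linear_op_tau])
  qed
  have xyF: "comm (gx n) F as = 0" "comm (gy n) F as = 0" if l: "as \<in> Ls n (Suc (Suc (Suc (Suc m))))" for as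
  proof -
    obtain a r where as: "as = a # r" "a \<in> sing n" "r \<in> Ls n (Suc (Suc (Suc m)))"
      using l by (rule Ls_SucE)
    have "a * f r \<in> sing n" using val[of a r] as by simp
    from tau_param[OF n(1) this] show "comm (gx n) F as = 0" "comm (gy n) F as = 0"
      by (simp_all add: comm_def F_def as(1) mult.assoc)
  qed
  have "\<exists>H. coch n I (Suc (Suc (Suc m))) d H \<and>
    (\<forall>as\<in>Ls n (Suc (Suc (Suc m))). comm (gx n) H as = 0 \<and> comm (gy n) H as = 0) \<and>
    (\<forall>as\<in>Ls n (Suc (Suc (Suc (Suc m)))). bd H as = F as)"
    by (rule bar_extension[OF n I F xyF bdF A]) (use L in \<open>simp_all add: F_def[abs_def]\<close>)
  then obtain H where H: "coch n I (Suc (Suc (Suc m))) d H"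
    "\<And>as. as \<in> Ls n (Suc (Suc (Suc m))) \<Longrightarrow> comm (gx n) H as = 0 \<and> comm (gy n) H as = 0"
    "\<And>as. as \<in> Ls n (Suc (Suc (Suc (Suc m)))) \<Longrightarrow> bd H as = F as"
    by blast
  define g where "g k l = gz ^ k * H (gz ^ (n - 1 - k) * hd l # tl l)" for k l
  define B where "B l = (\<Sum>k<n. g k l)" for l
  have g: "coch n I (Suc (Suc (Suc m))) j (g k)" if "k < n" for k
  proof -
    have "coch n I (Suc (Suc (Suc m))) (d + 2 * int (n - 1 - k)) (\<lambda>l. H (gz ^ (n - 1 - k) * hd l # tl l))"
    proof (rule coch_head[OF H(1) linear_op_mult])
      show "gz ^ (n - 1 - k) * u \<in> sing n" if "u \<in> sing n" for u :: "'k laurent"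
        by (intro sing_mult sing_power gz_sing that)
      show "gz ^ (n - 1 - k) * u \<in> homog (e + 2 * int (n - 1 - k))" if "u \<in> homog e" for u :: "'k laurent" and e
        using homog_mult[OF gz_homog_power that, of "n - 1 - k"] by (simp add: add.commute)
    qed simp
    then have "coch n I (Suc (Suc (Suc m))) (d + 2 * int (n - 1 - k) + 2 * int k) (g k)"
      unfolding g_def by (rule coch_mult) (intro sing_power gz_sing, rule gz_homog_power)
    moreover have "d + 2 * int (n - 1 - k) + 2 * int k = j"
      using that by (simp add: d of_nat_diff)
    ultimately show ?thesis by simp
  qed
  have B: "coch n I (Suc (Suc (Suc m))) j B"
    unfolding B_def[abs_def] by (rule coch_sum) (rule g, simp)
  have mB: "mlin n I (Suc (Suc (Suc m))) B" and mH: "mlin n I (Suc (Suc (Suc m))) H"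
    using B H(1) by (simp_all only: coch_def)
  have bdB: "bd B as = hd as * f (tl as)" if as: "as \<in> Ls n (Suc (Suc (Suc (Suc m))))" for as
  proof -
    obtain a r where ar: "as = a # r" "a \<in> sing n" "r \<in> Ls n (Suc (Suc (Suc m)))"
      using as by (rule Ls_SucE)
    have "bd B as = (\<Sum>k<n. gz ^ k * bd H (gz ^ (n - 1 - k) * a # r))"
      by (simp add: B_def[abs_def] g_def[abs_def] bd_sum bd_mult bd_head ar(1))
    also have "\<dots> = (\<Sum>k<n. gz ^ k * tau n (gz ^ (n - 1 - k) * (a * f r)))"
    proof (rule sum.cong[OF refl])
      fix k
      have "gz ^ (n - 1 - k) * a # r \<in> Ls n (Suc (Suc (Suc (Suc m))))"
        using as ar(1) by (intro Ls_hd sing_power gz_sing) simp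
      then show "gz ^ k * bd H (gz ^ (n - 1 - k) * a # r) = gz ^ k * tau n (gz ^ (n - 1 - k) * (a * f r))"
        using H(3) by (simp add: F_def mult.assoc)
    qed
    also have "\<dots> = a * f r"
      using casimir[OF n(1) val[of a r]] as by (simp add: ar(1))
    finally show ?thesis by (simp add: ar(1))
  qed
  have Bmult: "B (b * a # r) = b * B (a # r)" if "b \<in> sing n" "a \<in> sing n" "r \<in> Ls n (Suc (Suc m))" for a b r
    using that(1) n(1) that(2)
  proof (induction arbitrary: a rule: sing_generated)
    case (scalar c)
    then show ?case using mlinD(2)[OF mB that(3), of a a c] by simp
  next
    case x
    have "H (gz ^ i * (gx n * a) # r) = gx n * H (gz ^ i * a # r)" for i
      using H(2)[of "gz ^ i * a # r"] that(3) x
      by (simp add: comm_def sing_mult sing_power mult.left_commute)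
    then show ?case by (simp add: B_def g_def sum_distrib_left mult.left_commute)
  next
    case y
    have "H (gz ^ i * (gy n * a) # r) = gy n * H (gz ^ i * a # r)" for i
      using H(2)[of "gz ^ i * a # r"] that(3) y
      by (simp add: comm_def sing_mult sing_power mult.left_commute)
    then show ?case by (simp add: B_def g_def sum_distrib_left mult.left_commute)
  next
    case z
    define s where "s k = gz ^ k * H (gz ^ (n - k) * a # r)" for k
    have "B (gz * a # r) = (\<Sum>k<n. s k)"
      unfolding B_def
    proof (rule sum.cong[OF refl])
      fix k assume "k \<in> {..<n}"
      then have "n - k = Suc (n - 1 - k)" by auto
      then show "g k (gz * a # r) = s k"
        by (simp add: g_def s_def mult.assoc mult.left_commute)
    qed
    moreover have "gz * B (a # r) = (\<Sum>k<n. s (Suc k))"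
      by (simp add: B_def g_def s_def sum_distrib_left mult.assoc)
    ultimately have "B (gz * a # r) - gz * B (a # r) = s 0 - s n"
      by (simp add: sum_lessThan_telescope' flip: sum_subtractf)
    also have "s 0 = gx n * gy n * H (a # r)"
      using H(2)[of "gy n * a # r"] H(2)[of "a # r"] that(3) z
      by (simp add: s_def gz_power_n comm_def sing_mult mult.assoc)
    also have "\<dots> = s n"
      by (simp add: s_def gz_power_n)
    finally show ?case by simp
  next
    case (add u v)
    then show ?case
      using mlinD(1)[OF mB that(3), of "u * a" "v * a"] by (simp add: distrib_right sing_mult)
  next
    case (mult u v)
    then show ?case by (simp add: mult.assoc sing_mult)
  qed
  have "bardiff (sg B) as = f as" if l: "as \<in> Ls n (Suc (Suc (Suc m)))" for as
  proof -
    obtain a r where as: "as = a # r" "a \<in> sing n" "r \<in> Ls n (Suc (Suc m))"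
      using l by (rule Ls_SucE)
    have "bd (sg B) as = B as - f as"
      using bd_sg[OF Ls_Suc_ne[OF l], of B] bdB[of "1 # as"] l by (simp add: sg_def)
    then show ?thesis
      using Bmult[OF as(2) sing_one as(3)] by (simp add: bardiff_def as(1) sg_def)
  qed
  then show ?thesis
    using coch_sg[OF B] by blast
qed

text \<open>
  In degree three and above the last entry is far enough from the first one for the right inverse
  \<open>cinv\<close> to respect \<open>I\<close>, so the Koszul obstruction is always a boundary. This is the statement that
  \<open>Ext\<^sup>p(T/I, T)\<close> vanishes for \<open>p > 2\<close>.
\<close>

theorem ext_vanishes:
  fixes f :: "'k::field laurent list \<Rightarrow> 'k laurent"
  assumes n: "n > 0" "I \<subseteq> sing n" and I: "\<And>a u. a \<in> sing n \<Longrightarrow> u \<in> I \<Longrightarrow> a * u \<in> I"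
    and f: "coch n I (Suc (Suc (Suc (Suc m)))) j f"
    and cocycle: "\<And>as. as \<in> Ls n (Suc (Suc (Suc (Suc (Suc m))))) \<Longrightarrow> bardiff f as = 0"
  shows "\<exists>h. coch n I (Suc (Suc (Suc m))) j h \<and> (\<forall>as\<in>Ls n (Suc (Suc (Suc (Suc m)))). bardiff h as = f as)"
proof -
  define d where "d = j + - (2 * (int n - 1))"
  define F where "F l = tau n (hd l * f (tl l))" for l
  have F: "coch n I (Suc (Suc (Suc (Suc (Suc m))))) d F"
    unfolding F_def[abs_def] d_def
    by (rule coch_post[OF coch_cons[OF f] linear_op_tau tau_sing tau_homog])
  note cI = coch_comm[OF _ gx_sing gx_homog I] coch_comm[OF _ gy_sing gy_homog I]
  note K = coch_sg[OF cI(1)[OF coch_sg[OF F]]] coch_sg[OF cI(2)[OF coch_sg[OF F]]]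
  have L: "coch n I (Suc (Suc m)) (d + int n + int n) (kfun n F)"
    unfolding kfun_def by (rule coch_sg[OF coch_diff[OF cI(1)[OF K(2)] cI(2)[OF K(1)]]])
  define k where "k = (0 :: int, int n)"
  have k: "axis n k" "gx n = (lterm k 1 :: 'k laurent)"
    using n by (auto simp: axis_def k_def gx_def)
  have A2: "coch n I (Suc (Suc m)) (d + int n) (cinv k (kfun n F))"
    using coch_cinv[OF k(1) L n(2)] by (simp only: add_diff_cancel_right')
  have mL: "mlin n I (Suc (Suc m)) (kfun n F)"
    using L by (simp only: coch_def)
  show ?thesis
  proof (rule bar_exact[OF n I f cocycle d_def coch_zero A2])
    fix as :: "'k laurent list" assume "as \<in> Ls n (Suc (Suc m))"
    from comm_cinv[OF k(1) mL this] have "comm (gx n) (cinv k (kfun n F)) as = kfun n F as"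
      by (simp only: k(2))
    moreover have "comm (gy n) (\<lambda>l. 0) as = (0 :: 'k laurent)"
      by (simp add: comm_def)
    ultimately show "kfun n (\<lambda>l. tau n (hd l * f (tl l))) as
        = comm (gx n) (cinv k (kfun n F)) as - comm (gy n) (\<lambda>l. 0) as"
      by (simp add: F_def[abs_def])
  qed
qed

section \<open>The second local cohomology and the graded dual\<close>

text \<open>
  The ideals of elements of degree at least \<open>k\<close>; local cohomology is the limit of \<open>Ext(T/tr k, T)\<close>.
\<close>

definition tr :: "nat \<Rightarrow> nat \<Rightarrow> 'k::field laurent set"
  where "tr n k = {b \<in> sing n. \<forall>p q. lcoeff b (p, q) \<noteq> 0 \<longrightarrow> int k \<le> p + q}"

lemma tr_sing: "tr n k \<subseteq> sing n"
  by (auto simp: tr_def)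

lemma tr_ideal:
  fixes a :: "'k::field laurent"
  assumes "a \<in> sing n" "u \<in> tr n k"
  shows "a * u \<in> tr n k"
proof -
  have "int k \<le> p + q" if nz: "lcoeff (a * u) (p, q) \<noteq> 0" for p q
  proof -
    obtain c where "lcoeff a c * lcoeff u ((p, q) - c) \<noteq> 0"
      using nz unfolding lcoeff_mult by (auto elim: sum.not_neutral_contains_not_neutral)
    then have 1: "lcoeff a c \<noteq> 0" and 2: "lcoeff u (p - fst c, q - snd c) \<noteq> 0"
      by (cases c, auto)+
    have "int k \<le> p - fst c + (q - snd c)"
      using assms(2) 2 unfolding tr_def by blast
    moreover have "c \<in> cone n"
      by (rule singD[OF assms(1) 1])
    ultimately show ?thesis
      by (auto simp: cone_def)
  qed
  then show ?thesis
    using assms by (simp add: tr_def sing_mult)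
qed

definition xy :: "nat \<Rightarrow> nat \<Rightarrow> nat \<Rightarrow> 'k::field laurent \<Rightarrow> 'k laurent"
  where "xy n i j r = gx n ^ i * (gy n ^ j * r)"

lemma xy_sing: "r \<in> sing n \<Longrightarrow> xy n i j r \<in> sing n"
  by (simp add: xy_def sing_mult sing_power)

lemma xy_Suc: "gx n * xy n i j r = xy n (Suc i) j r" "gy n * xy n i j r = xy n i (Suc j) r"
  "xy n i j (gx n * r) = xy n (Suc i) j r" "xy n i j (gy n * r) = xy n i (Suc j) r"
  by (simp_all add: xy_def ac_simps)

lemma xy_xy: "xy n i j (xy n i' j' r) = xy n (i + i') (j + j') r"
  by (simp add: xy_def power_add ac_simps)

lemma xy_0 [simp]: "xy n 0 0 r = r"
  by (simp add: xy_def)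

lemma xy_eq: "xy n i j r = lterm (int j * int n, int i * int n) 1 * r"
  by (simp add: xy_def gx_power gy_power mult.assoc[symmetric] mult_single)

lemma xy_homog: "r \<in> homog e \<Longrightarrow> xy n i j r \<in> homog (e + int n * (int i + int j))"
  unfolding xy_eq
  using homog_mult[OF homog_term[OF refl], of r e "int j * int n" "int i * int n" 1]
  by (simp add: algebra_simps)

lemma xy_tr:
  fixes r :: "'k::field laurent"
  assumes "n > 0" "r \<in> sing n" "k \<le> i \<or> k \<le> j"
  shows "xy n i j r \<in> tr n k"
proof -
  have "int k \<le> p + q" if "lcoeff (xy n i j r) (p, q) \<noteq> 0" for p q
  proof -
    have "lcoeff r (p - int j * int n, q - int i * int n) \<noteq> 0"
      using that by (simp add: xy_eq lcoeff_term_mult)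
    from singD[OF assms(2) this] have "int j * int n \<le> p" "int i * int n \<le> q"
      by (simp_all add: cone_def)
    moreover have "int j \<le> int j * int n" "int i \<le> int i * int n"
      using assms(1) mult_left_mono[of 1 "int n"] by simp_all
    ultimately show ?thesis
      using assms(3) by linarith
  qed
  then show ?thesis
    using xy_sing[OF assms(2)] by (simp add: tr_def)
qed

text \<open>
  Comparison with the Koszul complex of the regular sequence \<open>x, y\<close>: a two-cocycle is antisymmetrised
  in these two entries.
\<close>

definition lam :: "nat \<Rightarrow> ('k::field laurent list \<Rightarrow> 'k laurent) \<Rightarrow> 'k laurent \<Rightarrow> 'k laurent"
  where "lam n f m = f [gy n, gx n, m] - f [gx n, gy n, m]"

definition tcoeff :: "nat \<Rightarrow> ('k::field laurent \<Rightarrow> 'k laurent) \<Rightarrow> 'k laurent \<Rightarrow> nat \<Rightarrow> nat \<Rightarrow> 'k"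
  where "tcoeff n \<Lambda> r i j
    = lcoeff (\<Lambda> (xy n i j r)) (int j * int n + int n - 1, int i * int n + int n - 1)"

text \<open>
  The residue pairing. The class of a cocycle \<open>f\<close> corresponds to the functional
  \<open>r \<mapsto> \<Sum>\<^bsub>i, j\<^esub> res (x\<^bsup>- i - 1\<^esup> y\<^bsup>- j - 1\<^esup> \<lambda>(x\<^sup>i y\<^sup>j r))\<close>, where \<open>res\<close> reads off the coefficient of \<open>z\<^bsup>n - 1\<^esup>\<close>. On
  \<open>x\<^sup>i y\<^sup>j r\<close> of high degree the cocycle vanishes, so the sum is finite. The definition sums over the
  nonzero terms so that it needs no bound.
\<close>

definition theta :: "nat \<Rightarrow> ('k::field laurent \<Rightarrow> 'k laurent) \<Rightarrow> 'k laurent \<Rightarrow> 'k"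
  where "theta n \<Lambda> r = (\<Sum>(i, j) | tcoeff n \<Lambda> r i j \<noteq> 0. tcoeff n \<Lambda> r i j)"

lemma theta_eq:
  assumes "\<And>i j. N \<le> i \<or> N \<le> j \<Longrightarrow> tcoeff n \<Lambda> r i j = 0"
  shows "theta n \<Lambda> r = (\<Sum>i<N. \<Sum>j<N. tcoeff n \<Lambda> r i j)"
proof -
  have "{(i, j). tcoeff n \<Lambda> r i j \<noteq> 0} \<subseteq> {..<N} \<times> {..<N}"
    using assms by (auto simp: not_le[symmetric] simp del: not_le)
  then have "theta n \<Lambda> r = (\<Sum>(i, j)\<in>{..<N} \<times> {..<N}. tcoeff n \<Lambda> r i j)"
    unfolding theta_def by (intro sum.mono_neutral_left) auto
  then show ?thesis
    by (simp add: sum.cartesian_product)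
qed

lemma theta_eq_tr:
  assumes "n > 0" "r \<in> sing n" "\<And>m. m \<in> tr n k \<Longrightarrow> \<Lambda> m = 0"
  shows "theta n \<Lambda> r = (\<Sum>i<k. \<Sum>j<k. tcoeff n \<Lambda> r i j)"
  by (rule theta_eq) (simp add: tcoeff_def assms(3)[OF xy_tr[OF assms(1,2)]])

text \<open>
  Both differences give telescoping sums: the summand for \<open>x\<^bsup>i + 1\<^esup>\<close> cancels the one for \<open>x\<^sup>i\<close>, and the
  boundary terms vanish for reasons of divisibility at one end and of degree at the other.
\<close>

lemma theta_telescope:
  fixes C1 C2 :: "'k::field laurent \<Rightarrow> 'k laurent"
  assumes n: "n > 0" and r: "r \<in> sing n"
    and C: "\<And>m. m \<in> sing n \<Longrightarrow> C1 m \<in> sing n" "\<And>m. m \<in> sing n \<Longrightarrow> C2 m \<in> sing n"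
    and C0: "\<And>m. m \<in> tr n k \<Longrightarrow> C1 m = 0" "\<And>m. m \<in> tr n k \<Longrightarrow> C2 m = 0"
    and \<Lambda>: "\<And>m. m \<in> sing n \<Longrightarrow> \<Lambda> m = (C1 (gx n * m) - gx n * C1 m) - (C2 (gy n * m) - gy n * C2 m)"
  shows "theta n \<Lambda> r = 0"
proof -
  have \<Lambda>0: "\<Lambda> m = 0" if "m \<in> tr n k" for m
    using \<Lambda>[OF subsetD[OF tr_sing that]] C0 tr_ideal[OF gx_sing that] tr_ideal[OF gy_sing that] that by simp
  define g where "g i j = lcoeff (C1 (xy n i j r)) (int j * int n + int n - 1, int i * int n - 1)" for i j
  define g' where "g' i j = lcoeff (C2 (xy n i j r)) (int j * int n - 1, int i * int n + int n - 1)" for i j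
  have "tcoeff n \<Lambda> r i j = (g (Suc i) j - g i j) - (g' i (Suc j) - g' i j)" for i j
  proof -
    have "tcoeff n \<Lambda> r i j = lcoeff (C1 (xy n (Suc i) j r) - gx n * C1 (xy n i j r)
        - (C2 (xy n i (Suc j) r) - gy n * C2 (xy n i j r))) (int j * int n + int n - 1, int i * int n + int n - 1)"
      unfolding tcoeff_def by (subst \<Lambda>[OF xy_sing[OF r]]) (simp only: xy_Suc)
    moreover have "int i * int n + int n - 1 - int n = int i * int n - 1" for i
      by simp
    ultimately show ?thesis
      by (simp add: g_def g'_def lookup_minus gx_def gy_def lcoeff_term_mult distrib_right add.commute)
  qed
  then have "theta n \<Lambda> r = (\<Sum>i<k. \<Sum>j<k. g (Suc i) j - g i j) - (\<Sum>i<k. \<Sum>j<k. g' i (Suc j) - g' i j)"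
    using theta_eq_tr[OF n r \<Lambda>0] by (simp add: sum_subtractf)
  also have "(\<Sum>i<k. \<Sum>j<k. g (Suc i) j - g i j) = (\<Sum>j<k. g k j - g 0 j)"
    by (subst sum.swap, rule sum.cong[OF refl], rule sum_lessThan_telescope)
  also have "\<dots> = 0"
    using C0(1)[OF xy_tr[OF n r]] sing_quad[OF C(1)[OF xy_sing[OF r]]] by (simp add: g_def)
  also have "(\<Sum>i<k. \<Sum>j<k. g' i (Suc j) - g' i j) = (\<Sum>i<k. g' i k - g' i 0)"
    by (simp add: sum_lessThan_telescope)
  also have "\<dots> = 0"
    using C0(2)[OF xy_tr[OF n r]] sing_quad[OF C(2)[OF xy_sing[OF r]]] by (simp add: g'_def)
  finally show ?thesis by simp
qed

lemma mlin3D: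
  assumes "mlin n I (Suc (Suc (Suc 0))) f" "a \<in> sing n" "b \<in> sing n"
  shows "u \<in> sing n \<Longrightarrow> v \<in> sing n \<Longrightarrow> f [a, b, u + v] = f [a, b, u] + f [a, b, v]"
    "u \<in> sing n \<Longrightarrow> f [a, b, scale c u] = scale c (f [a, b, u])"
    "u \<in> sing n \<Longrightarrow> f [a, b, u] \<in> sing n" "u \<in> I \<Longrightarrow> f [a, b, u] = 0"
  using assms by auto

lemma lam_coch:
  fixes f :: "'k::field laurent list \<Rightarrow> 'k laurent"
  assumes f: "coch n I (Suc (Suc (Suc 0))) j f" and I: "I \<subseteq> sing n"
  shows "coch n I (Suc 0) (j + 2 * int n) (\<lambda>l. lam n f (hd l))"
proof -
  have "coch n I (Suc 0) (j + int n + int n) (\<lambda>l. f (gy n # gx n # l) - f (gx n # gy n # l))"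
    by (intro coch_diff coch_slice[OF coch_slice[OF f]] gx_sing gy_sing gx_homog gy_homog)
  then have "coch n I (Suc 0) (j + int n + int n) (\<lambda>l. lam n f (hd l))"
    by (rule iffD1[OF coch_cong[OF _ I], rotated]) (auto simp: lam_def elim!: Ls_SucE)
  then show ?thesis by (simp add: add.assoc)
qed

lemma theta_coboundary:
  fixes h :: "'a::field laurent list \<Rightarrow> 'a laurent"
  assumes n: "n > 0" and r: "r \<in> sing n" and h: "mlin n (tr n k) (Suc (Suc 0)) h"
    and f: "\<And>as. as \<in> Ls n (Suc (Suc (Suc 0))) \<Longrightarrow> f as = bardiff h as"
  shows "theta n (lam n f) r = 0"
proof (rule theta_telescope[OF n r, where ?C1.0 = "\<lambda>m. h [gy n, m]" and ?C2.0 = "\<lambda>m. h [gx n, m]" and k = k])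
  fix m :: "'a laurent" assume m: "m \<in> sing n"
  have "f [gy n, gx n, m] = bardiff h [gy n, gx n, m]" "f [gx n, gy n, m] = bardiff h [gx n, gy n, m]"
    by (intro f; simp add: m)+
  then show "lam n f m = h [gy n, gx n * m] - gx n * h [gy n, m] - (h [gx n, gy n * m] - gy n * h [gx n, m])"
    by (simp add: lam_def bardiff_def mult.commute[of "gy n" "gx n"])
qed (use h in auto)

lemma theta_add:
  assumes n: "n > 0" and r: "r \<in> sing n"
    and f: "mlin n (tr n k) (Suc (Suc (Suc 0))) f" "mlin n (tr n l) (Suc (Suc (Suc 0))) g"
  shows "theta n (lam n (\<lambda>as. f as + g as)) r = theta n (lam n f) r + theta n (lam n g) r"
    "theta n (lam n (\<lambda>as. f as - g as)) r = theta n (lam n f) r - theta n (lam n g) r"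
proof -
  define N where "N = k + l"
  have z: "tcoeff n (lam n f) r i j = 0" "tcoeff n (lam n g) r i j = 0" if "N \<le> i \<or> N \<le> j" for i j
  proof -
    have "k \<le> i \<or> k \<le> j" "l \<le> i \<or> l \<le> j" using that by (auto simp: N_def)
    then show "tcoeff n (lam n f) r i j = 0" "tcoeff n (lam n g) r i j = 0"
      using xy_tr[OF n r] mlin3D(4)[OF f(1)] mlin3D(4)[OF f(2)] by (simp_all add: tcoeff_def lam_def)
  qed
  have a: "tcoeff n (lam n (\<lambda>as. f as + g as)) r i j = tcoeff n (lam n f) r i j + tcoeff n (lam n g) r i j"
    "tcoeff n (lam n (\<lambda>as. f as - g as)) r i j = tcoeff n (lam n f) r i j - tcoeff n (lam n g) r i j" for i j
    by (simp_all add: tcoeff_def lam_def lookup_add lookup_minus)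
  show "theta n (lam n (\<lambda>as. f as + g as)) r = theta n (lam n f) r + theta n (lam n g) r"
    "theta n (lam n (\<lambda>as. f as - g as)) r = theta n (lam n f) r - theta n (lam n g) r"
    using z by (simp_all add: theta_eq[of N] a sum.distrib sum_subtractf)
qed

lemma theta_linear:
  assumes n: "n > 0" and f: "coch n (tr n k) (Suc (Suc (Suc 0))) d f"
  shows "u \<in> sing n \<Longrightarrow> v \<in> sing n \<Longrightarrow> theta n (lam n f) (u + v) = theta n (lam n f) u + theta n (lam n f) v"
    "u \<in> sing n \<Longrightarrow> theta n (lam n f) (scale c u) = c * theta n (lam n f) u"
    "u \<in> sing n \<Longrightarrow> u \<in> homog e \<Longrightarrow> e \<noteq> - (d + 2) \<Longrightarrow> theta n (lam n f) u = 0"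
proof -
  note L = coch_1D[OF lam_coch[OF f tr_sing], unfolded list.sel]
  have eq: "theta n (lam n f) r = (\<Sum>i<k. \<Sum>j<k. tcoeff n (lam n f) r i j)" if "r \<in> sing n" for r
    using L(4) by (rule theta_eq_tr[OF n that])
  show "theta n (lam n f) (u + v) = theta n (lam n f) u + theta n (lam n f) v"
    if uv: "u \<in> sing n" "v \<in> sing n"
  proof -
    have "xy n i j (u + v) = xy n i j u + xy n i j v" for i j
      by (simp add: xy_def distrib_left)
    then have "tcoeff n (lam n f) (u + v) i j = tcoeff n (lam n f) u i j + tcoeff n (lam n f) v i j" for i j
      by (simp add: tcoeff_def L(1) xy_sing uv lookup_add)
    then show ?thesis by (simp add: eq uv sing_add sum.distrib)
  qed
  show "theta n (lam n f) (scale c u) = c * theta n (lam n f) u" if u: "u \<in> sing n"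
  proof -
    have "xy n i j (scale c u) = scale c (xy n i j u)" for i j
      by (simp add: xy_def mult.left_commute)
    then have "tcoeff n (lam n f) (scale c u) i j = c * tcoeff n (lam n f) u i j" for i j
      by (simp add: tcoeff_def L(2) xy_sing u)
    then show ?thesis by (simp add: eq u sing_scale sum_distrib_left)
  qed
  show "theta n (lam n f) u = 0" if u: "u \<in> sing n" "u \<in> homog e" "e \<noteq> - (d + 2)"
  proof -
    have "tcoeff n (lam n f) u i j = 0" for i j
    proof (rule ccontr)
      assume "tcoeff n (lam n f) u i j \<noteq> 0"
      moreover have "lam n f (xy n i j u) \<in> homog (d + 2 * int n + (e + int n * (int i + int j)))"
        by (rule L(5)[OF xy_sing[OF u(1)] xy_homog[OF u(2)]])
      ultimately have "int j * int n + int n - 1 + (int i * int n + int n - 1)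
          = d + 2 * int n + (e + int n * (int i + int j))"
        unfolding tcoeff_def homog_def by blast
      with u(3) show False by (simp add: algebra_simps)
    qed
    then show ?thesis by (simp add: eq u)
  qed
qed

text \<open>
  The cocycles \<open>f \<cdot> b\<close> and \<open>f(\<dots>, b \<cdot> _)\<close> differ by a coboundary, namely that of
  \<open>h(b\<^sub>1, m) = f(b, b\<^sub>1, m) - f(b\<^sub>1, b, m)\<close>.
\<close>

lemma theta_module:
  fixes f :: "'k::field laurent list \<Rightarrow> 'k laurent"
  assumes n: "n > 0" and r: "r \<in> sing n" and f: "mlin n (tr n k) (Suc (Suc (Suc 0))) f"
    and cocycle: "\<And>as. as \<in> Ls n (Suc (Suc (Suc (Suc 0)))) \<Longrightarrow> bardiff f as = 0"
    and b: "b \<in> sing n"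
  shows "theta n (lam n (\<lambda>as. f as * b)) r = theta n (lam n f) (b * r)"
proof -
  define C where "C c m = f [b, c, m] - f [c, b, m]" for c m
  define \<Lambda> where "\<Lambda> m = lam n f m * b - lam n f (b * m)" for m
  have co: "c0 * f [c1, c2, m] - (f [c0 * c1, c2, m] - (f [c0, c1 * c2, m] - f [c0, c1, c2 * m])) = 0"
    if "c0 \<in> sing n" "c1 \<in> sing n" "c2 \<in> sing n" "m \<in> sing n" for c0 c1 c2 m
    using cocycle[of "[c0, c1, c2, m]"] that by (simp add: bardiff_def)
  have key: "f [c, c', m] * b - f [c, c', b * m] = c * C c' m - (C (c * c') m - C c (c' * m))"
    if c: "c \<in> sing n" "c' \<in> sing n" "m \<in> sing n" for c c' m
  proof -
    have "f [c, c', m] * b - f [c, c', b * m] - (c * C c' m - (C (c * c') m - C c (c' * m)))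
      = (b * f [c, c', m] - (f [b * c, c', m] - (f [b, c * c', m] - f [b, c, c' * m])))
      - (c * f [b, c', m] - (f [c * b, c', m] - (f [c, b * c', m] - f [c, b, c' * m])))
      + (c * f [c', b, m] - (f [c * c', b, m] - (f [c, c' * b, m] - f [c, c', b * m])))"
      by (simp add: C_def algebra_simps)
    also have "\<dots> = 0"
      using co[OF b c] co[OF c(1) b c(2,3)] co[OF c(1,2) b c(3)] by simp
    finally show ?thesis by simp
  qed
  have 0: "theta n \<Lambda> r = 0"
  proof (rule theta_telescope[OF n r, where ?C1.0 = "C (gy n)" and ?C2.0 = "C (gx n)" and k = k])
    show "C (gy n) m \<in> sing n" "C (gx n) m \<in> sing n" if "m \<in> sing n" for m
      using mlin3D(3)[OF f b _ that] mlin3D(3)[OF f _ b that] by (simp_all add: C_def sing_diff)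
    show "C (gy n) m = 0" "C (gx n) m = 0" if "m \<in> tr n k" for m
      using mlin3D(4)[OF f b _ that] mlin3D(4)[OF f _ b that] by (simp_all add: C_def)
    show "\<Lambda> m = C (gy n) (gx n * m) - gx n * C (gy n) m - (C (gx n) (gy n * m) - gy n * C (gx n) m)"
      if "m \<in> sing n" for m
    proof -
      have "\<Lambda> m = (f [gy n, gx n, m] * b - f [gy n, gx n, b * m]) - (f [gx n, gy n, m] * b - f [gx n, gy n, b * m])"
        by (simp add: \<Lambda>_def lam_def left_diff_distrib)
      then show ?thesis
        unfolding key[OF gy_sing gx_sing that] key[OF gx_sing gy_sing that] mult.commute[of "gy n" "gx n"]
        by simp
    qed
  qed
  have v: "lam n f m = 0" if "m \<in> tr n k" for m
    using mlin3D(4)[OF f _ _ that] by (simp add: lam_def)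
  have v': "lam n f (b * m) = 0" if "m \<in> tr n k" for m
    by (rule v[OF tr_ideal[OF b that]])
  have vb: "lam n (\<lambda>as. f as * b) m = 0" if "m \<in> tr n k" for m
    using v[OF that] by (simp add: lam_def flip: left_diff_distrib)
  have v\<Lambda>: "\<Lambda> m = 0" if "m \<in> tr n k" for m
    using v[OF that] v'[OF that] by (simp add: \<Lambda>_def)
  have "tcoeff n \<Lambda> r i j = tcoeff n (lam n (\<lambda>as. f as * b)) r i j - tcoeff n (lam n f) (b * r) i j" for i j
    by (simp add: tcoeff_def \<Lambda>_def lam_def lookup_minus left_diff_distrib xy_def mult.left_commute)
  then have "theta n \<Lambda> r = theta n (lam n (\<lambda>as. f as * b)) r - theta n (lam n f) (b * r)"
    using theta_eq_tr[OF n r v\<Lambda>] theta_eq_tr[OF n r vb] theta_eq_tr[OF n sing_mult[OF b r] v]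
    by (simp add: sum_subtractf)
  with 0 show ?thesis by simp
qed

section \<open>Classes with vanishing functional\<close>

definition supp :: "(int \<times> int) set \<Rightarrow> 'k::zero laurent \<Rightarrow> bool"
  where "supp K f \<longleftrightarrow> (\<forall>k. lcoeff f k \<noteq> 0 \<longrightarrow> k \<in> K)"

lemma suppD: "supp K f \<Longrightarrow> lcoeff f k \<noteq> 0 \<Longrightarrow> k \<in> K"
  unfolding supp_def by blast

lemma supp_sing: "supp (cone n) f \<longleftrightarrow> f \<in> sing n"
  by (simp only: supp_def sing_def mem_Collect_eq)

lemma supp_add: "supp K f \<Longrightarrow> supp K g \<Longrightarrow> supp K (f + g)" for f g :: "'k::field laurent"
  unfolding supp_def lookup_add by (metis add.right_neutral)

lemma supp_uminus: "supp K f \<Longrightarrow> supp K (- f)" for f :: "'k::field laurent"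
  by (simp add: supp_def)

lemma supp_diff: "supp K f \<Longrightarrow> supp K g \<Longrightarrow> supp K (f - g)" for f g :: "'k::field laurent"
  using supp_add[OF _ supp_uminus] by fastforce

lemma supp_sum: "(\<And>i. i \<in> S \<Longrightarrow> supp K (f i)) \<Longrightarrow> supp K (\<Sum>i\<in>S. f i)"
  for f :: "'i \<Rightarrow> 'k::field laurent"
  by (induction S rule: infinite_finite_induct) (auto intro: supp_add simp: supp_def[of K 0])

lemma supp_part: "supp K f \<Longrightarrow> supp (K \<inter> H) (part H f)"
  unfolding supp_def by (simp split: if_splits)

lemma supp_mult:
  fixes f g :: "'k::field laurent"
  assumes "supp K f" "supp H g" "\<And>k h. k \<in> K \<Longrightarrow> h \<in> H \<Longrightarrow> k + h \<in> M"
  shows "supp M (f * g)"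
  unfolding supp_def
proof (intro allI impI)
  fix m assume "lcoeff (f * g) m \<noteq> 0"
  then obtain k where "lcoeff f k * lcoeff g (m - k) \<noteq> 0"
    unfolding lcoeff_mult by (auto elim: sum.not_neutral_contains_not_neutral)
  then have "k \<in> K" "m - k \<in> H"
    using suppD[OF assms(1), of k] suppD[OF assms(2), of "m - k"] by auto
  from assms(3)[OF this] show "m \<in> M" by simp
qed

lemma supp_term: "k \<in> K \<Longrightarrow> supp K (lterm k c)"
  unfolding supp_def by (auto simp: lookup_single when_def)

lemma supp_mono: "supp K f \<Longrightarrow> K \<subseteq> H \<Longrightarrow> supp H f"
  unfolding supp_def by blast

lemma supp_inter: "supp K f \<Longrightarrow> supp H f \<Longrightarrow> supp (K \<inter> H) f"
  unfolding supp_def by blast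

lemma sum_shift:
  fixes g :: "nat \<Rightarrow> 'a::comm_monoid_add"
  assumes "\<And>i. i < a \<Longrightarrow> g i = 0" "\<And>i. N \<le> i \<Longrightarrow> g i = 0"
  shows "(\<Sum>i<N. g i) = (\<Sum>i<N. g (i + a))"
proof -
  have "(\<Sum>i<N + a. g i) = (\<Sum>i<N. g (i + a))"
    using assms(1) by (induction N) (simp_all add: sum.neutral)
  moreover have "(\<Sum>i<N + a. g i) = (\<Sum>i<N. g i)"
    using assms(2) by (intro sum.mono_neutral_right) auto
  ultimately show ?thesis by simp
qed

abbreviation PX :: "'k::field laurent \<Rightarrow> 'k laurent"
  where "PX \<equiv> part {(p, q). 0 \<le> p}"

lemma PX_gx: "PX (gx n * f) = gx n * PX f"
  by (rule laurent_eqI) (simp add: gx_def lcoeff_term_mult)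

text \<open>
  Summing the solutions over all powers of \<open>x\<close> and \<open>y\<close> produces a Laurent polynomial whose only part with
  negative exponents in both variables has the pairing as coefficients. When the pairing is zero the
  Laurent polynomial splits into a part regular in one variable and a part regular in the other, and
  these two parts are the required Koszul cochains.
\<close>

lemma koszul_split:
  fixes L :: "'k::field laurent \<Rightarrow> 'k laurent"
  assumes n: "n > 0" and L: "coch n (tr n N) (Suc 0) (d + int n) (\<lambda>l. L (hd l))"
    and param: "\<And>m. m \<in> sing n \<Longrightarrow> supp {(p, q). int n dvd p \<and> int n dvd q} (L m)"
    and zero: "\<And>r. r \<in> sing n \<Longrightarrow> (\<Sum>i<N. \<Sum>j<N. lcoeff (L (xy n i j r)) (int j * int n, int i * int n)) = 0"
  shows "\<exists>A1 A2. coch n (tr n N) (Suc 0) d (\<lambda>l. A1 (hd l)) \<and> coch n (tr n N) (Suc 0) d (\<lambda>l. A2 (hd l)) \<and>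
    (\<forall>m\<in>sing n. L m = (gx n * A2 m - A2 (gx n * m)) - (gy n * A1 m - A1 (gy n * m)))"
proof -
  note L = coch_1D[OF L, unfolded list.sel]
  let ?x = "gx n :: 'k laurent" and ?y = "gy n :: 'k laurent"
  define e where "e i j = (lterm (- (int j * int n), - (int i * int n)) 1 :: 'k laurent)" for i j :: nat
  have xe: "?x * e (Suc i) j = e i j" and ye: "?y * e i (Suc j) = e i j" and e0: "e 0 0 = 1" for i j
    by (simp_all add: e_def gx_def gy_def mult_single algebra_simps flip: zero_prod_def)
  have L0: "L (xy n i j m) = 0" if "m \<in> sing n" "N \<le> i \<or> N \<le> j" for i j m
    by (rule L(4)[OF xy_tr[OF n that]])
  define U where "U m = (\<Sum>i<N. \<Sum>j<N. e (Suc i) (Suc j) * L (xy n i j m))" for m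
  define Sy where "Sy m = (\<Sum>j<N. e 0 (Suc j) * L (xy n 0 j m))" for m
  define Sx where "Sx m = (\<Sum>i<N. e (Suc i) 0 * L (xy n i 0 m))" for m
  define U2 where "U2 m = U m - PX (U m)" for m
  define A1 where "A1 m = - PX (Sy m)" for m
  define A2 where "A2 m = ?y * U2 m - U2 (?y * m)" for m
  have DxU: "?x * U m - U (?x * m) = Sy m" if m: "m \<in> sing n" for m
  proof -
    define t where "t i = (\<Sum>j<N. e i (Suc j) * L (xy n i j m))" for i
    have "?x * U m = (\<Sum>i<N. t i)"
      by (simp add: U_def t_def sum_distrib_left mult.assoc[symmetric] xe)
    moreover have "U (?x * m) = (\<Sum>i<N. t (Suc i))"
      by (simp add: U_def t_def xy_Suc)
    ultimately have "?x * U m - U (?x * m) = t 0 - t N"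
      by (simp add: sum_lessThan_telescope' flip: sum_subtractf)
    also have "t N = 0" by (simp add: t_def L0[OF m])
    finally show ?thesis by (simp add: t_def Sy_def)
  qed
  have DyU: "?y * U m - U (?y * m) = Sx m" if m: "m \<in> sing n" for m
  proof -
    define t where "t j = (\<Sum>i<N. e (Suc i) j * L (xy n i j m))" for j
    have "?y * U m = (\<Sum>j<N. t j)"
      unfolding U_def t_def by (subst sum.swap) (simp add: sum_distrib_left mult.assoc[symmetric] ye)
    moreover have "U (?y * m) = (\<Sum>j<N. t (Suc j))"
      unfolding U_def t_def by (subst sum.swap) (simp add: xy_Suc)
    ultimately have "?y * U m - U (?y * m) = t 0 - t N"
      by (simp add: sum_lessThan_telescope' flip: sum_subtractf)
    also have "t N = 0" by (simp add: t_def L0[OF m])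
    finally show ?thesis by (simp add: t_def Sx_def)
  qed
  have DySy: "?y * Sy m - Sy (?y * m) = L m" if m: "m \<in> sing n" for m
  proof -
    define t where "t j = e 0 j * L (xy n 0 j m)" for j
    have "?y * Sy m = (\<Sum>j<N. t j)"
      by (simp add: Sy_def t_def sum_distrib_left mult.assoc[symmetric] ye)
    moreover have "Sy (?y * m) = (\<Sum>j<N. t (Suc j))"
      by (simp add: Sy_def t_def xy_Suc)
    ultimately have "?y * Sy m - Sy (?y * m) = t 0 - t N"
      by (simp add: sum_lessThan_telescope' flip: sum_subtractf)
    also have "t N = 0" by (simp add: t_def L0[OF m])
    finally show ?thesis by (simp add: t_def e0)
  qed
  have DxU2: "?x * U2 m - U2 (?x * m) = Sy m - PX (Sy m)" if m: "m \<in> sing n" for m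
    unfolding DxU[OF m, symmetric] by (simp add: U2_def part_diff PX_gx algebra_simps)
  have "L m = (?x * A2 m - A2 (?x * m)) - (?y * A1 m - A1 (?y * m))" if m: "m \<in> sing n" for m
  proof -
    have "?x * A2 m - A2 (?x * m)
        = ?y * (?x * U2 m - U2 (?x * m)) - (?x * U2 (?y * m) - U2 (?x * (?y * m)))"
      by (simp add: A2_def algebra_simps)
    also have "\<dots> = ?y * (Sy m - PX (Sy m)) - (Sy (?y * m) - PX (Sy (?y * m)))"
      using m by (simp add: DxU2 sing_mult)
    finally show ?thesis
      by (simp add: A1_def algebra_simps flip: DySy[OF m])
  qed
  moreover have lin: "U (u + v) = U u + U v" "Sy (u + v) = Sy u + Sy v"
    if "u \<in> sing n" "v \<in> sing n" for u v
  proof -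
    have "xy n i j (u + v) = xy n i j u + xy n i j v" for i j
      by (simp add: xy_def distrib_left)
    then show "U (u + v) = U u + U v" "Sy (u + v) = Sy u + Sy v"
      using that by (simp_all add: U_def Sy_def L(1) xy_sing distrib_left sum.distrib)
  qed
  have scl: "U (scale c u) = scale c (U u)" "Sy (scale c u) = scale c (Sy u)" if "u \<in> sing n" for u c
  proof -
    have "xy n i j (scale c u) = scale c (xy n i j u)" for i j
      by (simp add: xy_def mult.left_commute)
    then show "U (scale c u) = scale c (U u)" "Sy (scale c u) = scale c (Sy u)"
      using that by (simp_all add: U_def Sy_def L(2) xy_sing sum_distrib_left mult.left_commute)
  qed
  have hom: "U u \<in> homog (d + f - int n)" "Sy u \<in> homog (d + f)" if u: "u \<in> sing n" "u \<in> homog f" for u f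
  proof -
    have e: "e i j \<in> homog (- (int n * (int i + int j)))" for i j
      unfolding e_def by (rule homog_term) (simp add: algebra_simps)
    have "e i' j' * L (xy n i j u) \<in> homog (- (int n * (int i' + int j')) + (d + int n + (f + int n * (int i + int j))))"
      for i' j' i j
      by (intro homog_mult e L(5) xy_sing xy_homog u)
    from this[of "Suc i" "Suc j" i j for i j] this[of 0 "Suc j" 0 j for j]
    show "U u \<in> homog (d + f - int n)" "Sy u \<in> homog (d + f)"
      unfolding U_def Sy_def by (auto intro!: homog_sum simp: algebra_simps)
  qed
  have van: "U u = 0" "Sy u = 0" if u: "u \<in> tr n N" for u
  proof -
    have "xy n i j u \<in> tr n N" for i j
      unfolding xy_def by (intro tr_ideal sing_power gx_sing gy_sing u)
    then show "U u = 0" "Sy u = 0"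
      by (simp_all add: U_def Sy_def L(4))
  qed
  let ?lat = "{(p, q). int n dvd p \<and> int n dvd q}"
  have supp_e: "supp M (e i j * L m)"
    if "m \<in> sing n" "\<And>p q. 0 \<le> p \<Longrightarrow> 0 \<le> q \<Longrightarrow> int n dvd p \<Longrightarrow> int n dvd q \<Longrightarrow>
        (p - int j * int n, q - int i * int n) \<in> M" for M i j m
  proof -
    have "supp (?lat \<inter> cone n) (L m)"
      by (rule supp_inter[OF param]) (simp_all add: that supp_sing L(3))
    then show ?thesis
      unfolding e_def
      by (rule supp_mult[OF supp_term[OF singletonI]]) (use that(2) in \<open>auto simp: cone_def algebra_simps\<close>)
  qed
  have latU: "supp ?lat (U m)" "supp {(p, q). 0 \<le> p \<and> int n dvd p \<and> int n dvd q} (Sx m)"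
    "supp {(p, q). 0 \<le> q \<and> int n dvd p \<and> int n dvd q} (Sy m)" if "m \<in> sing n" for m
    unfolding U_def Sx_def Sy_def
    by (intro supp_sum supp_e xy_sing that; simp)+
  have Uneg: "lcoeff (U m) (p, q) = 0" if m: "m \<in> sing n" and pq: "p < 0" "q < 0" for m p q
  proof (rule ccontr)
    assume nz: "lcoeff (U m) (p, q) \<noteq> 0"
    from suppD[OF latU(1)[OF m] nz] obtain p' q' where pq': "p = int n * p'" "q = int n * q'"
      by (auto simp: dvd_def)
    have "p' < 0" "q' < 0"
      using pq n by (auto simp: pq' mult_less_0_iff)
    then obtain a b where ab: "p' = - int (Suc b)" "q' = - int (Suc a)"
      using negD by meson
    define g where "g i j = lcoeff (L (xy n i j m)) (int n * (int j - int b), int n * (int i - int a))" for i j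
    have g0: "g i j = 0" if "i < a \<or> j < b" for i j
      unfolding g_def using that n
      by (intro sing_quad[OF L(3)[OF xy_sing[OF m]]]) (auto simp: mult_less_0_iff)
    have gN: "g i j = 0" if "N \<le> i \<or> N \<le> j" for i j
      by (simp add: g_def L0[OF m that])
    have "lcoeff (U m) (p, q) = (\<Sum>i<N. \<Sum>j<N. g i j)"
    proof -
      have "p - - (int (Suc j) * int n) = int n * (int j - int b)"
        "q - - (int (Suc i) * int n) = int n * (int i - int a)" for i j
        by (simp_all add: pq' ab algebra_simps)
      then have "lcoeff (e (Suc i) (Suc j) * w) (p, q) = lcoeff w (int n * (int j - int b), int n * (int i - int a))"
        for i j w
        unfolding e_def lcoeff_term_mult by simp
      then show ?thesis
        by (simp add: U_def lookup_sum g_def)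
    qed
    also have "\<dots> = (\<Sum>i<N. \<Sum>j<N. g (i + a) j)"
      by (rule sum_shift) (simp_all add: g0 gN)
    also have "\<dots> = (\<Sum>i<N. \<Sum>j<N. g (i + a) (j + b))"
      by (intro sum.cong refl sum_shift) (simp_all add: g0 gN)
    also have "\<dots> = (\<Sum>i<N. \<Sum>j<N. lcoeff (L (xy n i j (xy n a b m))) (int j * int n, int i * int n))"
      by (simp add: g_def xy_xy mult.commute)
    also have "\<dots> = 0"
      by (rule zero[OF xy_sing[OF m]])
    finally show False using nz by simp
  qed
  have U2q: "supp {(p, q). 0 \<le> q \<and> int n dvd p \<and> int n dvd q} (U2 m)" if m: "m \<in> sing n" for m
    unfolding supp_def
  proof (intro allI impI)
    fix k assume nz: "lcoeff (U2 m) k \<noteq> 0"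
    obtain p q where k: "k = (p, q)" by (cases k)
    have "lcoeff (U m) (p, q) \<noteq> 0" "p < 0"
      using nz by (auto simp: U2_def k lookup_minus split: if_splits)
    with Uneg[OF m] suppD[OF latU(1)[OF m], of k] show "k \<in> {(p, q). 0 \<le> q \<and> int n dvd p \<and> int n dvd q}"
      by (auto simp: k not_less[symmetric] simp del: not_less)
  qed
  have A1s: "A1 m \<in> sing n" if "m \<in> sing n" for m
    unfolding A1_def supp_sing[symmetric]
    by (intro supp_uminus supp_mono[OF supp_part[OF latU(3)[OF that]]]) (auto simp: cone_def intro: dvd_diff)
  have A2s: "A2 m \<in> sing n" if m: "m \<in> sing n" for m
  proof -
    have ym: "?y * m \<in> sing n" using m by (simp add: sing_mult)
    have y: "supp M (?y * w)" if "supp K w" "\<And>p q. (p, q) \<in> K \<Longrightarrow> (p + int n, q) \<in> M" for M K and w :: "'k laurent"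
      unfolding gy_def by (rule supp_mult[OF supp_term[OF singletonI] that(1)]) (use that(2) in \<open>auto simp: add.commute\<close>)
    have 1: "supp {(p, q). 0 \<le> q \<and> int n dvd p \<and> int n dvd q} (A2 m)"
      unfolding A2_def by (intro supp_diff U2q ym y[OF U2q[OF m]]) simp
    have PXs: "supp {(p, q). 0 \<le> p} (PX w)" for w :: "'k laurent"
      by (auto simp: supp_def split: if_splits)
    have "A2 m = Sx m - (?y * PX (U m) - PX (U (?y * m)))"
      using DyU[OF m] by (simp add: A2_def U2_def algebra_simps)
    also have "supp {(p, q). 0 \<le> p} \<dots>"
      by (intro supp_diff PXs y[OF PXs] supp_mono[OF latU(2)[OF m]]) auto
    finally have "supp ({(p, q). 0 \<le> q \<and> int n dvd p \<and> int n dvd q} \<inter> {(p, q). 0 \<le> p}) (A2 m)"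
      by (rule supp_inter[OF 1])
    then have "supp (cone n) (A2 m)"
      by (rule supp_mono) (auto simp: cone_def intro: dvd_diff)
    then show ?thesis by (simp add: supp_sing)
  qed
  have "coch n (tr n N) (Suc 0) d (\<lambda>l. A1 (hd l))"
  proof (rule coch_1I)
    fix u :: "'k laurent" and f assume u: "u \<in> sing n" "u \<in> homog f"
    show "A1 u \<in> homog (d + f)"
      unfolding A1_def by (intro homog_uminus homog_part hom u)
  next
    fix u v :: "'k laurent" assume "u \<in> sing n" "v \<in> sing n"
    then show "A1 (u + v) = A1 u + A1 v"
      by (simp add: A1_def lin part_add)
  next
    fix u :: "'k laurent" and c assume "u \<in> sing n"
    then show "A1 (scale c u) = scale c (A1 u)"
      by (simp add: A1_def scl part_scale)
  next
    fix u :: "'k laurent" assume "u \<in> tr n N"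
    then show "A1 u = 0"
      by (simp add: A1_def van)
  qed (rule A1s)
  moreover have "coch n (tr n N) (Suc 0) d (\<lambda>l. A2 (hd l))"
  proof (rule coch_1I)
    fix u :: "'k laurent" and f assume u: "u \<in> sing n" "u \<in> homog f"
    have U2: "U2 w \<in> homog (d + g - int n)" if "w \<in> sing n" "w \<in> homog g" for w g
      unfolding U2_def by (intro homog_diff homog_part hom that)
    have "?y * U2 u \<in> homog (int n + (d + f - int n))"
      by (intro homog_mult gy_homog U2 u)
    moreover have "U2 (?y * u) \<in> homog (d + (int n + f) - int n)"
      by (intro U2 sing_mult gy_sing homog_mult gy_homog u)
    ultimately show "A2 u \<in> homog (d + f)"
      unfolding A2_def by (intro homog_diff) (simp_all add: algebra_simps)
  next
    fix u v :: "'k laurent" assume uv: "u \<in> sing n" "v \<in> sing n"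
    show "A2 (u + v) = A2 u + A2 v"
      using uv by (simp add: A2_def U2_def lin distrib_left[of ?y] sing_mult part_add algebra_simps)
  next
    fix u :: "'k laurent" and c assume u: "u \<in> sing n"
    have U2s: "U2 (scale c w) = scale c (U2 w)" if "w \<in> sing n" for w
      by (simp add: U2_def scl part_scale right_diff_distrib that)
    show "A2 (scale c u) = scale c (A2 u)"
      unfolding A2_def mult.left_commute[of ?y "Poly_Mapping.single 0 c" u] U2s[OF u]
        U2s[OF sing_mult[OF gy_sing u]]
      by (simp add: right_diff_distrib mult.left_commute)
  next
    fix u :: "'k laurent" assume "u \<in> tr n N"
    then show "A2 u = 0"
      using tr_ideal[OF gy_sing, of u n N] by (simp add: A2_def U2_def van)
  qed (rule A2s)
  ultimately show ?thesis by blast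
qed

text \<open>
  A vanishing residue pairing makes the Koszul obstruction of \<open>bar_exact\<close> a boundary.
\<close>

theorem theta_injective:
  fixes f :: "'k::field laurent list \<Rightarrow> 'k laurent"
  assumes n: "n > 0" and f: "coch n (tr n N) (Suc (Suc (Suc 0))) j f"
    and cocycle: "\<And>as. as \<in> Ls n (Suc (Suc (Suc (Suc 0)))) \<Longrightarrow> bardiff f as = 0"
    and zero: "\<And>r. r \<in> sing n \<Longrightarrow> theta n (lam n f) r = 0"
  shows "\<exists>h. coch n (tr n N) (Suc (Suc 0)) j h \<and> (\<forall>as\<in>Ls n (Suc (Suc (Suc 0))). bardiff h as = f as)"
proof -
  let ?x = "gx n :: 'k laurent" and ?y = "gy n :: 'k laurent"
  define d where "d = j + - (2 * (int n - 1))"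
  have mf: "mlin n (tr n N) (Suc (Suc (Suc 0))) f"
    using f by (simp only: coch_def)
  define L where "L m = tau n (lam n f m)" for m
  have "coch n (tr n N) (Suc 0) (j + 2 * int n + - (2 * (int n - 1))) (\<lambda>l. L (hd l))"
    unfolding L_def by (rule coch_post[OF lam_coch[OF f tr_sing] linear_op_tau tau_sing tau_homog])
  then have L: "coch n (tr n N) (Suc 0) (d + int n + int n) (\<lambda>l. L (hd l))"
    by (simp add: d_def algebra_simps)
  have param: "supp {(p, q). int n dvd p \<and> int n dvd q} (L m)" for m
    by (auto simp: supp_def L_def lcoeff_tau split: if_splits)
  have "(\<Sum>i<N. \<Sum>j<N. lcoeff (L (xy n i j r)) (int j * int n, int i * int n)) = 0" if r: "r \<in> sing n" for r
  proof -
    have "lam n f m = 0" if "m \<in> tr n N" for m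
      using mlin3D(4)[OF mf _ _ that] by (simp add: lam_def)
    from theta_eq_tr[OF n r this] zero[OF r]
    show ?thesis by (simp add: L_def lcoeff_tau tcoeff_def)
  qed
  from koszul_split[OF n L param this] obtain A1 A2 where
    A: "coch n (tr n N) (Suc 0) (d + int n) (\<lambda>l. A1 (hd l))" "coch n (tr n N) (Suc 0) (d + int n) (\<lambda>l. A2 (hd l))"
      "\<And>m. m \<in> sing n \<Longrightarrow> L m = (?x * A2 m - A2 (?x * m)) - (?y * A1 m - A1 (?y * m))"
    by blast
  define q where "q m = tau n (f [1, 1, m])" for m
  have one: "(1 :: 'k laurent) \<in> homog 0"
    using homog_term[of 0 0 0 "1::'k"] by (simp flip: single_one zero_prod_def)
  have "coch n (tr n N) (Suc 0) (j + 0 + 0) (\<lambda>l. f (1 # 1 # l))"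
    by (rule coch_slice[OF coch_slice[OF f sing_one one] sing_one one])
  then have "coch n (tr n N) (Suc 0) (j + 0 + 0) (\<lambda>l. f [1, 1, hd l])"
    by (rule iffD1[OF coch_cong[OF _ tr_sing], rotated]) (auto elim!: Ls_SucE)
  then have "coch n (tr n N) (Suc 0) (j + 0 + 0 + - (2 * (int n - 1))) (\<lambda>l. q (hd l))"
    unfolding q_def by (rule coch_post[OF _ linear_op_tau tau_sing tau_homog])
  then have q: "coch n (tr n N) (Suc 0) d (\<lambda>l. q (hd l))"
    by (simp add: d_def)
  have Q: "coch n (tr n N) (Suc 0) (d + int n) (\<lambda>l. q (c * hd l))" if "c \<in> sing n" "c \<in> homog (int n)" for c
  proof -
    have "coch n (tr n N) (Suc 0) (d + int n) (\<lambda>l. q (hd (c * hd l # tl l)))"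
    proof (rule coch_head[OF q linear_op_mult])
      show "c * u \<in> homog (e + int n)" if "u \<in> homog e" for u and e
        using homog_mult[OF \<open>c \<in> homog (int n)\<close> that] by (simp add: add.commute)
    qed (simp_all add: sing_mult tr_ideal that(1))
    then show ?thesis by simp
  qed
  show ?thesis
  proof (rule bar_exact[OF n tr_sing tr_ideal f cocycle d_def])
    show "coch n (tr n N) (Suc 0) (d + int n) (\<lambda>l. A1 (hd l) + q (?x * hd l))"
      "coch n (tr n N) (Suc 0) (d + int n) (\<lambda>l. A2 (hd l) + q (?y * hd l))"
      using coch_add[OF A(1) Q[OF gx_sing gx_homog]] coch_add[OF A(2) Q[OF gy_sing gy_homog]] by simp_all
    fix as :: "'k laurent list" assume "as \<in> Ls n (Suc 0)"
    then obtain m where m: "as = [m]" "m \<in> sing n"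
      by (auto elim: Ls_SucE)
    have f1: "f [c, 1, m] = c * f [1, 1, m]" and f2: "f [1, c, m] = f [1, 1, c * m]" if "c \<in> sing n" for c
      using cocycle[of "[c, 1, 1, m]"] cocycle[of "[1, 1, c, m]"] that m by (simp_all add: bardiff_def)
    have s: "f [1, 1, m] \<in> sing n"
      by (rule mlin3D(3)[OF mf sing_one sing_one m(2)])
    note t = tau_param[OF n s] linear_opD(4)[OF linear_op_tau]
    show "kfun n (\<lambda>l. tau n (hd l * f (tl l))) as =
      comm (gx n) (\<lambda>l. A2 (hd l) + q (gy n * hd l)) as - comm (gy n) (\<lambda>l. A1 (hd l) + q (gx n * hd l)) as"
      using A(3)[OF m(2)]
      by (simp add: kfun_def sg_def comm_def m(1) f1[OF gx_sing] f1[OF gy_sing] f2[OF gx_sing] f2[OF gy_sing] t q_def L_def lam_def algebra_simps)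
  qed
qed

section \<open>Cocycles with prescribed functional\<close>

lemma coch_3I:
  assumes "\<And>a b u v. a \<in> sing n \<Longrightarrow> b \<in> sing n \<Longrightarrow> u \<in> sing n \<Longrightarrow> v \<in> sing n \<Longrightarrow>
      t (u + v) a b = t u a b + t v a b \<and> t a (u + v) b = t a u b + t a v b \<and> t a b (u + v) = t a b u + t a b v"
    "\<And>a b u c. a \<in> sing n \<Longrightarrow> b \<in> sing n \<Longrightarrow> u \<in> sing n \<Longrightarrow>
      t (scale c u) a b = scale c (t u a b) \<and> t a (scale c u) b = scale c (t a u b) \<and> t a b (scale c u) = scale c (t a b u)"
    "\<And>a b u. a \<in> sing n \<Longrightarrow> b \<in> sing n \<Longrightarrow> u \<in> sing n \<Longrightarrow> t a b u \<in> sing n"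
    "\<And>a b u. a \<in> sing n \<Longrightarrow> b \<in> sing n \<Longrightarrow> u \<in> I \<Longrightarrow> t a b u = 0"
    "\<And>a b u e e' e''. a \<in> sing n \<Longrightarrow> b \<in> sing n \<Longrightarrow> u \<in> sing n \<Longrightarrow>
      a \<in> homog e \<Longrightarrow> b \<in> homog e' \<Longrightarrow> u \<in> homog e'' \<Longrightarrow> t a b u \<in> homog (j + e + e' + e'')"
  shows "coch n I (Suc (Suc (Suc 0))) j (\<lambda>l. t (hd l) (hd (tl l)) (hd (tl (tl l))))"
  using assms by (auto simp: coch_def elim!: Ls_SucE)

definition PY :: "'k::field laurent \<Rightarrow> 'k laurent"
  where "PY = part {(p, q). p < 0 \<and> 0 \<le> q}"

definition PN :: "'k::field laurent \<Rightarrow> 'k laurent"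
  where "PN = part {(p, q). p < 0 \<and> q < 0}"

lemma part_split: "w = PX w + PY w + PN w"
  by (rule laurent_eqI) (simp add: lookup_add PY_def PN_def)

text \<open>
  For each \<open>m\<close> the functional \<open>r \<mapsto> \<xi>(r m)\<close> is written as a Laurent polynomial \<open>u(m)\<close> in negative powers.
  The cocycle multiplies \<open>u(m)\<close> by an argument, keeps the part that is negative in the first variable
  only, multiplies by the other argument and keeps the part that is regular in the first variable.
  These projections play the role of the connecting maps of a Cech complex, so the result is closed,
  and its residue functional is \<open>\<xi>\<close> up to sign.
\<close>

theorem theta_surjective:
  fixes \<xi> :: "'k::field laurent \<Rightarrow> 'k"
  assumes n: "n > 0"
    and add: "\<And>u v. u \<in> sing n \<Longrightarrow> v \<in> sing n \<Longrightarrow> \<xi> (u + v) = \<xi> u + \<xi> v"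
    and scale: "\<And>u c. u \<in> sing n \<Longrightarrow> \<xi> (scale c u) = c * \<xi> u"
    and deg: "\<And>u e. u \<in> sing n \<Longrightarrow> u \<in> homog e \<Longrightarrow> e \<noteq> e0 \<Longrightarrow> \<xi> u = 0"
  shows "\<exists>f N. coch n (tr n N) (Suc (Suc (Suc 0))) (- e0 - 2) f \<and>
    (\<forall>as\<in>Ls n (Suc (Suc (Suc (Suc 0)))). bardiff f as = 0) \<and>
    (\<forall>r\<in>sing n. theta n (lam n f) r = - \<xi> r)"
proof -
  define N where "N = nat (e0 + 1)"
  have zero: "\<xi> 0 = 0"
    using scale[of 0 0] by simp
  have single: "lterm k c = scale c (lterm k 1)" for k and c :: 'k
    by (simp add: mult_single)
  have \<xi>0: "\<xi> u = 0" if u: "u \<in> sing n" "\<And>p q. lcoeff u (p, q) \<noteq> 0 \<Longrightarrow> p + q \<noteq> e0" for u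
  proof -
    have "\<xi> (\<Sum>k\<in>K. lterm k (lcoeff u k)) = 0" if "finite K" "K \<subseteq> Poly_Mapping.keys u" for K
      using that
    proof (induction K)
      case (insert k K)
      have nz: "lcoeff u k \<noteq> 0" using insert by (auto simp: in_keys_iff)
      have k: "lterm k (lcoeff u k) \<in> sing n"
        by (rule sing_term[OF singD[OF u(1) nz]])
      have "(\<Sum>k\<in>K. lterm k (lcoeff u k)) \<in> sing n"
        using insert.prems by (intro sing_sum sing_term singD[OF u(1)]) (auto simp: in_keys_iff)
      moreover have "\<xi> (lterm k (lcoeff u k)) = 0"
        using u(2)[of "fst k" "snd k"] nz
        by (intro deg[OF k homog_term[of "fst k" "snd k" _ "lcoeff u k", OF refl, unfolded prod.collapse]]) simp
      ultimately show ?case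
        using insert add[OF k] by simp
    qed (simp add: zero)
    from this[of "Poly_Mapping.keys u"] show ?thesis
      by (simp add: laurent_sum_terms)
  qed
  define box where "box = cone n \<inter> {0..int N} \<times> {0..int N}"
  have fin: "finite box" by (simp add: box_def)
  define u where "u m = (\<Sum>k\<in>box. lterm (- 1 - fst k, - 1 - snd k) (\<xi> (lterm k 1 * m)))" for m
  have lu: "lcoeff (u m) (p, q)
      = (if (- 1 - p, - 1 - q) \<in> cone n then \<xi> (lterm (- 1 - p, - 1 - q) 1 * m) else 0)"
    if m: "m \<in> sing n" for m p q
  proof -
    have "lcoeff (u m) (p, q) = (\<Sum>k\<in>box. if k = (- 1 - p, - 1 - q) then \<xi> (lterm k 1 * m) else 0)"
      unfolding u_def lookup_sum
      by (intro sum.cong) (auto simp: lookup_single when_def)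
    also have "\<dots> = (if (- 1 - p, - 1 - q) \<in> box then \<xi> (lterm (- 1 - p, - 1 - q) 1 * m) else 0)"
      using fin by simp
    also have "\<dots> = (if (- 1 - p, - 1 - q) \<in> cone n then \<xi> (lterm (- 1 - p, - 1 - q) 1 * m) else 0)"
    proof (cases "(- 1 - p, - 1 - q) \<in> cone n \<and> (- 1 - p, - 1 - q) \<notin> box")
      case True
      have "\<xi> (lterm (- 1 - p, - 1 - q) 1 * m) = 0"
      proof (rule \<xi>0)
        show "lterm (- 1 - p, - 1 - q) 1 * m \<in> sing n"
          using True m by (intro sing_mult sing_term) auto
        fix p' q' assume "lcoeff (lterm (- 1 - p, - 1 - q) 1 * m) (p', q') \<noteq> 0"
        then have "lcoeff m (p' - (- 1 - p), q' - (- 1 - q)) \<noteq> 0"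
          by (simp only: lcoeff_term_mult diff_Pair mult_1_left not_False_eq_True)
        from singD[OF m this] True show "p' + q' \<noteq> e0"
          by (auto simp: cone_def box_def N_def)
      qed
      with True show ?thesis by simp
    next
      case False
      then show ?thesis by (auto simp: box_def)
    qed
    finally show ?thesis .
  qed
  have u_add: "u (v + w) = u v + u w" if "v \<in> sing n" "w \<in> sing n" for v w
    unfolding u_def sum.distrib[symmetric]
  proof (rule sum.cong[OF refl])
    fix k assume "k \<in> box"
    then have "lterm k 1 * v \<in> sing n" "lterm k 1 * w \<in> sing n"
      using that by (auto simp: box_def intro!: sing_mult sing_term)
    from add[OF this] show "lterm (- 1 - fst k, - 1 - snd k) (\<xi> (lterm k 1 * (v + w)))
        = lterm (- 1 - fst k, - 1 - snd k) (\<xi> (lterm k 1 * v)) + lterm (- 1 - fst k, - 1 - snd k) (\<xi> (lterm k 1 * w))"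
      by (simp add: distrib_left single_add)
  qed
  have u_scale: "u (scale c v) = scale c (u v)" if "v \<in> sing n" for v c
    unfolding u_def sum_distrib_left
  proof (rule sum.cong[OF refl])
    fix k assume "k \<in> box"
    then have "lterm k 1 * v \<in> sing n"
      using that by (auto simp: box_def intro!: sing_mult sing_term)
    from scale[OF this, of c] show "lterm (- 1 - fst k, - 1 - snd k) (\<xi> (lterm k 1 * scale c v))
        = scale c (lterm (- 1 - fst k, - 1 - snd k) (\<xi> (lterm k 1 * v)))"
      by (simp add: mult_single mult.left_commute[of "lterm k 1"])
  qed
  have u_neg: "supp {(p, q). p < 0 \<and> q < 0 \<and> int n dvd q - p} (u m)" if "m \<in> sing n" for m
  proof -
    have "int n dvd q - p" if "int n dvd (- 1 - q) - (- 1 - p)" for p q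
      using that by (simp add: dvd_diff_commute)
    then show ?thesis
      by (auto simp: supp_def lu[OF that] cone_def split: if_splits)
  qed
  have u_tr: "u m = 0" if m: "m \<in> tr n N" for m
  proof (rule laurent_eqI)
    fix p q
    have "\<xi> (lterm (- 1 - p, - 1 - q) 1 * m) = 0" if c: "(- 1 - p, - 1 - q) \<in> cone n"
    proof (rule \<xi>0)
      have t: "lterm (- 1 - p, - 1 - q) 1 * m \<in> tr n N"
        by (rule tr_ideal[OF sing_term[OF c] m])
      then show "lterm (- 1 - p, - 1 - q) 1 * m \<in> sing n" by (simp add: tr_def)
      fix p' q' assume "lcoeff (lterm (- 1 - p, - 1 - q) 1 * m) (p', q') \<noteq> 0"
      then have "int N \<le> p' + q'" using t by (simp add: tr_def)
      then show "p' + q' \<noteq> e0" by (cases "0 \<le> e0 + 1") (auto simp: N_def)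
    qed
    then show "lcoeff (u m) (p, q) = lcoeff 0 (p, q)"
      using m by (simp add: lu tr_def)
  qed
  have u_homog: "u m \<in> homog (d - e0 - 2)" if m: "m \<in> sing n" "m \<in> homog d" for m d
    unfolding homog_def
  proof safe
    fix p q assume nz: "lcoeff (u m) (p, q) \<noteq> 0"
    then have c: "(- 1 - p, - 1 - q) \<in> cone n" and x: "\<xi> (lterm (- 1 - p, - 1 - q) 1 * m) \<noteq> 0"
      by (auto simp: lu[OF m(1)] split: if_splits)
    have "- 1 - p + (- 1 - q) + d = e0"
      using deg[OF sing_mult[OF sing_term[OF c] m(1)] homog_mult[OF homog_term[OF refl] m(2)]] x by blast
    then show "p + q = d - e0 - 2" by simp
  qed
  have u_mult: "u (b * m) = PN (b * u m)" if m: "m \<in> sing n" and "b \<in> sing n" for b m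
    using that(2)
  proof (induction rule: sing_induct)
    case zero
    then show ?case using u_add[of 0 0] by (simp add: PN_def)
  next
    case (add f g)
    then show ?case using m by (simp add: distrib_right u_add sing_mult PN_def part_add)
  next
    case (monomial r s c)
    have b: "lterm (r, s) c * m \<in> sing n" by (intro sing_mult sing_term monomial m)
    show ?case
    proof (rule laurent_eqI)
      fix p q
      have eq: "lterm (- 1 - p, - 1 - q) 1 * (lterm (r, s) c * m) = scale c (lterm (- 1 - (p - r), - 1 - (q - s)) 1 * m)"
        by (simp add: mult.assoc[symmetric] mult_single algebra_simps)
      have cc: "(- 1 - (p - r), - 1 - (q - s)) \<in> cone n" if "(- 1 - p, - 1 - q) \<in> cone n"
        using cone_add[OF that monomial] by (simp add: algebra_simps)
      show "lcoeff (u (lterm (r, s) c * m)) (p, q) = lcoeff (PN (lterm (r, s) c * u m)) (p, q)"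
      proof (cases "(- 1 - p, - 1 - q) \<in> cone n")
        case True
        then have "p < 0" "q < 0" by (auto simp: cone_def)
        then show ?thesis
          using True cc[OF True] scale[of "lterm (- 1 - (p - r), - 1 - (q - s)) 1 * m" c] m
          unfolding lu[OF b] eq by (simp add: PN_def lcoeff_term_mult lu sing_mult sing_term)
      next
        case False
        have "(- 1 - p, - 1 - q) \<in> cone n" if "p < 0" "q < 0" "(- 1 - (p - r), - 1 - (q - s)) \<in> cone n"
        proof -
          have "int n dvd - 1 - (q - s) - (- 1 - (p - r))" "int n dvd s - r"
            using that(3) monomial unfolding cone_def by simp_all
          then have "int n dvd (- 1 - (q - s)) - (- 1 - (p - r)) - (s - r)"
            by (rule dvd_diff)
          moreover have "(- 1 - (q - s)) - (- 1 - (p - r)) - (s - r) = - 1 - q - (- 1 - p)"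
            by simp
          ultimately show ?thesis
            using that(1,2) by (simp add: cone_def)
        qed
        then show ?thesis
          using False unfolding lu[OF b] by (auto simp: PN_def lcoeff_term_mult lu[OF m])
      qed
    qed
  qed
  define h where "h b m = PX (b * u m)" for b m
  define t where "t b0 b1 m = b0 * h b1 m - h (b0 * b1) m + h b0 (b1 * m)" for b0 b1 m
  have t: "t b0 b1 m = - PX (b0 * PY (b1 * u m))"
    if b: "b0 \<in> sing n" "b1 \<in> sing n" and m: "m \<in> sing n" for b0 b1 m
  proof -
    have "PX (b0 * PX w) = b0 * PX w" for w
    proof -
      have "supp {(p, q). 0 \<le> p} (b0 * PX w)"
      proof (rule supp_mult[of "cone n" _ "{(p, q). 0 \<le> p}"])
        show "supp (cone n) b0"
          by (simp add: supp_sing b)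
        show "supp {(p, q). 0 \<le> p} (PX w)"
          by (auto simp: supp_def split: if_splits)
      qed (auto simp: cone_def)
      then show ?thesis
        by (intro laurent_eqI) (auto simp: supp_def)
    qed
    moreover have "h (b0 * b1) m = PX (b0 * (PX (b1 * u m) + PY (b1 * u m) + PN (b1 * u m)))"
      by (simp add: h_def mult.assoc flip: part_split)
    ultimately show ?thesis
      by (simp add: t_def h_def u_mult[OF m b(2)] distrib_left part_add)
  qed
  define f where "f l = t (hd l) (hd (tl l)) (hd (tl (tl l)))" for l
  have PYs: "supp {(p, q). p < 0 \<and> 0 \<le> q \<and> int n dvd q - p} (PY (b * u m))"
    if "b \<in> sing n" "m \<in> sing n" for b m
  proof -
    have "supp {(p, q). int n dvd q - p} (b * u m)"
    proof (rule supp_mult[OF _ u_neg[OF that(2)]])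
      show "supp (cone n) b" using that by (simp add: supp_sing)
      fix k h :: "int \<times> int" assume "k \<in> cone n" "h \<in> {(p, q). p < 0 \<and> q < 0 \<and> int n dvd q - p}"
      then have "int n dvd (snd k - fst k) + (snd h - fst h)"
        by (intro dvd_add) (auto simp: cone_def)
      then show "k + h \<in> {(p, q). int n dvd q - p}"
        by (cases k; cases h) (simp add: algebra_simps)
    qed
    then show ?thesis
      unfolding PY_def by (rule supp_mono[OF supp_part]) auto
  qed
  have "coch n (tr n N) (Suc (Suc (Suc 0))) (- e0 - 2) f"
    unfolding f_def
  proof (rule coch_3I)
    fix a b v w :: "'k laurent" assume "a \<in> sing n" "b \<in> sing n" "v \<in> sing n" "w \<in> sing n"
    then show "t (v + w) a b = t v a b + t w a b \<and> t a (v + w) b = t a v b + t a w b \<and> t a b (v + w) = t a b v + t a b w"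
      by (simp add: t sing_add u_add distrib_left distrib_right part_add PY_def)
  next
    fix a b v :: "'k laurent" and c assume "a \<in> sing n" "b \<in> sing n" "v \<in> sing n"
    then show "t (scale c v) a b = scale c (t v a b) \<and> t a (scale c v) b = scale c (t a v b) \<and> t a b (scale c v) = scale c (t a b v)"
      by (simp add: t sing_scale u_scale mult.assoc mult.left_commute[of _ "Poly_Mapping.single 0 c"] part_scale PY_def)
  next
    fix a b v :: "'k laurent" assume abv: "a \<in> sing n" "b \<in> sing n" "v \<in> sing n"
    have "supp {(p, q). 0 \<le> q \<and> int n dvd q - p} (a * PY (b * u v))"
    proof (rule supp_mult[OF _ PYs[OF abv(2,3)]])
      show "supp (cone n) a" using abv by (simp add: supp_sing)
      fix k h :: "int \<times> int" assume kh: "k \<in> cone n" "h \<in> {(p, q). p < 0 \<and> 0 \<le> q \<and> int n dvd q - p}"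
      then have "int n dvd (snd k - fst k) + (snd h - fst h)"
        by (intro dvd_add) (auto simp: cone_def)
      with kh show "k + h \<in> {(p, q). 0 \<le> q \<and> int n dvd q - p}"
        by (cases k; cases h) (simp add: cone_def algebra_simps)
    qed
    then have "supp (cone n) (PX (a * PY (b * u v)))"
      by (rule supp_mono[OF supp_part]) (auto simp: cone_def)
    then show "t a b v \<in> sing n"
      by (simp add: t abv supp_sing sing_uminus)
  next
    fix a b v :: "'k laurent" assume "a \<in> sing n" "b \<in> sing n" "v \<in> tr n N"
    then show "t a b v = 0"
      using tr_ideal[of b n v N] by (simp add: t_def h_def u_tr)
  next
    fix a b v :: "'k laurent" and e e' e''
    assume s: "a \<in> sing n" "b \<in> sing n" "v \<in> sing n" and h: "a \<in> homog e" "b \<in> homog e'" "v \<in> homog e''"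
    have "a * PY (b * u v) \<in> homog (e + (e' + (e'' - e0 - 2)))"
      unfolding PY_def by (intro homog_mult homog_part u_homog s h)
    then have "t a b v \<in> homog (e + (e' + (e'' - e0 - 2)))"
      by (simp add: t s homog_uminus homog_part)
    then show "t a b v \<in> homog (- e0 - 2 + e + e' + e'')"
      by (simp add: algebra_simps)
  qed
  moreover have "bardiff f as = 0" if "as \<in> Ls n (Suc (Suc (Suc (Suc 0))))" for as
  proof -
    have "length as = Suc (Suc (Suc (Suc 0)))"
      using that by (simp add: Ls_def)
    then obtain a b c m where "as = [a, b, c, m]"
      by (auto simp: length_Suc_conv)
    then show ?thesis
      by (simp add: bardiff_def f_def t_def algebra_simps)
  qed
  moreover have "theta n (lam n f) r = - \<xi> r" if r: "r \<in> sing n" for r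
  proof -
    have tc: "tcoeff n (lam n f) r i j = (if i = 0 \<and> j = 0 then - \<xi> r else 0)" for i j
    proof -
      let ?w = "xy n i j r" and ?p = "int j * int n + int n - 1" and ?q = "int i * int n + int n - 1"
      have w: "?w \<in> sing n" by (rule xy_sing[OF r])
      have "0 \<le> int j * int n" by simp
      then have p: "0 \<le> ?p" using n by linarith
      have "lcoeff (t (gx n) (gy n) ?w) (?p, ?q) = 0"
        unfolding t[OF gx_sing gy_sing w] using p by (simp add: gx_def lcoeff_term_mult PY_def)
      moreover have "lcoeff (t (gy n) (gx n) ?w) (?p, ?q) = (if i = 0 \<and> j = 0 then - \<xi> r else 0)"
      proof -
        have "lcoeff (t (gy n) (gx n) ?w) (?p, ?q)
            = - (if int j * int n - 1 < 0 \<and> 0 \<le> ?q then lcoeff (u ?w) (int j * int n - 1, int i * int n - 1) else 0)"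
          unfolding t[OF gy_sing gx_sing w] using p by (simp add: gx_def gy_def lcoeff_term_mult PY_def)
        also have "\<dots> = (if i = 0 \<and> j = 0 then - \<xi> r else 0)"
        proof (cases "i = 0 \<and> j = 0")
          case True
          then show ?thesis
            using n lu[OF r, of "-1" "-1"] by (simp flip: zero_prod_def)
        next
          case False
          have "lcoeff (u ?w) (int j * int n - 1, int i * int n - 1) = 0" if "int j * int n < 1"
          proof -
            have "j * n = 0" using that by (simp flip: of_nat_mult)
            then have "j = 0" using n by simp
            with False have "1 \<le> i * n" using n by simp
            then have "1 \<le> int i * int n" by (simp flip: of_nat_mult)
            then show ?thesis
              by (simp add: lu[OF w] cone_def)
          qed
          with False show ?thesis by auto
        qed
        finally show ?thesis .
      qed
      ultimately show ?thesis
        by (simp add: tcoeff_def lam_def f_def lookup_minus)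
    qed
    have "theta n (lam n f) r = (\<Sum>i<1. \<Sum>j<1. tcoeff n (lam n f) r i j)"
      by (rule theta_eq) (auto simp: tc)
    then show ?thesis by (simp add: tc)
  qed
  ultimately show ?thesis by blast
qed

section \<open>Twisting by monomial automorphisms\<close>

text \<open>
  The monomial automorphism that scales the monomial with exponent \<open>k\<close> by \<open>\<chi> k\<close> and, when \<open>s\<close> holds,
  exchanges the two variables, that is \<open>x\<close> and \<open>y\<close>.
\<close>

definition twist :: "bool \<Rightarrow> (int \<times> int \<Rightarrow> 'k) \<Rightarrow> 'k::field laurent \<Rightarrow> 'k laurent"
  where "twist s \<chi> f = Abs_poly_mapping (\<lambda>k. let k' = (if s then prod.swap k else k) in \<chi> k' * lcoeff f k')"

definition kap :: "bool \<Rightarrow> int \<times> int \<Rightarrow> int \<times> int"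
  where "kap s k = (if s then prod.swap k else k)"

lemma kap_kap [simp]: "kap s (kap s k) = k"
  and kap_add: "kap s (k + l) = kap s k + kap s l"
  and kap_diff: "kap s (k - l) = kap s k - kap s l"
  by (cases k; cases l; simp add: kap_def)+

lemma kap_cone [simp]: "kap s k \<in> cone n \<longleftrightarrow> k \<in> cone n"
  by (cases k) (auto simp: kap_def cone_def dvd_diff_commute)

lemma lcoeff_twist: "lcoeff (twist s \<chi> f) k = \<chi> (kap s k) * lcoeff f (kap s k)"
proof -
  have "finite (kap s ` {k. lcoeff f k \<noteq> 0})"
    by simp
  moreover have "{k. \<chi> (kap s k) * lcoeff f (kap s k) \<noteq> 0} \<subseteq> kap s ` {k. lcoeff f k \<noteq> 0}"
  proof
    fix k assume "k \<in> {k. \<chi> (kap s k) * lcoeff f (kap s k) \<noteq> 0}"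
    then show "k \<in> kap s ` {k. lcoeff f k \<noteq> 0}"
      by (intro image_eqI[of _ _ "kap s k"]) simp_all
  qed
  ultimately have "finite {k. \<chi> (kap s k) * lcoeff f (kap s k) \<noteq> 0}"
    by (rule finite_subset[rotated])
  then show ?thesis
    by (simp add: twist_def Let_def flip: kap_def)
qed

definition monchar :: "nat \<Rightarrow> (int \<times> int \<Rightarrow> 'k::field) \<Rightarrow> bool"
  where "monchar n \<chi> \<longleftrightarrow> (\<forall>k\<in>cone n. \<chi> k \<noteq> 0) \<and> (\<forall>k\<in>cone n. \<forall>l\<in>cone n. \<chi> (k + l) = \<chi> k * \<chi> l)"

lemma monchar_power_int:
  assumes "\<mu> \<noteq> 0" "\<nu> \<noteq> 0"
  shows "monchar n (\<lambda>(p, q). \<mu> powi p * \<nu> powi ((q - p) div int n))"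
proof -
  have "(\<mu> powi (p + p') * \<nu> powi ((q + q' - (p + p')) div int n))
      = \<mu> powi p * \<nu> powi ((q - p) div int n) * (\<mu> powi p' * \<nu> powi ((q' - p') div int n))"
    if "int n dvd q - p" "int n dvd q' - p'" for p q p' q'
  proof -
    have "(q + q' - (p + p')) div int n = (q - p) div int n + (q' - p') div int n"
      using div_plus_div_distrib_dvd_left[OF that(1), of "q' - p'"] by (simp add: algebra_simps)
    then show ?thesis
      using assms by (simp add: power_int_add)
  qed
  then show ?thesis
    using assms by (auto simp: monchar_def cone_def)
qed

lemma monchar_zero: "monchar n \<chi> \<Longrightarrow> \<chi> 0 = 1"
  unfolding monchar_def using zero_in_cone[of n]
  by (metis add.right_neutral mult_cancel_left1)

lemma monchar_inverse: "monchar n \<chi> \<Longrightarrow> monchar n (\<lambda>k. inverse (\<chi> (kap s k)))"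
  by (simp add: monchar_def kap_add)

lemma twist_add: "twist s \<chi> (f + g) = twist s \<chi> f + twist s \<chi> g"
  and twist_diff: "twist s \<chi> (f - g) = twist s \<chi> f - twist s \<chi> g"
  by (rule poly_mapping_eqI, simp add: lcoeff_twist lookup_add lookup_minus algebra_simps)+

lemma twist_scale: "twist s \<chi> (scale c f) = scale c (twist s \<chi> f)"
  by (rule poly_mapping_eqI) (simp add: lcoeff_twist mult.left_commute)

lemma linear_op_twist: "linear_op (twist s \<chi>)"
  by (simp add: linear_op_def twist_add twist_scale)

lemma twist_term: "twist s \<chi> (lterm k c) = lterm (kap s k) (\<chi> k * c)"
proof (rule poly_mapping_eqI)
  fix l
  have "kap s l = k \<longleftrightarrow> l = kap s k" by (metis kap_kap)
  then show "lcoeff (twist s \<chi> (lterm k c)) l = lcoeff (lterm (kap s k) (\<chi> k * c)) l"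
    by (auto simp: lcoeff_twist lookup_single when_def)
qed

lemma twist_sing: "f \<in> sing n \<Longrightarrow> twist s \<chi> f \<in> sing n"
  unfolding supp_sing[symmetric] supp_def
  by (metis kap_cone lcoeff_twist mult_zero_right)

lemma twist_homog:
  assumes "f \<in> homog d"
  shows "twist s \<chi> f \<in> homog d"
  unfolding homog_def
proof safe
  fix p q assume "lcoeff (twist s \<chi> f) (p, q) \<noteq> 0"
  then have "lcoeff f (kap s (p, q)) \<noteq> 0" by (simp add: lcoeff_twist)
  moreover have "p + q = fst (kap s (p, q)) + snd (kap s (p, q))" by (simp add: kap_def)
  ultimately show "p + q = d"
    using assms unfolding homog_def by (metis (mono_tags, lifting) mem_Collect_eq prod.collapse)
qed

lemma twist_mult:
  fixes f g :: "'k::field laurent"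
  assumes \<chi>: "monchar n \<chi>" and "f \<in> sing n" and g: "g \<in> sing n"
  shows "twist s \<chi> (f * g) = twist s \<chi> f * twist s \<chi> g"
  using assms(2)
proof (induction rule: sing_induct)
  case zero
  then show ?case by (simp add: linear_opD(3)[OF linear_op_twist])
next
  case (add f h)
  then show ?case by (simp add: distrib_right twist_add)
next
  case (monomial p q c)
  show ?case
  proof (rule poly_mapping_eqI)
    fix l
    have "\<chi> (kap s l) * (c * lcoeff g (kap s l - (p, q)))
        = \<chi> (p, q) * c * (\<chi> (kap s l - (p, q)) * lcoeff g (kap s l - (p, q)))"
    proof (cases "lcoeff g (kap s l - (p, q)) = 0")
      case False
      then have "kap s l - (p, q) \<in> cone n" by (rule singD[OF g])
      then have "\<chi> ((p, q) + (kap s l - (p, q))) = \<chi> (p, q) * \<chi> (kap s l - (p, q))"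
        using \<chi> monomial unfolding monchar_def by blast
      then show ?thesis by simp
    qed simp
    then show "lcoeff (twist s \<chi> (lterm (p, q) c * g)) l = lcoeff (twist s \<chi> (lterm (p, q) c) * twist s \<chi> g) l"
      by (simp only: twist_term lcoeff_twist lcoeff_term_mult kap_diff kap_kap)
  qed
qed

lemma twist_inverse:
  assumes \<chi>: "monchar n \<chi>" and f: "f \<in> sing n"
  shows "twist s \<chi> (twist s (\<lambda>k. inverse (\<chi> (kap s k))) f) = f"
    "twist s (\<lambda>k. inverse (\<chi> (kap s k))) (twist s \<chi> f) = f"
proof -
  have "\<chi> k \<noteq> 0" if "lcoeff f k \<noteq> 0" for k
    using \<chi> singD[OF f that] by (simp add: monchar_def)
  moreover have "\<chi> (kap s k) \<noteq> 0" if "lcoeff f k \<noteq> 0" for k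
    using \<chi> singD[OF f that] by (simp add: monchar_def)
  ultimately show "twist s \<chi> (twist s (\<lambda>k. inverse (\<chi> (kap s k))) f) = f"
    "twist s (\<lambda>k. inverse (\<chi> (kap s k))) (twist s \<chi> f) = f"
    by (auto intro!: poly_mapping_eqI simp: lcoeff_twist simp del: split_paired_All)
      (metis divide_self_if mult.commute mult_zero_left field_class.field_divide_inverse mult.assoc mult_1)+
qed

text \<open>
  Exchanging \<open>x\<close> and \<open>y\<close> changes the sign of \<open>lam\<close>. A character changes the residue by the scalar through
  which it acts on \<open>u v = z\<close>, since the residue involves the form \<open>du dv\<close>. The hypothesis on \<open>\<chi> (1, 1)\<close>
  says that the two effects cancel.
\<close>

lemma theta_twist:
  fixes f :: "'k::field laurent list \<Rightarrow> 'k laurent"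
  assumes n: "n > 0" and \<chi>: "monchar n \<chi>" and sgn: "\<chi> (1, 1) = (if s then - 1 else 1)"
    and f: "mlin n (tr n N) (Suc (Suc (Suc 0))) f"
    and f': "\<And>as. as \<in> Ls n (Suc (Suc (Suc 0))) \<Longrightarrow> f' as = twist s \<chi> (f (map (twist s (\<lambda>k. inverse (\<chi> (kap s k)))) as))"
    and r: "r \<in> sing n"
  shows "theta n (lam n f') r = theta n (lam n f) (twist s (\<lambda>k. inverse (\<chi> (kap s k))) r)"
proof -
  define \<chi>' where "\<chi>' k = inverse (\<chi> (kap s k))" for k
  let ?G = "twist s \<chi>" and ?H = "twist s \<chi>'"
  have \<chi>': "monchar n \<chi>'"
    unfolding \<chi>'_def[abs_def] by (rule monchar_inverse[OF \<chi>])
  have H: "?H r \<in> sing n" by (rule twist_sing[OF r])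
  have cone: "(0, int n) \<in> cone n" "(int n, 0) \<in> cone n" "(1, 1) \<in> cone n"
    "\<And>i j. (int j * int n, int i * int n) \<in> cone n" "\<And>k. (int k, int k) \<in> cone n"
    by (auto simp: cone_def)
  have mchi: "\<chi> (k + l) = \<chi> k * \<chi> l" "\<chi>' (k + l) = \<chi>' k * \<chi>' l" "\<chi> k \<noteq> 0" "\<chi>' k \<noteq> 0"
    if "k \<in> cone n" "l \<in> cone n" for k l
    using that \<chi> \<chi>' unfolding monchar_def by blast+
  have diag: "\<chi> (int k, int k) = \<chi> (1, 1) ^ k" for k
  proof (induction k)
    case 0
    then show ?case using monchar_zero[OF \<chi>] by (simp add: zero_prod_def)
  next
    case (Suc k)
    then show ?case using mchi(1)[OF cone(3) cone(5)[of k]] by (simp add: add.commute)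
  qed
  have chixy: "\<chi>' (0, int n) * \<chi>' (int n, 0) = inverse (\<chi> (1, 1) ^ n)"
  proof -
    have "\<chi>' (0, int n) * \<chi>' (int n, 0) = \<chi>' (int n, int n)"
      using mchi(2)[OF cone(1,2)] by simp
    also have "\<dots> = inverse (\<chi> (1, 1) ^ n)"
      by (simp add: \<chi>'_def kap_def diag)
    finally show ?thesis .
  qed
  define \<epsilon> where "\<epsilon> = (if s then - 1 else 1 :: 'k)"
  have gens: "?H (gx n) = scale (\<chi>' (0, int n)) (if s then gy n else gx n)"
    "?H (gy n) = scale (\<chi>' (int n, 0)) (if s then gx n else gy n)"
    by (auto simp: gx_def gy_def twist_term kap_def mult_single)
  have lin: "f [scale c a, scale d b, m] = scale (c * d) (f [a, b, m])"
    if "a \<in> sing n" "b \<in> sing n" "m \<in> sing n" for a b m c d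
  proof -
    have "f [scale c a, scale d b, m] = scale c (f [a, scale d b, m])"
      by (rule mlinD(2)[OF f _ that(1,1)]) (simp add: that sing_scale)
    also have "f [a, scale d b, m] = scale d (f [a, b, m])"
      by (rule mlinD(2)[OF mlin_slice[OF f that(1)] _ that(2,2)]) (simp add: that)
    finally show ?thesis
      by (simp add: mult.assoc[symmetric] mult_single)
  qed
  have lam': "lam n f' m = scale (\<epsilon> * inverse (\<chi> (1, 1) ^ n)) (?G (lam n f (?H m)))" if m: "m \<in> sing n" for m
  proof -
    have 1: "f' [gy n, gx n, m] = ?G (f [?H (gy n), ?H (gx n), ?H m])"
      "f' [gx n, gy n, m] = ?G (f [?H (gx n), ?H (gy n), ?H m])"
      using f'[of "[gy n, gx n, m]"] f'[of "[gx n, gy n, m]"] m by (simp_all add: \<chi>'_def[abs_def])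
    show ?thesis
      unfolding lam_def 1 gens chixy[symmetric]
      using twist_sing[OF m, of s \<chi>']
      by (cases s) (simp_all add: lin twist_scale twist_diff \<epsilon>_def mult.commute[of "\<chi>' (int n, 0)"]
          right_diff_distrib single_uminus)
  qed
  have tc: "tcoeff n (lam n f') r i j = (if s then tcoeff n (lam n f) (?H r) j i else tcoeff n (lam n f) (?H r) i j)" for i j
  proof -
    let ?k = "(int j * int n, int i * int n)" and ?d = "(int (n - 1), int (n - 1))"
    let ?i = "if s then j else i" and ?j = "if s then i else j"
    have pq: "(int j * int n + int n - 1, int i * int n + int n - 1) = ?k + ?d"
      using n by (simp add: of_nat_diff)
    have "?H (xy n i j r) = scale (\<chi>' ?k) (xy n ?i ?j (?H r))"
      unfolding xy_eq using twist_mult[OF \<chi>' sing_term[OF cone(4)] r]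
      by (auto simp: twist_term kap_def mult.assoc[symmetric] mult_single)
    then have "lam n f (?H (xy n i j r)) = scale (\<chi>' ?k) (lam n f (xy n ?i ?j (?H r)))"
      using mlin3D(2)[OF f gx_sing gy_sing xy_sing[OF H]] mlin3D(2)[OF f gy_sing gx_sing xy_sing[OF H]]
      by (simp add: lam_def right_diff_distrib)
    then have "tcoeff n (lam n f') r i j = \<epsilon> * inverse (\<chi> (1, 1) ^ n) *
      (\<chi> (kap s (?k + ?d)) * (\<chi>' ?k * lcoeff (lam n f (xy n ?i ?j (?H r))) (kap s (?k + ?d))))"
      by (simp only: tcoeff_def lam'[OF xy_sing[OF r]] lcoeff_scale lcoeff_twist pq)
    also have "\<chi> (kap s (?k + ?d)) = \<chi> (kap s ?k) * \<chi> (1, 1) ^ (n - 1)"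
      using mchi(1)[of "kap s ?k" "kap s ?d"] cone(4,5) diag[of "n - 1"]
      by (simp only: kap_add kap_cone) (simp add: kap_def)
    also have "\<epsilon> * inverse (\<chi> (1, 1) ^ n) * (\<chi> (kap s ?k) * \<chi> (1, 1) ^ (n - 1) * (\<chi>' ?k * x))
        = (\<epsilon> * (inverse (\<chi> (1, 1) ^ n) * \<chi> (1, 1) ^ (n - 1))) * (\<chi> (kap s ?k) * \<chi>' ?k) * x" for x
      by (simp only: mult.assoc mult.commute mult.left_commute)
    also have "\<chi> (kap s ?k) * \<chi>' ?k = 1"
    proof -
      have "\<chi> (kap s ?k) \<noteq> 0"
        by (rule mchi(3)[of _ "kap s ?k"]) (simp_all only: kap_cone cone(4))
      then show ?thesis by (simp add: \<chi>'_def)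
    qed
    also have "\<epsilon> * (inverse (\<chi> (1, 1) ^ n) * \<chi> (1, 1) ^ (n - 1)) = 1"
      using n by (cases n) (auto simp: sgn \<epsilon>_def power_minus_even split: if_splits
        simp flip: power_inverse power_mult_distrib)
    also have "kap s (?k + ?d) = (int ?j * int n + int n - 1, int ?i * int n + int n - 1)"
      unfolding pq[symmetric] by (simp add: kap_def)
    finally show ?thesis
      by (simp add: tcoeff_def)
  qed
  have van: "lam n f m = 0" if "m \<in> tr n N" for m
    using mlin3D(4)[OF f _ _ that] by (simp add: lam_def)
  have z: "tcoeff n (lam n f) (?H r) i j = 0" if "N \<le> i \<or> N \<le> j" for i j
    by (simp add: tcoeff_def van[OF xy_tr[OF n H that]])
  have "theta n (lam n f') r = (\<Sum>i<N. \<Sum>j<N. tcoeff n (lam n f') r i j)"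
  proof (rule theta_eq)
    fix i j assume "N \<le> i \<or> N \<le> j"
    then show "tcoeff n (lam n f') r i j = 0"
      using z[of i j] z[of j i] by (cases s) (simp_all add: tc disj_commute)
  qed
  also have "\<dots> = (\<Sum>i<N. \<Sum>j<N. tcoeff n (lam n f) (?H r) i j)"
  proof (cases s)
    case True
    then show ?thesis by (simp add: tc) (rule sum.swap)
  qed (simp add: tc)
  also have "\<dots> = theta n (lam n f) (?H r)"
    by (rule theta_eq[symmetric]) (rule z)
  finally show ?thesis by (simp add: \<chi>'_def[abs_def])
qed

section \<open>Comparison with slotwise multilinearity\<close>

text \<open>The recursive description of multilinear maps agrees with linearity in each slot.\<close>

lemma mlin_iff:
  fixes f :: "'k::field laurent list \<Rightarrow> 'k laurent"
  assumes I: "I \<subseteq> sing n"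
  shows "mlin n I (Suc p) f \<longleftrightarrow>
    (\<forall>as\<in>Ls n (Suc p). f as \<in> sing n \<and>
      (\<forall>q\<le>p. \<forall>u\<in>sing n. \<forall>v\<in>sing n. f (as[q := u + v]) = f (as[q := u]) + f (as[q := v])) \<and>
      (\<forall>q\<le>p. \<forall>u\<in>sing n. \<forall>c. f (as[q := scale c u]) = scale c (f (as[q := u]))) \<and>
      (last as \<in> I \<longrightarrow> f as = 0))"
proof (induction p arbitrary: f)
  case 0
  have *: "(\<forall>as\<in>Ls n (Suc 0). Q as) \<longleftrightarrow> (\<forall>a\<in>sing n. Q [a])" for Q :: "'k laurent list \<Rightarrow> bool"
    by (auto elim!: Ls_SucE)
  show ?case
    unfolding * using I sing_zero[of n, where 'a = 'k] by (auto simp: subset_iff)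
next
  case (Suc p)
  define P where "P p f as \<longleftrightarrow> f as \<in> sing n \<and>
      (\<forall>q\<le>p. \<forall>u\<in>sing n. \<forall>v\<in>sing n. f (as[q := u + v]) = f (as[q := u]) + f (as[q := v])) \<and>
      (\<forall>q\<le>p. \<forall>u\<in>sing n. \<forall>c. f (as[q := scale c u]) = scale c (f (as[q := u]))) \<and>
      (last as \<in> I \<longrightarrow> f as = 0)" for p and f :: "'k laurent list \<Rightarrow> 'k laurent" and as
  have IH: "mlin n I (Suc p) f \<longleftrightarrow> (\<forall>as\<in>Ls n (Suc p). P p f as)" for f
    using Suc.IH[of f] by (simp only: P_def)
  have q: "(\<forall>q\<le>Suc p. Q q) \<longleftrightarrow> Q 0 \<and> (\<forall>q\<le>p. Q (Suc q))" for Q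
    by (metis Suc_le_mono le0 not0_implies_Suc)
  have P: "P (Suc p) f (a # r) \<longleftrightarrow> P p (\<lambda>l. f (a # l)) r \<and>
      (\<forall>u\<in>sing n. \<forall>v\<in>sing n. f ((u + v) # r) = f (u # r) + f (v # r)) \<and>
      (\<forall>u\<in>sing n. \<forall>c. f (scale c u # r) = scale c (f (u # r)))" if "r \<in> Ls n (Suc p)" for a r
    unfolding P_def q using that by (auto simp: Ls_Suc_ne)
  have "mlin n I (Suc (Suc p)) f \<longleftrightarrow>
    (\<forall>r\<in>Ls n (Suc p). (\<forall>u\<in>sing n. \<forall>v\<in>sing n. f ((u + v) # r) = f (u # r) + f (v # r)) \<and>
        (\<forall>u\<in>sing n. \<forall>c. f (scale c u # r) = scale c (f (u # r))) \<and>
        (\<forall>u\<in>sing n. f (u # r) \<in> sing n)) \<and> (\<forall>a\<in>sing n. \<forall>r\<in>Ls n (Suc p). P p (\<lambda>l. f (a # l)) r)"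
    unfolding mlin.simps(2)[of n I "Suc p"] IH by simp
  also have "\<dots> \<longleftrightarrow> (\<forall>r\<in>Ls n (Suc p). \<forall>a\<in>sing n. P (Suc p) f (a # r))"
    using sing_zero[of n] by (simp only: P cong: ball_cong) (auto simp: P_def)
  also have "\<dots> \<longleftrightarrow> (\<forall>as\<in>Ls n (Suc (Suc p)). P (Suc p) f as)"
    by (metis Ls_Cons Ls_SucE)
  finally show ?case
    by (simp only: P_def)
qed

lemma grd_iff:
  fixes f :: "'k::field laurent list \<Rightarrow> 'k laurent"
  shows "grd n m j f \<longleftrightarrow> (\<forall>as\<in>Ls n m. \<forall>es. list_all2 (\<lambda>r e. r \<in> homog e) as es \<longrightarrow> f as \<in> homog (sum_list es + j))"
proof (induction m arbitrary: f j)
  case (Suc m)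
  show ?case
    unfolding grd.simps Suc.IH
  proof safe
    fix as :: "'k laurent list" and es
    assume *: "\<forall>e. \<forall>a\<in>sing n \<inter> homog e. \<forall>as\<in>Ls n m. \<forall>es. list_all2 (\<lambda>r e. r \<in> homog e) as es \<longrightarrow>
        f (a # as) \<in> homog (sum_list es + (j + e))"
      and as: "as \<in> Ls n (Suc m)" "list_all2 (\<lambda>r e. r \<in> homog e) as es"
    obtain a r where r: "as = a # r" "a \<in> sing n" "r \<in> Ls n m" using as(1) by (rule Ls_SucE)
    obtain e es' where e: "es = e # es'" "a \<in> homog e" "list_all2 (\<lambda>r e. r \<in> homog e) r es'"
      using as(2) by (auto simp: r list_all2_Cons1)
    have "f (a # r) \<in> homog (sum_list es' + (j + e))"
      using * r e by blast
    then show "f as \<in> homog (sum_list es + j)"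
      by (simp add: r e algebra_simps)
  next
    fix e and a :: "'k laurent" and as :: "'k laurent list" and es
    assume *: "\<forall>as\<in>Ls n (Suc m). \<forall>es. list_all2 (\<lambda>r e. r \<in> homog e) as es \<longrightarrow> f as \<in> homog (sum_list es + j)"
      and "a \<in> sing n" "a \<in> homog e" "as \<in> Ls n m" "list_all2 (\<lambda>r e. r \<in> homog e) as es"
    then have "f (a # as) \<in> homog (sum_list (e # es) + j)"
      by (intro *[rule_format]) auto
    then show "f (a # as) \<in> homog (sum_list es + (j + e))"
      by (simp add: algebra_simps)
  qed
qed auto

lemma bd_alternating_sum:
  fixes G :: "'k::field laurent list \<Rightarrow> 'k laurent"
  assumes "length bs = p + 2"
  shows "(\<Sum>q\<in>{0..p}. scale ((-1) ^ Suc q) (G (take q bs @ [bs ! q * bs ! Suc q] @ drop (q + 2) bs))) = - bd G bs"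
  using assms
proof (induction p arbitrary: G bs)
  case 0
  then obtain a b where "bs = [a, b]" by (auto simp: numeral_2_eq_2 length_Suc_conv)
  then show ?case by (simp add: single_uminus)
next
  case (Suc p)
  then obtain a b r where bs: "bs = a # b # r" and r: "length (b # r) = p + 2"
    by (cases bs; cases "tl bs") auto
  have "(\<Sum>q\<in>{0..Suc p}. scale ((-1) ^ Suc q) (G (take q bs @ [bs ! q * bs ! Suc q] @ drop (q + 2) bs)))
     = - G (a * b # r) + (\<Sum>q\<in>{0..p}. scale ((-1) ^ Suc (Suc q))
        (G (a # take q (b # r) @ [(b # r) ! q * (b # r) ! Suc q] @ drop (q + 2) (b # r))))"
    by (subst sum.atLeast0_atMost_Suc_shift) (simp add: bs single_uminus)
  also have "\<dots> = - G (a * b # r) - (\<Sum>q\<in>{0..p}. scale ((-1) ^ Suc q)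
        (G (a # take q (b # r) @ [(b # r) ! q * (b # r) ! Suc q] @ drop (q + 2) (b # r))))"
    by (simp add: single_uminus sum_negf)
  also have "\<dots> = - G (a * b # r) + bd (\<lambda>l. G (a # l)) (b # r)"
    by (subst Suc.IH[OF r]) simp
  finally show ?case by (simp add: bs)
qed

lemma coch_mono: "I' \<subseteq> I \<Longrightarrow> coch n I m j f \<Longrightarrow> coch n I' m j f"
proof -
  have "I' \<subseteq> I \<Longrightarrow> mlin n I m f \<Longrightarrow> mlin n I' m f"
    by (induction m arbitrary: f) auto
  then show "I' \<subseteq> I \<Longrightarrow> coch n I m j f \<Longrightarrow> coch n I' m j f"
    by (simp add: coch_def)
qed

lemma tr_mono: "k \<le> l \<Longrightarrow> tr n l \<subseteq> tr n k"
  by (fastforce simp: tr_def)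

section \<open>Homological determinants over a type A singularity\<close>

text \<open>
  An algebra given as a record, together with an identification with \<open>sing n\<close>. All homological notions
  are transported along \<open>\<iota>\<close>.
\<close>

locale sing_algebra =
  fixes A :: "('k::field, 'r) module" (structure) and Gr :: "int \<Rightarrow> 'r set" and n :: nat
    and \<iota> :: "'r \<Rightarrow> 'k laurent"
  assumes n: "n > 0"
    and bij: "bij_betw \<iota> (carrier A) (sing n)"
    and add_closed: "u \<in> carrier A \<Longrightarrow> v \<in> carrier A \<Longrightarrow> u \<oplus> v \<in> carrier A"
    and mult_closed: "u \<in> carrier A \<Longrightarrow> v \<in> carrier A \<Longrightarrow> u \<otimes> v \<in> carrier A"
    and smult_closed: "u \<in> carrier A \<Longrightarrow> c \<odot> u \<in> carrier A"
    and zero_closed: "\<zero> \<in> carrier A"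
    and one_closed: "\<one> \<in> carrier A"
    and iota_add: "u \<in> carrier A \<Longrightarrow> v \<in> carrier A \<Longrightarrow> \<iota> (u \<oplus> v) = \<iota> u + \<iota> v"
    and iota_mult: "u \<in> carrier A \<Longrightarrow> v \<in> carrier A \<Longrightarrow> \<iota> (u \<otimes> v) = \<iota> u * \<iota> v"
    and iota_smult: "u \<in> carrier A \<Longrightarrow> \<iota> (c \<odot> u) = scale c (\<iota> u)"
    and iota_zero: "\<iota> \<zero> = 0"
    and iota_one: "\<iota> \<one> = 1"
    and grading: "Gr e = {u \<in> carrier A. \<iota> u \<in> homog e}"
begin

lemma iota_sing [simp]: "u \<in> carrier A \<Longrightarrow> \<iota> u \<in> sing n"
  using bij by (rule bij_betw_apply)

lemma iota_inj: "u \<in> carrier A \<Longrightarrow> v \<in> carrier A \<Longrightarrow> \<iota> u = \<iota> v \<Longrightarrow> u = v"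
  using bij unfolding bij_betw_def inj_on_def by blast

lemma iota_eq_iff: "u \<in> carrier A \<Longrightarrow> v \<in> carrier A \<Longrightarrow> u = v \<longleftrightarrow> \<iota> u = \<iota> v"
  using iota_inj by blast

definition inv\<iota> :: "'k laurent \<Rightarrow> 'r"
  where "inv\<iota> = inv_into (carrier A) \<iota>"

lemma inv_closed [simp]: "b \<in> sing n \<Longrightarrow> inv\<iota> b \<in> carrier A"
  and iota_inv [simp]: "b \<in> sing n \<Longrightarrow> \<iota> (inv\<iota> b) = b"
  and inv_iota [simp]: "u \<in> carrier A \<Longrightarrow> inv\<iota> (\<iota> u) = u"
  using bij unfolding inv\<iota>_def
  by (auto simp: bij_betw_def inv_into_into f_inv_into_f)

lemma abelian: "abelian_group A"
proof (rule abelian_groupI)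
  fix u assume u: "u \<in> carrier A"
  then have "inv\<iota> (- \<iota> u) \<oplus> u = \<zero>"
    by (intro iota_inj) (simp_all add: add_closed zero_closed iota_add iota_zero sing_uminus)
  then show "\<exists>v\<in>carrier A. v \<oplus> u = \<zero>"
    using u by (intro bexI[of _ "inv\<iota> (- \<iota> u)"]) (simp_all add: sing_uminus)
qed (auto intro!: iota_inj simp: add_closed zero_closed iota_add iota_zero algebra_simps)

interpretation abelian_group A
  by (rule abelian)

lemma minus_closed: "u \<in> carrier A \<Longrightarrow> v \<in> carrier A \<Longrightarrow> u \<ominus> v \<in> carrier A"
  and iota_minus: "u \<in> carrier A \<Longrightarrow> v \<in> carrier A \<Longrightarrow> \<iota> (u \<ominus> v) = \<iota> u - \<iota> v"
proof -
  assume uv: "u \<in> carrier A" "v \<in> carrier A"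
  then show c: "u \<ominus> v \<in> carrier A" by simp
  have "(u \<ominus> v) \<oplus> v = u"
    using uv by (simp add: a_minus_def a_assoc l_neg)
  then have "\<iota> (u \<ominus> v) + \<iota> v = \<iota> u"
    using iota_add[OF c uv(2)] by simp
  then show "\<iota> (u \<ominus> v) = \<iota> u - \<iota> v"
    by (simp add: algebra_simps)
qed

lemma iota_finsum:
  assumes "finite S" "\<And>s. s \<in> S \<Longrightarrow> f s \<in> carrier A"
  shows "\<iota> (\<Oplus>s\<in>S. f s) = (\<Sum>s\<in>S. \<iota> (f s))"
  using assms
proof (induction S)
  case (insert s S)
  then show ?case
    by (subst finsum_insert) (auto simp: iota_add)
qed (simp add: iota_zero)

definition toT :: "('r list \<Rightarrow> 'r) \<Rightarrow> 'k laurent list \<Rightarrow> 'k laurent"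
  where "toT f bs = \<iota> (f (map inv\<iota> bs))"

definition fromT :: "nat \<Rightarrow> ('k laurent list \<Rightarrow> 'k laurent) \<Rightarrow> 'r list \<Rightarrow> 'r"
  where "fromT p h as = (if as \<in> tuples A p then inv\<iota> (h (map \<iota> as)) else \<zero>)"

lemma map_tuples: "as \<in> tuples A p \<Longrightarrow> map \<iota> as \<in> Ls n p" "bs \<in> Ls n p \<Longrightarrow> map inv\<iota> bs \<in> tuples A p"
  by (auto simp: tuples_def Ls_def)

lemma map_inv: "as \<in> tuples A p \<Longrightarrow> map inv\<iota> (map \<iota> as) = as" "bs \<in> Ls n p \<Longrightarrow> map \<iota> (map inv\<iota> bs) = bs"
  by (auto simp: tuples_def Ls_def intro!: map_idI)

lemma toT_map: "as \<in> tuples A p \<Longrightarrow> toT f (map \<iota> as) = \<iota> (f as)"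
  by (simp add: toT_def map_inv(1) del: map_map)

lemma ball_tuples: "(\<forall>as\<in>tuples A p. P as) \<longleftrightarrow> (\<forall>bs\<in>Ls n p. P (map inv\<iota> bs))"
  using map_tuples map_inv by metis

lemma ball_carrier: "(\<forall>u\<in>carrier A. P u) \<longleftrightarrow> (\<forall>b\<in>sing n. P (inv\<iota> b))"
  by (metis inv_closed inv_iota iota_sing)

lemma inv_add: "u \<in> sing n \<Longrightarrow> v \<in> sing n \<Longrightarrow> inv\<iota> u \<oplus> inv\<iota> v = inv\<iota> (u + v)"
  and inv_smult: "u \<in> sing n \<Longrightarrow> c \<odot> inv\<iota> u = inv\<iota> (scale c u)"
  and inv_mult: "u \<in> sing n \<Longrightarrow> v \<in> sing n \<Longrightarrow> inv\<iota> u \<otimes> inv\<iota> v = inv\<iota> (u * v)"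
  by (auto intro!: iota_inj simp: add_closed smult_closed mult_closed iota_add iota_smult iota_mult
      sing_add sing_scale sing_mult)

lemma Ls_update: "bs \<in> Ls n p \<Longrightarrow> u \<in> sing n \<Longrightarrow> bs[q := u] \<in> Ls n p"
  by (auto simp: Ls_def dest: set_update_subset_insert[THEN subsetD])

lemma cochains_iff:
  assumes I: "I \<subseteq> carrier A"
  shows "f \<in> cochains A Gr I p j \<longleftrightarrow>
    (\<forall>as\<in>tuples A (Suc p). f as \<in> carrier A) \<and> (\<forall>as. as \<notin> tuples A (Suc p) \<longrightarrow> f as = \<zero>) \<and>
    coch n (\<iota> ` I) (Suc p) j (toT f)"
proof (cases "\<forall>as\<in>tuples A (Suc p). f as \<in> carrier A")
  case c: True
  let ?T = "tuples A (Suc p)" and ?L = "Ls n (Suc p)"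
  have c': "f (map inv\<iota> bs) \<in> carrier A" if "bs \<in> ?L" for bs
    using c map_tuples(2)[OF that] by blast
  have eq: "f (map inv\<iota> bs) = f (map inv\<iota> bs') \<oplus> f (map inv\<iota> bs'') \<longleftrightarrow> toT f bs = toT f bs' + toT f bs''"
    if "bs \<in> ?L" "bs' \<in> ?L" "bs'' \<in> ?L" for bs bs' bs''
    unfolding iota_eq_iff[OF c'[OF that(1)] add_closed[OF c'[OF that(2)] c'[OF that(3)]]]
    by (simp add: toT_def iota_add c' that)
  have eqs: "f (map inv\<iota> bs) = a \<odot> f (map inv\<iota> bs') \<longleftrightarrow> toT f bs = scale a (toT f bs')"
    if "bs \<in> ?L" "bs' \<in> ?L" for bs bs' a
    unfolding iota_eq_iff[OF c'[OF that(1)] smult_closed[OF c'[OF that(2)]]]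
    by (simp add: toT_def iota_smult c' that)
  have eq0: "f (map inv\<iota> bs) = \<zero> \<longleftrightarrow> toT f bs = 0" if "bs \<in> ?L" for bs
    unfolding iota_eq_iff[OF c'[OF that] zero_closed] by (simp add: toT_def iota_zero)
  have 1: "(\<forall>as\<in>?T. \<forall>q\<le>p. \<forall>u\<in>carrier A. \<forall>v\<in>carrier A. f (as[q := u \<oplus> v]) = f (as[q := u]) \<oplus> f (as[q := v]))
     \<longleftrightarrow> (\<forall>bs\<in>?L. \<forall>q\<le>p. \<forall>u\<in>sing n. \<forall>v\<in>sing n. toT f (bs[q := u + v]) = toT f (bs[q := u]) + toT f (bs[q := v]))"
    unfolding ball_tuples ball_carrier
    by (intro ball_cong all_cong refl imp_cong) (simp add: inv_add eq Ls_update sing_add flip: map_update)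
  have 2: "(\<forall>as\<in>?T. \<forall>q\<le>p. \<forall>u\<in>carrier A. \<forall>c. f (as[q := c \<odot> u]) = c \<odot> f (as[q := u]))
     \<longleftrightarrow> (\<forall>bs\<in>?L. \<forall>q\<le>p. \<forall>u\<in>sing n. \<forall>c. toT f (bs[q := scale c u]) = scale c (toT f (bs[q := u])))"
    unfolding ball_tuples ball_carrier
    by (intro ball_cong all_cong refl imp_cong) (simp add: inv_smult eqs Ls_update sing_scale flip: map_update)
  have 3: "(\<forall>as\<in>?T. last as \<in> I \<longrightarrow> f as = \<zero>) \<longleftrightarrow> (\<forall>bs\<in>?L. last bs \<in> \<iota> ` I \<longrightarrow> toT f bs = 0)"
  proof -
    have "last (map inv\<iota> bs) \<in> I \<longleftrightarrow> last bs \<in> \<iota> ` I" if "bs \<in> ?L" for bs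
    proof -
      have "last bs \<in> sing n" "bs \<noteq> []"
        using that by (auto simp: Ls_def intro!: subsetD[OF _ last_in_set])
      moreover have "inv\<iota> b \<in> I \<longleftrightarrow> b \<in> \<iota> ` I" if "b \<in> sing n" for b
      proof
        assume "inv\<iota> b \<in> I"
        then show "b \<in> \<iota> ` I" by (rule image_eqI[rotated]) (simp add: that)
      next
        assume "b \<in> \<iota> ` I"
        then show "inv\<iota> b \<in> I" using I by auto
      qed
      ultimately show ?thesis
        by (simp add: last_map)
    qed
    then show ?thesis
      unfolding ball_tuples using eq0 by blast
  qed
  have 4: "(\<forall>as\<in>?T. \<forall>es. list_all2 (\<lambda>r e. r \<in> Gr e) as es \<longrightarrow> f as \<in> Gr (sum_list es + j)) \<longleftrightarrow> grd n (Suc p) j (toT f)"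
  proof -
    have "list_all2 (\<lambda>r e. r \<in> Gr e) (map inv\<iota> bs) es \<longleftrightarrow> list_all2 (\<lambda>r e. r \<in> homog e) bs es" if "bs \<in> ?L" for bs es
    proof -
      have "bs ! i \<in> sing n" if "i < length bs" for i
        using nth_mem[OF that] \<open>bs \<in> ?L\<close> by (auto simp: Ls_def)
      then show ?thesis
        unfolding list_all2_map1 list_all2_conv_all_nth by (auto simp: grading)
    qed
    then show ?thesis
      unfolding grd_iff ball_tuples using c' by (simp add: grading toT_def)
  qed
  have 5: "\<forall>bs\<in>?L. toT f bs \<in> sing n"
    using c' by (simp add: toT_def)
  have I': "\<iota> ` I \<subseteq> sing n"
    using I by auto
  show ?thesis
    unfolding cochains_def mem_Collect_eq coch_def 1 2 3 4 mlin_iff[OF I'] using c 5 by blast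
next
  case False
  then show ?thesis by (auto simp: cochains_def)
qed

lemma iota_bar_diff:
  assumes f: "\<And>as. as \<in> tuples A (Suc p) \<Longrightarrow> f as \<in> carrier A" and as: "as \<in> tuples A (p + 2)"
  shows "bar_diff A p f as \<in> carrier A" "\<iota> (bar_diff A p f as) = bardiff (toT f) (map \<iota> as)"
proof -
  define g where "g q = (-1) ^ Suc q \<odot> f (take q as @ [as ! q \<otimes> as ! Suc q] @ drop (q + 2) as)" for q
  have len: "length as = p + 2" and car: "set as \<subseteq> carrier A"
    using as by (auto simp: tuples_def)
  have m: "take q as @ [as ! q \<otimes> as ! Suc q] @ drop (q + 2) as \<in> tuples A (Suc p)" if "q \<le> p" for q
  proof -
    have "as ! q \<in> carrier A" "as ! Suc q \<in> carrier A"
      using that len by (auto intro: subsetD[OF car nth_mem])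
    then show ?thesis
      using that len car by (auto simp: tuples_def mult_closed dest: in_set_takeD in_set_dropD)
  qed
  have hd: "hd as \<in> carrier A" and tl: "tl as \<in> tuples A (Suc p)"
    using len car by (cases as; auto simp: tuples_def)+
  have g: "g q \<in> carrier A" if "q \<le> p" for q
    unfolding g_def by (rule smult_closed[OF f[OF m[OF that]]])
  have "\<iota> (g q) = scale ((-1) ^ Suc q) (toT f (take q (map \<iota> as) @ [map \<iota> as ! q * map \<iota> as ! Suc q] @ drop (q + 2) (map \<iota> as)))"
    if "q \<le> p" for q
  proof -
    have "as ! q \<in> carrier A" "as ! Suc q \<in> carrier A"
      using that len by (auto intro: subsetD[OF car nth_mem])
    then have "map \<iota> (take q as @ [as ! q \<otimes> as ! Suc q] @ drop (q + 2) as)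
      = take q (map \<iota> as) @ [map \<iota> as ! q * map \<iota> as ! Suc q] @ drop (q + 2) (map \<iota> as)"
      using that len by (simp add: take_map drop_map iota_mult)
    then show ?thesis
      using toT_map[OF m[OF that], of f] iota_smult[OF f[OF m[OF that]]] by (simp add: g_def)
  qed
  then have "(\<Sum>q\<in>{0..p}. \<iota> (g q)) = - bd (toT f) (map \<iota> as)"
    using bd_alternating_sum[of "map \<iota> as" p "toT f"] len by simp
  moreover have S: "(\<Oplus>q\<in>{0..p}. g q) \<in> carrier A"
    by (rule finsum_closed) (use g in auto)
  moreover have "\<iota> (\<Oplus>q\<in>{0..p}. g q) = (\<Sum>q\<in>{0..p}. \<iota> (g q))"
    by (rule iota_finsum) (use g in auto)
  moreover have "bar_diff A p f as = (hd as \<otimes> f (tl as)) \<oplus> (\<Oplus>q\<in>{0..p}. g q)"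
    using as by (simp add: bar_diff_def g_def)
  moreover have "toT f (tl (map \<iota> as)) = \<iota> (f (tl as))"
    using toT_map[OF tl] by (simp add: map_tl)
  moreover have "hd (map \<iota> as) = \<iota> (hd as)"
    using len by (cases as) auto
  ultimately show "bar_diff A p f as \<in> carrier A" "\<iota> (bar_diff A p f as) = bardiff (toT f) (map \<iota> as)"
    using hd f[OF tl] by (simp_all add: bardiff_def add_closed mult_closed iota_add iota_mult)
qed

lemma cocycles_iff:
  assumes I: "I \<subseteq> carrier A"
  shows "f \<in> cocycles A Gr I p j \<longleftrightarrow> f \<in> cochains A Gr I p j \<and> (\<forall>bs\<in>Ls n (p + 2). bardiff (toT f) bs = 0)"
proof (cases "f \<in> cochains A Gr I p j")
  case True
  then have f: "\<And>as. as \<in> tuples A (Suc p) \<Longrightarrow> f as \<in> carrier A"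
    by (simp add: cochains_def)
  have "bar_diff A p f = (\<lambda>as. \<zero>) \<longleftrightarrow> (\<forall>as\<in>tuples A (p + 2). bar_diff A p f as = \<zero>)"
    by (auto simp: fun_eq_iff bar_diff_def)
  also have "\<dots> \<longleftrightarrow> (\<forall>as\<in>tuples A (p + 2). bardiff (toT f) (map \<iota> as) = 0)"
  proof (rule ball_cong[OF refl])
    fix as assume "as \<in> tuples A (p + 2)"
    note 1 = iota_bar_diff[of p f, OF f this]
    show "bar_diff A p f as = \<zero> \<longleftrightarrow> bardiff (toT f) (map \<iota> as) = 0"
      using iota_eq_iff[OF 1(1) zero_closed] by (simp add: 1(2) iota_zero)
  qed
  also have "\<dots> \<longleftrightarrow> (\<forall>bs\<in>Ls n (p + 2). bardiff (toT f) bs = 0)"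
    unfolding ball_tuples by (rule ball_cong[OF refl]) (simp add: map_inv(2) del: map_map)
  finally show ?thesis
    using True by (simp add: cocycles_def)
qed (simp add: cocycles_def)

lemma bardiff_cong:
  assumes "\<And>bs. bs \<in> Ls n (Suc p) \<Longrightarrow> g bs = h bs" "bs \<in> Ls n (p + 2)"
  shows "bardiff g bs = bardiff h (bs :: 'k laurent list)"
proof -
  have "bs \<in> Ls n (Suc (Suc p))" using assms(2) by simp
  then obtain a r where "bs = a # r" "r \<in> Ls n (Suc p)" by (rule Ls_SucE)
  then show ?thesis
    using assms(1) bd_cong[of n "Suc p" g h bs] assms by (simp add: bardiff_def)
qed

lemma coboundaries_iff:
  assumes I: "I \<subseteq> carrier A" and f: "\<And>as. as \<in> tuples A (p + 2) \<Longrightarrow> f as \<in> carrier A"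
    "\<And>as. as \<notin> tuples A (p + 2) \<Longrightarrow> f as = \<zero>"
  shows "f \<in> coboundaries A Gr I (Suc p) j \<longleftrightarrow>
    (\<exists>h. coch n (\<iota> ` I) (Suc p) j h \<and> (\<forall>bs\<in>Ls n (p + 2). bardiff h bs = toT f bs))"
proof
  assume "f \<in> coboundaries A Gr I (Suc p) j"
  then obtain g where g: "g \<in> cochains A Gr I p j" "f = bar_diff A p g"
    by (auto simp: coboundaries_def)
  have gc: "\<And>as. as \<in> tuples A (Suc p) \<Longrightarrow> g as \<in> carrier A"
    using g by (simp add: cochains_def)
  have "bardiff (toT g) bs = toT f bs" if "bs \<in> Ls n (p + 2)" for bs
    using iota_bar_diff(2)[of p g, OF gc map_tuples(2)[OF that]] map_inv(2)[OF that] by (simp add: g(2) toT_def del: map_map)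
  then show "\<exists>h. coch n (\<iota> ` I) (Suc p) j h \<and> (\<forall>bs\<in>Ls n (p + 2). bardiff h bs = toT f bs)"
    using g(1) by (auto simp: cochains_iff[OF I])
next
  assume "\<exists>h. coch n (\<iota> ` I) (Suc p) j h \<and> (\<forall>bs\<in>Ls n (p + 2). bardiff h bs = toT f bs)"
  then obtain h where h: "coch n (\<iota> ` I) (Suc p) j h" "\<forall>bs\<in>Ls n (p + 2). bardiff h bs = toT f bs"
    by blast
  have mh: "mlin n (\<iota> ` I) (Suc p) h" using h(1) by (simp only: coch_def)
  define g where "g = fromT (Suc p) h"
  have gc: "g as \<in> carrier A" if "as \<in> tuples A (Suc p)" for as
    using that mlin_value[OF mh map_tuples(1)[OF that]] by (simp add: g_def fromT_def)
  have gh: "toT g bs = h bs" if "bs \<in> Ls n (Suc p)" for bs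
    using mlin_value[OF mh that] map_tuples(2)[OF that] map_inv(2)[OF that]
    by (simp add: toT_def g_def fromT_def del: map_map)
  have "coch n (\<iota> ` I) (Suc p) j (toT g)"
  proof -
    have "\<iota> ` I \<subseteq> sing n" using I by auto
    from coch_cong[of n "Suc p" "toT g" h "\<iota> ` I" j, OF gh this] h(1) show ?thesis by simp
  qed
  then have "g \<in> cochains A Gr I p j"
    using gc by (simp add: cochains_iff[OF I]) (simp add: g_def fromT_def)
  moreover have "bar_diff A p g as = f as" for as
  proof (cases "as \<in> tuples A (p + 2)")
    case True
    have "\<iota> (bar_diff A p g as) = bardiff h (map \<iota> as)"
      using iota_bar_diff(2)[of p g, OF gc True] bardiff_cong[OF gh map_tuples(1)[OF True]] by simp
    also have "\<dots> = \<iota> (f as)"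
      using h(2) map_tuples(1)[OF True] toT_map[OF True] by simp
    finally have eq: "\<iota> (bar_diff A p g as) = \<iota> (f as)" .
    have "bar_diff A p g as \<in> carrier A"
      using iota_bar_diff(1)[of p g, OF gc True] .
    from iota_inj[OF this f(1)[OF True] eq] show ?thesis .
  qed (simp add: f(2) bar_diff_def)
  then have "bar_diff A p g = f"
    by (intro ext)
  ultimately show "f \<in> coboundaries A Gr I (Suc p) j"
    by (auto simp: coboundaries_def)
qed

lemma graded_ideal:
  assumes "graded_left_ideal A Gr I"
  shows "I \<subseteq> carrier A" "\<iota> ` I \<subseteq> sing n" "\<And>a u. a \<in> sing n \<Longrightarrow> u \<in> \<iota> ` I \<Longrightarrow> a * u \<in> \<iota> ` I"
proof -
  show I: "I \<subseteq> carrier A"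
    using assms additive_subgroup.a_subset by (auto simp: graded_left_ideal_def)
  then show "\<iota> ` I \<subseteq> sing n" by auto
  show "a * u \<in> \<iota> ` I" if au: "a \<in> sing n" "u \<in> \<iota> ` I" for a u
  proof -
    obtain v where v: "v \<in> I" "u = \<iota> v" using au(2) by blast
    have "inv\<iota> a \<otimes> v \<in> I"
      using assms v(1) au(1) by (simp add: graded_left_ideal_def)
    moreover have "\<iota> (inv\<iota> a \<otimes> v) = a * u"
      using v subsetD[OF I v(1)] au(1) by (simp add: iota_mult)
    ultimately show ?thesis by (metis imageI)
  qed
qed

text \<open>This is \<open>ext_vanishes\<close> for the graded left ideals of \<open>A\<close>.\<close>

lemma inj_dim_le_2: "inj_dim_le A Gr 2"
  unfolding inj_dim_le_def
proof (intro allI impI subsetI)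
  fix I p j f
  assume "graded_left_ideal A Gr I \<and> 2 < p" and f: "f \<in> cocycles A Gr I p j"
  then have gI: "graded_left_ideal A Gr I" and "2 < p" by auto
  note I = graded_ideal[OF gI]
  from \<open>2 < p\<close> obtain m where p: "p = Suc (Suc (Suc m))"
    by (auto dest!: less_imp_Suc_add)
  have f': "coch n (\<iota> ` I) (Suc p) j (toT f)" "\<And>bs. bs \<in> Ls n (p + 2) \<Longrightarrow> bardiff (toT f) bs = 0"
    using f by (auto simp: cocycles_iff[OF I(1)] cochains_iff[OF I(1)])
  have "\<exists>h. coch n (\<iota> ` I) (Suc (Suc (Suc m))) j h \<and> (\<forall>as\<in>Ls n (Suc (Suc (Suc (Suc m)))). bardiff h as = toT f as)"
    by (rule ext_vanishes[OF n I(2,3)]) (use f' in \<open>simp_all add: p\<close>)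
  then show "f \<in> coboundaries A Gr I p j"
    using f unfolding p by (subst coboundaries_iff[OF I(1)]) (auto simp: cocycles_def cochains_def p)
qed

lemma trunc_carrier: "trunc A Gr k \<subseteq> carrier A"
proof
  fix u assume "u \<in> trunc A Gr k"
  then have "u \<in> generate (add_monoid A) (\<Union>i\<in>{int k..}. Gr i)" by (simp add: trunc_def)
  then show "u \<in> carrier A"
    using group.generate_in_carrier[OF a_group, of "\<Union>i\<in>{int k..}. Gr i" u] by (auto simp: grading)
qed

lemma iota_trunc: "\<iota> ` trunc A Gr k = tr n k"
proof -
  let ?H = "\<Union>i\<in>{int k..}. Gr i"
  have H: "?H \<subseteq> carrier A" by (auto simp: grading)
  have fwd: "\<iota> u \<in> tr n k" if "u \<in> generate (add_monoid A) ?H" for u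
    using that
  proof (induction rule: generate.induct)
    case one
    then show ?case by (simp add: iota_zero tr_def)
  next
    case (incl h)
    then show ?case by (auto simp: grading tr_def homog_def)
  next
    case (inv h)
    then have h: "h \<in> carrier A" and "\<iota> h \<in> tr n k"
      using H by (auto simp: grading tr_def homog_def)
    have "(\<ominus> h) \<oplus> h = \<zero>" using h by (rule l_neg)
    then have "\<iota> (\<ominus> h) = - \<iota> h"
      using iota_add[of "\<ominus> h" h] h iota_zero by (simp add: eq_neg_iff_add_eq_0)
    then show ?case
      using \<open>\<iota> h \<in> tr n k\<close> by (simp add: a_inv_def tr_def sing_uminus)
  next
    case (eng h1 h2)
    then have "h1 \<in> carrier A" "h2 \<in> carrier A"
      using group.generate_in_carrier[OF a_group, of ?H] H by simp_all
    moreover have "f + g \<in> tr n k" if "f \<in> tr n k" "g \<in> tr n k" for f g :: "'k laurent"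
    proof -
      have "lcoeff f (p, q) \<noteq> 0 \<or> lcoeff g (p, q) \<noteq> 0" if "lcoeff (f + g) (p, q) \<noteq> 0" for p q
        using that by (auto simp: lookup_add)
      then show ?thesis
        using that sing_add[of f n g] unfolding tr_def by blast
    qed
    ultimately show ?case
      using eng by (simp add: iota_add)
  qed
  have bwd: "inv\<iota> b \<in> generate (add_monoid A) ?H" if b: "b \<in> tr n k" for b
  proof -
    have nz: "l \<in> cone n" "int k \<le> fst l + snd l" if "l \<in> Poly_Mapping.keys b" for l
    proof -
      have nz: "lcoeff b l \<noteq> 0" using that by (simp add: in_keys_iff)
      have bs: "b \<in> sing n" and bk: "\<forall>p q. lcoeff b (p, q) \<noteq> 0 \<longrightarrow> int k \<le> p + q"
        using b by (simp_all add: tr_def)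
      show "l \<in> cone n"
        by (rule singD[OF bs nz])
      show "int k \<le> fst l + snd l"
        using bk[rule_format, of "fst l" "snd l"] nz by simp
    qed
    have "inv\<iota> (\<Sum>l\<in>K. lterm l (lcoeff b l)) \<in> generate (add_monoid A) ?H"
      if "finite K" "K \<subseteq> Poly_Mapping.keys b" for K
      using that
    proof (induction K)
      case empty
      have "inv\<iota> 0 = \<zero>" using inv_iota[OF zero_closed] by (simp add: iota_zero)
      then show ?case using generate.one[of "add_monoid A"] by simp
    next
      case (insert l K)
      have l: "lterm l (lcoeff b l) \<in> sing n" using insert.prems by (intro sing_term nz(1)) auto
      have K: "(\<Sum>l\<in>K. lterm l (lcoeff b l)) \<in> sing n" using insert.prems by (intro sing_sum sing_term nz(1)) auto
      have "lterm l (lcoeff b l) \<in> homog (fst l + snd l)"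
        using homog_term[of "fst l" "snd l" "fst l + snd l" "lcoeff b l"] by simp
      then have "inv\<iota> (lterm l (lcoeff b l)) \<in> ?H"
        using l nz(2)[of l] insert by (auto simp: grading)
      then have "inv\<iota> (lterm l (lcoeff b l)) \<otimes>\<^bsub>add_monoid A\<^esub> inv\<iota> (\<Sum>l\<in>K. lterm l (lcoeff b l)) \<in> generate (add_monoid A) ?H"
        by (rule generate.eng[OF generate.incl insert.IH]) (use insert.prems in auto)
      then show ?case
        using insert.hyps by (simp add: inv_add[OF l K])
    qed
    from this[of "Poly_Mapping.keys b"] show ?thesis
      by (simp add: laurent_sum_terms)
  qed
  have sing: "b \<in> sing n" if "b \<in> tr n k" for b :: "'k laurent"
    using that by (simp add: tr_def)
  show ?thesis
    unfolding trunc_def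
  proof (intro subset_antisym subsetI)
    fix b assume "b \<in> \<iota> ` generate (add_monoid A) ?H"
    then show "b \<in> tr n k" using fwd by auto
  next
    fix b :: "'k laurent" assume "b \<in> tr n k"
    then show "b \<in> \<iota> ` generate (add_monoid A) ?H"
      by (intro image_eqI[of _ _ "inv\<iota> b"]) (simp_all add: bwd sing)
  qed
qed

lemma trunc_iff: "u \<in> trunc A Gr k \<longleftrightarrow> u \<in> carrier A \<and> \<iota> u \<in> tr n k"
proof
  assume "u \<in> trunc A Gr k"
  then show "u \<in> carrier A \<and> \<iota> u \<in> tr n k"
    using trunc_carrier iota_trunc by blast
next
  assume u: "u \<in> carrier A \<and> \<iota> u \<in> tr n k"
  then obtain v where "v \<in> trunc A Gr k" "\<iota> u = \<iota> v"
    using iota_trunc[of k] by (metis imageE)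
  then show "u \<in> trunc A Gr k"
    using iota_inj[of u v] u trunc_carrier by blast
qed

lemma trunc_graded_ideal: "graded_left_ideal A Gr (trunc A Gr k)"
  unfolding graded_left_ideal_def
proof (intro conjI ballI)
  let ?G = "add_monoid A" and ?H = "\<Union>i\<in>{int k..}. Gr i"
  have H: "?H \<subseteq> carrier ?G" by (auto simp: grading)
  have sub: "subgroup (trunc A Gr k) ?G"
    unfolding trunc_def by (rule group.generate_is_subgroup[OF a_group H])
  then show "additive_subgroup (trunc A Gr k) A"
    by (rule additive_subgroup.intro)
  show "r \<otimes> s \<in> trunc A Gr k" if "r \<in> carrier A" "s \<in> trunc A Gr k" for r s
    using that by (simp add: trunc_iff mult_closed iota_mult tr_ideal)
  show "trunc A Gr k = generate ?G (\<Union>i. trunc A Gr k \<inter> Gr i)"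
  proof
    have "?H \<subseteq> (\<Union>i. trunc A Gr k \<inter> Gr i)"
      by (auto simp: trunc_def intro: generate.incl)
    then show "trunc A Gr k \<subseteq> generate ?G (\<Union>i. trunc A Gr k \<inter> Gr i)"
      unfolding trunc_def[of A Gr k] by (rule group.mono_generate[OF a_group])
    show "generate ?G (\<Union>i. trunc A Gr k \<inter> Gr i) \<subseteq> trunc A Gr k"
      by (rule group.generate_subgroup_incl[OF a_group _ sub]) auto
  qed
qed

definition lcc :: "nat \<Rightarrow> int \<Rightarrow> ('r list \<Rightarrow> 'r) \<Rightarrow> bool"
  where "lcc k j f \<longleftrightarrow> (\<forall>as\<in>tuples A (Suc (Suc (Suc 0))). f as \<in> carrier A) \<and>
    (\<forall>as. as \<notin> tuples A (Suc (Suc (Suc 0))) \<longrightarrow> f as = \<zero>) \<and>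
    coch n (tr n k) (Suc (Suc (Suc 0))) j (toT f) \<and>
    (\<forall>bs\<in>Ls n (Suc (Suc (Suc (Suc 0)))). bardiff (toT f) bs = 0)"

lemma lc_cocycles_iff: "f \<in> lc_cocycles A Gr 2 j \<longleftrightarrow> (\<exists>k. lcc k j f)"
  by (simp add: lc_cocycles_def cocycles_iff[OF trunc_carrier] cochains_iff[OF trunc_carrier]
      iota_trunc lcc_def numeral_2_eq_2 conj_assoc)

lemma lcc_mono: "k \<le> l \<Longrightarrow> lcc k j f \<Longrightarrow> lcc l j f"
  using coch_mono[OF tr_mono] by (auto simp: lcc_def)

lemma lccI:
  assumes "\<And>as. as \<in> tuples A (Suc (Suc (Suc 0))) \<Longrightarrow> g as \<in> carrier A"
    "\<And>as. as \<notin> tuples A (Suc (Suc (Suc 0))) \<Longrightarrow> g as = \<zero>"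
    "coch n (tr n k) (Suc (Suc (Suc 0))) j F" "\<And>bs. bs \<in> Ls n (Suc (Suc (Suc 0))) \<Longrightarrow> toT g bs = F bs"
    "\<And>bs. bs \<in> Ls n (Suc (Suc (Suc (Suc 0)))) \<Longrightarrow> bardiff F bs = 0"
  shows "lcc k j g"
proof -
  have "coch n (tr n k) (Suc (Suc (Suc 0))) j (toT g)"
    using coch_cong[of n "Suc (Suc (Suc 0))" "toT g" F "tr n k" j, OF assms(4) tr_sing] assms(3) by simp
  moreover have "bardiff (toT g) bs = bardiff F bs" if "bs \<in> Ls n (Suc (Suc (Suc (Suc 0))))" for bs
    using bardiff_cong[of "Suc (Suc 0)" "toT g" F bs, OF assms(4)] that by simp
  ultimately show ?thesis
    using assms by (simp add: lcc_def)
qed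

definition th :: "('r list \<Rightarrow> 'r) \<Rightarrow> 'r \<Rightarrow> 'k"
  where "th f r = (if r \<in> carrier A then theta n (lam n (toT f)) (\<iota> r) else 0)"

lemma lam_cong:
  assumes "\<And>bs. bs \<in> Ls n (Suc (Suc (Suc 0))) \<Longrightarrow> g bs = h bs" "r \<in> sing n"
  shows "theta n (lam n g) r = theta n (lam n h) (r :: 'k laurent)"
proof -
  have "lam n g (xy n i j r) = lam n h (xy n i j r)" for i j
    using assms xy_sing[OF assms(2)] by (simp add: lam_def)
  then show ?thesis by (simp add: theta_def tcoeff_def)
qed

lemma toT_minus:
  assumes "f (map inv\<iota> bs) \<in> carrier A" "g (map inv\<iota> bs) \<in> carrier A"
  shows "toT (\<lambda>as. f as \<ominus> g as) bs = toT f bs - toT g bs"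
  using assms by (simp add: toT_def iota_minus)

text \<open>
  Two cocycles have the same class exactly if their residue functionals agree; this uses
  \<open>theta_coboundary\<close> in one direction and \<open>theta_injective\<close> in the other.
\<close>

lemma class_iff:
  assumes f: "lcc k1 j f" and g: "lcc k2 j g"
  shows "(\<exists>k. (\<lambda>as. g as \<ominus> f as) \<in> coboundaries A Gr (trunc A Gr k) 2 j) \<longleftrightarrow> th g = th f"
proof -
  define N where "N = k1 + k2"
  have fN: "lcc N j f" "lcc N j g"
    using lcc_mono[OF _ f] lcc_mono[OF _ g] by (simp_all add: N_def)
  define D where "D as = g as \<ominus> f as" for as
  define DT where "DT bs = toT g bs - toT f bs" for bs
  have D: "D as \<in> carrier A" if "as \<in> tuples A (Suc 0 + 2)" for as
    using fN that by (simp add: lcc_def D_def minus_closed)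
  have D0: "D as = \<zero>" if "as \<notin> tuples A (Suc 0 + 2)" for as
    using fN that minus_eq[of \<zero> \<zero>] zero_closed by (simp add: lcc_def D_def)
  have DT: "toT D bs = DT bs" if "bs \<in> Ls n (Suc (Suc (Suc 0)))" for bs
    unfolding D_def DT_def using fN map_tuples(2)[OF that] by (intro toT_minus) (simp_all add: lcc_def)
  have cob: "D \<in> coboundaries A Gr (trunc A Gr k) 2 j \<longleftrightarrow>
      (\<exists>h. coch n (tr n k) (Suc (Suc 0)) j h \<and> (\<forall>bs\<in>Ls n (Suc (Suc (Suc 0))). bardiff h bs = DT bs))" for k
    using coboundaries_iff[OF trunc_carrier[of k], where p = "Suc 0" and f = D and j = j, OF D D0] DT
    by (simp add: iota_trunc numeral_2_eq_2)
  have m: "mlin n (tr n N) (Suc (Suc (Suc 0))) (toT f)" "mlin n (tr n N) (Suc (Suc (Suc 0))) (toT g)"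
    using fN by (simp_all only: lcc_def coch_def)
  have diff: "theta n (lam n DT) r = theta n (lam n (toT g)) r - theta n (lam n (toT f)) r" if "r \<in> sing n" for r
    unfolding DT_def by (rule theta_add(2)[OF n that m(2,1)])
  show ?thesis
    unfolding D_def[symmetric] cob
  proof
    assume "\<exists>k h. coch n (tr n k) (Suc (Suc 0)) j h \<and> (\<forall>bs\<in>Ls n (Suc (Suc (Suc 0))). bardiff h bs = DT bs)"
    then obtain k h where h: "mlin n (tr n k) (Suc (Suc 0)) h" "\<And>bs. bs \<in> Ls n (Suc (Suc (Suc 0))) \<Longrightarrow> DT bs = bardiff h bs"
      by (auto simp only: coch_def)
    have "theta n (lam n DT) r = 0" if "r \<in> sing n" for r
      by (rule theta_coboundary[OF n that h])
    then show "th g = th f"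
      using diff by (intro ext) (simp add: th_def)
  next
    assume eq: "th g = th f"
    have 0: "theta n (lam n DT) r = 0" if "r \<in> sing n" for r
      using fun_cong[OF eq, of "inv\<iota> r"] that diff[OF that] by (simp add: th_def)
    have "coch n (tr n N) (Suc (Suc (Suc 0))) j DT"
      unfolding DT_def using fN by (intro coch_diff) (simp_all only: lcc_def)
    moreover have "bardiff DT bs = 0" if "bs \<in> Ls n (Suc (Suc (Suc (Suc 0))))" for bs
    proof -
      have "bardiff (toT f) bs = 0" "bardiff (toT g) bs = 0" using fN that by (auto simp: lcc_def)
      then show ?thesis
        by (simp add: bardiff_def DT_def[abs_def] bd_diff algebra_simps)
    qed
    ultimately have "\<exists>h. coch n (tr n N) (Suc (Suc 0)) j h \<and> (\<forall>bs\<in>Ls n (Suc (Suc (Suc 0))). bardiff h bs = DT bs)"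
      by (rule theta_injective[OF n _ _ 0])
    then show "\<exists>k h. coch n (tr n k) (Suc (Suc 0)) j h \<and> (\<forall>bs\<in>Ls n (Suc (Suc (Suc 0))). bardiff h bs = DT bs)" ..
  qed
qed

lemma lc_class_eq:
  assumes "f \<in> lc_cocycles A Gr 2 j"
  shows "lc_class A Gr 2 j f = {g \<in> lc_cocycles A Gr 2 j. th g = th f}"
proof -
  obtain k where k: "lcc k j f" using assms by (auto simp: lc_cocycles_iff)
  have "(\<exists>k. (\<lambda>as. g as \<ominus> f as) \<in> coboundaries A Gr (trunc A Gr k) 2 j) \<longleftrightarrow> th g = th f"
    if "g \<in> lc_cocycles A Gr 2 j" for g
  proof -
    obtain l where "lcc l j g" using \<open>g \<in> lc_cocycles A Gr 2 j\<close> by (auto simp: lc_cocycles_iff)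
    from class_iff[OF k this] show ?thesis .
  qed
  then show ?thesis unfolding lc_class_def by blast
qed

lemma th_dual:
  assumes "f \<in> lc_cocycles A Gr 2 j"
  shows "th f \<in> graded_dual A Gr (j + 2)"
proof -
  obtain k where "lcc k j f" using assms by (auto simp: lc_cocycles_iff)
  then have f: "coch n (tr n k) (Suc (Suc (Suc 0))) j (toT f)" by (simp only: lcc_def)
  note L = theta_linear[OF n f]
  show ?thesis
    unfolding graded_dual_def mem_Collect_eq
    by (auto simp: th_def iota_add iota_smult add_closed smult_closed L(1,2) grading intro: L(3))
qed

lemma th_surj:
  assumes \<xi>: "\<xi> \<in> graded_dual A Gr (j + 2)"
  shows "\<exists>f\<in>lc_cocycles A Gr 2 j. th f = \<xi>"
proof -
  define \<zeta> where "\<zeta> b = - \<xi> (inv\<iota> b)" for b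
  have "\<exists>F N. coch n (tr n N) (Suc (Suc (Suc 0))) (- (- (j + 2)) - 2) F \<and>
    (\<forall>as\<in>Ls n (Suc (Suc (Suc (Suc 0)))). bardiff F as = 0) \<and> (\<forall>r\<in>sing n. theta n (lam n F) r = - \<zeta> r)"
  proof (rule theta_surjective[OF n])
    show "\<zeta> (u + v) = \<zeta> u + \<zeta> v" if "u \<in> sing n" "v \<in> sing n" for u v
      using \<xi> that by (simp add: \<zeta>_def graded_dual_def flip: inv_add)
    show "\<zeta> (scale c u) = c * \<zeta> u" if "u \<in> sing n" for u c
      using \<xi> that by (simp add: \<zeta>_def graded_dual_def flip: inv_smult)
    show "\<zeta> u = 0" if "u \<in> sing n" "u \<in> homog e" "e \<noteq> - (j + 2)" for u e
    proof -
      have "inv\<iota> u \<in> Gr e" using that by (simp add: grading)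
      then have "\<xi> (inv\<iota> u) = 0" using \<xi> that(3) unfolding graded_dual_def by blast
      then show ?thesis by (simp add: \<zeta>_def)
    qed
  qed
  then obtain F N where F: "coch n (tr n N) (Suc (Suc (Suc 0))) j F"
    "\<And>as. as \<in> Ls n (Suc (Suc (Suc (Suc 0)))) \<Longrightarrow> bardiff F as = 0"
    "\<And>r. r \<in> sing n \<Longrightarrow> theta n (lam n F) r = \<xi> (inv\<iota> r)"
    by (auto simp: \<zeta>_def)
  define f where "f = fromT (Suc (Suc (Suc 0))) F"
  have mF: "mlin n (tr n N) (Suc (Suc (Suc 0))) F" using F(1) by (simp only: coch_def)
  have fc: "f as \<in> carrier A" if "as \<in> tuples A (Suc (Suc (Suc 0)))" for as
    using that mlin_value[OF mF map_tuples(1)[OF that]] by (simp add: f_def fromT_def)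
  have fF: "toT f bs = F bs" if "bs \<in> Ls n (Suc (Suc (Suc 0)))" for bs
    using mlin_value[OF mF that] map_tuples(2)[OF that] map_inv(2)[OF that]
    by (simp add: toT_def f_def fromT_def del: map_map)
  have "lcc N j f"
    by (rule lccI[OF fc _ F(1) fF F(2)]) (simp_all add: f_def fromT_def)
  then have "f \<in> lc_cocycles A Gr 2 j"
    by (auto simp: lc_cocycles_iff)
  moreover have "th f = \<xi>"
  proof
    fix r
    show "th f r = \<xi> r"
    proof (cases "r \<in> carrier A")
      case True
      have "theta n (lam n (toT f)) (\<iota> r) = theta n (lam n F) (\<iota> r)"
        by (rule lam_cong[OF fF iota_sing[OF True]])
      then show ?thesis
        using F(3)[OF iota_sing[OF True]] True by (simp add: th_def)
    next
      case False
      then show ?thesis using \<xi> by (simp add: th_def graded_dual_def)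
    qed
  qed
  ultimately show ?thesis by blast
qed

lemma th_add:
  assumes "f \<in> lc_cocycles A Gr 2 j" "g \<in> lc_cocycles A Gr 2 j"
  shows "(\<lambda>as. f as \<oplus> g as) \<in> lc_cocycles A Gr 2 j" "th (\<lambda>as. f as \<oplus> g as) = (\<lambda>r. th f r + th g r)"
proof -
  obtain k1 k2 where k: "lcc k1 j f" "lcc k2 j g" using assms by (auto simp: lc_cocycles_iff)
  then have f: "lcc (k1 + k2) j f" "lcc (k1 + k2) j g"
    using lcc_mono[of k1 "k1 + k2"] lcc_mono[of k2 "k1 + k2"] by simp_all
  have eq: "toT (\<lambda>as. f as \<oplus> g as) bs = toT f bs + toT g bs" if "bs \<in> Ls n (Suc (Suc (Suc 0)))" for bs
    using f map_tuples(2)[OF that] by (simp add: lcc_def toT_def iota_add)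
  have "bardiff (\<lambda>bs. toT f bs + toT g bs) bs = 0" if "bs \<in> Ls n (Suc (Suc (Suc (Suc 0))))" for bs
  proof -
    have "bardiff (toT f) bs = 0" "bardiff (toT g) bs = 0" using f that by (auto simp: lcc_def)
    then show ?thesis by (simp add: bardiff_def bd_add algebra_simps)
  qed
  moreover have "coch n (tr n (k1 + k2)) (Suc (Suc (Suc 0))) j (\<lambda>bs. toT f bs + toT g bs)"
    by (rule coch_add) (use f in \<open>simp_all only: lcc_def\<close>)
  moreover have "f as \<oplus> g as \<in> carrier A" if "as \<in> tuples A (Suc (Suc (Suc 0)))" for as
    using f that by (simp add: lcc_def add_closed)
  moreover have "f as \<oplus> g as = \<zero>" if "as \<notin> tuples A (Suc (Suc (Suc 0)))" for as
    using f that by (simp add: lcc_def)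
  ultimately have "lcc (k1 + k2) j (\<lambda>as. f as \<oplus> g as)"
    using eq by (intro lccI[where F = "\<lambda>bs. toT f bs + toT g bs"])
  then show "(\<lambda>as. f as \<oplus> g as) \<in> lc_cocycles A Gr 2 j" by (auto simp: lc_cocycles_iff)
  have m: "mlin n (tr n (k1 + k2)) (Suc (Suc (Suc 0))) (toT f)" "mlin n (tr n (k1 + k2)) (Suc (Suc (Suc 0))) (toT g)"
    using f by (simp_all only: lcc_def coch_def)
  show "th (\<lambda>as. f as \<oplus> g as) = (\<lambda>r. th f r + th g r)"
  proof
    fix r
    have "theta n (lam n (toT (\<lambda>as. f as \<oplus> g as))) (\<iota> r) = theta n (lam n (\<lambda>bs. toT f bs + toT g bs)) (\<iota> r)"
      if "r \<in> carrier A"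
      by (rule lam_cong[OF eq iota_sing[OF that]])
    then show "th (\<lambda>as. f as \<oplus> g as) r = th f r + th g r"
      using theta_add(1)[OF n iota_sing m, of r] by (simp add: th_def)
  qed
qed

lemma th_module:
  assumes "f \<in> lc_cocycles A Gr 2 j" "b \<in> Gr e"
  shows "(\<lambda>as. f as \<otimes> b) \<in> lc_cocycles A Gr 2 (j + e)"
    "th (\<lambda>as. f as \<otimes> b) = (\<lambda>r. if r \<in> carrier A then th f (b \<otimes> r) else 0)"
proof -
  obtain k where f: "lcc k j f" using assms by (auto simp: lc_cocycles_iff)
  have b: "b \<in> carrier A" "\<iota> b \<in> homog e" using assms(2) by (simp_all add: grading)
  have cf: "coch n (tr n k) (Suc (Suc (Suc 0))) j (toT f)" and co: "\<And>bs. bs \<in> Ls n (Suc (Suc (Suc (Suc 0)))) \<Longrightarrow> bardiff (toT f) bs = 0"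
    using f by (auto simp only: lcc_def)
  have mf: "mlin n (tr n k) (Suc (Suc (Suc 0))) (toT f)" using cf by (simp only: coch_def)
  have eq: "toT (\<lambda>as. f as \<otimes> b) bs = toT f bs * \<iota> b" if "bs \<in> Ls n (Suc (Suc (Suc 0)))" for bs
    using f b map_tuples(2)[OF that] by (simp add: lcc_def toT_def iota_mult)
  have c: "coch n (tr n k) (Suc (Suc (Suc 0))) (j + e) (\<lambda>bs. toT f bs * \<iota> b)"
  proof (rule coch_post[OF cf])
    show "linear_op (\<lambda>u. u * \<iota> b)" by (simp add: linear_op_def algebra_simps)
  qed (auto simp: b sing_mult homog_mult)
  have "\<iota> (\<zero> \<otimes> b) = \<iota> \<zero>"
    using b zero_closed by (simp add: iota_mult iota_zero)
  then have z: "\<zero> \<otimes> b = \<zero>"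
    using b zero_closed mult_closed iota_inj by blast
  have "bardiff (\<lambda>bs. toT f bs * \<iota> b) bs = bardiff (toT f) bs * \<iota> b" for bs
    by (simp add: bardiff_def left_diff_distrib mult.assoc bd_additive[of "\<lambda>u. u * \<iota> b"])
  then have "lcc k (j + e) (\<lambda>as. f as \<otimes> b)"
    using f b z co by (intro lccI[OF _ _ c eq]) (simp_all add: lcc_def mult_closed)
  then show "(\<lambda>as. f as \<otimes> b) \<in> lc_cocycles A Gr 2 (j + e)" by (auto simp: lc_cocycles_iff)
  show "th (\<lambda>as. f as \<otimes> b) = (\<lambda>r. if r \<in> carrier A then th f (b \<otimes> r) else 0)"
  proof
    fix r
    have "theta n (lam n (toT (\<lambda>as. f as \<otimes> b))) (\<iota> r) = theta n (lam n (\<lambda>bs. toT f bs * \<iota> b)) (\<iota> r)"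
      if "r \<in> carrier A"
      by (rule lam_cong[OF eq iota_sing[OF that]])
    then show "th (\<lambda>as. f as \<otimes> b) r = (if r \<in> carrier A then th f (b \<otimes> r) else 0)"
      using theta_module[OF n iota_sing mf co iota_sing[OF b(1)], of r] b
      by (simp add: th_def iota_mult mult_closed)
  qed
qed

definition lc_iso :: "int \<Rightarrow> ('r list \<Rightarrow> 'r) set \<Rightarrow> 'r \<Rightarrow> 'k"
  where "lc_iso j C = th (SOME f. f \<in> C)"

lemma lc_iso_class:
  assumes "f \<in> lc_cocycles A Gr 2 j"
  shows "lc_iso j (lc_class A Gr 2 j f) = th f"
proof -
  have "f \<in> lc_class A Gr 2 j f" using assms by (simp add: lc_class_eq)
  then have "(SOME g. g \<in> lc_class A Gr 2 j f) \<in> lc_class A Gr 2 j f"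
    using someI[of "\<lambda>g. g \<in> lc_class A Gr 2 j f" f] by simp
  then show ?thesis using assms by (simp add: lc_iso_def lc_class_eq)
qed

text \<open>The residue pairing identifies the second local cohomology with the graded dual shifted by two.\<close>

theorem lc_dual: "lc_dual_iso A Gr 2 2 lc_iso"
  unfolding lc_dual_iso_def
proof (intro conjI allI ballI)
  fix j
  show "bij_betw (lc_iso j) (local_cohomology A Gr 2 j) (graded_dual A Gr (j + 2))"
    unfolding bij_betw_def
  proof
    show "inj_on (lc_iso j) (local_cohomology A Gr 2 j)"
      by (auto simp: inj_on_def local_cohomology_def lc_iso_class) (auto simp: lc_class_eq)
    have "lc_iso j ` local_cohomology A Gr 2 j = th ` lc_cocycles A Gr 2 j"
      by (auto simp: local_cohomology_def image_image lc_iso_class)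
    also have "\<dots> = graded_dual A Gr (j + 2)"
      using th_dual th_surj by (fastforce simp: image_iff)
    finally show "lc_iso j ` local_cohomology A Gr 2 j = graded_dual A Gr (j + 2)" .
  qed
qed (simp_all add: lc_iso_class th_add th_module cong: if_cong)

lemma coch_precompose:
  fixes f :: "'k laurent list \<Rightarrow> 'k laurent"
  assumes f: "coch n I m j f" and H: "linear_op H" "\<And>u. u \<in> sing n \<Longrightarrow> H u \<in> sing n"
    "\<And>u d. u \<in> homog d \<Longrightarrow> H u \<in> homog d" "\<And>u. u \<in> I \<Longrightarrow> H u \<in> I"
  shows "coch n I m j (\<lambda>bs. f (map H bs))"
proof -
  have Ls: "map H r \<in> Ls n m" if "r \<in> Ls n m" for r m
    using that H(2) by (auto simp: Ls_def)
  have "mlin n I m f \<Longrightarrow> mlin n I m (\<lambda>bs. f (map H bs))"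
  proof (induction m arbitrary: f)
    case (Suc m)
    have "mlin n I m (\<lambda>bs. f (H a # map H bs))" if "a \<in> sing n" "m \<noteq> 0" for a
      using Suc.prems that H(2)[OF that(1)] by (intro Suc.IH[of "\<lambda>l. f (H a # l)"]) simp
    then show ?case
      using Suc.prems by (auto simp: Ls linear_opD[OF H(1)] H(2,4))
  qed simp
  moreover have "grd n m j f \<Longrightarrow> grd n m j (\<lambda>bs. f (map H bs))"
  proof (induction m arbitrary: f j)
    case (Suc m)
    have "grd n m (j + e) (\<lambda>bs. f (H a # map H bs))" if "a \<in> sing n" "a \<in> homog e" for a e
      using Suc.prems H(2)[OF that(1)] H(3)[OF that(2)] by (intro Suc.IH[of _ "\<lambda>l. f (H a # l)"]) simp
    then show ?case by simp
  qed simp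
  ultimately show ?thesis using f by (simp add: coch_def)
qed

lemma bd_precompose:
  fixes f :: "'k laurent list \<Rightarrow> 'k laurent"
  assumes H: "\<And>u v. u \<in> sing n \<Longrightarrow> v \<in> sing n \<Longrightarrow> H (u * v) = H u * H v"
  shows "set bs \<subseteq> sing n \<Longrightarrow> bd (\<lambda>l. f (map H l)) bs = bd f (map H bs)"
proof (induction "length bs" arbitrary: bs f)
  case (Suc m)
  show ?case
  proof (cases "(f, bs)" rule: bd.cases)
    case (1 G a b r)
    have "bd (\<lambda>l. f (H a # map H l)) (b # r) = bd (\<lambda>l. f (H a # l)) (map H (b # r))"
      using Suc 1 by (intro Suc.hyps(1)[of "b # r" "\<lambda>l. f (H a # l)"]) auto
    then show ?thesis
      using 1 Suc.prems by (simp add: H)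
  qed auto
qed simp

context
  fixes g s \<chi>
  assumes g: "bij_betw g (carrier A) (carrier A)"
    and \<chi>: "monchar n \<chi>" and sgn: "\<chi> (1, 1) = (if s then - 1 else 1)"
    and iota_g: "\<And>u. u \<in> carrier A \<Longrightarrow> \<iota> (g u) = twist s \<chi> (\<iota> u)"
begin

abbreviation (input) ginv where "ginv \<equiv> inv_into (carrier A) g"
abbreviation (input) tinv where "tinv \<equiv> twist s (\<lambda>k. inverse (\<chi> (kap s k)))"

lemma ginv: "u \<in> carrier A \<Longrightarrow> ginv u \<in> carrier A" "u \<in> carrier A \<Longrightarrow> g (ginv u) = u"
  using g by (auto simp: bij_betw_def inv_into_into f_inv_into_f)

lemma iota_ginv: "u \<in> carrier A \<Longrightarrow> \<iota> (ginv u) = tinv (\<iota> u)"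
proof -
  assume u: "u \<in> carrier A"
  have "tinv (twist s \<chi> (\<iota> (ginv u))) = \<iota> (ginv u)"
    by (rule twist_inverse(2)[OF \<chi> iota_sing[OF ginv(1)[OF u]]])
  then show ?thesis
    by (simp only: iota_g[OF ginv(1)[OF u], symmetric] ginv(2)[OF u])
qed

lemma twist_tr: "b \<in> tr n k \<Longrightarrow> twist s' \<psi> b \<in> tr n k" for s' \<psi> and b :: "'k laurent"
proof -
  assume b: "b \<in> tr n k"
  have "int k \<le> p + q" if "lcoeff (twist s' \<psi> b) (p, q) \<noteq> 0" for p q
  proof -
    have "lcoeff b (fst (kap s' (p, q)), snd (kap s' (p, q))) \<noteq> 0"
      using that by (simp add: lcoeff_twist)
    then have "int k \<le> fst (kap s' (p, q)) + snd (kap s' (p, q))"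
      using b unfolding tr_def by blast
    then show ?thesis by (simp add: kap_def split: if_splits)
  qed
  then show ?thesis
    using b twist_sing[of b n s' \<psi>] by (simp add: tr_def)
qed

lemma th_act:
  assumes "f \<in> lc_cocycles A Gr 2 j"
  shows "cochain_act A 2 g f \<in> lc_cocycles A Gr 2 j"
    "th (cochain_act A 2 g f) = (\<lambda>r. if r \<in> carrier A then th f (ginv r) else 0)"
proof -
  obtain k where f: "lcc k j f" using assms by (auto simp: lc_cocycles_iff)
  then have cf: "coch n (tr n k) (Suc (Suc (Suc 0))) j (toT f)"
    and co: "\<And>bs. bs \<in> Ls n (Suc (Suc (Suc (Suc 0)))) \<Longrightarrow> bardiff (toT f) bs = 0"
    by (auto simp only: lcc_def)
  have mf: "mlin n (tr n k) (Suc (Suc (Suc 0))) (toT f)" using cf by (simp only: coch_def)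
  define F where "F bs = twist s \<chi> (toT f (map tinv bs))" for bs
  have m: "monchar n (\<lambda>k. inverse (\<chi> (kap s k)))" by (rule monchar_inverse[OF \<chi>])
  have Ls: "map tinv bs \<in> Ls n p" if "bs \<in> Ls n p" for bs p
    using that by (auto simp: Ls_def intro!: twist_sing)
  have cF: "coch n (tr n k) (Suc (Suc (Suc 0))) j F"
  proof -
    have "coch n (tr n k) (Suc (Suc (Suc 0))) j (\<lambda>bs. toT f (map tinv bs))"
      by (rule coch_precompose[OF cf linear_op_twist twist_sing twist_homog twist_tr])
    then have "coch n (tr n k) (Suc (Suc (Suc 0))) (j + 0) F"
      unfolding F_def by (rule coch_post) (auto simp: linear_op_twist twist_sing twist_homog)
    then show ?thesis by simp
  qed
  have car: "map ginv as \<in> tuples A p" if "as \<in> tuples A p" for as p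
    using that by (auto simp: tuples_def intro!: ginv)
  have eq: "toT (cochain_act A 2 g f) bs = F bs" if bs: "bs \<in> Ls n (Suc (Suc (Suc 0)))" for bs
  proof -
    have "map ginv (map inv\<iota> bs) = map inv\<iota> (map tinv bs)"
      using bs by (auto simp: Ls_def intro!: iota_inj simp: iota_ginv twist_sing ginv subset_iff)
    moreover have "f (map inv\<iota> (map tinv bs)) \<in> carrier A"
      using f map_tuples(2)[OF Ls[OF bs]] by (simp add: lcc_def)
    ultimately show ?thesis
      using map_tuples(2)[OF bs] by (simp add: toT_def cochain_act_def F_def iota_g numeral_2_eq_2 del: map_map)
  qed
  have "bardiff F bs = 0" if bs: "bs \<in> Ls n (Suc (Suc (Suc (Suc 0))))" for bs
  proof -
    obtain a r where ar: "bs = a # r" "a \<in> sing n" "r \<in> Ls n (Suc (Suc (Suc 0)))" using bs by (rule Ls_SucE)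
    have "bd F bs = twist s \<chi> (bd (\<lambda>l. toT f (map tinv l)) bs)"
      unfolding F_def by (rule bd_additive) (rule twist_diff)
    also have "bd (\<lambda>l. toT f (map tinv l)) bs = bd (toT f) (map tinv bs)"
      by (rule bd_precompose) (use bs in \<open>auto simp: Ls_def twist_mult[OF m]\<close>)
    finally have 1: "bd F bs = twist s \<chi> (bd (toT f) (map tinv bs))" .
    have v: "toT f (map tinv r) \<in> sing n"
      by (rule mlin_value[OF mf Ls[OF ar(3)]])
    have "a * F r = twist s \<chi> (tinv a * toT f (map tinv r))"
      unfolding twist_mult[OF \<chi> twist_sing[OF ar(2)] v] by (simp add: F_def twist_inverse(1)[OF \<chi> ar(2)])
    then have "bardiff F bs = twist s \<chi> (bardiff (toT f) (map tinv bs))"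
      using 1 by (simp add: bardiff_def ar(1) twist_diff)
    then show ?thesis
      using co[OF Ls[OF bs]] by (simp add: linear_opD(3)[OF linear_op_twist])
  qed
  then have "lcc k j (cochain_act A 2 g f)"
    by (intro lccI[OF _ _ cF eq])
      (use f car bij_betw_apply[OF g] in \<open>auto simp: cochain_act_def lcc_def numeral_2_eq_2\<close>)
  then show "cochain_act A 2 g f \<in> lc_cocycles A Gr 2 j" by (auto simp: lc_cocycles_iff)
  show "th (cochain_act A 2 g f) = (\<lambda>r. if r \<in> carrier A then th f (ginv r) else 0)"
  proof
    fix r
    have "theta n (lam n (toT (cochain_act A 2 g f))) (\<iota> r) = theta n (lam n F) (\<iota> r)"
      if "r \<in> carrier A"
      by (rule lam_cong[OF eq iota_sing[OF that]])
    then show "th (cochain_act A 2 g f) r = (if r \<in> carrier A then th f (ginv r) else 0)"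
      using theta_twist[OF n \<chi> sgn mf F_def iota_sing, of r]
      by (simp add: th_def iota_ginv ginv)
  qed
qed

definition aug :: "'r \<Rightarrow> 'k"
  where "aug r = (if r \<in> carrier A then lcoeff (\<iota> r) (0, 0) else 0)"

lemma aug_dual: "aug \<in> graded_dual A Gr 0"
proof -
  have "lcoeff (\<iota> r) (0, 0) = 0" if "r \<in> Gr e" "e \<noteq> 0" for r e
  proof (rule ccontr)
    assume "lcoeff (\<iota> r) (0, 0) \<noteq> 0"
    moreover have "\<iota> r \<in> homog e" using that(1) by (simp add: grading)
    ultimately have "0 + 0 = e" unfolding homog_def by blast
    with that(2) show False by simp
  qed
  then show ?thesis
    unfolding graded_dual_def mem_Collect_eq
    by (auto simp: aug_def add_closed smult_closed iota_add iota_smult lookup_add)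
qed

text \<open>
  In degree zero the algebra consists of scalars, so functionals of degree zero are multiples of the
  augmentation.
\<close>

lemma graded_dual_eq:
  assumes \<theta>: "\<theta> \<in> graded_dual A Gr i" and i: "i \<ge> 0"
  shows "\<theta> r = \<theta> \<one> * aug r"
proof (cases "r \<in> carrier A")
  case True
  have T: "\<theta> (u \<oplus> v) = \<theta> u + \<theta> v" "\<theta> (c \<odot> u) = c * \<theta> u" if "u \<in> carrier A" "v \<in> carrier A" for u v c
    using \<theta> that by (simp_all add: graded_dual_def)
  have "\<theta> (inv\<iota> b) = \<theta> \<one> * lcoeff b (0, 0)" if "b \<in> sing n" for b
    using that
  proof (induction rule: sing_induct)
    case zero
    have "inv\<iota> (scale 0 0) = 0 \<odot> inv\<iota> 0" by (simp only: inv_smult sing_zero)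
    then have "\<theta> (inv\<iota> 0) = 0 * \<theta> (inv\<iota> 0)" using T(2)[of "inv\<iota> 0" "inv\<iota> 0" 0] by simp
    then show ?case by simp
  next
    case (add b c)
    then show ?case using T(1)[of "inv\<iota> b" "inv\<iota> c"] by (simp add: inv_add lookup_add distrib_left)
  next
    case (monomial p q c)
    show ?case
    proof (cases "(p, q) = 0")
      case True
      have "inv\<iota> (scale c 1) = c \<odot> inv\<iota> 1" by (simp only: inv_smult sing_one)
      moreover have "inv\<iota> 1 = \<one>" using inv_iota[OF one_closed] by (simp add: iota_one)
      ultimately have "\<theta> (inv\<iota> (lterm 0 c)) = c * \<theta> \<one>" using T(2)[OF one_closed one_closed, of c] by simp
      then show ?thesis unfolding True by (simp add: zero_prod_def)
    next
      case False
      have "inv\<iota> (lterm (p, q) c) \<in> Gr (p + q)" using monomial by (simp add: grading sing_term homog_term)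
      moreover have "p + q \<noteq> - i" using monomial i False by (auto simp: cone_def zero_prod_def)
      ultimately have "\<theta> (inv\<iota> (lterm (p, q) c)) = 0" using \<theta> unfolding graded_dual_def by blast
      then show ?thesis using False by (auto simp: lookup_single when_def zero_prod_def)
    qed
  qed
  from this[of "\<iota> r"] True show ?thesis by (simp add: aug_def)
next
  case False
  then show ?thesis using \<theta> by (simp add: graded_dual_def aug_def)
qed

lemma graded_dual_pos: "i > 0 \<Longrightarrow> graded_dual A Gr i = {\<lambda>r. 0}"
proof -
  assume i: "i > 0"
  have "(1 :: 'k laurent) \<in> homog 0"
    using homog_term[of 0 0 0 "1::'k"] by (simp flip: single_one zero_prod_def)
  then have one: "\<one> \<in> Gr 0" by (simp add: grading one_closed iota_one)
  have "\<theta> = (\<lambda>r. 0)" if \<theta>: "\<theta> \<in> graded_dual A Gr i" for \<theta>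
  proof -
    have "(0 :: int) \<noteq> - i" using i by simp
    then have "\<theta> \<one> = 0" using \<theta> one unfolding graded_dual_def by blast
    then show ?thesis using graded_dual_eq[OF \<theta> less_imp_le[OF i]] by (intro ext) (metis mult_zero_left)
  qed
  moreover have "(\<lambda>r. 0) \<in> graded_dual A Gr i" by (simp add: graded_dual_def)
  ultimately show ?thesis by blast
qed

lemma aug_one: "aug \<one> = 1"
  by (simp add: aug_def one_closed iota_one lookup_one zero_prod_def)

lemma aug_ginv: "(\<lambda>r. if r \<in> carrier A then aug (ginv r) else 0) = aug"
  using monchar_zero[OF \<chi>]
  by (auto simp: aug_def ginv iota_ginv lcoeff_twist kap_def zero_prod_def)

lemma ginv_one: "ginv \<one> = \<one>"
proof (rule iota_inj[OF ginv(1)[OF one_closed] one_closed])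
  have "tinv 1 = (1 :: 'k laurent)"
    using twist_term[of s "\<lambda>k. inverse (\<chi> (kap s k))" 0 1] monchar_zero[OF \<chi>]
    by (simp add: kap_def zero_prod_def flip: single_one)
  then show "\<iota> (ginv \<one>) = \<iota> \<one>" by (simp add: iota_ginv one_closed iota_one)
qed

lemma has_inj_dim_2: "has_inj_dim A Gr 2"
  unfolding has_inj_dim_def
proof (intro conjI allI impI notI inj_dim_le_2)
  fix d' :: nat assume "d' < 2" and inj: "inj_dim_le A Gr d'"
  have cob: "f \<in> coboundaries A Gr (trunc A Gr k) 2 j" if "f \<in> cocycles A Gr (trunc A Gr k) 2 j" for f k j
    using inj trunc_graded_ideal[of k] \<open>d' < 2\<close> that unfolding inj_dim_le_def by blast
  obtain f where f: "f \<in> lc_cocycles A Gr 2 (- 2)" "th f = aug"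
    using th_surj[of aug "- 2"] aug_dual by auto
  obtain k where k: "f \<in> cocycles A Gr (trunc A Gr k) 2 (- 2)"
    using f(1) by (auto simp: lc_cocycles_def)
  have fc: "\<And>as. as \<in> tuples A (Suc 0 + 2) \<Longrightarrow> f as \<in> carrier A" "\<And>as. as \<notin> tuples A (Suc 0 + 2) \<Longrightarrow> f as = \<zero>"
    using k by (simp_all add: cocycles_def cochains_def numeral_2_eq_2)
  obtain h where h: "coch n (tr n k) (Suc (Suc 0)) (- 2) h"
    "\<And>bs. bs \<in> Ls n (Suc (Suc (Suc 0))) \<Longrightarrow> toT f bs = bardiff h bs"
    using cob[OF k] coboundaries_iff[OF trunc_carrier[of k], where p = "Suc 0" and f = f and j = "- 2", OF fc]
    by (auto simp: iota_trunc numeral_2_eq_2)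
  have "mlin n (tr n k) (Suc (Suc 0)) h" using h(1) by (simp only: coch_def)
  from theta_coboundary[OF n iota_sing[OF one_closed] this h(2)]
  have "th f \<one> = 0" by (simp add: th_def one_closed)
  then show False by (simp add: f(2) aug_one)
qed

text \<open>
  The residue pairing realises the homological determinant one. It is the only possible value: the
  graded dual is zero in positive degrees and one-dimensional in degree zero, so the action of an
  automorphism on the top degree of local cohomology, where it fixes the augmentation, determines
  the scalar whatever identification is used.
\<close>

theorem hdet_eq_1: "hdet A Gr g = 1"
  unfolding hdet_def
proof (rule the_equality)
  have "lc_iso j (lc_class A Gr 2 j (cochain_act A 2 g f)) =
      (\<lambda>r. if r \<in> carrier A then 1 * lc_iso j (lc_class A Gr 2 j f) (ginv r) else 0)"
    if "f \<in> lc_cocycles A Gr 2 j" for j f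
    using th_act[OF that] that by (simp add: lc_iso_class cong: if_cong)
  then show "has_hdet A Gr g 1"
    unfolding has_hdet_def
    by (intro exI[of _ 2] exI[of _ "2 :: int"] exI[of _ lc_iso] exI[of _ 1] conjI has_inj_dim_2 lc_dual allI ballI)
      simp_all
next
  fix h assume "has_hdet A Gr g h"
  then obtain d l \<phi> c where d: "has_inj_dim A Gr d" and \<phi>: "lc_dual_iso A Gr d l \<phi>" and "c \<noteq> 0"
    and act: "\<And>j f. f \<in> lc_cocycles A Gr d j \<Longrightarrow> \<phi> j (lc_class A Gr d j (cochain_act A d g f)) =
        (\<lambda>r. if r \<in> carrier A then c * \<phi> j (lc_class A Gr d j f) (ginv r) else 0)"
    and h: "h = inverse c"
    unfolding has_hdet_def by blast
  have "d = 2"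
    using d has_inj_dim_2 unfolding has_inj_dim_def by (metis linorder_neqE_nat)
  note \<phi> = \<phi>[unfolded this] and act = act[unfolded this]
  have bij1: "bij_betw (\<phi> j) (local_cohomology A Gr 2 j) (graded_dual A Gr (j + l))" for j
    using \<phi> by (simp add: lc_dual_iso_def)
  have bij2: "bij_betw (lc_iso j) (local_cohomology A Gr 2 j) (graded_dual A Gr (j + 2))" for j
    using lc_dual by (simp add: lc_dual_iso_def)
  have card: "card (graded_dual A Gr (j + l)) = card (graded_dual A Gr (j + 2))" for j
    using bij_betw_same_card[OF bij1] bij_betw_same_card[OF bij2] by metis
  have ne: "card (graded_dual A Gr 0) \<noteq> 1"
  proof
    assume "card (graded_dual A Gr 0) = 1"
    then obtain x where "graded_dual A Gr 0 = {x}" by (auto simp: card_1_singleton_iff)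
    moreover have "(\<lambda>r. 0) \<in> graded_dual A Gr 0" by (simp add: graded_dual_def)
    ultimately have "aug = (\<lambda>r. 0)" using aug_dual by auto
    then show False using aug_one by simp
  qed
  have "l = 2"
  proof (rule ccontr)
    assume "l \<noteq> 2"
    then consider "l < 2" | "l > 2" by linarith
    then show False
    proof cases
      case 1
      then show False using card[of "- l"] ne graded_dual_pos[of "2 - l"] by simp
    next
      case 2
      then show False using card[of "- 2"] ne graded_dual_pos[of "l - 2"] by simp
    qed
  qed
  obtain f where f: "f \<in> lc_cocycles A Gr 2 (- 2)" "th f = aug"
    using th_surj[of aug "- 2"] aug_dual by auto
  obtain f0 where f0: "f0 \<in> lc_cocycles A Gr 2 (- 2)" "th f0 = (\<lambda>r. 0)"
    using th_surj[of "\<lambda>r. 0" "- 2"] by (auto simp: graded_dual_def)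
  let ?\<phi> = "\<lambda>f. \<phi> (- 2) (lc_class A Gr 2 (- 2) f)"
  have "th (\<lambda>as. f0 as \<oplus> f0 as) = th f0"
    using th_add(2)[OF f0(1,1)] f0(2) by simp
  then have "lc_class A Gr 2 (- 2) (\<lambda>as. f0 as \<oplus> f0 as) = lc_class A Gr 2 (- 2) f0"
    by (simp add: lc_class_eq f0(1) th_add(1))
  moreover have "?\<phi> (\<lambda>as. f0 as \<oplus> f0 as) = (\<lambda>r. ?\<phi> f0 r + ?\<phi> f0 r)"
    using \<phi> f0(1) unfolding lc_dual_iso_def by blast
  ultimately have \<phi>0: "?\<phi> f0 = (\<lambda>r. 0)"
    by (metis (mono_tags, lifting) add_cancel_left_right ext)
  have in_dual: "?\<phi> f \<in> graded_dual A Gr 0"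
    using bij_betw_apply[OF bij1[of "- 2"], of "lc_class A Gr 2 (- 2) f"] f(1) \<open>l = 2\<close>
    by (simp add: local_cohomology_def)
  have "?\<phi> f \<one> \<noteq> 0"
  proof
    assume z: "?\<phi> f \<one> = 0"
    have "?\<phi> f = (\<lambda>r. 0)"
      using graded_dual_eq[OF in_dual order_refl] z by (intro ext) (metis mult_zero_left)
    then have "lc_class A Gr 2 (- 2) f = lc_class A Gr 2 (- 2) f0"
      using bij1[of "- 2"] f(1) f0(1) \<phi>0 unfolding bij_betw_def inj_on_def local_cohomology_def by auto
    then have "th f = th f0"
      using f(1) f0(1) by (auto simp: lc_class_eq)
    then show False
      using f(2) f0(2) aug_one by (metis zero_neq_one)
  qed
  moreover have "?\<phi> f \<one> = c * ?\<phi> f \<one>"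
  proof -
    have "th (cochain_act A 2 g f) = th f"
      using th_act(2)[OF f(1)] aug_ginv unfolding f(2) by (rule trans)
    then have "lc_class A Gr 2 (- 2) (cochain_act A 2 g f) = lc_class A Gr 2 (- 2) f"
      by (simp only: lc_class_eq[OF f(1)] lc_class_eq[OF th_act(1)[OF f(1)]])
    then have "?\<phi> f = (\<lambda>r. if r \<in> carrier A then c * ?\<phi> f (ginv r) else 0)"
      using act[OF f(1)] by (simp only:)
    from fun_cong[OF this, of \<one>] show ?thesis
      by (simp only: one_closed ginv_one if_True)
  qed
  ultimately show "h = 1"
    by (simp add: h)
qed

end

end

section \<open>Algebras over a field and evaluation of noncommutative polynomials\<close>

text \<open>Algebras over a field that need not be commutative.\<close>

locale kalg = ring R for R :: "('k::field, 'r) module" (structure) +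
  assumes sm_closed [simp]: "u \<in> carrier R \<Longrightarrow> c \<odot> u \<in> carrier R"
    and sm_add: "u \<in> carrier R \<Longrightarrow> v \<in> carrier R \<Longrightarrow> c \<odot> (u \<oplus> v) = c \<odot> u \<oplus> c \<odot> v"
    and sm_add2: "u \<in> carrier R \<Longrightarrow> (c + d) \<odot> u = c \<odot> u \<oplus> d \<odot> u"
    and sm_mult: "u \<in> carrier R \<Longrightarrow> (c * d) \<odot> u = c \<odot> (d \<odot> u)"
    and sm_one: "u \<in> carrier R \<Longrightarrow> 1 \<odot> u = u"
    and sm_l: "u \<in> carrier R \<Longrightarrow> v \<in> carrier R \<Longrightarrow> (c \<odot> u) \<otimes> v = c \<odot> (u \<otimes> v)"
    and sm_r: "u \<in> carrier R \<Longrightarrow> v \<in> carrier R \<Longrightarrow> u \<otimes> (c \<odot> v) = c \<odot> (u \<otimes> v)"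
begin

lemma sm_zero: "u \<in> carrier R \<Longrightarrow> 0 \<odot> u = \<zero>"
  using sm_add2[of u 0 0] add.l_cancel_one[of "0 \<odot> u" "0 \<odot> u"] by simp

lemma sm_0 [simp]: "c \<odot> \<zero> = \<zero>"
  using sm_add[of \<zero> \<zero> c] add.l_cancel_one[of "c \<odot> \<zero>" "c \<odot> \<zero>"] by simp

definition wd :: "('g \<Rightarrow> 'r) \<Rightarrow> 'g list \<Rightarrow> 'r"
  where "wd h w = foldr (\<otimes>) (map h w) \<one>"

lemma wd_simps [simp]: "wd h [] = \<one>" "wd h (v # w) = h v \<otimes> wd h w"
  by (simp_all add: wd_def)

lemma add_minus_cancel: "u \<in> carrier R \<Longrightarrow> v \<in> carrier R \<Longrightarrow> (u \<oplus> v) \<ominus> v = u"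
  by (simp add: a_minus_def a_assoc r_neg)

lemma minus_zero_iff: "u \<in> carrier R \<Longrightarrow> v \<in> carrier R \<Longrightarrow> u \<ominus> v = \<zero> \<longleftrightarrow> u = v"
proof
  assume uv: "u \<in> carrier R" "v \<in> carrier R"
  have "(u \<ominus> v) \<oplus> v = u"
    using uv by (simp add: a_minus_def a_assoc l_neg)
  then show "u \<ominus> v = \<zero> \<Longrightarrow> u = v" using uv by simp
qed (simp add: a_minus_def r_neg)

lemma wd_closed: "(\<And>v. h v \<in> carrier R) \<Longrightarrow> wd h w \<in> carrier R"
  by (induction w) auto

lemma wd_append: "(\<And>v. h v \<in> carrier R) \<Longrightarrow> wd h (u @ w) = wd h u \<otimes> wd h w"
  by (induction u) (auto simp: wd_closed m_assoc)

end

definition mon :: "'k::field \<Rightarrow> 'g list \<Rightarrow> 'g list \<Rightarrow> 'k"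
  where "mon c w = (\<lambda>u. if u = w then c else 0)"

abbreviation free_carrier :: "('g list \<Rightarrow> 'k::field) set"
  where "free_carrier \<equiv> {f. finite {w. f w \<noteq> 0}}"

lemma free_carrier: "carrier free_alg = free_carrier"
  by (simp add: free_alg_def)

lemma free_ops:
  "f \<oplus>\<^bsub>free_alg\<^esub> g = (\<lambda>w. f w + g w)" "\<zero>\<^bsub>free_alg\<^esub> = (\<lambda>w. 0)" "c \<odot>\<^bsub>free_alg\<^esub> f = (\<lambda>w. c * f w)"
  "\<one>\<^bsub>free_alg\<^esub> = mon 1 []" "free_gen v = mon 1 [v]"
  by (auto simp: free_alg_def free_gen_def mon_def)

lemma mon_free [simp]: "mon c w \<in> carrier free_alg"
  by (simp add: free_alg_def mon_def)

lemma free_minus: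
  fixes f g :: "'g list \<Rightarrow> 'k::field"
  assumes "f \<in> carrier free_alg" "g \<in> carrier free_alg"
  shows "f \<ominus>\<^bsub>free_alg\<^esub> g = (\<lambda>w. f w - g w)"
proof -
  interpret ring "free_alg :: ('k, 'g list \<Rightarrow> 'k) module" by (rule ring_free_alg)
  have n: "(\<lambda>w. - g w) \<in> carrier free_alg"
    using assms by (simp add: free_alg_def)
  have "(\<lambda>w. - g w) \<oplus>\<^bsub>free_alg\<^esub> g = \<zero>\<^bsub>free_alg\<^esub>"
    by (simp add: free_alg_def)
  then have "\<ominus>\<^bsub>free_alg\<^esub> g = (\<lambda>w. - g w)"
    by (rule minus_equality[OF _ assms(2) n])
  then show ?thesis
    by (simp add: a_minus_def free_ops)
qed

lemma free_add_closed: "f \<in> carrier free_alg \<Longrightarrow> g \<in> carrier free_alg \<Longrightarrow> (\<lambda>w. f w + g w) \<in> carrier free_alg"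
  using ring.ring_simprules(1)[OF ring_free_alg, of f g] by (simp add: free_ops)

lemma free_smult_closed: "f \<in> carrier free_alg \<Longrightarrow> (\<lambda>w. c * f w) \<in> carrier free_alg"
  by (auto simp: free_alg_def elim: rev_finite_subset)

lemma kalg_free: "kalg (free_alg :: ('k::field, 'g list \<Rightarrow> 'k) module)"
proof -
  interpret ring "free_alg :: ('k, 'g list \<Rightarrow> 'k) module" by (rule ring_free_alg)
  show ?thesis
    by unfold_locales
      (auto simp: free_ops free_smult_closed algebra_simps fun_eq_iff free_alg_def sum_distrib_left elim: rev_finite_subset)
qed

lemma mon_mult: "mon c u \<otimes>\<^bsub>free_alg\<^esub> mon d v = mon (c * d) (u @ v)"
proof
  fix w
  have "(\<Sum>i\<le>length w. mon c u (take i w) * mon d v (drop i w))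
      = (\<Sum>i\<le>length w. if i = length u then mon (c * d) (u @ v) w else 0)"
  proof (rule sum.cong[OF refl])
    fix i assume i: "i \<in> {..length w}"
    have "take i w = u \<and> drop i w = v \<longleftrightarrow> i = length u \<and> w = u @ v"
    proof
      assume *: "take i w = u \<and> drop i w = v"
      then have "i = length u" using i by auto
      moreover have "w = u @ v" using * append_take_drop_id[of i w] by simp
      ultimately show "i = length u \<and> w = u @ v" ..
    qed auto
    have "mon c u (take i w) * mon d v (drop i w) = (if take i w = u \<and> drop i w = v then c * d else 0)"
      by (simp add: mon_def)
    also have "\<dots> = (if i = length u \<and> w = u @ v then c * d else 0)"
      by (simp only: \<open>take i w = u \<and> drop i w = v \<longleftrightarrow> i = length u \<and> w = u @ v\<close>)
    finally show "mon c u (take i w) * mon d v (drop i w) = (if i = length u then mon (c * d) (u @ v) w else 0)"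
      by (simp add: mon_def)
  qed
  also have "\<dots> = mon (c * d) (u @ v) w"
    by (auto simp: mon_def)
  finally show "(mon c u \<otimes>\<^bsub>free_alg\<^esub> mon d v) w = mon (c * d) (u @ v) w"
    by (simp add: free_alg_def)
qed

lemma free_induct [consumes 1, case_names zero mon add]:
  assumes "f \<in> carrier free_alg" "P (\<lambda>w. 0)" "\<And>c w. P (mon c w)"
    "\<And>f g. f \<in> carrier free_alg \<Longrightarrow> g \<in> carrier free_alg \<Longrightarrow> P f \<Longrightarrow> P g \<Longrightarrow> P (\<lambda>w. f w + g w)"
  shows "P f"
proof -
  have "P (\<lambda>w. if w \<in> S then f w else 0) \<and> (\<lambda>w. if w \<in> S then f w else 0) \<in> carrier free_alg" if "finite S" for S
    using that
  proof induction
    case empty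
    then show ?case using assms(2) by (simp add: free_alg_def)
  next
    case (insert u S)
    have eq: "(\<lambda>w. if w \<in> insert u S then f w else 0) = (\<lambda>w. mon (f u) u w + (if w \<in> S then f w else 0))"
      using insert by (auto simp: mon_def)
    note g = conjunct1[OF insert.IH] conjunct2[OF insert.IH]
    show ?case
      unfolding eq
      by (rule conjI[OF assms(4)[OF mon_free g(2) assms(3) g(1)] free_add_closed[OF mon_free g(2)]])
  qed
  moreover have "(\<lambda>w. if w \<in> {w. f w \<noteq> 0} then f w else 0) = f" by auto
  moreover have "finite {w. f w \<noteq> 0}" using assms(1) by (simp add: free_alg_def)
  ultimately show ?thesis by metis
qed

context kalg
begin

context
  fixes h :: "'g \<Rightarrow> 'r"
  assumes h: "\<And>v. h v \<in> carrier R"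
begin

lemma free_eval_superset:
  assumes "finite S" "{w. f w \<noteq> 0} \<subseteq> S"
  shows "free_eval R h f = (\<Oplus>w\<in>S. f w \<odot> wd h w)"
  unfolding free_eval_def wd_def[symmetric]
  by (rule add.finprod_mono_neutral_cong_left)
    (use assms in \<open>auto simp: wd_closed[OF h] sm_zero\<close>)

lemma free_eval_closed: "f \<in> carrier free_alg \<Longrightarrow> free_eval R h f \<in> carrier R"
  unfolding free_eval_def wd_def[symmetric] by (rule finsum_closed) (auto simp: wd_closed[OF h])

lemma free_eval_zero: "free_eval R h (\<lambda>w. 0) = \<zero>"
  by (simp add: free_eval_def)

lemma free_eval_mon: "free_eval R h (mon c w) = c \<odot> wd h w"
proof -
  have "{u. mon c w u \<noteq> 0} \<subseteq> {w}" by (auto simp: mon_def)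
  from free_eval_superset[OF _ this] show ?thesis
    by (simp add: mon_def wd_closed[OF h])
qed

lemma free_eval_add:
  assumes "f \<in> carrier free_alg" "g \<in> carrier free_alg"
  shows "free_eval R h (\<lambda>w. f w + g w) = free_eval R h f \<oplus> free_eval R h g"
proof -
  let ?S = "{w. f w \<noteq> 0} \<union> {w. g w \<noteq> 0}"
  have S: "finite ?S" using assms by (simp add: free_alg_def)
  have "free_eval R h (\<lambda>w. f w + g w) = (\<Oplus>w\<in>?S. f w \<odot> wd h w \<oplus> g w \<odot> wd h w)"
    by (subst free_eval_superset[OF S]) (auto simp: sm_add2 wd_closed[OF h] intro!: finsum_cong')
  also have "\<dots> = (\<Oplus>w\<in>?S. f w \<odot> wd h w) \<oplus> (\<Oplus>w\<in>?S. g w \<odot> wd h w)"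
    by (rule finsum_addf) (auto simp: wd_closed[OF h])
  also have "\<dots> = free_eval R h f \<oplus> free_eval R h g"
    using free_eval_superset[OF S, of f] free_eval_superset[OF S, of g] by auto
  finally show ?thesis .
qed

lemma free_eval_smult:
  assumes "f \<in> carrier free_alg"
  shows "free_eval R h (\<lambda>w. c * f w) = c \<odot> free_eval R h f"
  using assms
proof (induction rule: free_induct)
  case (mon d w)
  have "(\<lambda>u. c * mon d w u) = mon (c * d) w" by (auto simp: mon_def)
  then show ?case by (simp add: free_eval_mon sm_mult wd_closed[OF h])
next
  case (add f g)
  then show ?case
    using free_eval_add[OF free_smult_closed free_smult_closed, of f g c c]
    by (simp add: free_eval_add free_eval_closed sm_add distrib_left)
qed (simp add: free_eval_zero)

lemma free_eval_mult:
  assumes "f \<in> carrier free_alg" "g \<in> carrier free_alg"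
  shows "free_eval R h (f \<otimes>\<^bsub>free_alg\<^esub> g) = free_eval R h f \<otimes> free_eval R h g"
proof -
  interpret F: kalg "free_alg :: ('k, 'g list \<Rightarrow> 'k) module" by (rule kalg_free)
  have ev_add: "free_eval R h (f \<oplus>\<^bsub>free_alg\<^esub> g) = free_eval R h f \<oplus> free_eval R h g"
    if "f \<in> carrier free_alg" "g \<in> carrier free_alg" for f g
    using free_eval_add[OF that] by (simp add: free_ops)
  have z: "free_eval R h \<zero>\<^bsub>free_alg\<^esub> = \<zero>" by (simp add: free_ops free_eval_zero)
  show ?thesis
    using assms(1)
  proof (induction rule: free_induct)
    case zero
    then show ?case
      using F.l_null[OF assms(2)] free_eval_closed[OF assms(2)] z by (simp add: free_ops(2)[symmetric])
  next
    case (mon c u)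
    show ?case
      using assms(2)
    proof (induction rule: free_induct)
      case zero
      then show ?case
        using F.r_null[of "mon c u"] free_eval_closed[of "mon c u"] z by (simp add: free_ops(2)[symmetric])
    next
      case (mon d v)
      then show ?case
        by (simp add: mon_mult free_eval_mon wd_append[OF h] wd_closed[OF h] sm_l sm_r sm_mult mult.commute[of c d])
    next
      case (add f g)
      then show ?case
        using F.r_distr[of f g "mon c u"] free_eval_closed[of f] free_eval_closed[of g] free_eval_closed[of "mon c u"]
        by (simp add: free_ops(1)[symmetric] ev_add r_distr)
    qed
  next
    case (add f f')
    then show ?case
      using F.l_distr[of f f' g] free_eval_closed[of f] free_eval_closed[of f'] free_eval_closed[of g] assms(2)
      by (simp add: free_ops(1)[symmetric] ev_add l_distr)
  qed
qed

lemma free_eval_one: "free_eval R h \<one>\<^bsub>free_alg\<^esub> = \<one>"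
  by (simp add: free_ops free_eval_mon sm_one)

lemma free_eval_gen: "free_eval R h (free_gen v) = h v"
  by (simp add: free_ops free_eval_mon sm_one h)

lemma free_eval_minus:
  assumes "f \<in> carrier free_alg" "g \<in> carrier free_alg"
  shows "free_eval R h (f \<ominus>\<^bsub>free_alg\<^esub> g) = free_eval R h f \<ominus> free_eval R h g"
proof -
  interpret F: kalg "free_alg :: ('k, 'g list \<Rightarrow> 'k) module" by (rule kalg_free)
  have "free_eval R h (f \<ominus>\<^bsub>free_alg\<^esub> g) \<oplus> free_eval R h g = free_eval R h ((f \<ominus>\<^bsub>free_alg\<^esub> g) \<oplus>\<^bsub>free_alg\<^esub> g)"
    using free_eval_add[of "f \<ominus>\<^bsub>free_alg\<^esub> g" g] assms by (simp add: free_ops(1))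
  also have "(f \<ominus>\<^bsub>free_alg\<^esub> g) \<oplus>\<^bsub>free_alg\<^esub> g = f"
    using assms by (simp add: free_minus free_ops)
  finally show ?thesis
    using add_minus_cancel[OF free_eval_closed free_eval_closed, of "f \<ominus>\<^bsub>free_alg\<^esub> g" g] assms
    by (simp only: F.minus_closed)
qed

lemma free_eval_kernel_ideal: "ideal {f \<in> carrier free_alg. free_eval R h f = \<zero>} free_alg"
proof -
  interpret F: kalg "free_alg :: ('k, 'g list \<Rightarrow> 'k) module" by (rule kalg_free)
  let ?K = "{f \<in> carrier free_alg. free_eval R h f = \<zero>}"
  have neg: "free_eval R h (\<ominus>\<^bsub>free_alg\<^esub> f) = \<zero>" if "f \<in> ?K" for f
  proof -
    have f: "f \<in> carrier free_alg" "free_eval R h f = \<zero>" using that by auto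
    have "free_eval R h (\<ominus>\<^bsub>free_alg\<^esub> f) \<oplus> free_eval R h f = free_eval R h (\<ominus>\<^bsub>free_alg\<^esub> f \<oplus>\<^bsub>free_alg\<^esub> f)"
      unfolding free_ops(1) by (rule free_eval_add[symmetric]) (simp_all add: f)
    also have "\<ominus>\<^bsub>free_alg\<^esub> f \<oplus>\<^bsub>free_alg\<^esub> f = \<zero>\<^bsub>free_alg\<^esub>" by (rule F.l_neg[OF f(1)])
    also have "free_eval R h \<zero>\<^bsub>free_alg\<^esub> = \<zero>" by (simp add: free_ops free_eval_zero)
    finally show ?thesis using f free_eval_closed[OF F.a_inv_closed[OF f(1)]] by simp
  qed
  show ?thesis
  proof (rule idealI[OF F.ring_axioms])
    show "subgroup ?K (add_monoid free_alg)"
    proof (rule group.subgroupI[OF F.a_group])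
      have "\<zero>\<^bsub>free_alg\<^esub> \<in> ?K" by (simp add: free_ops(2) free_eval_zero free_alg_def)
      then show "?K \<noteq> {}" by blast
      show "inv\<^bsub>add_monoid free_alg\<^esub> f \<in> ?K" if "f \<in> ?K" for f
        using neg[OF that] that by (simp add: a_inv_def[symmetric])
      show "f \<otimes>\<^bsub>add_monoid free_alg\<^esub> g \<in> ?K" if "f \<in> ?K" "g \<in> ?K" for f g
        using that free_eval_add[of f g] free_add_closed[of f g] by (simp add: free_ops(1))
    qed simp
  qed (auto simp: free_eval_mult free_eval_closed)
qed

end

end

section \<open>The generalized Weyl algebra as a quotient\<close>

lemma set_subset_replicate: "set w \<subseteq> {v} \<longleftrightarrow> w = replicate (length w) v"
  by (induction w) auto

lemma zpoly_free: "zpoly d \<in> carrier free_alg"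
proof -
  have "{w. zpoly d w \<noteq> 0} \<subseteq> (\<lambda>k. replicate k Z) ` {..Polynomial.degree d}"
  proof
    fix w assume "w \<in> {w. zpoly d w \<noteq> 0}"
    then have "w = replicate (length w) Z" "length w \<le> Polynomial.degree d"
      by (auto simp: zpoly_def set_subset_replicate[symmetric] le_degree split: if_splits)
    then show "w \<in> (\<lambda>k. replicate k Z) ` {..Polynomial.degree d}" by auto
  qed
  from finite_subset[OF this] show ?thesis by (simp add: free_alg_def)
qed

lemma zpoly_0: "zpoly 0 = (\<lambda>w. 0)"
  by (auto simp: zpoly_def)

lemma zpoly_pCons: "zpoly (pCons c d) = (\<lambda>w. mon c [] w + (free_gen Z \<otimes>\<^bsub>free_alg\<^esub> zpoly d) w)"
proof
  fix w
  show "zpoly (pCons c d) w = mon c [] w + (free_gen Z \<otimes>\<^bsub>free_alg\<^esub> zpoly d) w"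
  proof (cases w)
    case (Cons v u)
    have "(\<Sum>i\<le>length w. free_gen Z (take i w) * zpoly d (drop i w))
        = (\<Sum>i\<le>length w. if i = 1 then (if v = Z then zpoly d u else 0) else 0)"
    proof (rule sum.cong[OF refl])
      fix i assume i: "i \<in> {..length w}"
      show "free_gen Z (take i w) * zpoly d (drop i w) = (if i = 1 then (if v = Z then zpoly d u else 0) else 0)"
      proof (cases "i = 1")
        case False
        then have "take i w \<noteq> [Z]"
          using i by (cases i; cases "i - 1"; cases u) (auto simp: Cons)
        with False show ?thesis by (simp add: free_gen_def)
      qed (simp add: Cons free_gen_def)
    qed
    also have "\<dots> = (if v = Z then zpoly d u else 0)"
      by (simp add: Cons Suc_le_eq)
    finally have m: "(free_gen Z \<otimes>\<^bsub>free_alg\<^esub> zpoly d) w = (if v = Z then zpoly d u else 0)"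
      by (simp add: free_alg_def)
    show ?thesis
      unfolding m by (simp add: Cons zpoly_def mon_def)
  qed (simp add: zpoly_def mon_def free_alg_def free_gen_def)
qed

lemma gwa_rel_carrier: "gwa_relations a \<subseteq> carrier (free_alg :: ('k::field, gen list \<Rightarrow> 'k) module)"
proof -
  interpret F: kalg "free_alg :: ('k, gen list \<Rightarrow> 'k) module" by (rule kalg_free)
  show ?thesis
    unfolding gwa_relations_def Let_def
    by (auto simp: free_ops zpoly_free)
qed

lemma ideal_gwa: "ideal (gwa_ideal a) free_alg"
  unfolding gwa_ideal_def by (rule ring.genideal_ideal[OF ring_free_alg gwa_rel_carrier])

definition cl :: "'k::field poly \<Rightarrow> (gen list \<Rightarrow> 'k) \<Rightarrow> (gen list \<Rightarrow> 'k) set"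
  where "cl a f = gwa_ideal a +>\<^bsub>free_alg\<^esub> f"

lemma cl_eq_iff:
  assumes "f \<in> carrier free_alg" "g \<in> carrier free_alg"
  shows "cl a f = cl a g \<longleftrightarrow> f \<ominus>\<^bsub>free_alg\<^esub> g \<in> gwa_ideal a"
  unfolding cl_def using ring.quotient_eq_iff_same_a_r_cos[OF ring_free_alg ideal_gwa assms] by blast

lemma cl_self: "f \<in> carrier free_alg \<Longrightarrow> f \<in> cl a f"
proof -
  interpret I: ideal "gwa_ideal a" free_alg by (rule ideal_gwa)
  assume "f \<in> carrier free_alg"
  then show ?thesis unfolding cl_def by (rule I.a_rcos_self)
qed

lemma cl_mem: "r \<in> cl a f \<Longrightarrow> f \<in> carrier free_alg \<Longrightarrow> r \<in> carrier free_alg \<and> cl a r = cl a f"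
proof -
  interpret I: ideal "gwa_ideal a" free_alg by (rule ideal_gwa)
  assume rf: "r \<in> cl a f" "f \<in> carrier free_alg"
  then have r: "r \<in> carrier free_alg"
    unfolding cl_def using I.a_r_coset_subset_G[OF I.a_subset] by blast
  have "subgroup (gwa_ideal a) (add_monoid free_alg)"
    by (rule I.a_subgroup)
  with rf have "gwa_ideal a +>\<^bsub>free_alg\<^esub> f = gwa_ideal a +>\<^bsub>free_alg\<^esub> r"
    unfolding cl_def by (intro I.a_repr_independence)
  then show ?thesis using r by (simp add: cl_def)
qed

lemma gwa_carrier: "carrier (gwa a) = cl a ` carrier free_alg"
  by (auto simp: gwa_def quot_alg_def FactRing_def A_RCOSETS_def' cl_def)

lemma cl_closed [simp]: "f \<in> carrier free_alg \<Longrightarrow> cl a f \<in> carrier (gwa a)"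
  by (simp add: gwa_carrier)

lemma gwa_ops:
  assumes f: "f \<in> carrier free_alg"
  shows "g \<in> carrier free_alg \<Longrightarrow> cl a f \<otimes>\<^bsub>gwa a\<^esub> cl a g = cl a (f \<otimes>\<^bsub>free_alg\<^esub> g)"
    "g \<in> carrier free_alg \<Longrightarrow> cl a f \<oplus>\<^bsub>gwa a\<^esub> cl a g = cl a (f \<oplus>\<^bsub>free_alg\<^esub> g)"
    "c \<odot>\<^bsub>gwa a\<^esub> cl a f = cl a (c \<odot>\<^bsub>free_alg\<^esub> f)"
proof -
  interpret F: kalg "free_alg :: ('a, gen list \<Rightarrow> 'a) module" by (rule kalg_free)
  interpret I: ideal "gwa_ideal a" free_alg by (rule ideal_gwa)
  show "cl a f \<otimes>\<^bsub>gwa a\<^esub> cl a g = cl a (f \<otimes>\<^bsub>free_alg\<^esub> g)" if "g \<in> carrier free_alg"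
    using ring_hom_mult[OF I.rcos_ring_hom f that] by (simp add: gwa_def quot_alg_def cl_def)
  show "cl a f \<oplus>\<^bsub>gwa a\<^esub> cl a g = cl a (f \<oplus>\<^bsub>free_alg\<^esub> g)" if "g \<in> carrier free_alg"
    using ring_hom_add[OF I.rcos_ring_hom f that] by (simp add: gwa_def quot_alg_def cl_def)
  have eq: "cl a (c \<odot>\<^bsub>free_alg\<^esub> r) = cl a (c \<odot>\<^bsub>free_alg\<^esub> f)" if r: "r \<in> cl a f" for r
  proof -
    have r': "r \<in> carrier free_alg" "cl a r = cl a f" using cl_mem[OF r f] by auto
    have "r \<ominus>\<^bsub>free_alg\<^esub> f \<in> gwa_ideal a" using cl_eq_iff[OF r'(1) f] r'(2) by blast
    then have "mon c [] \<otimes>\<^bsub>free_alg\<^esub> (r \<ominus>\<^bsub>free_alg\<^esub> f) \<in> gwa_ideal a" by (intro I.I_l_closed) auto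
    also have "mon c [] = c \<odot>\<^bsub>free_alg\<^esub> \<one>\<^bsub>free_alg\<^esub>" by (auto simp: free_ops mon_def)
    also have "(c \<odot>\<^bsub>free_alg\<^esub> \<one>\<^bsub>free_alg\<^esub>) \<otimes>\<^bsub>free_alg\<^esub> (r \<ominus>\<^bsub>free_alg\<^esub> f) = c \<odot>\<^bsub>free_alg\<^esub> (r \<ominus>\<^bsub>free_alg\<^esub> f)"
      using f r' by (simp add: F.sm_l)
    also have "\<dots> = (c \<odot>\<^bsub>free_alg\<^esub> r) \<ominus>\<^bsub>free_alg\<^esub> (c \<odot>\<^bsub>free_alg\<^esub> f)"
      using f r' free_smult_closed[of r c] free_smult_closed[of f c]
      by (simp add: free_minus free_ops(3) right_diff_distrib)
    finally have "c \<odot>\<^bsub>free_alg\<^esub> r \<ominus>\<^bsub>free_alg\<^esub> c \<odot>\<^bsub>free_alg\<^esub> f \<in> gwa_ideal a" .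
    then show ?thesis by (rule cl_eq_iff[OF F.sm_closed[OF r'(1)] F.sm_closed[OF f], THEN iffD2])
  qed
  have "(\<Union>r\<in>cl a f. cl a (c \<odot>\<^bsub>free_alg\<^esub> r)) = (\<Union>r\<in>cl a f. cl a (c \<odot>\<^bsub>free_alg\<^esub> f))"
    by (rule SUP_cong[OF refl eq])
  also have "\<dots> = cl a (c \<odot>\<^bsub>free_alg\<^esub> f)" using cl_self[OF f, of a] by blast
  finally have "(\<Union>r\<in>cl a f. cl a (c \<odot>\<^bsub>free_alg\<^esub> r)) = cl a (c \<odot>\<^bsub>free_alg\<^esub> f)" .
  then show "c \<odot>\<^bsub>gwa a\<^esub> cl a f = cl a (c \<odot>\<^bsub>free_alg\<^esub> f)"
    by (simp add: gwa_def quot_alg_def cl_def)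
qed

lemma gwa_one: "\<one>\<^bsub>gwa a\<^esub> = cl a \<one>\<^bsub>free_alg\<^esub>"
  by (simp add: gwa_def quot_alg_def FactRing_def cl_def)

lemma gwa_zero: "\<zero>\<^bsub>gwa a\<^esub> = cl a \<zero>\<^bsub>free_alg\<^esub>"
proof -
  interpret I: ideal "gwa_ideal a" free_alg by (rule ideal_gwa)
  have "gwa_ideal a +>\<^bsub>free_alg\<^esub> \<zero>\<^bsub>free_alg\<^esub> = gwa_ideal a"
    using I.a_coset_add_zero[OF I.a_subset] .
  then show ?thesis by (simp add: gwa_def quot_alg_def FactRing_def cl_def)
qed

lemma kalg_gwa: "kalg (gwa a)"
proof -
  interpret F: kalg "free_alg :: ('a, gen list \<Rightarrow> 'a) module" by (rule kalg_free)
  have ab: "abelian_group (gwa a)"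
  proof (rule abelian_groupI)
    fix u assume "u \<in> carrier (gwa a)"
    then obtain f where f: "f \<in> carrier free_alg" "u = cl a f" by (auto simp: gwa_carrier)
    then show "\<exists>v\<in>carrier (gwa a). v \<oplus>\<^bsub>gwa a\<^esub> u = \<zero>\<^bsub>gwa a\<^esub>"
      by (intro bexI[of _ "cl a (\<ominus>\<^bsub>free_alg\<^esub> f)"]) (simp_all add: gwa_ops gwa_zero F.l_neg)
  qed (auto simp: gwa_carrier gwa_ops gwa_zero F.a_ac)
  have mo: "Group.monoid (gwa a)"
    by (rule monoidI) (auto simp: gwa_carrier gwa_ops gwa_one F.m_assoc)
  have "ring (gwa a)"
    by (rule ringI[OF ab mo]) (auto simp: gwa_carrier gwa_ops F.l_distr F.r_distr)
  then show ?thesis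
    by (intro kalg.intro kalg_axioms.intro)
      (auto simp: gwa_carrier gwa_ops F.sm_add F.sm_add2 F.sm_mult F.sm_one F.sm_l F.sm_r)
qed

lemma gen_closed: "gwa_gen a v \<in> carrier (gwa a)"
  using cl_closed[of "free_gen v" a] by (simp add: gwa_gen_def cl_def free_ops)

lemma free_eval_gwa: "f \<in> carrier free_alg \<Longrightarrow> free_eval (gwa a) (gwa_gen a) f = cl a f"
proof -
  interpret R: kalg "gwa a" by (rule kalg_gwa)
  interpret F: kalg "free_alg :: ('a, gen list \<Rightarrow> 'a) module" by (rule kalg_free)
  have w: "R.wd (gwa_gen a) w = cl a (mon 1 w)" for w
    by (induction w) (simp_all add: gwa_one free_ops(4) gwa_gen_def[folded cl_def] free_ops(5) gwa_ops mon_mult)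
  assume "f \<in> carrier free_alg"
  then show ?thesis
  proof (induction rule: free_induct)
    case zero
    then show ?case by (simp add: R.free_eval_zero[OF gen_closed] gwa_zero free_ops)
  next
    case (mon c w)
    have "(\<lambda>u. c * mon 1 w u) = mon c w" by (auto simp: mon_def)
    then show ?case by (simp add: R.free_eval_mon[OF gen_closed] w gwa_ops free_ops)
  next
    case (add f g)
    then show ?case by (simp add: R.free_eval_add[OF gen_closed] gwa_ops free_ops)
  qed
qed

text \<open>
  The homomorphism out of the quotient induced by \<open>h\<close>, computed on any representative.
\<close>

definition lift :: "('k::field, 'r) module \<Rightarrow> (gen \<Rightarrow> 'r) \<Rightarrow> (gen list \<Rightarrow> 'k) set \<Rightarrow> 'r"
  where "lift B h C = the_elem (free_eval B h ` C)"

text \<open>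
  The images \<open>h\<close> of the generators satisfy the defining relations of the generalized Weyl algebra.
\<close>

definition good :: "'k::field poly \<Rightarrow> ('k, 'r) module \<Rightarrow> (gen \<Rightarrow> 'r) \<Rightarrow> bool"
  where "good a B h \<longleftrightarrow> kalg B \<and> (\<forall>v. h v \<in> carrier B) \<and> (\<forall>f\<in>gwa_relations a. free_eval B h f = \<zero>\<^bsub>B\<^esub>)"

lemma lift_cl:
  assumes "good a B h" "f \<in> carrier free_alg"
  shows "lift B h (cl a f) = free_eval B h f"
proof -
  interpret B: kalg B using assms by (simp add: good_def)
  have h: "h v \<in> carrier B" for v using assms by (simp add: good_def)
  have sub: "gwa_ideal a \<subseteq> {f \<in> carrier free_alg. free_eval B h f = \<zero>\<^bsub>B\<^esub>}"
    unfolding gwa_ideal_def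
    by (rule ring.genideal_minimal[OF ring_free_alg B.free_eval_kernel_ideal[OF h]])
      (use assms(1) gwa_rel_carrier in \<open>auto simp: good_def\<close>)
  have "free_eval B h r = free_eval B h f" if "r \<in> cl a f" for r
  proof -
    have r: "r \<in> carrier free_alg" "cl a r = cl a f" using cl_mem[OF that assms(2)] by auto
    then have "r \<ominus>\<^bsub>free_alg\<^esub> f \<in> gwa_ideal a" using cl_eq_iff[OF r(1) assms(2)] by blast
    then have "free_eval B h r \<ominus>\<^bsub>B\<^esub> free_eval B h f = \<zero>\<^bsub>B\<^esub>"
      using sub B.free_eval_minus[OF h r(1) assms(2)] by auto
    then show ?thesis
      using B.minus_zero_iff[OF B.free_eval_closed[of h, OF h r(1)] B.free_eval_closed[of h, OF h assms(2)]] by blast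
  qed
  moreover have "f \<in> cl a f" by (rule cl_self[OF assms(2)])
  ultimately have "free_eval B h ` cl a f = {free_eval B h f}" by blast
  then show ?thesis by (simp add: lift_def)
qed

lemma lift_hom:
  assumes g: "good a B h" and u: "u \<in> carrier (gwa a)" and v: "v \<in> carrier (gwa a)"
  shows "lift B h u \<in> carrier B" "lift B h (u \<oplus>\<^bsub>gwa a\<^esub> v) = lift B h u \<oplus>\<^bsub>B\<^esub> lift B h v"
    "lift B h (u \<otimes>\<^bsub>gwa a\<^esub> v) = lift B h u \<otimes>\<^bsub>B\<^esub> lift B h v"
    "lift B h (c \<odot>\<^bsub>gwa a\<^esub> u) = c \<odot>\<^bsub>B\<^esub> lift B h u"
    "lift B h \<one>\<^bsub>gwa a\<^esub> = \<one>\<^bsub>B\<^esub>" "lift B h (gwa_gen a w) = h w" "lift B h \<zero>\<^bsub>gwa a\<^esub> = \<zero>\<^bsub>B\<^esub>"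
proof -
  interpret B: kalg B using g by (simp add: good_def)
  interpret F: kalg "free_alg :: ('a, gen list \<Rightarrow> 'a) module" by (rule kalg_free)
  have h: "h v \<in> carrier B" for v using g by (simp add: good_def)
  obtain f f' where f: "f \<in> carrier free_alg" "u = cl a f" "f' \<in> carrier free_alg" "v = cl a f'"
    using u v by (auto simp: gwa_carrier)
  note l = lift_cl[OF g]
  show "lift B h u \<in> carrier B" "lift B h (u \<otimes>\<^bsub>gwa a\<^esub> v) = lift B h u \<otimes>\<^bsub>B\<^esub> lift B h v"
    using f by (simp_all add: l gwa_ops B.free_eval_closed[OF h] B.free_eval_mult[OF h])
  show "lift B h (u \<oplus>\<^bsub>gwa a\<^esub> v) = lift B h u \<oplus>\<^bsub>B\<^esub> lift B h v"
    using f B.free_eval_add[OF h f(1,3)] l[OF F.a_closed[OF f(1,3)]] by (simp add: l gwa_ops free_ops(1))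
  show "lift B h (c \<odot>\<^bsub>gwa a\<^esub> u) = c \<odot>\<^bsub>B\<^esub> lift B h u"
    using f B.free_eval_smult[OF h f(1)] l[OF F.sm_closed[OF f(1)]] by (simp add: l gwa_ops free_ops(3))
  show "lift B h \<one>\<^bsub>gwa a\<^esub> = \<one>\<^bsub>B\<^esub>" by (simp add: gwa_one l B.free_eval_one[OF h])
  show "lift B h \<zero>\<^bsub>gwa a\<^esub> = \<zero>\<^bsub>B\<^esub>"
    using l[OF F.zero_closed] by (simp add: gwa_zero free_ops(2) B.free_eval_zero[OF h])
  show "lift B h (gwa_gen a w) = h w"
  proof -
    have "free_gen w \<in> carrier (free_alg :: ('a, gen list \<Rightarrow> 'a) module)" by (simp add: free_ops(5))
    from l[OF this] show ?thesis by (simp add: gwa_gen_def[folded cl_def] B.free_eval_gen[OF h])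
  qed
qed

section \<open>The shift representation\<close>

type_synonym 'k vec = "int \<Rightarrow> 'k poly"

text \<open>Linear endomorphisms of the space of sequences of polynomials indexed by the integers.\<close>

definition EndV :: "('k::field, 'k vec \<Rightarrow> 'k vec) module"
  where "EndV = \<lparr>carrier = {T. (\<forall>u v. T (\<lambda>i. u i + v i) = (\<lambda>i. T u i + T v i)) \<and>
      (\<forall>c u. T (\<lambda>i. Polynomial.smult c (u i)) = (\<lambda>i. Polynomial.smult c (T u i)))},
    mult = (\<lambda>S T v. S (T v)), one = (\<lambda>v. v), zero = (\<lambda>v i. 0), add = (\<lambda>S T v i. S v i + T v i),
    smult = (\<lambda>c T v i. Polynomial.smult c (T v i))\<rparr>"

lemma EndV_ops [simp]: "(S \<otimes>\<^bsub>EndV\<^esub> T) = (\<lambda>v. S (T v))" "\<one>\<^bsub>EndV\<^esub> = (\<lambda>v. v)" "\<zero>\<^bsub>EndV\<^esub> = (\<lambda>v i. 0)"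
  "(S \<oplus>\<^bsub>EndV\<^esub> T) = (\<lambda>v i. S v i + T v i)" "(c \<odot>\<^bsub>EndV\<^esub> T) = (\<lambda>v i. Polynomial.smult c (T v i))"
  by (simp_all add: EndV_def)

lemma EndV_carrier: "T \<in> carrier EndV \<longleftrightarrow> (\<forall>u v. T (\<lambda>i. u i + v i) = (\<lambda>i. T u i + T v i)) \<and>
      (\<forall>c u. T (\<lambda>i. Polynomial.smult c (u i)) = (\<lambda>i. Polynomial.smult c (T u i)))"
  by (simp add: EndV_def)

lemma kalg_EndV: "kalg (EndV :: ('k::field, 'k vec \<Rightarrow> 'k vec) module)"
proof -
  let ?E = "EndV :: ('k, 'k vec \<Rightarrow> 'k vec) module"
  have ab: "abelian_group ?E"
  proof (rule abelian_groupI)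
    fix T :: "'k vec \<Rightarrow> 'k vec" assume "T \<in> carrier EndV"
    then show "\<exists>S\<in>carrier EndV. S \<oplus>\<^bsub>EndV\<^esub> T = \<zero>\<^bsub>EndV\<^esub>"
      by (intro bexI[of _ "\<lambda>v i. - T v i"]) (auto simp: EndV_carrier)
  qed (auto simp: EndV_carrier algebra_simps smult_add_right)
  have mo: "Group.monoid ?E" by (rule monoidI) (auto simp: EndV_carrier)
  have "ring ?E" by (rule ringI[OF ab mo]) (auto simp: EndV_carrier)
  then show ?thesis
    by (intro kalg.intro kalg_axioms.intro) (auto simp: EndV_carrier smult_add_right smult_add_left mult.commute)
qed

definition shift :: "int \<Rightarrow> 'k::field poly"
  where "shift i = [:of_int i, 1:]"

text \<open>
  The algebra acts on \<open>\<Bbbk>[z]\<close>-valued sequences: \<open>x\<close> shifts, \<open>z\<close> acts at place \<open>i\<close> by \<open>z + i\<close>, and \<open>y\<close> shifts back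
  with the factor that the relation \<open>y x = a\<close> dictates. This representation is faithful and replaces a
  confluence argument for normal forms.
\<close>

fun act :: "'k::field poly \<Rightarrow> gen \<Rightarrow> 'k vec \<Rightarrow> 'k vec" where
  "act a X = (\<lambda>v i. v (i - 1))"
| "act a Y = (\<lambda>v i. (a \<circ>\<^sub>p shift i) * v (i + 1))"
| "act a Z = (\<lambda>v i. shift i * v i)"

lemma act_closed: "act a v \<in> carrier EndV"
  by (cases v) (auto simp: EndV_carrier algebra_simps)

lemma free_eval_diag:
  assumes h: "\<And>v. h v \<in> carrier EndV" and Z: "h Z = (\<lambda>v i. q i * v i)"
  shows "free_eval EndV h (zpoly d) = (\<lambda>v i. (d \<circ>\<^sub>p q i) * v i)"
proof -
  interpret E: kalg "EndV :: ('a, 'a vec \<Rightarrow> 'a vec) module" by (rule kalg_EndV)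
  interpret F: kalg "free_alg :: ('a, gen list \<Rightarrow> 'a) module" by (rule kalg_free)
  show ?thesis
  proof (induction d)
    case 0
    then show ?case by (simp add: zpoly_0 E.free_eval_zero[OF h])
  next
    case (pCons c d)
    have "free_gen Z \<in> carrier (free_alg :: ('a, gen list \<Rightarrow> 'a) module)" by (simp add: free_ops)
    then have "free_eval EndV h (zpoly (pCons c d)) = free_eval EndV h (mon c []) \<oplus>\<^bsub>EndV\<^esub>
        (h Z \<otimes>\<^bsub>EndV\<^esub> free_eval EndV h (zpoly d))"
      unfolding zpoly_pCons
      by (subst E.free_eval_add[OF h]) (simp_all add: zpoly_free E.free_eval_mult[OF h] E.free_eval_gen[OF h])
    then show ?case
      by (simp add: pCons.IH E.free_eval_mon[OF h] Z pcompose_pCons algebra_simps)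
  qed
qed

lemma pcompose_shift: "((p :: 'k::field poly) \<circ>\<^sub>p [:c, 1:]) \<circ>\<^sub>p [:e, 1:] = p \<circ>\<^sub>p [:c + e, 1:]"
  by (simp add: pcompose_assoc[symmetric] pcompose_pCons)

text \<open>
  The relations involving an arbitrary polynomial reduce to statements about substitution because \<open>z\<close>
  acts diagonally.
\<close>

lemma good_EndV:
  assumes h: "\<And>v. h v \<in> carrier EndV" and Z: "h Z = (\<lambda>v i. q i * v i)"
    and XY: "\<And>v. h X (h Y v) = (\<lambda>i. (sigma a \<circ>\<^sub>p q i) * v i)" and YX: "\<And>v. h Y (h X v) = (\<lambda>i. (a \<circ>\<^sub>p q i) * v i)"
    and X: "\<And>d v. h X (\<lambda>i. (d \<circ>\<^sub>p q i) * v i) = (\<lambda>i. (sigma d \<circ>\<^sub>p q i) * h X v i)"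
    and Y: "\<And>d v. h Y (\<lambda>i. (d \<circ>\<^sub>p q i) * v i) = (\<lambda>i. (sigma_inv d \<circ>\<^sub>p q i) * h Y v i)"
  shows "good a EndV h"
proof -
  interpret E: kalg "EndV :: ('a, 'a vec \<Rightarrow> 'a vec) module" by (rule kalg_EndV)
  interpret F: kalg "free_alg :: ('a, gen list \<Rightarrow> 'a) module" by (rule kalg_free)
  have g: "free_gen v \<in> carrier (free_alg :: ('a, gen list \<Rightarrow> 'a) module)" for v by (simp add: free_ops)
  have R: "free_eval EndV h (u \<ominus>\<^bsub>free_alg\<^esub> w) = \<zero>\<^bsub>EndV\<^esub>"
    if "u \<in> carrier free_alg" "w \<in> carrier free_alg" "free_eval EndV h u = free_eval EndV h w" for u w
    unfolding E.free_eval_minus[of h, OF h that(1,2)] that(3)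
    using E.minus_zero_iff[OF E.free_eval_closed[of h, OF h that(2)] E.free_eval_closed[of h, OF h that(2)]] by (simp only:)
  note diag = free_eval_diag[where h = h and q = q, OF h Z]
  note m = E.free_eval_mult[OF h] E.free_eval_gen[OF h] diag zpoly_free g EndV_ops
  have "free_eval EndV h f = \<zero>\<^bsub>EndV\<^esub>" if "f \<in> gwa_relations a" for f
  proof -
    from that consider
        "f = (free_gen X \<otimes>\<^bsub>free_alg\<^esub> free_gen Y) \<ominus>\<^bsub>free_alg\<^esub> zpoly (sigma a)"
      | "f = (free_gen Y \<otimes>\<^bsub>free_alg\<^esub> free_gen X) \<ominus>\<^bsub>free_alg\<^esub> zpoly a"
      | d where "f = (free_gen X \<otimes>\<^bsub>free_alg\<^esub> zpoly d) \<ominus>\<^bsub>free_alg\<^esub> (zpoly (sigma d) \<otimes>\<^bsub>free_alg\<^esub> free_gen X)"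
      | d where "f = (free_gen Y \<otimes>\<^bsub>free_alg\<^esub> zpoly d) \<ominus>\<^bsub>free_alg\<^esub> (zpoly (sigma_inv d) \<otimes>\<^bsub>free_alg\<^esub> free_gen Y)"
      unfolding gwa_relations_def Let_def by blast
    then show ?thesis
    proof cases
      case 1
      show ?thesis unfolding 1
        by (rule R) (simp_all only: F.m_closed m XY)
    next
      case 2
      show ?thesis unfolding 2
        by (rule R) (simp_all only: F.m_closed m YX)
    next
      case 3
      show ?thesis unfolding 3
        by (rule R) (simp_all only: F.m_closed m X)
    next
      case 4
      show ?thesis unfolding 4
        by (rule R) (simp_all only: F.m_closed m Y)
    qed
  qed
  then show ?thesis by (simp add: good_def h kalg_EndV)
qed

lemma good_act: "good a EndV (act a)"
proof (rule good_EndV[OF act_closed, where q = shift])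
  have s: "sigma d \<circ>\<^sub>p shift i = d \<circ>\<^sub>p shift (i - 1)" "sigma_inv d \<circ>\<^sub>p shift i = d \<circ>\<^sub>p shift (i + 1)" for d :: "'a poly" and i
    by (simp_all add: sigma_def sigma_inv_def shift_def pcompose_shift add.commute)
  show "act a X (act a Y v) = (\<lambda>i. (sigma a \<circ>\<^sub>p shift i) * v i)" for v by (simp add: s)
  show "act a X (\<lambda>i. (d \<circ>\<^sub>p shift i) * v i) = (\<lambda>i. (sigma d \<circ>\<^sub>p shift i) * act a X v i)" for d v by (simp add: s)
  show "act a Y (\<lambda>i. (d \<circ>\<^sub>p shift i) * v i) = (\<lambda>i. (sigma_inv d \<circ>\<^sub>p shift i) * act a Y v i)" for d v
    by (simp add: s mult.left_commute)
qed simp_all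

definition rp :: "'k::field poly \<Rightarrow> (gen list \<Rightarrow> 'k) set \<Rightarrow> 'k vec \<Rightarrow> 'k vec"
  where "rp a = lift EndV (act a)"

text \<open>The value on the basis vector at place zero. It already determines an element of the algebra.\<close>

definition ev :: "'k::field poly \<Rightarrow> (gen list \<Rightarrow> 'k) set \<Rightarrow> 'k vec"
  where "ev a r = rp a r (\<lambda>i. if i = 0 then 1 else 0)"

lemmas rp_hom = lift_hom[OF good_act, folded rp_def]

definition pz :: "'k::field poly \<Rightarrow> 'k poly \<Rightarrow> (gen list \<Rightarrow> 'k) set"
  where "pz a d = cl a (zpoly d)"

lemma pz_closed [simp]: "pz a d \<in> carrier (gwa a)"
  by (simp add: pz_def zpoly_free)

lemma rp_pz: "rp a (pz a d) = (\<lambda>v i. (d \<circ>\<^sub>p shift i) * v i)"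
  unfolding rp_def pz_def lift_cl[OF good_act zpoly_free] by (rule free_eval_diag[OF act_closed]) simp

section \<open>Normal forms and the standard filtration\<close>

lemma zpoly_add: "zpoly (d + e) = (\<lambda>w. zpoly d w + zpoly e w)"
  and zpoly_smult: "zpoly (Polynomial.smult c d) = (\<lambda>w. c * zpoly d w)"
  by (auto simp: zpoly_def)

lemma free_mon_nil: "f \<in> carrier free_alg \<Longrightarrow> mon c [] \<otimes>\<^bsub>free_alg\<^esub> f = (\<lambda>w. c * f w)"
  for f :: "gen list \<Rightarrow> 'k::field"
proof -
  interpret F: kalg "free_alg :: ('k, gen list \<Rightarrow> 'k) module" by (rule kalg_free)
  assume f: "f \<in> carrier free_alg"
  have "mon c [] = c \<odot>\<^bsub>free_alg\<^esub> (\<one>\<^bsub>free_alg\<^esub> :: gen list \<Rightarrow> 'k)" by (auto simp: free_ops mon_def)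
  have "mon c [] \<otimes>\<^bsub>free_alg\<^esub> f = c \<odot>\<^bsub>free_alg\<^esub> (\<one>\<^bsub>free_alg\<^esub> \<otimes>\<^bsub>free_alg\<^esub> f)"
    unfolding \<open>mon c [] = _\<close> by (rule F.sm_l[OF F.one_closed f])
  then show ?thesis unfolding F.l_one[OF f] by (simp add: free_ops(3))
qed

lemma zpoly_mult: "zpoly (d * e) = zpoly d \<otimes>\<^bsub>free_alg\<^esub> zpoly e" for d e :: "'k::field poly"
proof -
  interpret F: kalg "free_alg :: ('k, gen list \<Rightarrow> 'k) module" by (rule kalg_free)
  have g: "free_gen Z \<in> carrier (free_alg :: ('k, gen list \<Rightarrow> 'k) module)" by (simp add: free_ops(5))
  show ?thesis
  proof (induction d)
    case 0
    then show ?case using F.l_null[OF zpoly_free[of e]] by (simp add: zpoly_0 free_ops(2))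
  next
    case (pCons c d)
    have p: "zpoly (pCons c d) = mon c [] \<oplus>\<^bsub>free_alg\<^esub> (free_gen Z \<otimes>\<^bsub>free_alg\<^esub> zpoly d)" for c and d :: "'k poly"
      by (simp add: zpoly_pCons free_ops(1))
    have "zpoly (pCons c d * e) = (\<lambda>w. c * zpoly e w) \<oplus>\<^bsub>free_alg\<^esub> zpoly (pCons 0 (d * e))"
      by (simp add: zpoly_add zpoly_smult free_ops(1))
    also have "zpoly (pCons 0 (d * e)) = free_gen Z \<otimes>\<^bsub>free_alg\<^esub> zpoly (d * e)"
      by (auto simp: zpoly_pCons mon_def)
    also have "(\<lambda>w. c * zpoly e w) = mon c [] \<otimes>\<^bsub>free_alg\<^esub> zpoly e"
      by (simp add: free_mon_nil zpoly_free)
    finally show ?case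
      unfolding p pCons.IH using g by (simp add: F.l_distr F.m_assoc zpoly_free)
  qed
qed

lemma cl_rel:
  assumes "u \<ominus>\<^bsub>free_alg\<^esub> w \<in> gwa_relations a" "u \<in> carrier free_alg" "w \<in> carrier free_alg"
  shows "cl a u = cl a w"
  using cl_eq_iff[OF assms(2,3)] assms(1) ring.genideal_self[OF ring_free_alg gwa_rel_carrier]
  unfolding gwa_ideal_def by blast

text \<open>
  The weight bound: a term \<open>z\<^sup>c\<close> at place \<open>i\<close> has weight \<open>2 c + n i\<close>, so that \<open>x\<close>, \<open>y\<close> and \<open>z\<close> raise weights
  by their filtration degrees.
\<close>

definition wle :: "nat \<Rightarrow> int \<Rightarrow> 'k::field vec \<Rightarrow> bool"
  where "wle n m v \<longleftrightarrow> (\<forall>i. v i \<noteq> 0 \<longrightarrow> 2 * int (Polynomial.degree (v i)) + int n * i \<le> m)"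

locale classical_gwa =
  fixes a :: "'k::field_char_0 poly"
  assumes monic: "lead_coeff a = 1" and deg: "Polynomial.degree a > 2"
begin

abbreviation "n \<equiv> Polynomial.degree a"
abbreviation "R \<equiv> gwa a"
abbreviation "F \<equiv> std_filtration a"
abbreviation "g \<equiv> gwa_gen a"

interpretation Fr: kalg "free_alg :: ('k, gen list \<Rightarrow> 'k) module" by (rule kalg_free)

sublocale R: kalg R by (rule kalg_gwa)

lemma gen_cl: "g v = cl a (free_gen v)"
  by (simp add: gwa_gen_def cl_def)

lemma fg: "free_gen v \<in> carrier (free_alg :: ('k, gen list \<Rightarrow> 'k) module)"
  by (simp add: free_ops(5))

lemmas gc [simp] = gen_closed[of a]

lemma rel:
  "g X \<otimes>\<^bsub>R\<^esub> g Y = pz a (sigma a)" "g Y \<otimes>\<^bsub>R\<^esub> g X = pz a a"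
  "g X \<otimes>\<^bsub>R\<^esub> pz a d = pz a (sigma d) \<otimes>\<^bsub>R\<^esub> g X" "g Y \<otimes>\<^bsub>R\<^esub> pz a d = pz a (sigma_inv d) \<otimes>\<^bsub>R\<^esub> g Y"
  unfolding gen_cl pz_def
  by (simp_all only: gwa_ops fg zpoly_free)
    (rule cl_rel; auto simp: gwa_relations_def Let_def fg zpoly_free)+

lemma pz_mult: "pz a (d * e) = pz a d \<otimes>\<^bsub>R\<^esub> pz a e"
  by (simp add: pz_def zpoly_mult gwa_ops zpoly_free)

lemma pz_add: "pz a (d + e) = pz a d \<oplus>\<^bsub>R\<^esub> pz a e"
  by (simp add: pz_def zpoly_add gwa_ops zpoly_free free_ops(1))

lemma pz_smult: "pz a (Polynomial.smult c d) = c \<odot>\<^bsub>R\<^esub> pz a d"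
  by (simp add: pz_def zpoly_smult gwa_ops zpoly_free free_ops(3))

lemma pz_0: "pz a 0 = \<zero>\<^bsub>R\<^esub>"
  by (simp add: pz_def zpoly_0 gwa_zero free_ops(2))

lemma pz_1: "pz a 1 = \<one>\<^bsub>R\<^esub>"
proof -
  have "zpoly (1 :: 'k poly) = \<one>\<^bsub>free_alg\<^esub>"
    by (auto simp: zpoly_def free_ops(4) mon_def coeff_1 set_subset_replicate)
  then show ?thesis by (simp add: pz_def gwa_one)
qed

lemma pz_Z: "pz a [:0, 1:] = g Z"
proof -
  have "zpoly [:0, 1 :: 'k:] = free_gen Z"
    by (rule ext) (auto simp: zpoly_def free_gen_def coeff_pCons set_subset_replicate length_Suc_conv split: nat.splits)
  then show ?thesis by (simp add: pz_def gen_cl)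
qed

text \<open>
  The power \<open>x\<^sup>i\<close>, read as \<open>y\<^bsup>- i\<^esup>\<close> for negative \<open>i\<close>.
\<close>

definition xp :: "int \<Rightarrow> (gen list \<Rightarrow> 'k) set"
  where "xp i = R.wd g (if 0 \<le> i then replicate (nat i) X else replicate (nat (- i)) Y)"

lemma xp_closed [simp]: "xp i \<in> carrier R"
  by (simp add: xp_def R.wd_closed)

lemma xp_0: "xp 0 = \<one>\<^bsub>R\<^esub>" by (simp add: xp_def)

lemma xp_up: "0 \<le> i \<Longrightarrow> xp (i + 1) = g X \<otimes>\<^bsub>R\<^esub> xp i"
  by (simp add: xp_def nat_add_distrib)

lemma xp_down: "i \<le> 0 \<Longrightarrow> xp (i - 1) = g Y \<otimes>\<^bsub>R\<^esub> xp i"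
proof -
  assume i: "i \<le> 0"
  then have "nat (- (i - 1)) = Suc (nat (- i))" by simp
  with i show ?thesis by (cases "i = 0") (simp_all add: xp_def)
qed

text \<open>
  Combinations of the normal forms \<open>d(z) x\<^sup>i\<close> and \<open>d(z) y\<^sup>i\<close> of weight at most \<open>m\<close>.
\<close>

inductive NF :: "int \<Rightarrow> (gen list \<Rightarrow> 'k) set \<Rightarrow> bool" where
  NF_zero: "NF m \<zero>\<^bsub>R\<^esub>"
| NF_term: "2 * int (Polynomial.degree d) + int n * \<bar>i\<bar> \<le> m \<Longrightarrow> NF m (pz a d \<otimes>\<^bsub>R\<^esub> xp i)"
| NF_add: "NF m r \<Longrightarrow> NF m s \<Longrightarrow> NF m (r \<oplus>\<^bsub>R\<^esub> s)"

lemma NF_closed: "NF m r \<Longrightarrow> r \<in> carrier R"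
  by (induction rule: NF.induct) auto

lemma NF_mono: "NF m r \<Longrightarrow> m \<le> m' \<Longrightarrow> NF m' r"
  by (induction rule: NF.induct) (auto intro: NF.intros)

lemma NF_smult: "NF m r \<Longrightarrow> NF m (c \<odot>\<^bsub>R\<^esub> r)"
proof (induction rule: NF.induct)
  case (NF_term d i m)
  have "NF m (pz a (Polynomial.smult c d) \<otimes>\<^bsub>R\<^esub> xp i)"
    by (rule NF.NF_term) (use NF_term degree_smult_le[of c d] in linarith)
  then show ?case by (simp add: pz_smult R.sm_l)
qed (auto simp: R.sm_add NF_closed intro: NF.intros)

lemma degree_sigma [simp]: "Polynomial.degree (sigma d) = Polynomial.degree d"
  "Polynomial.degree (sigma_inv d) = Polynomial.degree d" for d :: "'b::field poly"
  by (simp_all add: sigma_def sigma_inv_def degree_pcompose)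

lemma NF_X: "NF m r \<Longrightarrow> NF (m + int n) (g X \<otimes>\<^bsub>R\<^esub> r)"
proof (induction rule: NF.induct)
  case (NF_term d i m)
  have "g X \<otimes>\<^bsub>R\<^esub> (pz a d \<otimes>\<^bsub>R\<^esub> xp i) = pz a (sigma d) \<otimes>\<^bsub>R\<^esub> (g X \<otimes>\<^bsub>R\<^esub> xp i)"
    by (simp add: R.m_assoc[symmetric] rel)
  also have "NF (m + int n) \<dots>"
  proof (cases "0 \<le> i")
    case True
    have "NF (m + int n) (pz a (sigma d) \<otimes>\<^bsub>R\<^esub> xp (i + 1))"
      by (rule NF.NF_term) (use NF_term True in \<open>simp add: algebra_simps\<close>)
    then show ?thesis by (simp add: xp_up True)
  next
    case False
    have "xp i = g Y \<otimes>\<^bsub>R\<^esub> xp (i + 1)" using xp_down[of "i + 1"] False by simp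
    then have "pz a (sigma d) \<otimes>\<^bsub>R\<^esub> (g X \<otimes>\<^bsub>R\<^esub> xp i) = pz a (sigma d * sigma a) \<otimes>\<^bsub>R\<^esub> xp (i + 1)"
      by (simp add: R.m_assoc[symmetric] pz_mult) (simp add: R.m_assoc rel)
    moreover have "NF (m + int n) (pz a (sigma d * sigma a) \<otimes>\<^bsub>R\<^esub> xp (i + 1))"
      by (rule NF.NF_term)
        (use NF_term False degree_mult_le[of "sigma d" "sigma a"] in \<open>simp add: algebra_simps\<close>)
    ultimately show ?thesis by simp
  qed
  finally show ?case .
qed (auto simp: R.r_distr NF_closed intro: NF.intros)

lemma NF_Y: "NF m r \<Longrightarrow> NF (m + int n) (g Y \<otimes>\<^bsub>R\<^esub> r)"
proof (induction rule: NF.induct)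
  case (NF_term d i m)
  have "g Y \<otimes>\<^bsub>R\<^esub> (pz a d \<otimes>\<^bsub>R\<^esub> xp i) = pz a (sigma_inv d) \<otimes>\<^bsub>R\<^esub> (g Y \<otimes>\<^bsub>R\<^esub> xp i)"
    by (simp add: R.m_assoc[symmetric] rel)
  also have "NF (m + int n) \<dots>"
  proof (cases "i \<le> 0")
    case True
    have "NF (m + int n) (pz a (sigma_inv d) \<otimes>\<^bsub>R\<^esub> xp (i - 1))"
      by (rule NF.NF_term) (use NF_term True in \<open>simp add: algebra_simps\<close>)
    then show ?thesis by (simp add: xp_down True)
  next
    case False
    have "xp i = g X \<otimes>\<^bsub>R\<^esub> xp (i - 1)" using xp_up[of "i - 1"] False by simp
    then have "pz a (sigma_inv d) \<otimes>\<^bsub>R\<^esub> (g Y \<otimes>\<^bsub>R\<^esub> xp i) = pz a (sigma_inv d * a) \<otimes>\<^bsub>R\<^esub> xp (i - 1)"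
      by (simp add: R.m_assoc[symmetric] pz_mult) (simp add: R.m_assoc rel)
    moreover have "NF (m + int n) (pz a (sigma_inv d * a) \<otimes>\<^bsub>R\<^esub> xp (i - 1))"
      by (rule NF.NF_term)
        (use NF_term False degree_mult_le[of "sigma_inv d" a] in \<open>simp add: algebra_simps\<close>)
    ultimately show ?thesis by simp
  qed
  finally show ?case .
qed (auto simp: R.r_distr NF_closed intro: NF.intros)

lemma NF_Z: "NF m r \<Longrightarrow> NF (m + 2) (g Z \<otimes>\<^bsub>R\<^esub> r)"
proof (induction rule: NF.induct)
  case (NF_term d i m)
  have "g Z \<otimes>\<^bsub>R\<^esub> (pz a d \<otimes>\<^bsub>R\<^esub> xp i) = pz a ([:0, 1:] * d) \<otimes>\<^bsub>R\<^esub> xp i"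
    by (simp only: pz_mult pz_Z R.m_assoc[OF gc pz_closed xp_closed])
  moreover have "NF (m + 2) (pz a ([:0, 1:] * d) \<otimes>\<^bsub>R\<^esub> xp i)"
    by (rule NF.NF_term) (use NF_term degree_mult_le[of "[:0, 1:]" d] in \<open>simp del: mult_pCons_left\<close>)
  ultimately show ?case by (simp only:)
qed (auto simp: R.r_distr NF_closed intro: NF.intros)

definition wt :: "gen list \<Rightarrow> int" where "wt w = int (sum_list (map (gen_weight n) w))"

lemma wt_simps [simp]: "wt [] = 0" "wt (v # w) = int (gen_weight n v) + wt w" "wt (u @ w) = wt u + wt w"
  by (simp_all add: wt_def)

lemma wt_nonneg: "0 \<le> wt w" by (simp add: wt_def)

lemma wt_Z: "set w \<subseteq> {Z} \<Longrightarrow> wt w = 2 * int (length w)"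
  by (induction w) auto

lemma NF_word: "NF (wt w) (R.wd g w)"
proof (induction w)
  case Nil
  have "NF 0 (pz a 1 \<otimes>\<^bsub>R\<^esub> xp 0)" by (rule NF.NF_term) simp
  then show ?case by (simp add: pz_1 xp_0)
next
  case (Cons v w)
  show ?case using NF_X[OF Cons.IH] NF_Y[OF Cons.IH] NF_Z[OF Cons.IH] by (cases v) (simp_all add: add.commute[of _ "wt w"])
qed

lemma F_def': "F m = {cl a f | f. f \<in> carrier free_alg \<and> (\<forall>w. f w \<noteq> 0 \<longrightarrow> wt w \<le> m)}"
  by (simp add: std_filtration_def cl_def wt_def)

lemma F_add: "r \<in> F m \<Longrightarrow> s \<in> F m \<Longrightarrow> r \<oplus>\<^bsub>R\<^esub> s \<in> F m"
proof -
  assume "r \<in> F m" "s \<in> F m"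
  then obtain f h where fh: "f \<in> carrier free_alg" "\<forall>w. f w \<noteq> 0 \<longrightarrow> wt w \<le> m" "r = cl a f"
    "h \<in> carrier free_alg" "\<forall>w. h w \<noteq> 0 \<longrightarrow> wt w \<le> m" "s = cl a h"
    unfolding F_def' by blast
  have "\<forall>w. f w + h w \<noteq> 0 \<longrightarrow> wt w \<le> m" using fh(2,5) by (metis add.right_neutral)
  then show ?thesis
    unfolding F_def' using fh free_add_closed[OF fh(1,4)]
    by (auto simp: gwa_ops free_ops(1) intro!: exI[of _ "\<lambda>w. f w + h w"])
qed

lemma F_word: "wt w \<le> m \<Longrightarrow> c \<odot>\<^bsub>R\<^esub> R.wd g w \<in> F m"
proof -
  assume w: "wt w \<le> m"
  have "c \<odot>\<^bsub>R\<^esub> R.wd g w = cl a (mon c w)"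
    using R.free_eval_mon[where h = g and c = c and w = w, OF gc] free_eval_gwa[of "mon c w" a, OF mon_free]
    by (simp only:)
  moreover have "\<forall>u. mon c w u \<noteq> 0 \<longrightarrow> wt u \<le> m" using w by (simp add: mon_def)
  ultimately show ?thesis unfolding F_def' using mon_free by blast
qed

lemma F_zero: "\<zero>\<^bsub>R\<^esub> \<in> F m"
proof -
  have "\<zero>\<^bsub>R\<^esub> = cl a (mon 0 [])" by (simp add: gwa_zero free_ops(2) mon_def)
  moreover have "\<forall>u. mon (0 :: 'k) [] u \<noteq> 0 \<longrightarrow> wt u \<le> m" by (simp add: mon_def)
  ultimately show ?thesis unfolding F_def' using mon_free by blast
qed

lemma F_induct [consumes 1, case_names zero word add]:
  assumes r: "r \<in> F m" and z: "P \<zero>\<^bsub>R\<^esub>"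
    and wd: "\<And>c w. wt w \<le> m \<Longrightarrow> P (c \<odot>\<^bsub>R\<^esub> R.wd g w)"
    and ad: "\<And>u v. u \<in> F m \<Longrightarrow> v \<in> F m \<Longrightarrow> P u \<Longrightarrow> P v \<Longrightarrow> P (u \<oplus>\<^bsub>R\<^esub> v)"
  shows "P r"
proof -
  obtain f where f: "f \<in> carrier free_alg" "\<And>w. f w \<noteq> 0 \<Longrightarrow> wt w \<le> m" "r = cl a f"
    using r unfolding F_def' by blast
  have "P (\<Oplus>\<^bsub>R\<^esub>w\<in>S. f w \<odot>\<^bsub>R\<^esub> R.wd g w) \<and> (\<Oplus>\<^bsub>R\<^esub>w\<in>S. f w \<odot>\<^bsub>R\<^esub> R.wd g w) \<in> F m"
    if "finite S" "S \<subseteq> {w. f w \<noteq> 0}" for S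
    using that
  proof (induction S)
    case (insert w S)
    then have "wt w \<le> m" using f(2)[of w] by auto
    then have 1: "P (f w \<odot>\<^bsub>R\<^esub> R.wd g w)" "f w \<odot>\<^bsub>R\<^esub> R.wd g w \<in> F m" using wd F_word by blast+
    have "(\<Oplus>\<^bsub>R\<^esub>w\<in>insert w S. f w \<odot>\<^bsub>R\<^esub> R.wd g w) = f w \<odot>\<^bsub>R\<^esub> R.wd g w \<oplus>\<^bsub>R\<^esub> (\<Oplus>\<^bsub>R\<^esub>w\<in>S. f w \<odot>\<^bsub>R\<^esub> R.wd g w)"
      using insert.hyps by (intro R.finsum_insert) (auto simp: R.wd_closed)
    moreover have "P (\<Oplus>\<^bsub>R\<^esub>w\<in>S. f w \<odot>\<^bsub>R\<^esub> R.wd g w)" "(\<Oplus>\<^bsub>R\<^esub>w\<in>S. f w \<odot>\<^bsub>R\<^esub> R.wd g w) \<in> F m"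
      using insert by blast+
    ultimately show ?case using ad[OF 1(2) _ 1(1)] F_add[OF 1(2)] by simp
  qed (simp add: z F_zero)
  from this[of "{w. f w \<noteq> 0}"] f show "P r"
    using free_eval_gwa[OF f(1), of a] by (simp add: free_eval_def R.wd_def[symmetric] free_alg_def)
qed

text \<open>
  Left multiplication by a generator turns normal forms into normal forms and raises the weight by the
  degree of the generator, hence every word is a combination of normal forms of at most its weight.
\<close>

lemma F_eq_NF: "r \<in> F m \<longleftrightarrow> NF m r"
proof
  assume "r \<in> F m"
  then show "NF m r"
  proof (induction rule: F_induct)
    case (word c w)
    then show ?case by (rule NF_smult[OF NF_mono[OF NF_word]])
  qed (auto intro: NF.intros)
next
  assume "NF m r"
  then show "r \<in> F m"
  proof (induction rule: NF.induct)
    case (NF_zero m)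
    then show ?case by (rule F_zero)
  next
    case (NF_term d i m)
    define u where "u = (if 0 \<le> i then replicate (nat i) X else replicate (nat (- i)) Y)"
    have wu: "wt u = int n * \<bar>i\<bar>" by (simp add: u_def wt_def sum_list_replicate)
    have w: "R.wd g w = cl a (mon 1 w)" for w
      using R.free_eval_mon[where h = g and c = 1 and w = w] free_eval_gwa[of "mon 1 w" a] by (simp add: R.sm_one R.wd_closed)
    have "pz a d \<otimes>\<^bsub>R\<^esub> xp i = cl a (zpoly d \<otimes>\<^bsub>free_alg\<^esub> mon 1 u)"
      by (simp add: xp_def w pz_def gwa_ops zpoly_free flip: u_def)
    moreover have "wt w \<le> m" if nz: "(zpoly d \<otimes>\<^bsub>free_alg\<^esub> mon 1 u) w \<noteq> 0" for w
    proof -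
      have "(\<Sum>k\<le>length w. zpoly d (take k w) * mon 1 u (drop k w)) \<noteq> 0"
        using nz by (simp add: free_alg_def)
      then obtain k where k: "zpoly d (take k w) * mon 1 u (drop k w) \<noteq> 0"
        by (auto elim: sum.not_neutral_contains_not_neutral)
      then have "drop k w = u" "set (take k w) \<subseteq> {Z}" "length (take k w) \<le> Polynomial.degree d"
        by (auto simp: mon_def zpoly_def le_degree split: if_splits)
      moreover have "wt (take k w) = 2 * int (length (take k w))" if "set (take k w) \<subseteq> {Z}"
        using wt_Z[OF that] .
      ultimately show ?thesis
        using NF_term wu append_take_drop_id[of k w] wt_simps(3)[of "take k w" "drop k w"] by simp
    qed
    ultimately show ?case
      unfolding F_def' by (auto intro!: exI[of _ "zpoly d \<otimes>\<^bsub>free_alg\<^esub> mon 1 u"] simp: zpoly_free)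
  qed (rule F_add)
qed

section \<open>The symbol map\<close>

lemma ev_add: "r \<in> carrier R \<Longrightarrow> s \<in> carrier R \<Longrightarrow> ev a (r \<oplus>\<^bsub>R\<^esub> s) = (\<lambda>i. ev a r i + ev a s i)"
  and ev_smult: "r \<in> carrier R \<Longrightarrow> ev a (c \<odot>\<^bsub>R\<^esub> r) = (\<lambda>i. Polynomial.smult c (ev a r i))"
  and ev_mult: "r \<in> carrier R \<Longrightarrow> s \<in> carrier R \<Longrightarrow> ev a (r \<otimes>\<^bsub>R\<^esub> s) = rp a r (ev a s)"
  and ev_zero: "ev a \<zero>\<^bsub>R\<^esub> = (\<lambda>i. 0)"
  and ev_one: "ev a \<one>\<^bsub>R\<^esub> = (\<lambda>i. if i = 0 then 1 else 0)"
  using rp_hom(2)[of r a s] rp_hom(4)[of r a r c] rp_hom(3)[of r a s] rp_hom(7)[of "\<one>\<^bsub>R\<^esub>" a "\<one>\<^bsub>R\<^esub>"] rp_hom(5)[of "\<one>\<^bsub>R\<^esub>" a "\<one>\<^bsub>R\<^esub>"]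
  by (simp_all add: ev_def)

lemma rp_gen: "rp a (g v) = act a v"
  using rp_hom(6)[of "\<one>\<^bsub>R\<^esub>" a "\<one>\<^bsub>R\<^esub>" v] by simp

text \<open>The coefficient of \<open>y\<^sup>k\<close> applied to the basis vector at place zero.\<close>

fun om :: "nat \<Rightarrow> 'k poly" where
  "om 0 = 1"
| "om (Suc k) = (a \<circ>\<^sub>p shift (- 1 - int k)) * om k"

definition omega :: "int \<Rightarrow> 'k poly" where "omega i = (if 0 \<le> i then 1 else om (nat (- i)))"

lemma ev_xp: "ev a (xp i) = (\<lambda>j. if j = i then omega i else 0)"
proof -
  have up: "ev a (xp (int k)) = (\<lambda>j. if j = int k then 1 else 0)" for k
  proof (induction k)
    case (Suc k)
    have "xp (int (Suc k)) = g X \<otimes>\<^bsub>R\<^esub> xp (int k)" using xp_up[of "int k"] by (simp add: add.commute)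
    then show ?case using Suc by (auto simp: ev_mult rp_gen fun_eq_iff)
  qed (simp add: xp_0 ev_one)
  have down: "ev a (xp (- int k)) = (\<lambda>j. if j = - int k then om k else 0)" for k
  proof (induction k)
    case (Suc k)
    have "xp (- int (Suc k)) = g Y \<otimes>\<^bsub>R\<^esub> xp (- int k)" using xp_down[of "- int k"] by (simp add: minus_diff_commute)
    then have "ev a (xp (- int (Suc k))) = act a Y (\<lambda>j. if j = - int k then om k else 0)"
      using Suc by (simp add: ev_mult rp_gen)
    moreover have "j + 1 = - int k \<longleftrightarrow> j = - 1 - int k" "- int (Suc k) = - 1 - int k" for j by auto
    ultimately show ?case by (simp add: fun_eq_iff)
  qed (simp add: xp_0 ev_one cong: if_cong)
  show ?thesis
  proof (cases "0 \<le> i")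
    case True
    then show ?thesis using up[of "nat i"] by (simp add: omega_def cong: if_cong)
  next
    case False
    then show ?thesis using down[of "nat (- i)"] by (simp add: omega_def cong: if_cong)
  qed
qed

lemma degree_shift [simp]: "Polynomial.degree (shift i :: 'k poly) = 1"
  by (simp add: shift_def)

lemma degree_pcompose_shift [simp]: "Polynomial.degree (p \<circ>\<^sub>p shift i) = Polynomial.degree p" for p :: "'k poly"
  by (simp add: degree_pcompose)

lemma pcompose_shift_nz: "p \<circ>\<^sub>p shift i = 0 \<longleftrightarrow> p = 0" for p :: "'k poly"
  using pcompose_eq_0[of p "shift i"] by auto

lemma omega_props: "omega i \<noteq> 0" "2 * int (Polynomial.degree (omega i)) + int n * i = int n * \<bar>i\<bar>"
proof -
  have a0: "a \<noteq> 0" using monic by auto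
  have om: "om k \<noteq> 0 \<and> Polynomial.degree (om k) = n * k" for k
    by (induction k) (auto simp: pcompose_shift_nz a0 degree_mult_eq)
  then show "omega i \<noteq> 0" by (simp add: omega_def)
  show "2 * int (Polynomial.degree (omega i)) + int n * i = int n * \<bar>i\<bar>"
    using om by (simp add: omega_def algebra_simps)
qed

text \<open>
  Different normal forms are moved to different places by the representation, so their coefficients
  can be read off; this is the PBW theorem in the form needed here.
\<close>

lemma NF_coeffs:
  assumes "NF m r"
  obtains P where "\<And>i. P i \<noteq> 0 \<Longrightarrow> 2 * int (Polynomial.degree (P i)) + int n * \<bar>i\<bar> \<le> m"
    "ev a r = (\<lambda>i. (P i \<circ>\<^sub>p shift i) * omega i)"
    "\<And>M. m \<le> int n * M \<Longrightarrow> r = (\<Oplus>\<^bsub>R\<^esub>i\<in>{- M..M}. pz a (P i) \<otimes>\<^bsub>R\<^esub> xp i)"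
proof -
  have "\<exists>P. (\<forall>i. P i \<noteq> 0 \<longrightarrow> 2 * int (Polynomial.degree (P i)) + int n * \<bar>i\<bar> \<le> m) \<and>
      ev a r = (\<lambda>i. (P i \<circ>\<^sub>p shift i) * omega i) \<and>
      (\<forall>M. m \<le> int n * M \<longrightarrow> r = (\<Oplus>\<^bsub>R\<^esub>i\<in>{- M..M}. pz a (P i) \<otimes>\<^bsub>R\<^esub> xp i))"
    using assms
  proof (induction rule: NF.induct)
    case (NF_zero m)
    then show ?case by (intro exI[of _ "\<lambda>i. 0"]) (simp add: ev_zero pz_0)
  next
    case (NF_term d j m)
    let ?P = "\<lambda>i. if i = j then d else 0"
    have "pz a d \<otimes>\<^bsub>R\<^esub> xp j = (\<Oplus>\<^bsub>R\<^esub>i\<in>{- M..M}. pz a (?P i) \<otimes>\<^bsub>R\<^esub> xp i)" if M: "m \<le> int n * M" for M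
    proof -
      have "int n * \<bar>j\<bar> \<le> int n * M" using NF_term M by linarith
      then have "\<bar>j\<bar> \<le> M" using deg by simp
      then have j: "j \<in> {- M..M}" by auto
      have "(\<Oplus>\<^bsub>R\<^esub>i\<in>{- M..M}. pz a (?P i) \<otimes>\<^bsub>R\<^esub> xp i) = (\<Oplus>\<^bsub>R\<^esub>i\<in>{- M..M}. if j = i then pz a d \<otimes>\<^bsub>R\<^esub> xp i else \<zero>\<^bsub>R\<^esub>)"
        by (rule R.finsum_cong') (auto simp: pz_0)
      then show ?thesis using R.finsum_singleton[OF j, of "\<lambda>i. pz a d \<otimes>\<^bsub>R\<^esub> xp i"] by simp
    qed
    moreover have "ev a (pz a d \<otimes>\<^bsub>R\<^esub> xp j) = (\<lambda>i. (?P i \<circ>\<^sub>p shift i) * omega i)"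
      by (auto simp: ev_mult rp_pz ev_xp fun_eq_iff)
    ultimately show ?case using NF_term by (intro exI[of _ ?P]) auto
  next
    case (NF_add m r s)
    then obtain P Q where P: "\<forall>i. P i \<noteq> 0 \<longrightarrow> 2 * int (Polynomial.degree (P i)) + int n * \<bar>i\<bar> \<le> m"
        "ev a r = (\<lambda>i. (P i \<circ>\<^sub>p shift i) * omega i)"
        "\<forall>M. m \<le> int n * M \<longrightarrow> r = (\<Oplus>\<^bsub>R\<^esub>i\<in>{- M..M}. pz a (P i) \<otimes>\<^bsub>R\<^esub> xp i)"
      and Q: "\<forall>i. Q i \<noteq> 0 \<longrightarrow> 2 * int (Polynomial.degree (Q i)) + int n * \<bar>i\<bar> \<le> m"
        "ev a s = (\<lambda>i. (Q i \<circ>\<^sub>p shift i) * omega i)"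
        "\<forall>M. m \<le> int n * M \<longrightarrow> s = (\<Oplus>\<^bsub>R\<^esub>i\<in>{- M..M}. pz a (Q i) \<otimes>\<^bsub>R\<^esub> xp i)"
      by blast
    have "2 * int (Polynomial.degree (P i + Q i)) + int n * \<bar>i\<bar> \<le> m" if "P i + Q i \<noteq> 0" for i
    proof (cases "P i = 0 \<or> Q i = 0")
      case True
      then show ?thesis using that P(1)[rule_format, of i] Q(1)[rule_format, of i] by auto
    next
      case False
      then show ?thesis
        using P(1)[rule_format, of i] Q(1)[rule_format, of i] degree_add_le_max[of "P i" "Q i"] by auto
    qed
    moreover have "r \<oplus>\<^bsub>R\<^esub> s = (\<Oplus>\<^bsub>R\<^esub>i\<in>{- M..M}. pz a (P i + Q i) \<otimes>\<^bsub>R\<^esub> xp i)" if "m \<le> int n * M" for M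
    proof -
      have "r \<oplus>\<^bsub>R\<^esub> s = (\<Oplus>\<^bsub>R\<^esub>i\<in>{- M..M}. pz a (P i) \<otimes>\<^bsub>R\<^esub> xp i) \<oplus>\<^bsub>R\<^esub> (\<Oplus>\<^bsub>R\<^esub>i\<in>{- M..M}. pz a (Q i) \<otimes>\<^bsub>R\<^esub> xp i)"
        using P(3)[rule_format, OF that] Q(3)[rule_format, OF that] by (simp only:)
      also have "\<dots> = (\<Oplus>\<^bsub>R\<^esub>i\<in>{- M..M}. pz a (P i) \<otimes>\<^bsub>R\<^esub> xp i \<oplus>\<^bsub>R\<^esub> pz a (Q i) \<otimes>\<^bsub>R\<^esub> xp i)"
        by (rule R.finsum_addf[symmetric]) auto
      also have "\<dots> = (\<Oplus>\<^bsub>R\<^esub>i\<in>{- M..M}. pz a (P i + Q i) \<otimes>\<^bsub>R\<^esub> xp i)"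
        by (rule R.finsum_cong') (auto simp: pz_add R.l_distr)
      finally show ?thesis .
    qed
    moreover have "ev a (r \<oplus>\<^bsub>R\<^esub> s) = (\<lambda>i. ((P i + Q i) \<circ>\<^sub>p shift i) * omega i)"
      using NF_closed[OF NF_add.hyps(1)] NF_closed[OF NF_add.hyps(2)]
      by (simp add: ev_add P(2) Q(2) pcompose_add distrib_right)
    ultimately show ?case by (intro exI[of _ "\<lambda>i. P i + Q i"]) auto
  qed
  then show ?thesis using that by blast
qed

lemma deg_coeff: "P \<noteq> 0 \<Longrightarrow> 2 * int (Polynomial.degree ((P \<circ>\<^sub>p shift i) * omega i)) + int n * i
    = 2 * int (Polynomial.degree P) + int n * \<bar>i\<bar>"
  using omega_props[of i] by (simp add: degree_mult_eq pcompose_shift_nz)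

lemma F_wle: "r \<in> F m \<Longrightarrow> wle n m (ev a r)" (is "_ \<Longrightarrow> ?W")
  and F_finite: "r \<in> F m \<Longrightarrow> finite {i. ev a r i \<noteq> 0}" (is "_ \<Longrightarrow> ?F")
proof -
  have "?W \<and> ?F" if "r \<in> F m"
  proof -
  have "NF m r" using that by (simp add: F_eq_NF)
  then obtain P where P: "\<And>i. P i \<noteq> 0 \<Longrightarrow> 2 * int (Polynomial.degree (P i)) + int n * \<bar>i\<bar> \<le> m"
    "ev a r = (\<lambda>i. (P i \<circ>\<^sub>p shift i) * omega i)" by (rule NF_coeffs) blast
  have "wle n m (ev a r)"
    unfolding wle_def
  proof (intro allI impI)
    fix i assume "ev a r i \<noteq> 0"
    then have "P i \<noteq> 0" by (auto simp: P(2))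
    then show "2 * int (Polynomial.degree (ev a r i)) + int n * i \<le> m"
      using P(1)[of i] deg_coeff[of "P i" i] by (simp add: P(2))
  qed
  have "i \<in> {- \<bar>m\<bar>..\<bar>m\<bar>}" if "ev a r i \<noteq> 0" for i
  proof -
    have "P i \<noteq> 0" using that by (auto simp: P(2))
    then have "int n * \<bar>i\<bar> \<le> m" using P(1)[of i] by linarith
    moreover have "\<bar>i\<bar> \<le> int n * \<bar>i\<bar>" using deg mult_right_mono[of 1 "int n" "\<bar>i\<bar>"] by simp
    ultimately show ?thesis by auto
  qed
  then have "finite {i. ev a r i \<noteq> 0}" by (rule finite_subset[OF subsetI finite_atLeastAtMost_int[of "- \<bar>m\<bar>" "\<bar>m\<bar>"]]) auto
  with \<open>wle n m (ev a r)\<close> show ?thesis by blast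
  qed
  then show "r \<in> F m \<Longrightarrow> ?W" "r \<in> F m \<Longrightarrow> ?F" by blast+
qed

text \<open>
  The filtration is determined by weights in the representation: no cancellation between different
  normal forms can lower the weight.
\<close>

lemma wle_F:
  assumes "r \<in> F m" "wle n m' (ev a r)"
  shows "r \<in> F m'"
proof -
  have "NF m r" using assms(1) by (simp add: F_eq_NF)
  then obtain P where P: "\<And>i. P i \<noteq> 0 \<Longrightarrow> 2 * int (Polynomial.degree (P i)) + int n * \<bar>i\<bar> \<le> m"
    "ev a r = (\<lambda>i. (P i \<circ>\<^sub>p shift i) * omega i)"
    "\<And>M. m \<le> int n * M \<Longrightarrow> r = (\<Oplus>\<^bsub>R\<^esub>i\<in>{- M..M}. pz a (P i) \<otimes>\<^bsub>R\<^esub> xp i)" by (rule NF_coeffs) blast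
  have t: "NF m' (pz a (P i) \<otimes>\<^bsub>R\<^esub> xp i)" for i
  proof (cases "P i = 0")
    case False
    then have "ev a r i \<noteq> 0" using omega_props(1)[of i] by (simp add: P(2) pcompose_shift_nz)
    then show ?thesis
      using assms(2)[unfolded wle_def, rule_format, of i] deg_coeff[OF False, of i]
      by (intro NF_term) (simp add: P(2))
  qed (simp add: pz_0 NF_zero)
  have "NF m' (\<Oplus>\<^bsub>R\<^esub>i\<in>S. pz a (P i) \<otimes>\<^bsub>R\<^esub> xp i)" if "finite S" for S
    using that
  proof (induction S)
    case (insert i S)
    then show ?case by (subst R.finsum_insert) (auto intro: NF_add t)
  qed (simp add: NF_zero)
  moreover have "m \<le> int n * \<bar>m\<bar>" using deg mult_right_mono[of 1 "int n" "\<bar>m\<bar>"] by simp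
  ultimately show ?thesis using P(3)[of "\<bar>m\<bar>"] by (simp add: F_eq_NF)
qed

lemma F_neg: "m < 0 \<Longrightarrow> F m = {\<zero>\<^bsub>R\<^esub>}"
proof -
  assume m: "m < 0"
  have "r = \<zero>\<^bsub>R\<^esub>" if "NF m r" for r
    using that m
  proof (induction rule: NF.induct)
    case (NF_term d i m)
    have "0 \<le> int n * \<bar>i\<bar>" by simp
    with NF_term show ?case by linarith
  qed simp_all
  then have "r \<in> F m \<longleftrightarrow> r = \<zero>\<^bsub>R\<^esub>" for r using NF_zero[of m] unfolding F_eq_NF by metis
  then show ?thesis by blast
qed

lemma F_carrier: "F m \<subseteq> carrier R"
  by (auto simp: F_eq_NF NF_closed)

lemma F_mono: "m \<le> m' \<Longrightarrow> F m \<subseteq> F m'"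
  by (auto simp: F_eq_NF NF_mono)

lemma F_exhaust: "r \<in> carrier R \<Longrightarrow> \<exists>k. r \<in> F (int k)"
proof -
  assume "r \<in> carrier R"
  then obtain f where f: "f \<in> carrier free_alg" "r = cl a f" by (auto simp: gwa_carrier)
  then have fin: "finite {w. f w \<noteq> 0}" by (simp add: free_alg_def)
  have "wt w \<le> int (nat (\<Sum>w\<in>{w. f w \<noteq> 0}. wt w))" if "f w \<noteq> 0" for w
    using member_le_sum[of w "{w. f w \<noteq> 0}" wt] that fin wt_nonneg by (simp add: sum_nonneg)
  then have "r \<in> F (int (nat (\<Sum>w\<in>{w. f w \<noteq> 0}. wt w)))"
    unfolding F_def' using f by (intro CollectI exI[of _ f] conjI) blast+
  then show ?thesis ..
qed

lemma ev_zero_iff: "r \<in> carrier R \<Longrightarrow> ev a r = (\<lambda>i. 0) \<Longrightarrow> r = \<zero>\<^bsub>R\<^esub>"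
proof -
  assume r: "r \<in> carrier R" "ev a r = (\<lambda>i. 0)"
  obtain k where "r \<in> F (int k)" using F_exhaust[OF r(1)] by blast
  then have "r \<in> F (- 1)" by (rule wle_F) (simp add: r(2) wle_def)
  then show ?thesis using F_neg[of "- 1"] by simp
qed

lemma ev_inj: "r \<in> carrier R \<Longrightarrow> s \<in> carrier R \<Longrightarrow> ev a r = ev a s \<Longrightarrow> r = s"
proof -
  assume rs: "r \<in> carrier R" "s \<in> carrier R" "ev a r = ev a s"
  have c: "r \<ominus>\<^bsub>R\<^esub> s \<in> carrier R" using rs by simp
  have "(r \<ominus>\<^bsub>R\<^esub> s) \<oplus>\<^bsub>R\<^esub> s = r" using rs by (simp add: a_minus_def R.a_assoc R.l_neg)
  then have "(\<lambda>i. ev a (r \<ominus>\<^bsub>R\<^esub> s) i + ev a s i) = ev a s" using ev_add[OF c rs(2)] rs(3) by simp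
  then have "ev a (r \<ominus>\<^bsub>R\<^esub> s) = (\<lambda>i. 0)" by (simp add: fun_eq_iff)
  from ev_zero_iff[OF c this] show ?thesis using R.minus_zero_iff[OF rs(1,2)] by simp
qed

end

section \<open>Principal symbols\<close>

abbreviation fin :: "'k::field vec \<Rightarrow> bool" where "fin v \<equiv> finite {i. v i \<noteq> 0}"

text \<open>
  The terms of weight exactly \<open>d\<close>, encoded as monomials: \<open>z\<^sup>c\<close> at place \<open>i\<close> becomes the exponent
  \<open>(c, c + n i)\<close>, which corresponds to \<open>z\<^sup>c x\<^sup>i\<close> in \<open>sing n\<close>.
\<close>

definition symb :: "nat \<Rightarrow> int \<Rightarrow> 'k::field vec \<Rightarrow> 'k laurent"
  where "symb n d v = Abs_poly_mapping (\<lambda>(p, q).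
    if p + q = d \<and> 0 \<le> p \<and> int n dvd q - p then poly.coeff (v ((q - p) div int n)) (nat p) else 0)"

lemma lcoeff_symb:
  assumes v: "fin v" and n: "n > 0"
  shows "lcoeff (symb n d v) (p, q)
    = (if p + q = d \<and> 0 \<le> p \<and> int n dvd q - p then poly.coeff (v ((q - p) div int n)) (nat p) else 0)"
proof -
  let ?f = "\<lambda>(p, q). if p + q = d \<and> 0 \<le> p \<and> int n dvd q - p then poly.coeff (v ((q - p) div int n)) (nat p) else 0"
  let ?S = "SIGMA i:{i. v i \<noteq> 0}. {..Polynomial.degree (v i)}"
  have "{k. ?f k \<noteq> 0} \<subseteq> (\<lambda>(i, j). (int j, int j + int n * i)) ` ?S"
  proof
    fix k :: "int \<times> int" assume "k \<in> {k. ?f k \<noteq> 0}"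
    moreover obtain p q where k: "k = (p, q)" by (cases k)
    ultimately have h: "0 \<le> p" "int n dvd q - p" "poly.coeff (v ((q - p) div int n)) (nat p) \<noteq> 0"
      by (auto split: if_splits)
    then have "((q - p) div int n, nat p) \<in> ?S" by (auto intro: le_degree)
    moreover have "k = (\<lambda>(i, j). (int j, int j + int n * i)) ((q - p) div int n, nat p)"
      using h(1,2) k by simp
    ultimately show "k \<in> (\<lambda>(i, j). (int j, int j + int n * i)) ` ?S" by (rule rev_image_eqI)
  qed
  moreover have "finite ((\<lambda>(i, j). (int j, int j + int n * i)) ` ?S)" using v by (intro finite_imageI finite_SigmaI) auto
  ultimately have "finite {k. ?f k \<noteq> 0}" by (rule finite_subset)
  then show ?thesis unfolding symb_def by simp
qed

lemma lcoeff_symb':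
  assumes "fin v" "n > 0"
  shows "lcoeff (symb n d v) (p, p + int n * i) = (if 2 * p + int n * i = d \<and> 0 \<le> p then poly.coeff (v i) (nat p) else 0)"
  using assms(2) by (simp add: lcoeff_symb[OF assms])

lemma symb_eqI:
  assumes v: "fin v" "n > 0"
    and 1: "\<And>p i. lcoeff t (p, p + int n * i) = (if 2 * p + int n * i = d \<and> 0 \<le> p then poly.coeff (v i) (nat p) else 0)"
    and 2: "\<And>p q. \<not> int n dvd q - p \<Longrightarrow> lcoeff t (p, q) = 0"
  shows "symb n d v = t"
proof (rule laurent_eqI)
  fix p q
  show "lcoeff (symb n d v) (p, q) = lcoeff t (p, q)"
  proof (cases "int n dvd q - p")
    case True
    then obtain i where "q - p = int n * i" by (rule dvdE)
    then have "q = p + int n * i" by simp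
    then show ?thesis by (simp only: lcoeff_symb'[OF v] 1)
  qed (simp add: lcoeff_symb[OF v] 2)
qed

lemma symb_nondvd: "fin v \<Longrightarrow> n > 0 \<Longrightarrow> \<not> int n dvd q - p \<Longrightarrow> lcoeff (symb n d v) (p, q) = 0"
  by (simp add: lcoeff_symb)

lemma coeff_mult_top:
  assumes "Polynomial.degree A \<le> N" "Polynomial.degree B \<le> M"
  shows "poly.coeff (A * B) (N + M) = poly.coeff A N * poly.coeff B M"
proof -
  have "poly.coeff (A * B) (N + M) = (\<Sum>i\<le>N + M. if i = N then poly.coeff A N * poly.coeff B M else 0)"
    unfolding coeff_mult
  proof (rule sum.cong[OF refl])
    fix i
    show "poly.coeff A i * poly.coeff B (N + M - i) = (if i = N then poly.coeff A N * poly.coeff B M else 0)"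
    proof (cases "i < N")
      case True
      then have "poly.coeff B (N + M - i) = 0" using assms(2) by (intro coeff_eq_0) auto
      with True show ?thesis by simp
    next
      case False
      have "poly.coeff A i = 0" if "i \<noteq> N" using False that assms(1) by (intro coeff_eq_0) auto
      then show ?thesis by auto
    qed
  qed
  then show ?thesis by simp
qed

lemma fin_add: "fin u \<Longrightarrow> fin v \<Longrightarrow> fin (\<lambda>i. u i + v i)"
  by (rule finite_subset[of _ "{i. u i \<noteq> 0} \<union> {i. v i \<noteq> 0}"]) auto

lemma fin_smult: "fin v \<Longrightarrow> fin (\<lambda>i. Polynomial.smult c (v i))"
  by (rule finite_subset[of _ "{i. v i \<noteq> 0}"]) auto

lemma wle_add: "wle n d u \<Longrightarrow> wle n d v \<Longrightarrow> wle n d (\<lambda>i. u i + v i)"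
  unfolding wle_def
proof (intro allI impI)
  fix i
  assume h: "\<forall>i. u i \<noteq> 0 \<longrightarrow> 2 * int (Polynomial.degree (u i)) + int n * i \<le> d"
    "\<forall>i. v i \<noteq> 0 \<longrightarrow> 2 * int (Polynomial.degree (v i)) + int n * i \<le> d" "u i + v i \<noteq> 0"
  show "2 * int (Polynomial.degree (u i + v i)) + int n * i \<le> d"
  proof (cases "u i = 0 \<or> v i = 0")
    case True
    then show ?thesis using h by auto
  next
    case False
    then show ?thesis using h(1)[rule_format, of i] h(2)[rule_format, of i] degree_add_le_max[of "u i" "v i"] by auto
  qed
qed

lemma wle_smult: "wle n d v \<Longrightarrow> wle n d (\<lambda>i. Polynomial.smult c (v i))"
  unfolding wle_def using degree_smult_le[of c] by (auto simp: degree_smult_eq)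

lemma symb_add: "fin u \<Longrightarrow> fin v \<Longrightarrow> n > 0 \<Longrightarrow> symb n d (\<lambda>i. u i + v i) = symb n d u + symb n d v"
  by (intro symb_eqI fin_add) (simp_all add: lookup_add lcoeff_symb' symb_nondvd)

lemma symb_smult: "fin v \<Longrightarrow> n > 0 \<Longrightarrow> symb n d (\<lambda>i. Polynomial.smult c (v i)) = scale c (symb n d v)"
  by (intro symb_eqI fin_smult) (simp_all add: lcoeff_symb' symb_nondvd)

lemma symb_high:
  assumes "fin v" "n > 0" "wle n d v" "d < m"
  shows "symb n m v = 0"
proof (rule symb_eqI[OF assms(1,2)])
  fix p i
  show "lcoeff 0 (p, p + int n * i) = (if 2 * p + int n * i = m \<and> 0 \<le> p then poly.coeff (v i) (nat p) else 0)"
  proof (cases "v i = 0")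
    case False
    then have "2 * int (Polynomial.degree (v i)) + int n * i < m" using assms(3,4) unfolding wle_def by force
    then have "Polynomial.degree (v i) < nat p" if "2 * p + int n * i = m" using that by linarith
    then show ?thesis by (auto simp: coeff_eq_0)
  qed simp
qed simp

definition ge :: "nat \<Rightarrow> gen \<Rightarrow> int \<times> int"
  where "ge n v = (case v of X \<Rightarrow> (0, int n) | Y \<Rightarrow> (int n, 0) | Z \<Rightarrow> (1, 1))"

context classical_gwa
begin

lemma n0: "n > 0" using deg by simp

text \<open>
  On top weights the shifts in \<open>z + i\<close> and the lower terms of \<open>a\<close> disappear, and since \<open>a\<close> is monic the
  generators act by multiplication with the corresponding monomials.
\<close>

lemma act_props:
  assumes v: "fin v" and w: "wle n d v"
  shows "fin (act a s v)" "wle n (d + int (gen_weight n s)) (act a s v)"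
    "symb n (d + int (gen_weight n s)) (act a s v) = lterm (ge n s) 1 * symb n d v"
proof -
  have a0: "a \<noteq> 0" using monic by auto
  have sh: "shift i \<noteq> (0 :: 'k poly)" for i by (simp add: shift_def)
  have w': "2 * int (Polynomial.degree (v i)) + int n * i \<le> d" if "v i \<noteq> 0" for i
    using w that by (simp add: wle_def)
  show fs: "fin (act a s v)"
  proof (cases s)
    case X
    then show ?thesis by (intro finite_subset[OF _ finite_imageI[OF v, of "\<lambda>i. i + 1"]]) (auto intro!: image_eqI[of _ _ "_ - 1"])
  next
    case Y
    then show ?thesis by (intro finite_subset[OF _ finite_imageI[OF v, of "\<lambda>i. i - 1"]]) (auto intro!: image_eqI[of _ _ "_ + 1"])
  next
    case Z
    then show ?thesis by (intro finite_subset[OF _ v]) auto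
  qed
  show "wle n (d + int (gen_weight n s)) (act a s v)"
    unfolding wle_def
  proof (intro allI impI)
    fix i assume nz: "act a s v i \<noteq> 0"
    show "2 * int (Polynomial.degree (act a s v i)) + int n * i \<le> d + int (gen_weight n s)"
    proof (cases s)
      case X
      then show ?thesis using nz w'[of "i - 1"] by (simp add: algebra_simps)
    next
      case Y
      then show ?thesis using nz w'[of "i + 1"] a0 by (simp add: degree_mult_eq pcompose_shift_nz algebra_simps)
    next
      case Z
      then show ?thesis using nz w'[of i] sh[of i] by (simp add: degree_mult_eq algebra_simps)
    qed
  qed
  have nd: "lcoeff (lterm (ge n s) 1 * symb n d v) (p, q) = 0" if "\<not> int n dvd q - p" for p q
  proof -
    have "\<not> int n dvd (q - snd (ge n s)) - (p - fst (ge n s))"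
    proof
      assume "int n dvd (q - snd (ge n s)) - (p - fst (ge n s))"
      moreover have "int n dvd snd (ge n s) - fst (ge n s)" by (cases s) (simp_all add: ge_def)
      ultimately have "int n dvd ((q - snd (ge n s)) - (p - fst (ge n s))) + (snd (ge n s) - fst (ge n s))" by (rule dvd_add)
      then show False using that by (simp add: algebra_simps)
    qed
    then show ?thesis using symb_nondvd[OF v n0] by (simp add: lcoeff_term_mult minus_prod_def)
  qed
  show "symb n (d + int (gen_weight n s)) (act a s v) = lterm (ge n s) 1 * symb n d v"
  proof (rule symb_eqI[OF fs n0 _ nd])
    fix p i
    show "lcoeff (lterm (ge n s) 1 * symb n d v) (p, p + int n * i)
      = (if 2 * p + int n * i = d + int (gen_weight n s) \<and> 0 \<le> p then poly.coeff (act a s v i) (nat p) else 0)"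
    proof (cases s)
      case X
      have "(p, p + int n * i) - ge n s = (p, p + int n * (i - 1))" by (simp add: X ge_def algebra_simps)
      then show ?thesis by (simp add: X lcoeff_term_mult lcoeff_symb'[OF v n0]) (simp add: algebra_simps)
    next
      case Y
      have e: "(p, p + int n * i) - ge n s = (p - int n, (p - int n) + int n * (i + 1))" by (simp add: Y ge_def algebra_simps)
      have c: "poly.coeff ((a \<circ>\<^sub>p shift i) * v (i + 1)) (nat p) = (if int n \<le> p then poly.coeff (v (i + 1)) (nat (p - int n)) else 0)"
        if p: "2 * p + int n * i = d + int n" "0 \<le> p"
      proof (cases "v (i + 1) = 0")
        case False
        have dv: "int (Polynomial.degree (v (i + 1))) \<le> p - int n" using w'[OF False] p(1) by (simp add: algebra_simps)
        then have "Polynomial.degree (v (i + 1)) \<le> nat (p - int n)" "int n \<le> p" by linarith+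
        moreover have "nat p = n + nat (p - int n)" using \<open>int n \<le> p\<close> by simp
        moreover have "poly.coeff (a \<circ>\<^sub>p shift i) n = 1"
        proof -
          have "lead_coeff (shift i :: 'k poly) = 1" by (simp add: shift_def)
          then have "lead_coeff (a \<circ>\<^sub>p shift i) = 1" using lead_coeff_comp[of "shift i" a] monic by simp
          then show ?thesis by (simp only: degree_pcompose_shift)
        qed
        ultimately show ?thesis
          using coeff_mult_top[of "a \<circ>\<^sub>p shift i" n "v (i + 1)" "nat (p - int n)"] by simp
      qed simp
      show ?thesis
        unfolding lcoeff_term_mult e lcoeff_symb'[OF v n0]
        using c by (simp add: Y algebra_simps) auto?
    next
      case Z
      have e: "(p, p + int n * i) - ge n s = (p - 1, (p - 1) + int n * i)" by (simp add: Z ge_def)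
      have c: "poly.coeff (shift i * v i) (nat p) = (if 1 \<le> p then poly.coeff (v i) (nat (p - 1)) else 0)"
        if p: "2 * p + int n * i = d + 2" "0 \<le> p"
      proof (cases "v i = 0")
        case False
        have "int (Polynomial.degree (v i)) < p" using w'[OF False] p(1) by linarith
        then have "poly.coeff (v i) (nat p) = 0" "1 \<le> p" by (auto intro!: coeff_eq_0)
        moreover have "nat p = Suc (nat (p - 1))" using \<open>1 \<le> p\<close> by simp
        ultimately show ?thesis by (simp add: shift_def)
      qed simp
      show ?thesis
        unfolding lcoeff_term_mult e lcoeff_symb'[OF v n0]
        using c by (simp add: Z algebra_simps) auto?
    qed
  qed
qed

text \<open>The leading part of \<open>r\<close> in degree \<open>m\<close>, read off from its action on the faithful module.\<close>

definition sy :: "int \<Rightarrow> (gen list \<Rightarrow> 'k) set \<Rightarrow> 'k laurent" where "sy m r = symb n m (ev a r)"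

text \<open>
  The element \<open>r\<close> acts on top weights as multiplication by \<open>t\<close>. This property passes to products, unlike
  a direct description of the leading part of a product.
\<close>

definition mulp :: "int \<Rightarrow> (gen list \<Rightarrow> 'k) set \<Rightarrow> 'k laurent \<Rightarrow> bool"
  where "mulp m r t \<longleftrightarrow> (\<forall>d v. fin v \<and> wle n d v \<longrightarrow> fin (rp a r v) \<and> wle n (m + d) (rp a r v) \<and>
    symb n (m + d) (rp a r v) = t * symb n d v)"

lemma rp_simps:
  "r \<in> carrier R \<Longrightarrow> s \<in> carrier R \<Longrightarrow> rp a (r \<oplus>\<^bsub>R\<^esub> s) v = (\<lambda>i. rp a r v i + rp a s v i)"
  "r \<in> carrier R \<Longrightarrow> s \<in> carrier R \<Longrightarrow> rp a (r \<otimes>\<^bsub>R\<^esub> s) v = rp a r (rp a s v)"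
  "r \<in> carrier R \<Longrightarrow> rp a (c \<odot>\<^bsub>R\<^esub> r) v = (\<lambda>i. Polynomial.smult c (rp a r v i))"
  "rp a \<one>\<^bsub>R\<^esub> v = v" "rp a \<zero>\<^bsub>R\<^esub> v = (\<lambda>i. 0)"
  using rp_hom(2)[of r a s] rp_hom(3)[of r a s] rp_hom(4)[of r a r c]
    rp_hom(7)[of "\<one>\<^bsub>R\<^esub>" a "\<one>\<^bsub>R\<^esub>"] rp_hom(5)[of "\<one>\<^bsub>R\<^esub>" a "\<one>\<^bsub>R\<^esub>"]
  by simp_all

lemma mulp_mult:
  assumes "r \<in> carrier R" "s \<in> carrier R" "mulp m r t" "mulp k s u"
  shows "mulp (m + k) (r \<otimes>\<^bsub>R\<^esub> s) (t * u)"
  unfolding mulp_def rp_simps(2)[OF assms(1,2)]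
proof (intro allI impI)
  fix d and v :: "'k vec" assume v: "fin v \<and> wle n d v"
  have s: "fin (rp a s v)" "wle n (k + d) (rp a s v)" "symb n (k + d) (rp a s v) = u * symb n d v"
    using assms(4) v unfolding mulp_def by blast+
  then have "fin (rp a r (rp a s v)) \<and> wle n (m + (k + d)) (rp a r (rp a s v)) \<and>
      symb n (m + (k + d)) (rp a r (rp a s v)) = t * symb n (k + d) (rp a s v)"
    using assms(3) unfolding mulp_def by blast
  then show "fin (rp a r (rp a s v)) \<and> wle n (m + k + d) (rp a r (rp a s v)) \<and>
      symb n (m + k + d) (rp a r (rp a s v)) = t * u * symb n d v"
    by (simp only: s(3) add.assoc mult.assoc)
qed

fun ex :: "gen list \<Rightarrow> int \<times> int" where
  "ex [] = 0"
| "ex (s # w) = ge n s + ex w"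

lemma ex_cone: "ex w \<in> cone n" "fst (ex w) + snd (ex w) = wt w"
proof -
  have "ge n s \<in> cone n" "fst (ge n s) + snd (ge n s) = int (gen_weight n s)" for s
    by (cases s; simp add: ge_def cone_def)+
  note ge = this
  show "ex w \<in> cone n" by (induction w) (simp_all add: cone_add ge(1))
  show "fst (ex w) + snd (ex w) = wt w"
  proof (induction w)
    case (Cons s w)
    then show ?case using ge(2)[of s] by simp
  qed simp
qed

lemma mulp_word: "mulp (wt w) (R.wd g w) (lterm (ex w) 1)"
proof (induction w)
  case Nil
  have "lterm (0 :: int \<times> int) (1 :: 'k) = 1" by simp
  then show ?case by (simp add: mulp_def rp_simps)
next
  case (Cons s w)
  have "mulp (int (gen_weight n s)) (g s) (lterm (ge n s) 1)"
    unfolding mulp_def rp_gen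
  proof (intro allI impI)
    fix d and v :: "'k vec" assume h: "fin v \<and> wle n d v"
    show "fin (act a s v) \<and> wle n (int (gen_weight n s) + d) (act a s v) \<and>
        symb n (int (gen_weight n s) + d) (act a s v) = lterm (ge n s) 1 * symb n d v"
      using act_props[OF h[THEN conjunct1] h[THEN conjunct2], of s] by (simp add: add.commute)
  qed
  from mulp_mult[OF gc R.wd_closed[OF gc] this Cons.IH] show ?case by (simp add: mult_single)
qed

lemma mulp_mono:
  assumes "mulp m r t" "m < m'"
  shows "mulp m' r 0"
  unfolding mulp_def
proof (intro allI impI)
  fix d and v :: "'k vec" assume "fin v \<and> wle n d v"
  then have h: "fin (rp a r v)" "wle n (m + d) (rp a r v)" using assms(1) unfolding mulp_def by blast+
  then have "wle n (m' + d) (rp a r v)" using assms(2) unfolding wle_def by force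
  with h symb_high[OF h(1) n0 h(2), of "m' + d"] assms(2)
  show "fin (rp a r v) \<and> wle n (m' + d) (rp a r v) \<and> symb n (m' + d) (rp a r v) = 0 * symb n d v" by simp
qed

lemma mulp_sy: "mulp m r t \<Longrightarrow> sy m r = t"
proof -
  assume t: "mulp m r t"
  let ?e = "\<lambda>i :: int. if i = 0 then 1 else 0 :: 'k poly"
  have e: "fin ?e" "wle n 0 ?e" by (auto simp: wle_def)
  have "symb n 0 ?e = 1"
  proof (rule symb_eqI[OF e(1) n0])
    have k: "lcoeff (1 :: 'k laurent) (p, q) = (if p = 0 \<and> q = 0 then 1 else 0)" for p q
      by (simp add: lookup_one when_def zero_prod_def)
    fix p q
    show "lcoeff (1 :: 'k laurent) (p, q) = 0" if "\<not> int n dvd q - p"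
    proof -
      have "\<not> (p = 0 \<and> q = 0)" using that by (metis diff_self dvd_0_right)
      then show ?thesis unfolding k by (rule if_not_P)
    qed
    fix i
    have "p = 0 \<and> p + int n * i = 0 \<longleftrightarrow> p = 0 \<and> i = 0" using n0 by auto
    then show "lcoeff (1 :: 'k laurent) (p, p + int n * i) = (if 2 * p + int n * i = 0 \<and> 0 \<le> p then poly.coeff (?e i) (nat p) else 0)"
      unfolding k by (auto simp: coeff_1)
  qed
  moreover have "symb n (m + 0) (rp a r ?e) = t * symb n 0 ?e"
    using t[unfolded mulp_def, rule_format, OF conjI[OF e]] by (elim conjE)
  ultimately show ?thesis by (simp add: sy_def ev_def)
qed

text \<open>
  Every element of the filtration acts on top weights by multiplication, as the generators do; applying
  this to the basis vector at place zero identifies the multiplier.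
\<close>

lemma F_mulp: "r \<in> F m \<Longrightarrow> mulp m r (sy m r) \<and> sy m r \<in> sing n \<and> sy m r \<in> homog m"
proof -
  assume "r \<in> F m"
  then have "\<exists>t. mulp m r t \<and> t \<in> sing n \<and> t \<in> homog m"
  proof (induction rule: F_induct)
    case zero
    have "mulp m \<zero>\<^bsub>R\<^esub> 0"
      unfolding mulp_def rp_simps using symb_high[of "\<lambda>i. 0" n] n0 by (auto simp: wle_def symb_eqI)
    then show ?case by (intro exI[of _ 0]) (simp add: sing_def)
  next
    case (word c w)
    obtain t where t: "mulp m (R.wd g w) t" "t \<in> sing n" "t \<in> homog m"
    proof (cases "wt w = m")
      case True
      have "lterm (ex w) (1 :: 'k) \<in> sing n" "lterm (ex w) (1 :: 'k) \<in> homog m"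
        using ex_cone[of w] True by (auto simp: sing_def lookup_single when_def homog_def split: if_splits)
      then show ?thesis using that mulp_word[of w] True by simp
    next
      case False
      then show ?thesis using that[OF mulp_mono[OF mulp_word]] word by (simp add: sing_def)
    qed
    have "mulp m (c \<odot>\<^bsub>R\<^esub> R.wd g w) (scale c t)"
      unfolding mulp_def rp_simps(3)[OF R.wd_closed[OF gc]]
    proof (intro allI impI)
      fix d and v :: "'k vec" assume "fin v \<and> wle n d v"
      then have h: "fin (rp a (R.wd g w) v)" "wle n (m + d) (rp a (R.wd g w) v)"
        "symb n (m + d) (rp a (R.wd g w) v) = t * symb n d v" using t(1) unfolding mulp_def by blast+
      show "fin (\<lambda>i. Polynomial.smult c (rp a (R.wd g w) v i)) \<and>
          wle n (m + d) (\<lambda>i. Polynomial.smult c (rp a (R.wd g w) v i)) \<and>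
          symb n (m + d) (\<lambda>i. Polynomial.smult c (rp a (R.wd g w) v i)) = scale c t * symb n d v"
        using fin_smult[OF h(1)] wle_smult[OF h(2)] symb_smult[OF h(1) n0] h(3) by (simp add: mult.assoc)
    qed
    moreover have "scale c t \<in> sing n" "scale c t \<in> homog m" using t(2,3) by (auto simp: sing_def homog_def)
    ultimately show ?case by blast
  next
    case (add r s)
    then obtain t u where t: "mulp m r t" "t \<in> sing n" "t \<in> homog m" and u: "mulp m s u" "u \<in> sing n" "u \<in> homog m" by blast
    have c: "r \<in> carrier R" "s \<in> carrier R" using add F_carrier by blast+
    have "mulp m (r \<oplus>\<^bsub>R\<^esub> s) (t + u)"
      unfolding mulp_def rp_simps(1)[OF c]
    proof (intro allI impI)
      fix d and v :: "'k vec" assume v: "fin v \<and> wle n d v"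
      have h: "fin (rp a r v)" "wle n (m + d) (rp a r v)" "symb n (m + d) (rp a r v) = t * symb n d v"
        using t(1) v unfolding mulp_def by blast+
      have k: "fin (rp a s v)" "wle n (m + d) (rp a s v)" "symb n (m + d) (rp a s v) = u * symb n d v"
        using u(1) v unfolding mulp_def by blast+
      show "fin (\<lambda>i. rp a r v i + rp a s v i) \<and> wle n (m + d) (\<lambda>i. rp a r v i + rp a s v i) \<and>
          symb n (m + d) (\<lambda>i. rp a r v i + rp a s v i) = (t + u) * symb n d v"
        using fin_add[OF h(1) k(1)] wle_add[OF h(2) k(2)] symb_add[OF h(1) k(1) n0] h(3) k(3)
        by (simp add: distrib_right)
    qed
    moreover have "t + u \<in> sing n"
      using t(2) u(2) unfolding sing_def mem_Collect_eq lookup_add by (metis add.right_neutral)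
    ultimately show ?case using homog_add[OF t(3) u(3)] by blast
  qed
  then show ?thesis using mulp_sy by blast
qed

lemmas sy_mulp = F_mulp[THEN conjunct1]
  and sy_sing = F_mulp[THEN conjunct2, THEN conjunct1]
  and sy_homog = F_mulp[THEN conjunct2, THEN conjunct2]

lemma F_closed: "r \<in> F m \<Longrightarrow> r \<in> carrier R" using F_carrier by blast

lemma sy_add: "r \<in> F m \<Longrightarrow> s \<in> F m \<Longrightarrow> sy m (r \<oplus>\<^bsub>R\<^esub> s) = sy m r + sy m s"
  unfolding sy_def using symb_add[OF F_finite[of r m] F_finite[of s m] n0, where d = m] by (simp add: ev_add F_closed)

lemma F_smult: "r \<in> F m \<Longrightarrow> c \<odot>\<^bsub>R\<^esub> r \<in> F m"
  unfolding F_eq_NF by (rule NF_smult)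

lemma sy_smult: "r \<in> F m \<Longrightarrow> sy m (c \<odot>\<^bsub>R\<^esub> r) = scale c (sy m r)"
  unfolding sy_def using symb_smult[OF F_finite[of r m] n0, where d = m and c = c] by (simp add: ev_smult F_closed)

lemma sy_zero [simp]: "sy m \<zero>\<^bsub>R\<^esub> = 0"
  using sy_smult[OF F_zero[of m], where c = 0] by simp

lemma sy_word: "sy (wt w) (R.wd g w) = lterm (ex w) 1"
  by (rule mulp_sy[OF mulp_word])

lemma F_mult:
  assumes "r \<in> F m" "s \<in> F k"
  shows "r \<otimes>\<^bsub>R\<^esub> s \<in> F (m + k)" "sy (m + k) (r \<otimes>\<^bsub>R\<^esub> s) = sy m r * sy k s"
proof -
  have c: "r \<in> carrier R" "s \<in> carrier R" using assms F_closed by blast+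
  have mp: "mulp (m + k) (r \<otimes>\<^bsub>R\<^esub> s) (sy m r * sy k s)"
    by (rule mulp_mult[OF c sy_mulp[OF assms(1)] sy_mulp[OF assms(2)]])
  then show "sy (m + k) (r \<otimes>\<^bsub>R\<^esub> s) = sy m r * sy k s" by (rule mulp_sy)
  let ?e = "\<lambda>i :: int. if i = 0 then 1 else 0 :: 'k poly"
  have "fin ?e" "wle n 0 ?e" by (auto simp: wle_def)
  then have "wle n (m + k + 0) (ev a (r \<otimes>\<^bsub>R\<^esub> s))" 
    using mp[unfolded mulp_def, rule_format, OF conjI, of ?e 0] unfolding ev_def by simp
  moreover obtain j where "r \<otimes>\<^bsub>R\<^esub> s \<in> F (int j)" using F_exhaust[of "r \<otimes>\<^bsub>R\<^esub> s"] c by auto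
  ultimately show "r \<otimes>\<^bsub>R\<^esub> s \<in> F (m + k)" using wle_F by simp
qed

lemma sy_zero_iff: "r \<in> F m \<Longrightarrow> sy m r = 0 \<longleftrightarrow> r \<in> F (m - 1)"
proof
  assume r: "r \<in> F m" and "sy m r = 0"
  have "wle n (m - 1) (ev a r)"
    unfolding wle_def
  proof (intro allI impI)
    fix i assume nz: "ev a r i \<noteq> 0"
    let ?d = "Polynomial.degree (ev a r i)"
    have "lcoeff (sy m r) (int ?d, int ?d + int n * i) = 0" using \<open>sy m r = 0\<close> by simp
    then have "2 * int ?d + int n * i \<noteq> m"
      using nz unfolding sy_def lcoeff_symb'[OF F_finite[OF r] n0] by (auto split: if_splits)
    moreover have "2 * int ?d + int n * i \<le> m" using F_wle[OF r] nz by (simp add: wle_def)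
    ultimately show "2 * int ?d + int n * i \<le> m - 1" by simp
  qed
  then show "r \<in> F (m - 1)" by (rule wle_F[OF r])
next
  assume "r \<in> F (m - 1)"
  then show "sy m r = 0" unfolding sy_def by (intro symb_high[OF F_finite n0 F_wle]) auto
qed

text \<open>Words in the generators realise every monomial of the cone.\<close>

lemma sy_surj:
  assumes "t \<in> sing n" "t \<in> homog m"
  obtains r where "r \<in> F m" "sy m r = t"
proof -
  have wd: "\<exists>w. ex w = k" if "k \<in> cone n" for k
  proof -
    obtain p q where k: "k = (p, q)" by (cases k)
    have z: "ex (replicate j Z) = (int j, int j)" "ex (replicate j X) = (0, int n * int j)"
      "ex (replicate j Y) = (int n * int j, 0)" for j
      by (induction j) (simp_all add: ge_def zero_prod_def algebra_simps)
    have ap: "ex (u @ w) = ex u + ex w" for u w by (induction u) (simp_all add: add.assoc)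
    have pq: "0 \<le> p" "0 \<le> q" and dv: "int n dvd q - p" using that k by (auto simp: cone_def)
    obtain i where i: "q - p = int n * i" using dv by (rule dvdE)
    show ?thesis
    proof (cases "0 \<le> i")
      case True
      have "ex (replicate (nat p) Z @ replicate (nat i) X) = k" using True i pq by (simp add: ap z k)
      then show ?thesis by blast
    next
      case False
      have "ex (replicate (nat q) Z @ replicate (nat (- i)) Y) = k" using False i pq by (simp add: ap z k)
      then show ?thesis by blast
    qed
  qed
  have tm: "\<exists>r. r \<in> F m \<and> sy m r = lterm k (lcoeff t k)" if k: "k \<in> Poly_Mapping.keys t" for k
  proof -
    have "lcoeff t k \<noteq> 0" using k by (simp add: in_keys_iff)
    then obtain w where w: "ex w = k" using wd assms(1) unfolding sing_def by blast
    have "fst k + snd k = m" using assms(2) \<open>lcoeff t k \<noteq> 0\<close> unfolding homog_def by (cases k) auto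
    then have m: "wt w = m" using ex_cone(2)[of w] w by simp
    have "R.wd g w \<in> F m" using F_word[of w m 1] m by (simp add: R.sm_one R.wd_closed)
    then have "sy m (lcoeff t k \<odot>\<^bsub>R\<^esub> R.wd g w) = lterm k (lcoeff t k)"
      using sy_smult[of "R.wd g w" m "lcoeff t k"] sy_word[of w] m w by (simp add: mult_single)
    then show ?thesis using F_word[of w m] m by auto
  qed
  have "\<exists>r. r \<in> F m \<and> sy m r = (\<Sum>k\<in>S. lterm k (lcoeff t k))" if "finite S" "S \<subseteq> Poly_Mapping.keys t" for S
    using that
  proof (induction S)
    case empty
    then show ?case using F_zero[of m] by (intro exI[of _ "\<zero>\<^bsub>R\<^esub>"]) simp
  next
    case (insert k S)
    then obtain r s where "r \<in> F m" "sy m r = (\<Sum>k\<in>S. lterm k (lcoeff t k))" "s \<in> F m" "sy m s = lterm k (lcoeff t k)"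
      using tm[of k] by auto
    then show ?case using insert.hyps F_add[of s m r] sy_add[of s m r] by (intro exI[of _ "s \<oplus>\<^bsub>R\<^esub> r"]) simp
  qed
  from this[of "Poly_Mapping.keys t"] show ?thesis using that laurent_sum_terms[of t] by auto
qed

end

section \<open>The associated graded algebra\<close>

text \<open>The homogeneous component of degree \<open>i\<close>.\<close>

definition hp :: "int \<Rightarrow> 'k::field laurent \<Rightarrow> 'k laurent"
  where "hp i f = part {(p, q). p + q = i} f"

lemma lcoeff_hp [simp]: "lcoeff (hp i f) (p, q) = (if p + q = i then lcoeff f (p, q) else 0)"
  by (simp add: hp_def)

lemma hp_homog [simp]: "hp i f \<in> homog i"
  by (simp add: homog_def)

lemma hp_sing: "f \<in> sing n \<Longrightarrow> hp i f \<in> sing n"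
  by (auto simp: sing_def hp_def split: if_splits)

lemma hp_add: "hp i (f + g) = hp i f + hp i g" and hp_scale: "hp i (scale c f) = scale c (hp i f)"
  by (simp_all add: hp_def part_add part_scale)

lemma hp_of_homog: "f \<in> homog d \<Longrightarrow> hp i f = (if i = d then f else 0)"
  by (rule laurent_eqI) (auto simp: homog_def)

lemma hp_homog_mult:
  assumes "h \<in> homog i"
  shows "hp m (h * g) = h * hp (m - i) g"
proof (rule laurent_eqI)
  fix p q
  have eq: "lcoeff h k * (if p + q = m then lcoeff g ((p, q) - k) else 0) = lcoeff h k * lcoeff (hp (m - i) g) ((p, q) - k)" for k
  proof (cases "lcoeff h k = 0")
    case False
    then have "fst k + snd k = i" using assms unfolding homog_def by (cases k) auto
    then show ?thesis by (cases k) auto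
  qed simp
  have "lcoeff (hp m (h * g)) (p, q) = (\<Sum>k\<in>Poly_Mapping.keys h. lcoeff h k * (if p + q = m then lcoeff g ((p, q) - k) else 0))"
    by (cases "p + q = m") (simp_all add: lcoeff_mult)
  also have "\<dots> = lcoeff (h * hp (m - i) g) (p, q)"
    unfolding lcoeff_mult by (rule sum.cong[OF refl eq])
  finally show "lcoeff (hp m (h * g)) (p, q) = lcoeff (h * hp (m - i) g) (p, q)" .
qed

lemma hp_bound: "\<exists>N. \<forall>i>N. hp i f = 0"
proof -
  have fin: "finite ((\<lambda>(p, q). p + q) ` Poly_Mapping.keys f)" by simp
  let ?N = "Max (insert 0 ((\<lambda>(p, q). p + q) ` Poly_Mapping.keys f))"
  have "hp i f = 0" if i: "i > ?N" for i
  proof (rule laurent_eqI)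
    fix p q
    have "p + q \<le> ?N" if "lcoeff f (p, q) \<noteq> 0"
      using fin that by (intro Max_ge) (auto simp: in_keys_iff intro!: image_eqI[of _ _ "(p, q)"])
    then have "lcoeff f (p, q) = 0" if "p + q = i" using i that by linarith
    then show "lcoeff (hp i f) (p, q) = lcoeff 0 (p, q)" by simp
  qed
  then show ?thesis by blast
qed

lemma hp_neg: "f \<in> sing n \<Longrightarrow> i < 0 \<Longrightarrow> hp i f = 0"
proof (rule laurent_eqI)
  fix p q assume "f \<in> sing n" "i < 0"
  then have "lcoeff f (p, q) = 0" if "p + q = i" using that unfolding sing_def cone_def by fastforce
  then show "lcoeff (hp i f) (p, q) = lcoeff 0 (p, q)" by simp
qed

lemma hp_sum:
  assumes "finite I" "\<And>i. i \<notin> I \<Longrightarrow> hp i f = 0"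
  shows "(\<Sum>i\<in>I. hp i f) = f"
proof (rule laurent_eqI)
  fix p q
  have "lcoeff f (p, q) = 0" if "p + q \<notin> I"
  proof -
    have "lcoeff (hp (p + q) f) (p, q) = 0" using assms(2)[OF that] by (simp only: lookup_zero)
    then show ?thesis by simp
  qed
  then show "lcoeff (\<Sum>i\<in>I. hp i f) (p, q) = lcoeff f (p, q)"
    using assms(1) by (auto simp: lookup_sum)
qed

lemma hp_mult:
  assumes f: "f \<in> sing n" and g: "g \<in> sing n"
  shows "hp m (f * g) = (\<Sum>i\<in>{0..m}. hp i f * hp (m - i) g)"
proof -
  obtain N where N: "\<forall>i>N. hp i f = 0" using hp_bound by blast
  define M where "M = max N m"
  have "hp i f = 0" if "i \<notin> {0..M}" for i
    using that N hp_neg[OF f] unfolding M_def by (cases "i < 0") auto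
  then have "(\<Sum>i\<in>{0..M}. hp i f) = f" by (intro hp_sum) simp_all
  then have "hp m (f * g) = hp m (\<Sum>i\<in>{0..M}. hp i f * g)" by (simp flip: sum_distrib_right)
  also have "\<dots> = (\<Sum>i\<in>{0..M}. hp m (hp i f * g))" unfolding hp_def by (rule part_sum)
  also have "\<dots> = (\<Sum>i\<in>{0..M}. hp i f * hp (m - i) g)" by (simp add: hp_homog_mult[OF hp_homog])
  also have "\<dots> = (\<Sum>i\<in>{0..m}. hp i f * hp (m - i) g)"
    by (rule sum.mono_neutral_right) (auto simp: M_def hp_neg[OF g])
  finally show ?thesis .
qed

lemma hp_ext: "(\<And>i. hp i f = hp i g) \<Longrightarrow> f = g"
proof (rule laurent_eqI)
  fix p q
  assume "\<And>i. hp i f = hp i g"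
  then have "lcoeff (hp (p + q) f) (p, q) = lcoeff (hp (p + q) g) (p, q)" by simp
  then show "lcoeff f (p, q) = lcoeff g (p, q)" by simp
qed

lemma hp_twist: "hp i (twist s \<chi> f) = twist s \<chi> (hp i f)"
  by (rule laurent_eqI) (auto simp: lcoeff_twist kap_def)

context classical_gwa
begin

text \<open>A coset of \<open>F (m - 1)\<close> in \<open>F m\<close> is the set of elements with a given symbol.\<close>

definition cs :: "int \<Rightarrow> 'k laurent \<Rightarrow> (gen list \<Rightarrow> 'k) set set"
  where "cs m t = {r \<in> F m. sy m r = t}"

lemma F_uminus: "r \<in> F m \<Longrightarrow> \<ominus>\<^bsub>R\<^esub> r \<in> F m \<and> sy m (\<ominus>\<^bsub>R\<^esub> r) = - sy m r"
proof -
  assume r: "r \<in> F m"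
  have c: "r \<in> carrier R" by (rule F_closed[OF r])
  have "r \<oplus>\<^bsub>R\<^esub> (- 1) \<odot>\<^bsub>R\<^esub> r = \<zero>\<^bsub>R\<^esub>"
    using R.sm_add2[OF c, of 1 "- 1"] R.sm_zero[OF c] R.sm_one[OF c] by simp
  then have "\<ominus>\<^bsub>R\<^esub> r = (- 1) \<odot>\<^bsub>R\<^esub> r"
    using R.minus_equality[of "(- 1) \<odot>\<^bsub>R\<^esub> r" r] c by (simp add: R.a_comm)
  moreover have "scale (- 1) (sy m r) = - sy m r" by (rule poly_mapping_eqI) simp
  ultimately show ?thesis using F_smult[OF r, of "- 1"] sy_smult[OF r, of "- 1"] by simp
qed

lemma F_minus:
  assumes "r \<in> F m" "s \<in> F m"
  shows "r \<ominus>\<^bsub>R\<^esub> s \<in> F m" "sy m (r \<ominus>\<^bsub>R\<^esub> s) = sy m r - sy m s"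
  using F_uminus[OF assms(2)] assms F_add[of r m "\<ominus>\<^bsub>R\<^esub> s"] sy_add[of r m "\<ominus>\<^bsub>R\<^esub> s"] by (simp_all add: a_minus_def)

lemma minus_add: "r \<in> carrier R \<Longrightarrow> s \<in> carrier R \<Longrightarrow> (r \<ominus>\<^bsub>R\<^esub> s) \<oplus>\<^bsub>R\<^esub> s = r"
  by (simp add: a_minus_def R.a_assoc R.l_neg)

lemma coset: "r \<in> F m \<Longrightarrow> F (m - 1) +>\<^bsub>R\<^esub> r = cs m (sy m r)"
proof (rule Set.set_eqI)
  fix s assume r: "r \<in> F m"
  have "s \<in> F (m - 1) +>\<^bsub>R\<^esub> r \<longleftrightarrow> (\<exists>x\<in>F (m - 1). s = x \<oplus>\<^bsub>R\<^esub> r)"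
    by (auto simp: a_r_coset_def' )
  also have "\<dots> \<longleftrightarrow> s \<in> cs m (sy m r)"
  proof
    assume "\<exists>x\<in>F (m - 1). s = x \<oplus>\<^bsub>R\<^esub> r"
    then obtain x where x: "x \<in> F (m - 1)" "s = x \<oplus>\<^bsub>R\<^esub> r" by blast
    have x': "x \<in> F m" using x(1) F_mono[of "m - 1" m] by auto
    then have "sy m x = 0" using x(1) sy_zero_iff by blast
    then show "s \<in> cs m (sy m r)" unfolding cs_def x(2) using sy_add[OF x' r] F_add[OF x' r] by simp
  next
    assume "s \<in> cs m (sy m r)"
    then have s: "s \<in> F m" "sy m s = sy m r" by (auto simp: cs_def)
    have "s \<ominus>\<^bsub>R\<^esub> r \<in> F (m - 1)"
      using sy_zero_iff[OF F_minus(1)[OF s(1) r]] F_minus(2)[OF s(1) r] s(2) by simp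
    moreover have "s = (s \<ominus>\<^bsub>R\<^esub> r) \<oplus>\<^bsub>R\<^esub> r" using minus_add[OF F_closed[OF s(1)] F_closed[OF r]] by simp
    ultimately show "\<exists>x\<in>F (m - 1). s = x \<oplus>\<^bsub>R\<^esub> r" by blast
  qed
  finally show "s \<in> F (m - 1) +>\<^bsub>R\<^esub> r \<longleftrightarrow> s \<in> cs m (sy m r)" .
qed

lemma cs_zero: "cs m 0 = F (m - 1)"
proof (rule Set.set_eqI)
  fix r
  show "r \<in> cs m 0 \<longleftrightarrow> r \<in> F (m - 1)"
    unfolding cs_def mem_Collect_eq using sy_zero_iff[of r m] F_mono[of "m - 1" m] by auto
qed

lemma cs_obtain:
  assumes "t \<in> sing n" "t \<in> homog m"
  obtains r where "r \<in> F m" "sy m r = t" "r \<in> cs m t"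
  using sy_surj[OF assms] unfolding cs_def by blast

text \<open>
  The element of the associated graded algebra with symbol \<open>f\<close>. Working with this map rather than
  with its inverse avoids choices of representatives.
\<close>

definition cosets_of :: "'k laurent \<Rightarrow> int \<Rightarrow> (gen list \<Rightarrow> 'k) set set"
  where "cosets_of f = (\<lambda>i. cs i (hp i f))"

abbreviation "G \<equiv> gr_alg R F"

lemma cs_inj: "t \<in> sing n \<Longrightarrow> t \<in> homog m \<Longrightarrow> cs m t = cs m u \<Longrightarrow> t = u"
  by (metis (mono_tags, lifting) cs_def cs_obtain mem_Collect_eq)

lemma cosets_of_inj: "f \<in> sing n \<Longrightarrow> g' \<in> sing n \<Longrightarrow> cosets_of f = cosets_of g' \<Longrightarrow> f = g'"
proof (rule hp_ext)
  fix i assume h: "f \<in> sing n" "g' \<in> sing n" "cosets_of f = cosets_of g'"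
  then show "hp i f = hp i g'" unfolding cosets_of_def by (intro cs_inj[of _ i] hp_sing hp_homog) (auto dest: fun_cong)
qed

lemma gr_carrier: "carrier G = cosets_of ` sing n"
proof (intro equalityI subsetI)
  fix u assume "u \<in> carrier G"
  then have u: "\<forall>i. \<exists>r\<in>F i. u i = F (i - 1) +>\<^bsub>R\<^esub> r" "finite {i. u i \<noteq> F (i - 1)}" by (auto simp: gr_alg_def)
  obtain r where r: "\<And>i. r i \<in> F i" "\<And>i. u i = F (i - 1) +>\<^bsub>R\<^esub> r i" using u(1) by metis
  let ?I = "{i. u i \<noteq> F (i - 1)}"
  let ?f = "\<Sum>i\<in>?I. sy i (r i)"
  have z: "sy i (r i) = 0" if "i \<notin> ?I" for i
  proof -
    have "cs i (sy i (r i)) = cs i 0" using that r(2)[of i] coset[OF r(1)[of i]] cs_zero[of i] by simp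
    then show ?thesis using cs_inj[OF sy_sing[OF r(1)] sy_homog[OF r(1)]] by blast
  qed
  have "hp i ?f = sy i (r i)" for i
  proof -
    have "hp i ?f = (\<Sum>j\<in>?I. hp i (sy j (r j)))" unfolding hp_def by (rule part_sum)
    also have "\<dots> = (\<Sum>j\<in>?I. if i = j then sy j (r j) else 0)"
      by (rule sum.cong[OF refl]) (rule hp_of_homog[OF sy_homog[OF r(1)]])
    also have "\<dots> = sy i (r i)" using u(2) z[of i] by (simp add: sum.delta)
    finally show ?thesis .
  qed
  then have "u = cosets_of ?f" unfolding cosets_of_def by (intro ext) (simp only: r(2) coset[OF r(1)])
  moreover have "?f \<in> sing n" by (rule sing_sum) (rule sy_sing[OF r(1)])
  ultimately show "u \<in> cosets_of ` sing n" by (rule image_eqI)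
next
  fix u assume "u \<in> cosets_of ` sing n"
  then obtain f where f: "f \<in> sing n" "u = cosets_of f" by blast
  have "\<exists>r\<in>F i. u i = F (i - 1) +>\<^bsub>R\<^esub> r" for i
  proof -
    obtain r where "r \<in> F i" "sy i r = hp i f" using cs_obtain[OF hp_sing[OF f(1)] hp_homog] by metis
    then show ?thesis using coset[of r i] unfolding f(2) cosets_of_def by auto
  qed
  moreover have "finite {i. u i \<noteq> F (i - 1)}"
  proof -
    obtain N where N: "\<forall>i>N. hp i f = 0" using hp_bound by blast
    have "{i. u i \<noteq> F (i - 1)} \<subseteq> {0..N}"
    proof
      fix i assume "i \<in> {i. u i \<noteq> F (i - 1)}"
      then have ui: "u i \<noteq> F (i - 1)" by simp
      have "hp i f \<noteq> 0"
      proof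
        assume "hp i f = 0"
        then have "u i = F (i - 1)" using cs_zero[of i] by (simp only: f(2) cosets_of_def)
        with ui show False by simp
      qed
      moreover have "i < 0 \<Longrightarrow> hp i f = 0" "i > N \<Longrightarrow> hp i f = 0" using N hp_neg[OF f(1)] by blast+
      ultimately show "i \<in> {0..N}" by (meson atLeastAtMost_iff not_less)
    qed
    then show ?thesis by (rule finite_subset) simp
  qed
  ultimately show "u \<in> carrier G" by (simp add: gr_alg_def)
qed

lemma Union_const: "A \<noteq> {} \<Longrightarrow> (\<And>x. x \<in> A \<Longrightarrow> x = B) \<Longrightarrow> \<Union> A = B"
  by blast

lemma cosets_of_add: "f \<in> sing n \<Longrightarrow> h \<in> sing n \<Longrightarrow> cosets_of f \<oplus>\<^bsub>G\<^esub> cosets_of h = cosets_of (f + h)"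
proof -
  assume f: "f \<in> sing n" and h: "h \<in> sing n"
  have "cs i (hp i f) <+>\<^bsub>R\<^esub> cs i (hp i h) = cs i (hp i f + hp i h)" for i
  proof (intro equalityI subsetI)
    fix x assume "x \<in> cs i (hp i f) <+>\<^bsub>R\<^esub> cs i (hp i h)"
    then obtain r s where "r \<in> cs i (hp i f)" "s \<in> cs i (hp i h)" "x = r \<oplus>\<^bsub>R\<^esub> s"
      unfolding set_add_def set_mult_def by auto
    then show "x \<in> cs i (hp i f + hp i h)" by (auto simp: cs_def F_add sy_add)
  next
    fix x assume "x \<in> cs i (hp i f + hp i h)"
    then have x: "x \<in> F i" "sy i x = hp i f + hp i h" by (auto simp: cs_def)
    obtain r where r: "r \<in> F i" "sy i r = hp i h" "r \<in> cs i (hp i h)" using cs_obtain[OF hp_sing[OF h] hp_homog] by metis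
    have "x \<ominus>\<^bsub>R\<^esub> r \<in> cs i (hp i f)" using F_minus[OF x(1) r(1)] x(2) r(2) by (simp add: cs_def)
    moreover have "x = (x \<ominus>\<^bsub>R\<^esub> r) \<oplus>\<^bsub>R\<^esub> r" using minus_add[OF F_closed[OF x(1)] F_closed[OF r(1)]] by simp
    ultimately show "x \<in> cs i (hp i f) <+>\<^bsub>R\<^esub> cs i (hp i h)" using r(3) unfolding set_add_def set_mult_def by auto
  qed
  then show ?thesis by (simp add: gr_alg_def cosets_of_def hp_add)
qed

lemma cosets_of_smult: "f \<in> sing n \<Longrightarrow> c \<odot>\<^bsub>G\<^esub> cosets_of f = cosets_of (scale c f)"
proof -
  assume f: "f \<in> sing n"
  have "(\<Union>r\<in>cs i (hp i f). F (i - 1) +>\<^bsub>R\<^esub> (c \<odot>\<^bsub>R\<^esub> r)) = cs i (scale c (hp i f))" for i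
  proof (rule Union_const)
    obtain r where "r \<in> cs i (hp i f)" using cs_obtain[OF hp_sing[OF f] hp_homog] by metis
    then show "(\<lambda>r. F (i - 1) +>\<^bsub>R\<^esub> (c \<odot>\<^bsub>R\<^esub> r)) ` cs i (hp i f) \<noteq> {}" by blast
  next
    fix x assume "x \<in> (\<lambda>r. F (i - 1) +>\<^bsub>R\<^esub> (c \<odot>\<^bsub>R\<^esub> r)) ` cs i (hp i f)"
    then obtain r where "r \<in> F i" "sy i r = hp i f" "x = F (i - 1) +>\<^bsub>R\<^esub> (c \<odot>\<^bsub>R\<^esub> r)" by (auto simp: cs_def)
    then show "x = cs i (scale c (hp i f))" using coset[OF F_smult[of r i c]] sy_smult[of r i c] by simp
  qed
  then show ?thesis by (simp add: gr_alg_def cosets_of_def hp_scale)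
qed

lemma sum_F:
  assumes "finite I" "\<And>i. i \<in> I \<Longrightarrow> r i \<in> F m"
  shows "(\<Oplus>\<^bsub>R\<^esub>i\<in>I. r i) \<in> F m \<and> sy m (\<Oplus>\<^bsub>R\<^esub>i\<in>I. r i) = (\<Sum>i\<in>I. sy m (r i))"
  using assms
proof (induction I rule: finite_induct)
  case (insert i I)
  have "(\<Oplus>\<^bsub>R\<^esub>i\<in>insert i I. r i) = r i \<oplus>\<^bsub>R\<^esub> (\<Oplus>\<^bsub>R\<^esub>i\<in>I. r i)"
    using insert by (intro R.finsum_insert) (auto intro: F_closed)
  then show ?case using insert F_add[of "r i" m] sy_add[of "r i" m] by simp
qed (simp add: F_zero)

lemma cosets_of_mult: "f \<in> sing n \<Longrightarrow> h \<in> sing n \<Longrightarrow> cosets_of f \<otimes>\<^bsub>G\<^esub> cosets_of h = cosets_of (f * h)"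
proof -
  assume f: "f \<in> sing n" and h: "h \<in> sing n"
  have "\<Union>{F (m - 1) +>\<^bsub>R\<^esub> (\<Oplus>\<^bsub>R\<^esub>i\<in>{0..m}. s i \<otimes>\<^bsub>R\<^esub> t (m - i)) | s t.
      (\<forall>i. s i \<in> cs i (hp i f)) \<and> (\<forall>i. t i \<in> cs i (hp i h))} = cs m (hp m (f * h))" (is "\<Union> ?A = _") for m
  proof (rule Union_const)
    have "\<forall>i. \<exists>r. r \<in> cs i (hp i f)" "\<forall>i. \<exists>r. r \<in> cs i (hp i h)"
      using cs_obtain[OF hp_sing[OF f] hp_homog] cs_obtain[OF hp_sing[OF h] hp_homog] by metis+
    then obtain s t where "\<forall>i. s i \<in> cs i (hp i f)" "\<forall>i. t i \<in> cs i (hp i h)" by metis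
    then show "?A \<noteq> {}" by blast
  next
    fix x assume "x \<in> ?A"
    then obtain s t where x: "x = F (m - 1) +>\<^bsub>R\<^esub> (\<Oplus>\<^bsub>R\<^esub>i\<in>{0..m}. s i \<otimes>\<^bsub>R\<^esub> t (m - i))"
      and s: "\<forall>i. s i \<in> cs i (hp i f)" and t: "\<forall>i. t i \<in> cs i (hp i h)" by blast
    have st: "s i \<otimes>\<^bsub>R\<^esub> t (m - i) \<in> F m \<and> sy m (s i \<otimes>\<^bsub>R\<^esub> t (m - i)) = hp i f * hp (m - i) h" for i
      using F_mult[of "s i" i "t (m - i)" "m - i"] s[rule_format, of i] t[rule_format, of "m - i"] by (simp add: cs_def)
    have "(\<Oplus>\<^bsub>R\<^esub>i\<in>{0..m}. s i \<otimes>\<^bsub>R\<^esub> t (m - i)) \<in> F m \<and>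
        sy m (\<Oplus>\<^bsub>R\<^esub>i\<in>{0..m}. s i \<otimes>\<^bsub>R\<^esub> t (m - i)) = (\<Sum>i\<in>{0..m}. hp i f * hp (m - i) h)"
      using sum_F[of "{0..m}" "\<lambda>i. s i \<otimes>\<^bsub>R\<^esub> t (m - i)" m] st by simp
    note y = this
    show "x = cs m (hp m (f * h))" unfolding x hp_mult[OF f h] coset[OF y[THEN conjunct1]] y[THEN conjunct2] ..
  qed
  then show ?thesis by (simp add: gr_alg_def cosets_of_def)
qed

lemma cosets_of_zero: "cosets_of 0 = \<zero>\<^bsub>G\<^esub>"
proof -
  have "hp i 0 = (0 :: 'k laurent)" for i by (rule laurent_eqI) simp
  then show ?thesis by (simp add: gr_alg_def cosets_of_def cs_zero)
qed

lemma cosets_of_one: "cosets_of 1 = \<one>\<^bsub>G\<^esub>"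
proof
  fix i
  have 1: "hp i (1 :: 'k laurent) = (if i = 0 then 1 else 0)"
    by (rule hp_of_homog) (auto simp: homog_def lookup_one when_def zero_prod_def split: if_splits)
  have "sy 0 \<one>\<^bsub>R\<^esub> = 1" "\<one>\<^bsub>R\<^esub> \<in> F 0" using sy_word[of "[]"] F_word[of "[]" 0 1] by (simp_all add: R.sm_one)
  then have "F (- 1) +>\<^bsub>R\<^esub> \<one>\<^bsub>R\<^esub> = cs 0 1" using coset[of "\<one>\<^bsub>R\<^esub>" 0] by simp
  moreover have "F (i - 1) +>\<^bsub>R\<^esub> \<zero>\<^bsub>R\<^esub> = cs i 0" using coset[OF F_zero, of i] by simp
  ultimately show "cosets_of 1 i = \<one>\<^bsub>G\<^esub> i" by (simp add: gr_alg_def cosets_of_def 1)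
qed

lemma cosets_of_grading: "gr_comp R F e = cosets_of ` (sing n \<inter> homog e)"
proof -
  have "(\<forall>m. m \<noteq> e \<longrightarrow> cosets_of f m = F (m - 1)) \<longleftrightarrow> f \<in> homog e" if f: "f \<in> sing n" for f
  proof
    assume h: "\<forall>m. m \<noteq> e \<longrightarrow> cosets_of f m = F (m - 1)"
    show "f \<in> homog e"
      unfolding homog_def
    proof (intro CollectI allI impI, rule ccontr)
      fix p q assume nz: "lcoeff f (p, q) \<noteq> 0" and "p + q \<noteq> e"
      then have "cs (p + q) (hp (p + q) f) = cs (p + q) 0" using h by (simp add: cosets_of_def cs_zero)
      then have "hp (p + q) f = 0" by (rule cs_inj[OF hp_sing[OF f] hp_homog])
      then have "lcoeff (hp (p + q) f) (p, q) = 0" by (simp only: lookup_zero)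
      with nz show False by simp
    qed
  next
    assume "f \<in> homog e"
    then show "\<forall>m. m \<noteq> e \<longrightarrow> cosets_of f m = F (m - 1)" by (simp add: cosets_of_def hp_of_homog cs_zero)
  qed
  then show ?thesis unfolding gr_comp_def gr_carrier by blast
qed

definition gi :: "(int \<Rightarrow> (gen list \<Rightarrow> 'k) set set) \<Rightarrow> 'k laurent"
  where "gi = inv_into (sing n) cosets_of"

lemma cosets_of_inj_on: "inj_on cosets_of (sing n)"
  by (rule inj_onI) (rule cosets_of_inj)

lemma gi_cosets_of [simp]: "f \<in> sing n \<Longrightarrow> gi (cosets_of f) = f"
  unfolding gi_def by (rule inv_into_f_f[OF cosets_of_inj_on])

lemma scale_sing: "f \<in> sing n \<Longrightarrow> scale c f \<in> sing n" for f :: "'k laurent"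
  by (auto simp: sing_def)

lemma one_sing: "1 \<in> (sing n :: 'k laurent set)"
  by (auto simp: sing_def lookup_one when_def split: if_splits)

text \<open>
  The associated graded algebra is \<open>sing n\<close>: symbols are additive, multiplicative and surjective, and
  the kernel in degree \<open>m\<close> is the next smaller filtration step.
\<close>

lemma gr_sing_algebra: "sing_algebra G (gr_comp R F) n gi"
proof
  show "0 < n" by (rule n0)
  show "bij_betw gi (carrier G) (sing n)"
    unfolding gr_carrier gi_def by (rule bij_betw_inv_into) (simp add: bij_betw_def cosets_of_inj_on)
next
  show "gr_comp R F e = {u \<in> carrier G. gi u \<in> homog e}" for e
    unfolding cosets_of_grading gr_carrier by auto
next
  fix u v :: "int \<Rightarrow> (gen list \<Rightarrow> 'k) set set" and c assume u: "u \<in> carrier G" and v: "v \<in> carrier G"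
  obtain f h where fh: "f \<in> sing n" "h \<in> sing n" "u = cosets_of f" "v = cosets_of h" using u v unfolding gr_carrier by blast
  show "u \<oplus>\<^bsub>G\<^esub> v \<in> carrier G" "u \<otimes>\<^bsub>G\<^esub> v \<in> carrier G"
    "gi (u \<oplus>\<^bsub>G\<^esub> v) = gi u + gi v" "gi (u \<otimes>\<^bsub>G\<^esub> v) = gi u * gi v"
    using fh by (simp_all add: gr_carrier cosets_of_add cosets_of_mult sing_add sing_mult)
next
  fix u :: "int \<Rightarrow> (gen list \<Rightarrow> 'k) set set" and c assume u: "u \<in> carrier G"
  obtain f where f: "f \<in> sing n" "u = cosets_of f" using u unfolding gr_carrier by blast
  show "c \<odot>\<^bsub>G\<^esub> u \<in> carrier G" "gi (c \<odot>\<^bsub>G\<^esub> u) = scale c (gi u)"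
    using f scale_sing[OF f(1), of c] unfolding gr_carrier by (simp_all only: cosets_of_smult gi_cosets_of imageI)
next
  show "\<zero>\<^bsub>G\<^esub> \<in> carrier G" "gi \<zero>\<^bsub>G\<^esub> = 0" "\<one>\<^bsub>G\<^esub> \<in> carrier G" "gi \<one>\<^bsub>G\<^esub> = 1"
    unfolding cosets_of_zero[symmetric] cosets_of_one[symmetric] gr_carrier using one_sing by simp_all
qed

section \<open>Homological determinants of monomial automorphisms\<close>

text \<open>
  The symbols of the images of words are determined by those of the generators, so the induced
  automorphism of the associated graded algebra is a monomial automorphism, and \<open>hdet_eq_1\<close> applies.
\<close>

lemma hdet_monomial:
  assumes lin: "\<And>c r. r \<in> carrier R \<Longrightarrow> \<phi> (c \<odot>\<^bsub>R\<^esub> r) = c \<odot>\<^bsub>R\<^esub> \<phi> r"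
    and hom: "\<phi> \<in> ring_hom R R"
    and filt: "\<And>m r. r \<in> carrier R \<Longrightarrow> \<phi> r \<in> F m \<longleftrightarrow> r \<in> F m"
    and surj: "\<phi> ` carrier R = carrier R"
    and \<chi>: "monchar n \<chi>" and sgn: "\<chi> (1, 1) = (if s then - 1 else 1)"
    and gens: "\<And>v. sy (int (gen_weight n v)) (\<phi> (g v)) = twist s \<chi> (lterm (ge n v) 1)"
  shows "hdet_fl R F \<phi> = 1"
proof -
  have h: "\<phi> (u \<oplus>\<^bsub>R\<^esub> v) = \<phi> u \<oplus>\<^bsub>R\<^esub> \<phi> v" "\<phi> (u \<otimes>\<^bsub>R\<^esub> v) = \<phi> u \<otimes>\<^bsub>R\<^esub> \<phi> v" "\<phi> \<one>\<^bsub>R\<^esub> = \<one>\<^bsub>R\<^esub>" "\<phi> u \<in> carrier R"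
    if "u \<in> carrier R" "v \<in> carrier R" for u v
    using ring_hom_closed[OF hom] ring_hom_add[OF hom] ring_hom_mult[OF hom] ring_hom_one[OF hom] that by auto
  have z: "\<phi> \<zero>\<^bsub>R\<^esub> = \<zero>\<^bsub>R\<^esub>" using lin[of "\<zero>\<^bsub>R\<^esub>" 0] R.sm_zero h(4)[of "\<zero>\<^bsub>R\<^esub>" "\<zero>\<^bsub>R\<^esub>"] by simp
  have wd: "sy (wt w) (\<phi> (R.wd g w)) = twist s \<chi> (lterm (ex w) 1)" for w
  proof (induction w)
    case Nil
    have "sy 0 \<one>\<^bsub>R\<^esub> = 1" using sy_word[of "[]"] by simp
    moreover have "kap s 0 = 0" by (simp add: kap_def zero_prod_def)
    ultimately show ?case using h(3)[OF R.one_closed R.one_closed] monchar_zero[OF \<chi>] twist_term[of s \<chi> 0 1] by simp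
  next
    case (Cons v w)
    have F: "\<phi> (g v) \<in> F (int (gen_weight n v))" "\<phi> (R.wd g w) \<in> F (wt w)"
      using filt F_word[of "[v]" _ 1] F_word[of w _ 1] by (simp_all add: R.sm_one R.wd_closed)
    have "\<chi> (ge n v + ex w) = \<chi> (ge n v) * \<chi> (ex w)"
      using \<chi> ex_cone(1)[of w] ex_cone(1)[of "[v]"] unfolding monchar_def by simp
    then show ?case
      using F_mult(2)[OF F] Cons gens[of v] h(2)[OF gc[of v] R.wd_closed[where h = g and w = w, OF gc]]
      by (simp add: twist_term mult_single kap_add)
  qed
  have tw: "sy m (\<phi> r) = twist s \<chi> (sy m r)" if "r \<in> F m" for r m
    using that
  proof (induction rule: F_induct)
    case zero
    then show ?case by (simp add: z linear_opD(3)[OF linear_op_twist])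
  next
    case (word c w)
    have W: "R.wd g w \<in> F m" using F_word[of w m 1] word by (simp add: R.sm_one R.wd_closed)
    then have pW: "\<phi> (R.wd g w) \<in> F m" using filt F_closed by blast
    have "sy m (\<phi> (R.wd g w)) = twist s \<chi> (sy m (R.wd g w))"
    proof (cases "wt w = m")
      case True
      then show ?thesis using wd[of w] sy_word[of w] by simp
    next
      case False
      then have "R.wd g w \<in> F (m - 1)" using F_word[of w "m - 1" 1] word by (simp add: R.sm_one R.wd_closed)
      moreover from this have "\<phi> (R.wd g w) \<in> F (m - 1)" using filt F_closed by blast
      ultimately show ?thesis using sy_zero_iff[OF W] sy_zero_iff[OF pW] linear_opD(3)[OF linear_op_twist] by metis
    qed
    then show ?case using sy_smult[OF W] sy_smult[OF pW] lin[OF F_closed[OF W]] by (simp add: twist_scale)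
  next
    case (add r t)
    then have "\<phi> r \<in> F m" "\<phi> t \<in> F m" using filt F_closed by blast+
    then show ?case using add h(1)[of r t] sy_add[of r m t] sy_add[of "\<phi> r" m "\<phi> t"] F_closed by (simp add: twist_add)
  qed
  let ?\<chi>' = "\<lambda>k. inverse (\<chi> (kap s k))"
  have img: "\<phi> ` cs m t = cs m (twist s \<chi> t)" if t: "t \<in> sing n" for m t
  proof (intro equalityI subsetI)
    fix x assume "x \<in> \<phi> ` cs m t"
    then show "x \<in> cs m (twist s \<chi> t)" using filt F_closed tw by (auto simp: cs_def)
  next
    fix x assume "x \<in> cs m (twist s \<chi> t)"
    then have x: "x \<in> F m" "sy m x = twist s \<chi> t" by (auto simp: cs_def)
    obtain r where r: "r \<in> carrier R" "x = \<phi> r" using surj F_closed[OF x(1)] by blast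
    then have rF: "r \<in> F m" using x(1) filt by blast
    have "twist s ?\<chi>' (twist s \<chi> (sy m r)) = twist s ?\<chi>' (twist s \<chi> t)" using tw[OF rF] x(2) r(2) by simp
    then have "sy m r = t" using twist_inverse(2)[OF \<chi>] sy_sing[OF rF] t by simp
    then show "x \<in> \<phi> ` cs m t" using rF r(2) by (auto simp: cs_def)
  qed
  have map: "gr_map R F \<phi> (cosets_of f) = cosets_of (twist s \<chi> f)" if "f \<in> sing n" for f
    using that img[OF hp_sing[OF that]] by (simp add: gr_map_def gr_carrier cosets_of_def hp_twist)
  interpret S: sing_algebra G "gr_comp R F" n gi by (rule gr_sing_algebra)
  have tb: "twist s \<chi> ` sing n = sing n"
  proof (intro equalityI subsetI)
    fix f :: "'k laurent" assume "f \<in> twist s \<chi> ` sing n"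
    then show "f \<in> sing n" using twist_sing by blast
  next
    fix f :: "'k laurent" assume f: "f \<in> sing n"
    show "f \<in> twist s \<chi> ` sing n"
      using twist_inverse(1)[OF \<chi> f, symmetric] twist_sing[OF f] by (rule image_eqI)
  qed
  have "inj_on (gr_map R F \<phi>) (carrier G)"
  proof (rule inj_onI)
    fix u v assume uv: "u \<in> carrier G" "v \<in> carrier G" "gr_map R F \<phi> u = gr_map R F \<phi> v"
    then obtain f h' where fh: "f \<in> sing n" "h' \<in> sing n" "u = cosets_of f" "v = cosets_of h'" unfolding gr_carrier by blast
    then have "cosets_of (twist s \<chi> f) = cosets_of (twist s \<chi> h')" using uv(3) map by simp
    then have "twist s \<chi> f = twist s \<chi> h'" by (rule cosets_of_inj[OF twist_sing[OF fh(1)] twist_sing[OF fh(2)]])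
    then have "twist s ?\<chi>' (twist s \<chi> f) = twist s ?\<chi>' (twist s \<chi> h')" by (rule arg_cong)
    then have "f = h'" unfolding twist_inverse(2)[OF \<chi> fh(1)] twist_inverse(2)[OF \<chi> fh(2)] .
    then show "u = v" unfolding fh(3,4) by (rule arg_cong)
  qed
  moreover have "gr_map R F \<phi> ` carrier G = carrier G"
  proof -
    have "gr_map R F \<phi> ` carrier G = (\<lambda>f. cosets_of (twist s \<chi> f)) ` sing n"
      unfolding gr_carrier image_image using map by (intro image_cong) auto
    also have "\<dots> = cosets_of ` twist s \<chi> ` sing n" by (rule image_image[symmetric])
    finally show ?thesis by (simp only: tb gr_carrier)
  qed
  ultimately have "bij_betw (gr_map R F \<phi>) (carrier G) (carrier G)" by (simp add: bij_betw_def)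
  moreover have "gi (gr_map R F \<phi> u) = twist s \<chi> (gi u)" if "u \<in> carrier G" for u
  proof -
    obtain f where f: "f \<in> sing n" "u = cosets_of f" using \<open>u \<in> carrier G\<close> unfolding gr_carrier by blast
    then show ?thesis by (simp add: map twist_sing)
  qed
  ultimately show ?thesis unfolding hdet_fl_def using S.hdet_eq_1[OF _ \<chi> sgn] by blast
qed

end

section \<open>Filtered automorphisms\<close>

context classical_gwa
begin

text \<open>Unital algebra endomorphisms.\<close>

definition alghom :: "((gen list \<Rightarrow> 'k) set \<Rightarrow> (gen list \<Rightarrow> 'k) set) \<Rightarrow> bool"
  where "alghom \<phi> \<longleftrightarrow> \<phi> \<in> ring_hom R R \<and> (\<forall>c. \<forall>r\<in>carrier R. \<phi> (c \<odot>\<^bsub>R\<^esub> r) = c \<odot>\<^bsub>R\<^esub> \<phi> r)"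

lemma alghomD:
  assumes "alghom \<phi>"
  shows "u \<in> carrier R \<Longrightarrow> \<phi> u \<in> carrier R"
    "u \<in> carrier R \<Longrightarrow> v \<in> carrier R \<Longrightarrow> \<phi> (u \<oplus>\<^bsub>R\<^esub> v) = \<phi> u \<oplus>\<^bsub>R\<^esub> \<phi> v"
    "u \<in> carrier R \<Longrightarrow> v \<in> carrier R \<Longrightarrow> \<phi> (u \<otimes>\<^bsub>R\<^esub> v) = \<phi> u \<otimes>\<^bsub>R\<^esub> \<phi> v"
    "u \<in> carrier R \<Longrightarrow> \<phi> (c \<odot>\<^bsub>R\<^esub> u) = c \<odot>\<^bsub>R\<^esub> \<phi> u"
    "\<phi> \<one>\<^bsub>R\<^esub> = \<one>\<^bsub>R\<^esub>" "\<phi> \<zero>\<^bsub>R\<^esub> = \<zero>\<^bsub>R\<^esub>"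
proof -
  have hom: "\<phi> \<in> ring_hom R R" and lin: "\<And>c r. r \<in> carrier R \<Longrightarrow> \<phi> (c \<odot>\<^bsub>R\<^esub> r) = c \<odot>\<^bsub>R\<^esub> \<phi> r"
    using assms by (auto simp: alghom_def)
  show 1: "u \<in> carrier R \<Longrightarrow> \<phi> u \<in> carrier R" for u by (rule ring_hom_closed[OF hom])
  show "u \<in> carrier R \<Longrightarrow> v \<in> carrier R \<Longrightarrow> \<phi> (u \<oplus>\<^bsub>R\<^esub> v) = \<phi> u \<oplus>\<^bsub>R\<^esub> \<phi> v" by (rule ring_hom_add[OF hom])
  show "u \<in> carrier R \<Longrightarrow> v \<in> carrier R \<Longrightarrow> \<phi> (u \<otimes>\<^bsub>R\<^esub> v) = \<phi> u \<otimes>\<^bsub>R\<^esub> \<phi> v" by (rule ring_hom_mult[OF hom])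
  show "u \<in> carrier R \<Longrightarrow> \<phi> (c \<odot>\<^bsub>R\<^esub> u) = c \<odot>\<^bsub>R\<^esub> \<phi> u" by (rule lin)
  show "\<phi> \<one>\<^bsub>R\<^esub> = \<one>\<^bsub>R\<^esub>" by (rule ring_hom_one[OF hom])
  show "\<phi> \<zero>\<^bsub>R\<^esub> = \<zero>\<^bsub>R\<^esub>" using lin[of "\<zero>\<^bsub>R\<^esub>" 0] R.sm_zero[OF 1[of "\<zero>\<^bsub>R\<^esub>"]] by simp
qed

lemma alghom_comp: "alghom \<phi> \<Longrightarrow> alghom \<psi> \<Longrightarrow> alghom (compose (carrier R) \<phi> \<psi>)"
  unfolding alghom_def[of "compose _ _ _"] by (auto intro!: ring_hom_memI simp: compose_eq alghomD)

lemma alghom_eq: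
  assumes \<phi>: "alghom \<phi>" and \<psi>: "alghom \<psi>" and eq: "\<And>v. \<phi> (g v) = \<psi> (g v)" and r: "r \<in> carrier R"
  shows "\<phi> r = \<psi> r"
proof -
  obtain k where "r \<in> F (int k)" using F_exhaust[OF r] by blast
  then show ?thesis
  proof (induction rule: F_induct)
    case (word c w)
    have "\<phi> (R.wd g w) = \<psi> (R.wd g w)"
      by (induction w) (simp_all add: alghomD[OF \<phi>] alghomD[OF \<psi>] eq R.wd_closed)
    then show ?case by (simp add: alghomD(4)[OF \<phi>] alghomD(4)[OF \<psi>] R.wd_closed)
  next
    case (add u v)
    then show ?case by (simp add: alghomD(2)[OF \<phi>] alghomD(2)[OF \<psi>] F_closed)
  qed (simp add: alghomD(6)[OF \<phi>] alghomD(6)[OF \<psi>])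
qed

lemma gen_F: "g v \<in> F (int (gen_weight n v))"
  using F_word[of "[v]" _ 1] by (simp add: R.sm_one)

lemma alghom_F:
  assumes \<phi>: "alghom \<phi>" and gens: "\<And>v. \<phi> (g v) \<in> F (int (gen_weight n v))" and r: "r \<in> F m"
  shows "\<phi> r \<in> F m"
  using r
proof (induction rule: F_induct)
  case zero
  then show ?case by (simp add: alghomD(6)[OF \<phi>] F_zero)
next
  case (word c w)
  have "\<phi> (R.wd g w) \<in> F (wt w)"
  proof (induction w)
    case Nil
    then show ?case using F_word[of "[]" 0 1] by (simp add: alghomD(5)[OF \<phi>] R.sm_one)
  next
    case (Cons v w)
    then show ?case using F_mult(1)[OF gens[of v] Cons.IH] by (simp add: alghomD(3)[OF \<phi>] R.wd_closed)
  qed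
  then have "\<phi> (R.wd g w) \<in> F m" using F_mono[OF word] by blast
  then show ?case by (simp add: alghomD(4)[OF \<phi>] R.wd_closed F_smult)
next
  case (add u v)
  then show ?case by (simp add: alghomD(2)[OF \<phi>] F_closed F_add)
qed

lemma fdeg_iff: "r \<in> carrier R \<Longrightarrow> r \<in> F (int k) \<longleftrightarrow> fdeg F r \<le> k"
proof
  assume "r \<in> F (int k)"
  then show "fdeg F r \<le> k" unfolding fdeg_def by (rule Least_le)
next
  assume r: "r \<in> carrier R" "fdeg F r \<le> k"
  have "r \<in> F (int (fdeg F r))" unfolding fdeg_def using F_exhaust[OF r(1)] by (rule LeastI_ex)
  then show "r \<in> F (int k)" using F_mono[of "int (fdeg F r)" "int k"] r(2) by auto
qed

abbreviation "A \<equiv> Aut_fl R F"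

lemma A_carrier: "\<phi> \<in> carrier A \<longleftrightarrow> \<phi> \<in> Bij (carrier R) \<and> alghom \<phi> \<and> (\<forall>r\<in>carrier R. fdeg F (\<phi> r) = fdeg F r)"
  by (auto simp: Aut_fl_def alg_aut_def alghom_def)

text \<open>
  Preserving degrees is the same as preserving and reflecting each filtration step. In negative
  degrees, which \<open>fdeg\<close> does not see, this is injectivity.
\<close>

lemma A_filt:
  assumes "\<phi> \<in> carrier A" "r \<in> carrier R"
  shows "\<phi> r \<in> F m \<longleftrightarrow> r \<in> F m"
proof (cases "0 \<le> m")
  case True
  then obtain k where k: "m = int k" by (metis nonneg_int_cases)
  have "alghom \<phi>" "fdeg F (\<phi> r) = fdeg F r" using assms by (auto simp: A_carrier)
  then show ?thesis using fdeg_iff[OF assms(2)] fdeg_iff[OF alghomD(1)[OF _ assms(2)]] by (simp add: k)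
next
  case False
  have al: "alghom \<phi>" and inj: "inj_on \<phi> (carrier R)" using assms by (auto simp: A_carrier Bij_def bij_betw_def)
  have "\<phi> r = \<zero>\<^bsub>R\<^esub> \<longleftrightarrow> r = \<zero>\<^bsub>R\<^esub>" using inj_on_eq_iff[OF inj assms(2) R.zero_closed] alghomD(6)[OF al] by simp
  then show ?thesis using F_neg[of m] False by simp
qed

text \<open>All conditions on an automorphism with given inverse can be checked on generators.\<close>

lemma A_intro:
  assumes \<phi>: "alghom \<phi>" and \<psi>: "alghom \<psi>" and ext: "\<phi> \<in> extensional (carrier R)"
    and inv: "\<And>v. \<psi> (\<phi> (g v)) = g v" "\<And>v. \<phi> (\<psi> (g v)) = g v"
    and gens: "\<And>v. \<phi> (g v) \<in> F (int (gen_weight n v))" "\<And>v. \<psi> (g v) \<in> F (int (gen_weight n v))"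
  shows "\<phi> \<in> carrier A"
proof -
  have id: "alghom (\<lambda>r. r)" by (auto simp: alghom_def intro!: ring_hom_memI)
  have 1: "\<psi> (\<phi> r) = r" "\<phi> (\<psi> r) = r" if r: "r \<in> carrier R" for r
    using alghom_eq[OF alghom_comp[OF \<psi> \<phi>] id _ r] alghom_eq[OF alghom_comp[OF \<phi> \<psi>] id _ r] inv r
    by (simp_all add: compose_eq)
  have "bij_betw \<phi> (carrier R) (carrier R)"
    using 1 alghomD(1)[OF \<phi>] alghomD(1)[OF \<psi>] by (intro bij_betwI[where g = \<psi>]) auto
  moreover have "fdeg F (\<phi> r) = fdeg F r" if r: "r \<in> carrier R" for r
  proof -
    have "\<phi> r \<in> F m \<longleftrightarrow> r \<in> F m" for m
      using alghom_F[OF \<phi> gens(1), of r m] alghom_F[OF \<psi> gens(2), of "\<phi> r" m] 1(1)[OF r] by auto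
    then show ?thesis by (simp add: fdeg_def)
  qed
  ultimately show ?thesis using \<phi> ext by (simp add: A_carrier Bij_def)
qed

lemma A_mult: "\<phi> \<in> carrier A \<Longrightarrow> \<psi> \<in> carrier A \<Longrightarrow> \<phi> \<otimes>\<^bsub>A\<^esub> \<psi> = compose (carrier R) \<phi> \<psi>"
  by (simp add: A_carrier) (simp add: Aut_fl_def BijGroup_def)

lemma A_group: "group A"
proof -
  let ?S = "carrier R" and ?B = "BijGroup (carrier R)"
  have "subgroup (carrier A) ?B"
  proof (rule group.subgroupI[OF group_BijGroup])
    show "carrier A \<subseteq> carrier ?B" by (auto simp: A_carrier BijGroup_def)
    have "restrict (\<lambda>r. r) ?S \<in> carrier A"
      by (auto simp: A_carrier id_Bij alghom_def intro!: ring_hom_memI)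
    then show "carrier A \<noteq> {}" by blast
  next
    fix \<phi> assume \<phi>: "\<phi> \<in> carrier A"
    then have B: "\<phi> \<in> Bij ?S" and al: "alghom \<phi>" and fd: "\<forall>r\<in>?S. fdeg F (\<phi> r) = fdeg F r" by (auto simp: A_carrier)
    have bij: "bij_betw \<phi> ?S ?S" using B by (simp add: Bij_def)
    let ?\<psi> = "restrict (inv_into ?S \<phi>) ?S"
    have c: "?\<psi> r \<in> ?S" "\<phi> (?\<psi> r) = r" if "r \<in> ?S" for r
      using that bij bij_betw_inv_into_right[OF bij] bij_betw_inv_into[OF bij] by (auto simp: bij_betw_def)
    have u: "?\<psi> (\<phi> r) = r" if "r \<in> ?S" for r
      using that bij_betw_inv_into_left[OF bij that] alghomD(1)[OF al that] by simp
    have "alghom ?\<psi>"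
      unfolding alghom_def
    proof (intro conjI ballI allI ring_hom_memI)
      fix r s and k :: 'k assume r: "r \<in> ?S" and s: "s \<in> ?S"
      show "?\<psi> r \<in> ?S" by (rule c(1)[OF r])
      show "?\<psi> (r \<otimes>\<^bsub>R\<^esub> s) = ?\<psi> r \<otimes>\<^bsub>R\<^esub> ?\<psi> s"
        using u[of "?\<psi> r \<otimes>\<^bsub>R\<^esub> ?\<psi> s"] alghomD(3)[OF al c(1)[OF r] c(1)[OF s]] c(1)[OF r] c(1)[OF s] c(2)[OF r] c(2)[OF s] by (metis R.m_closed)
      show "?\<psi> (r \<oplus>\<^bsub>R\<^esub> s) = ?\<psi> r \<oplus>\<^bsub>R\<^esub> ?\<psi> s"
        using u[of "?\<psi> r \<oplus>\<^bsub>R\<^esub> ?\<psi> s"] alghomD(2)[OF al c(1)[OF r] c(1)[OF s]] c(1)[OF r] c(1)[OF s] c(2)[OF r] c(2)[OF s] by (metis R.a_closed)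
    next
      show "?\<psi> \<one>\<^bsub>R\<^esub> = \<one>\<^bsub>R\<^esub>" using u[OF R.one_closed] alghomD(5)[OF al] by simp
    next
      fix r and k :: 'k assume r: "r \<in> ?S"
      show "?\<psi> (k \<odot>\<^bsub>R\<^esub> r) = k \<odot>\<^bsub>R\<^esub> ?\<psi> r"
        using u[of "k \<odot>\<^bsub>R\<^esub> ?\<psi> r"] alghomD(4)[OF al c(1)[OF r], of k] c(1)[OF r] c(2)[OF r] by (metis R.sm_closed)
    qed
    moreover have "fdeg F (?\<psi> r) = fdeg F r" if "r \<in> ?S" for r
      using fd[rule_format, OF c(1)[OF that]] c(2)[OF that] by metis
    ultimately have "?\<psi> \<in> carrier A"
      using restrict_inv_into_Bij[OF B] by (simp add: A_carrier)
    then show "inv\<^bsub>?B\<^esub> \<phi> \<in> carrier A" using inv_BijGroup[OF B] by simp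
  next
    fix \<phi> \<psi> assume h: "\<phi> \<in> carrier A" "\<psi> \<in> carrier A"
    then have "alghom (compose ?S \<phi> \<psi>)" "compose ?S \<phi> \<psi> \<in> Bij ?S" by (auto simp: A_carrier alghom_comp compose_Bij)
    moreover have "fdeg F (compose ?S \<phi> \<psi> r) = fdeg F r" if "r \<in> ?S" for r
      using h that alghomD(1)[of \<psi> r] by (simp add: A_carrier compose_eq)
    ultimately have "compose ?S \<phi> \<psi> \<in> carrier A" by (simp add: A_carrier)
    then show "\<phi> \<otimes>\<^bsub>?B\<^esub> \<psi> \<in> carrier A" using h by (simp add: BijGroup_def A_carrier)
  qed
  then have "group (?B\<lparr>carrier := carrier A\<rparr>)" by (rule subgroup.subgroup_is_group[OF _ group_BijGroup])
  moreover have "?B\<lparr>carrier := carrier A\<rparr> = A" by (simp add: Aut_fl_def)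
  ultimately show ?thesis by simp
qed

section \<open>The automorphisms \<Theta> and \<Omega>\<close>

text \<open>The relations of the algebra can be tested in its faithful representation.\<close>

lemma good_by_rep:
  assumes h: "\<And>v. h v \<in> carrier R" and E: "good a EndV (\<lambda>v. rp a (h v))"
  shows "good a R h"
proof -
  interpret E: kalg "EndV :: ('k, 'k vec \<Rightarrow> 'k vec) module" by (rule kalg_EndV)
  have hE: "\<And>v. rp a (h v) \<in> carrier EndV" using E by (simp add: good_def)
  have rpw: "rp a (R.wd h w) = E.wd (\<lambda>v. rp a (h v)) w" for w
  proof (induction w)
    case Nil
    show ?case by (rule ext) (simp add: rp_simps)
  next
    case (Cons v w)
    show ?case by (rule ext) (simp add: rp_simps(2)[OF h R.wd_closed[OF h]] Cons)
  qed
  have "rp a (free_eval R h f) = free_eval EndV (\<lambda>v. rp a (h v)) f" if "f \<in> carrier free_alg" for f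
    using that
  proof (induction rule: free_induct)
    case zero
    then show ?case by (rule_tac ext) (simp add: R.free_eval_zero E.free_eval_zero rp_simps h hE)
  next
    case (mon c w)
    have "rp a (c \<odot>\<^bsub>R\<^esub> R.wd h w) = c \<odot>\<^bsub>EndV\<^esub> rp a (R.wd h w)"
      by (rule ext) (simp add: rp_simps(3)[OF R.wd_closed[OF h]])
    then show ?case by (simp only: R.free_eval_mon[OF h] E.free_eval_mon[OF hE] rpw)
  next
    case (add f k)
    have "rp a (free_eval R h f \<oplus>\<^bsub>R\<^esub> free_eval R h k) = rp a (free_eval R h f) \<oplus>\<^bsub>EndV\<^esub> rp a (free_eval R h k)"
      by (rule ext) (simp add: rp_simps(1)[OF R.free_eval_closed[OF h add(1)] R.free_eval_closed[OF h add(2)]])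
    then show ?case
      by (simp only: R.free_eval_add[OF h add(1,2)] E.free_eval_add[OF hE add(1,2)] add.IH)
  qed
  note rpf = this
  have "free_eval R h f = \<zero>\<^bsub>R\<^esub>" if f: "f \<in> gwa_relations a" for f
  proof (rule ev_zero_iff)
    have fc: "f \<in> carrier free_alg" using f gwa_rel_carrier by blast
    show "free_eval R h f \<in> carrier R" by (rule R.free_eval_closed[OF h fc])
    show "ev a (free_eval R h f) = (\<lambda>i. 0)" using E f by (simp add: ev_def rpf[OF fc] good_def)
  qed
  then show ?thesis using h kalg_gwa by (simp add: good_def)
qed

lemma gwa_map_lift: "gwa_map a h = restrict (lift R h) (carrier R)"
  by (rule ext) (simp add: gwa_map_def lift_def restrict_def)

lemma gwa_map_alghom:
  assumes "good a R h"
  shows "alghom (gwa_map a h)" "gwa_map a h (g v) = h v"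
proof -
  have m: "gwa_map a h u = lift R h u" if "u \<in> carrier R" for u using that by (simp add: gwa_map_lift)
  note L = lift_hom[OF assms]
  show "alghom (gwa_map a h)"
    unfolding alghom_def
  proof (intro conjI allI ballI ring_hom_memI)
    fix u v and c :: 'k assume u: "u \<in> carrier R" and v: "v \<in> carrier R"
    show "gwa_map a h u \<in> carrier R" using L(1)[OF u u] m[OF u] by simp
    show "gwa_map a h (u \<otimes>\<^bsub>R\<^esub> v) = gwa_map a h u \<otimes>\<^bsub>R\<^esub> gwa_map a h v" using L(3)[OF u v] m u v by simp
    show "gwa_map a h (u \<oplus>\<^bsub>R\<^esub> v) = gwa_map a h u \<oplus>\<^bsub>R\<^esub> gwa_map a h v" using L(2)[OF u v] m u v by simp
  next
    show "gwa_map a h \<one>\<^bsub>R\<^esub> = \<one>\<^bsub>R\<^esub>" using L(5)[OF R.one_closed R.one_closed] m by simp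
  next
    fix u and c :: 'k assume u: "u \<in> carrier R"
    show "gwa_map a h (c \<odot>\<^bsub>R\<^esub> u) = c \<odot>\<^bsub>R\<^esub> gwa_map a h u" using L(4)[OF u u] m u by simp
  qed
  show "gwa_map a h (g v) = h v" using L(6)[OF R.one_closed R.one_closed] m by simp
qed

lemma Theta_hom:
  assumes l: "l \<noteq> 0"
  shows "alghom (Theta a l)" "Theta a l (g X) = l \<odot>\<^bsub>R\<^esub> g X" "Theta a l (g Y) = inverse l \<odot>\<^bsub>R\<^esub> g Y" "Theta a l (g Z) = g Z"
proof -
  define h where "h = (\<lambda>v. case v of X \<Rightarrow> l \<odot>\<^bsub>R\<^esub> g X | Y \<Rightarrow> inverse l \<odot>\<^bsub>R\<^esub> g Y | Z \<Rightarrow> g Z)"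
  have hc: "h v \<in> carrier R" for v by (cases v) (simp_all add: h_def)
  have rph: "rp a (h X) = (\<lambda>v i. Polynomial.smult l (v (i - 1)))"
    "rp a (h Y) = (\<lambda>v i. Polynomial.smult (inverse l) ((a \<circ>\<^sub>p shift i) * v (i + 1)))"
    "rp a (h Z) = (\<lambda>v i. shift i * v i)"
    by (intro ext; simp add: h_def rp_simps(3)[OF gc] rp_gen)+
  have sh: "sigma d \<circ>\<^sub>p shift i = d \<circ>\<^sub>p shift (i - 1)" "sigma_inv d \<circ>\<^sub>p shift i = d \<circ>\<^sub>p shift (i + 1)" for d :: "'k poly" and i
    unfolding sigma_def sigma_inv_def shift_def by (simp_all add: pcompose_shift algebra_simps)
  have "good a EndV (\<lambda>v. rp a (h v))"
  proof (rule good_EndV[where q = shift])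
    show "rp a (h v) \<in> carrier EndV" for v
      by (cases v) (simp_all add: rph EndV_carrier smult_add_right distrib_left mult.commute)
  qed (use l in \<open>simp_all add: rph sh mult.left_commute\<close>)
  then have good: "good a R h" by (rule good_by_rep[OF hc])
  have T: "Theta a l = gwa_map a h" by (simp add: Theta_def h_def)
  show "alghom (Theta a l)" "Theta a l (g X) = l \<odot>\<^bsub>R\<^esub> g X" "Theta a l (g Y) = inverse l \<odot>\<^bsub>R\<^esub> g Y" "Theta a l (g Z) = g Z"
    unfolding T gwa_map_alghom(2)[OF good] by (rule gwa_map_alghom(1)[OF good]) (simp_all add: h_def)
qed

lemma pz_reflect: "pz a [:1 + \<rho>, -1:] = ((1 + \<rho>) \<odot>\<^bsub>R\<^esub> \<one>\<^bsub>R\<^esub>) \<ominus>\<^bsub>R\<^esub> g Z"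
proof -
  have "pz a [:1 + \<rho>, -1:] \<oplus>\<^bsub>R\<^esub> g Z = pz a (Polynomial.smult (1 + \<rho>) 1)"
    unfolding pz_Z[symmetric] pz_add[symmetric] by (rule arg_cong[of _ _ "pz a"]) simp
  then have "pz a [:1 + \<rho>, -1:] \<oplus>\<^bsub>R\<^esub> g Z = (1 + \<rho>) \<odot>\<^bsub>R\<^esub> \<one>\<^bsub>R\<^esub>" by (simp only: pz_smult pz_1)
  then show ?thesis using R.add_minus_cancel[OF pz_closed gc, of "[:1 + \<rho>, -1:]" Z] by simp
qed

lemma Omega_hom:
  assumes refl: "reflective_at a \<rho>"
  shows "alghom (Omega a \<rho>)" "Omega a \<rho> (g X) = g Y" "Omega a \<rho> (g Y) = (-1) ^ n \<odot>\<^bsub>R\<^esub> g X"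
    "Omega a \<rho> (g Z) = pz a [:1 + \<rho>, -1:]"
proof -
  define h where "h = (\<lambda>v. case v of X \<Rightarrow> g Y | Y \<Rightarrow> (-1) ^ n \<odot>\<^bsub>R\<^esub> g X | Z \<Rightarrow> pz a [:1 + \<rho>, -1:])"
  define q :: "int \<Rightarrow> 'k poly" where "q i = [:1 + \<rho> - of_int i, -1:]" for i
  have hc: "h v \<in> carrier R" for v by (cases v) (simp_all add: h_def)
  have rph: "rp a (h X) = (\<lambda>v i. (a \<circ>\<^sub>p shift i) * v (i + 1))"
    "rp a (h Y) = (\<lambda>v i. Polynomial.smult ((-1) ^ n) (v (i - 1)))"
    "rp a (h Z) = (\<lambda>v i. q i * v i)"
    by (intro ext; simp add: h_def rp_simps(3)[OF gc] rp_gen rp_pz q_def shift_def pcompose_pCons)+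
  have sq: "sigma d \<circ>\<^sub>p q i = d \<circ>\<^sub>p q (i + 1)" "sigma_inv d \<circ>\<^sub>p q i = d \<circ>\<^sub>p q (i - 1)" for d :: "'k poly" and i
    unfolding sigma_def sigma_inv_def pcompose_assoc[symmetric] by (simp_all add: q_def pcompose_pCons algebra_simps)
  have aq: "a \<circ>\<^sub>p q (i + 1) = Polynomial.smult ((-1) ^ n) (a \<circ>\<^sub>p shift i)" for i
  proof -
    have "q (i + 1) = [:\<rho>, -1:] \<circ>\<^sub>p shift i" by (simp add: q_def shift_def pcompose_pCons)
    then have "a \<circ>\<^sub>p q (i + 1) = (a \<circ>\<^sub>p [:\<rho>, -1:]) \<circ>\<^sub>p shift i" by (simp only: pcompose_assoc)
    then show ?thesis using refl by (simp only: reflective_at_def pcompose_smult)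
  qed
  have aq': "a \<circ>\<^sub>p q i = Polynomial.smult ((-1) ^ n) (a \<circ>\<^sub>p shift (i - 1))" for i using aq[of "i - 1"] by simp
  have "good a EndV (\<lambda>v. rp a (h v))"
  proof (rule good_EndV[where q = q])
    show "rp a (h v) \<in> carrier EndV" for v
      by (cases v) (simp_all add: rph EndV_carrier smult_add_right distrib_left mult.commute)
  qed (simp_all add: rph sq aq aq' mult.assoc mult.left_commute)
  then have good: "good a R h" by (rule good_by_rep[OF hc])
  have T: "Omega a \<rho> = gwa_map a h" unfolding Omega_def h_def pz_reflect ..
  show "alghom (Omega a \<rho>)" "Omega a \<rho> (g X) = g Y" "Omega a \<rho> (g Y) = (-1) ^ n \<odot>\<^bsub>R\<^esub> g X"
    "Omega a \<rho> (g Z) = pz a [:1 + \<rho>, -1:]"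
    unfolding T gwa_map_alghom(2)[OF good] by (rule gwa_map_alghom(1)[OF good]) (simp_all add: h_def)
qed

lemma sm_sm: "u \<in> carrier R \<Longrightarrow> c \<odot>\<^bsub>R\<^esub> (d \<odot>\<^bsub>R\<^esub> u) = (c * d) \<odot>\<^bsub>R\<^esub> u"
  by (simp add: R.sm_mult)

lemma gens_F: "c \<odot>\<^bsub>R\<^esub> g X \<in> F (int n)" "c \<odot>\<^bsub>R\<^esub> g Y \<in> F (int n)" "g X \<in> F (int n)" "g Y \<in> F (int n)" "g Z \<in> F 2"
  "pz a [:\<beta>, \<alpha>:] \<in> F 2"
proof -
  show x: "g X \<in> F (int n)" and y: "g Y \<in> F (int n)" and z: "g Z \<in> F 2"
    using gen_F[of X] gen_F[of Y] gen_F[of Z] by simp_all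
  show "c \<odot>\<^bsub>R\<^esub> g X \<in> F (int n)" "c \<odot>\<^bsub>R\<^esub> g Y \<in> F (int n)" by (rule F_smult[OF x] F_smult[OF y])+
  have "NF 2 (pz a [:\<beta>, \<alpha>:] \<otimes>\<^bsub>R\<^esub> xp 0)" by (rule NF.NF_term) simp
  then show "pz a [:\<beta>, \<alpha>:] \<in> F 2" by (simp add: xp_0 F_eq_NF)
qed

lemma Theta_A: "l \<noteq> 0 \<Longrightarrow> Theta a l \<in> carrier A"
proof -
  assume l: "l \<noteq> 0"
  then have l': "inverse l \<noteq> 0" by simp
  note T = Theta_hom[OF l] and T' = Theta_hom[OF l']
  show ?thesis
  proof (rule A_intro[OF T(1) T'(1)])
    show "Theta a l \<in> extensional (carrier R)" by (simp add: Theta_def gwa_map_def)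
    fix v
    show "Theta a (inverse l) (Theta a l (g v)) = g v" "Theta a l (Theta a (inverse l) (g v)) = g v"
      using l by (cases v; simp add: T(2-4) T'(2-4) alghomD(4)[OF T(1)] alghomD(4)[OF T'(1)] sm_sm R.sm_one)+
    show "Theta a l (g v) \<in> F (int (gen_weight n v))" "Theta a (inverse l) (g v) \<in> F (int (gen_weight n v))"
      by (cases v; simp add: T(2-4) T'(2-4) gens_F)+
  qed
qed

text \<open>An algebra map acts on polynomials in \<open>z\<close> by substitution.\<close>

lemma alghom_pz:
  assumes \<phi>: "alghom \<phi>" and Z: "\<phi> (g Z) = pz a w"
  shows "\<phi> (pz a d) = pz a (d \<circ>\<^sub>p w)"
proof (induction d)
  case 0
  then show ?case by (simp add: pz_0 alghomD(6)[OF \<phi>])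
next
  case (pCons c d)
  have 1: "pz a (pCons c d) = c \<odot>\<^bsub>R\<^esub> \<one>\<^bsub>R\<^esub> \<oplus>\<^bsub>R\<^esub> (g Z \<otimes>\<^bsub>R\<^esub> pz a d)"
  proof -
    have "pCons c d = Polynomial.smult c 1 + [:0, 1:] * d" by simp
    then show ?thesis by (simp only: pz_add pz_mult pz_smult pz_1 pz_Z)
  qed
  have 2: "pz a (pCons c d \<circ>\<^sub>p w) = c \<odot>\<^bsub>R\<^esub> \<one>\<^bsub>R\<^esub> \<oplus>\<^bsub>R\<^esub> (pz a w \<otimes>\<^bsub>R\<^esub> pz a (d \<circ>\<^sub>p w))"
  proof -
    have "pCons c d \<circ>\<^sub>p w = Polynomial.smult c 1 + w * (d \<circ>\<^sub>p w)" by (simp add: pcompose_pCons)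
    then show ?thesis by (simp only: pz_add pz_mult pz_smult pz_1)
  qed
  show ?case
    unfolding 1 2 by (simp add: alghomD[OF \<phi>] Z pCons.IH)
qed

text \<open>
  The square of \<open>\<Omega>\<close> multiplies \<open>x\<close> and \<open>y\<close> by \<open>(-1)\<^sup>n\<close>, hence the inverse of \<open>\<Omega>\<close> is \<open>\<Theta>\<^sub>\<epsilon> \<Omega>\<close> with \<open>\<epsilon> = (-1)\<^sup>n\<close>.
\<close>

lemma Omega_A: "reflective_at a \<rho> \<Longrightarrow> Omega a \<rho> \<in> carrier A"
proof -
  assume refl: "reflective_at a \<rho>"
  define e :: 'k where "e = (-1) ^ n"
  have e: "e \<noteq> 0" "e * e = 1" by (simp_all add: e_def flip: power_mult_distrib)
  have ie: "inverse e = e" by (rule inverse_unique[OF e(2)])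
  note O = Omega_hom[OF refl] and T = Theta_hom[OF e(1)]
  note O' = O(2) O(3)[folded e_def] O(4)
  let ?\<psi> = "compose (carrier R) (Theta a e) (Omega a \<rho>)"
  have P: "alghom ?\<psi>" by (rule alghom_comp[OF T(1) O(1)])
  have Tz: "Theta a e (pz a d) = pz a d" for d
    using alghom_pz[OF T(1), of "[:0, 1:]" d] T(4) pz_Z by (simp add: pcompose_idR)
  have Oz: "Omega a \<rho> (pz a [:1 + \<rho>, -1:]) = g Z"
    using alghom_pz[OF O(1) O(4), of "[:1 + \<rho>, -1:]"] by (simp add: pcompose_pCons pz_Z)
  show ?thesis
  proof (rule A_intro[OF O(1) P])
    show "Omega a \<rho> \<in> extensional (carrier R)" by (simp add: Omega_def gwa_map_def)
    fix v
    show "?\<psi> (Omega a \<rho> (g v)) = g v" "Omega a \<rho> (?\<psi> (g v)) = g v"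
      by (cases v; simp add: compose_eq O' Tz Oz T(2-4) alghomD(4)[OF T(1)] alghomD(4)[OF O(1)] sm_sm e ie R.sm_one)+
    show "Omega a \<rho> (g v) \<in> F (int (gen_weight n v))" "?\<psi> (g v) \<in> F (int (gen_weight n v))"
      by (cases v; simp add: compose_eq O' Tz T(2-4) alghomD(4)[OF T(1)] gens_F sm_sm)+
  qed
qed

section \<open>Classification\<close>

text \<open>
  Otherwise \<open>a\<close> would take the value \<open>a(0)\<close> at all multiples of \<open>\<beta>\<close>, which are infinitely many in
  characteristic zero.
\<close>

lemma shift_invariant:
  assumes "a \<circ>\<^sub>p [:\<beta>, 1:] = a"
  shows "\<beta> = 0"
proof (rule ccontr)
  assume b: "\<beta> \<noteq> 0"
  have st: "poly a (\<beta> + x) = poly a x" for x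
    using arg_cong[OF assms, of "\<lambda>p. poly p x"] by (simp add: poly_pcompose)
  have "poly a (of_nat k * \<beta>) = poly a 0" for k
  proof (induction k)
    case (Suc k)
    then show ?case using st[of "of_nat k * \<beta>"] by (simp add: algebra_simps)
  qed simp
  then have "range (\<lambda>k. of_nat k * \<beta>) \<subseteq> {x. poly (a - [:poly a 0:]) x = 0}" by auto
  moreover have "infinite (range (\<lambda>k. of_nat k * \<beta>))"
    using b by (intro range_inj_infinite injI) simp
  ultimately have "a - [:poly a 0:] = 0" using poly_roots_finite finite_subset by blast
  then have "a = [:poly a 0:]" by simp
  then have "n = 0" by (metis degree_pCons_0)
  then show False using deg by simp
qed

text \<open>
  Composing two reflections that preserve \<open>a\<close> up to the same sign gives a translation that preserves \<open>a\<close>.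
\<close>

lemma reflective_at_unique:
  assumes "reflective_at a \<rho>" "reflective_at a \<rho>'"
  shows "\<rho> = \<rho>'"
proof -
  have "a \<circ>\<^sub>p [:\<rho>, -1:] = a \<circ>\<^sub>p [:\<rho>', -1:]" using assms by (simp add: reflective_at_def)
  then have "(a \<circ>\<^sub>p [:\<rho>, -1:]) \<circ>\<^sub>p [:\<rho>', -1:] = (a \<circ>\<^sub>p [:\<rho>', -1:]) \<circ>\<^sub>p [:\<rho>', -1:]" by simp
  then have "a \<circ>\<^sub>p [:\<rho> - \<rho>', 1:] = a"
    by (simp add: pcompose_assoc[symmetric] pcompose_pCons pcompose_idR)
  from shift_invariant[OF this] show ?thesis by simp
qed

lemma ev_pz: "ev a (pz a d) = (\<lambda>i. if i = 0 then d else 0)"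
  by (rule ext) (simp add: ev_def rp_pz shift_def pcompose_idR)

lemma ev_gens: "ev a (g X) = (\<lambda>i. if i = 1 then 1 else 0)" "ev a (g Y) = (\<lambda>i. if i = - 1 then a \<circ>\<^sub>p shift (- 1) else 0)"
  by (rule ext; auto simp: ev_def rp_gen)+

lemma pz_inj: "pz a d = pz a e \<Longrightarrow> d = e"
proof -
  assume "pz a d = pz a e"
  then have "ev a (pz a d) 0 = ev a (pz a e) 0" by simp
  then show "d = e" by (simp only: ev_pz if_True simp_thms)
qed

text \<open>
  Since \<open>n > 2\<close>, no power of \<open>x\<close> or \<open>y\<close> has degree at most two.
\<close>

lemma F2_form:
  assumes "r \<in> F 2"
  obtains \<alpha> \<beta> where "r = pz a [:\<beta>, \<alpha>:]"
proof -
  have "NF 2 r" using assms by (simp add: F_eq_NF)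
  then obtain P where P: "\<And>i. P i \<noteq> 0 \<Longrightarrow> 2 * int (Polynomial.degree (P i)) + int n * \<bar>i\<bar> \<le> 2"
    "ev a r = (\<lambda>i. (P i \<circ>\<^sub>p shift i) * omega i)" by (rule NF_coeffs) blast
  have "P i = 0" if "i \<noteq> 0" for i
  proof (rule ccontr)
    assume "P i \<noteq> 0"
    then have "int n * \<bar>i\<bar> \<le> 2" using P(1)[of i] by linarith
    moreover have "int n * 1 \<le> int n * \<bar>i\<bar>" using that by (intro mult_left_mono) auto
    ultimately show False using deg by linarith
  qed
  then have "ev a r = ev a (pz a (P 0))"
    unfolding P(2) ev_pz by (intro ext) (simp add: omega_def shift_def pcompose_idR)
  then have r: "r = pz a (P 0)" by (rule ev_inj[OF F_closed[OF assms] pz_closed])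
  have "Polynomial.degree (P 0) \<le> 1" using P(1)[of 0] by (cases "P 0 = 0") auto
  then have "P 0 = [:poly.coeff (P 0) 0, poly.coeff (P 0) 1:]"
    by (intro poly_eqI) (auto simp: coeff_pCons coeff_eq_0 split: nat.splits)
  then show ?thesis using that r by metis
qed

lemma Fn_form:
  assumes "r \<in> F (int n)"
  obtains b p c where "r = b \<odot>\<^bsub>R\<^esub> g X \<oplus>\<^bsub>R\<^esub> (pz a p \<oplus>\<^bsub>R\<^esub> c \<odot>\<^bsub>R\<^esub> g Y)"
proof -
  have "NF (int n) r" using assms by (simp add: F_eq_NF)
  then obtain P where P: "\<And>i. P i \<noteq> 0 \<Longrightarrow> 2 * int (Polynomial.degree (P i)) + int n * \<bar>i\<bar> \<le> int n"
    "ev a r = (\<lambda>i. (P i \<circ>\<^sub>p shift i) * omega i)" by (rule NF_coeffs) blast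
  have z: "P i = 0" if "1 < \<bar>i\<bar>" for i
  proof (rule ccontr)
    assume "P i \<noteq> 0"
    then have "int n * \<bar>i\<bar> \<le> int n" using P(1)[of i] by linarith
    moreover have "int n * 2 \<le> int n * \<bar>i\<bar>" using that by (intro mult_left_mono) auto
    ultimately show False using deg by linarith
  qed
  have "Polynomial.degree (P i) = 0" if "\<bar>i\<bar> = 1" for i
    using P(1)[of i] that by (cases "P i = 0") auto
  then have "Polynomial.degree (P 1) = 0" "Polynomial.degree (P (- 1)) = 0" by simp_all
  then have "\<exists>b. P 1 = [:b:]" "\<exists>c. P (- 1) = [:c:]" by (meson degree_eq_zeroE)+
  then obtain b c where bc: "P 1 = [:b:]" "P (- 1) = [:c:]" by blast
  have om: "omega 0 = 1" "omega 1 = 1" "omega (- 1) = a \<circ>\<^sub>p shift (- 1)"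
    by (simp_all add: omega_def)
  let ?s = "b \<odot>\<^bsub>R\<^esub> g X \<oplus>\<^bsub>R\<^esub> (pz a (P 0) \<oplus>\<^bsub>R\<^esub> c \<odot>\<^bsub>R\<^esub> g Y)"
  have "ev a r i = ev a ?s i" for i
  proof -
    consider "i = 0" | "i = 1" | "i = - 1" | "1 < \<bar>i\<bar>" by linarith
    then show ?thesis
      unfolding P(2) by cases (use z[of i] in \<open>auto simp: ev_add ev_smult ev_pz ev_gens om bc shift_def pcompose_idR\<close>)
  qed
  then have "r = ?s" by (intro ev_inj[OF F_closed[OF assms]]) auto
  then show ?thesis by (rule that)
qed

text \<open>
  An element of degree at most \<open>n\<close> that shifts \<open>w = \<alpha> z + \<beta>\<close> by \<open>\<epsilon>\<close> is an eigenvector, so it is a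
  multiple of \<open>x\<close> or of \<open>y\<close> according to the sign of \<open>\<alpha>\<close>.
\<close>

lemma eigen_form:
  assumes r: "r \<in> F (int n)" "r \<noteq> \<zero>\<^bsub>R\<^esub>" and e: "\<epsilon> \<noteq> 0"
    and rel: "r \<otimes>\<^bsub>R\<^esub> pz a [:\<beta>, \<alpha>:] = pz a [:\<beta> - \<epsilon>, \<alpha>:] \<otimes>\<^bsub>R\<^esub> r"
  shows "\<alpha> = \<epsilon> \<and> (\<exists>b. b \<noteq> 0 \<and> r = b \<odot>\<^bsub>R\<^esub> g X) \<or> \<alpha> = - \<epsilon> \<and> (\<exists>c. c \<noteq> 0 \<and> r = c \<odot>\<^bsub>R\<^esub> g Y)"
proof -
  obtain b p c where f: "r = b \<odot>\<^bsub>R\<^esub> g X \<oplus>\<^bsub>R\<^esub> (pz a p \<oplus>\<^bsub>R\<^esub> c \<odot>\<^bsub>R\<^esub> g Y)" by (rule Fn_form[OF r(1)])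
  have a0: "a \<circ>\<^sub>p shift (- 1) \<noteq> 0" using monic pcompose_shift_nz[of a "- 1"] by auto
  let ?w = "[:\<beta>, \<alpha>:]" and ?u = "[:\<beta> - \<epsilon>, \<alpha>:]"
  have rc: "r \<in> carrier R" by (rule F_closed[OF r(1)])
  have "rp a r (ev a (pz a ?w)) i = (?u \<circ>\<^sub>p shift i) * ev a r i" for i
    using arg_cong[OF rel, of "\<lambda>s. ev a s i"] rc by (simp add: ev_mult rp_pz)
  moreover have "rp a r v i = Polynomial.smult b (v (i - 1)) + ((p \<circ>\<^sub>p shift i) * v i + Polynomial.smult c ((a \<circ>\<^sub>p shift i) * v (i + 1)))" for v i
    unfolding f by (simp add: rp_simps rp_pz rp_gen)
  ultimately have eq: "Polynomial.smult b (ev a (pz a ?w) (i - 1)) + ((p \<circ>\<^sub>p shift i) * ev a (pz a ?w) i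
      + Polynomial.smult c ((a \<circ>\<^sub>p shift i) * ev a (pz a ?w) (i + 1))) = (?u \<circ>\<^sub>p shift i) * ev a r i" for i
    by simp
  have er: "ev a r i = (if i = 1 then [:b:] else if i = 0 then p else if i = - 1 then Polynomial.smult c (a \<circ>\<^sub>p shift (- 1)) else 0)" for i
    unfolding f by (auto simp: ev_add ev_smult ev_pz ev_gens)
  have "Polynomial.smult b ?w = (?u \<circ>\<^sub>p shift 1) * [:b:]" using eq[of 1] by (simp add: er ev_pz)
  then have 1: "b = 0 \<or> \<alpha> = \<epsilon>" by (auto simp: shift_def pcompose_pCons algebra_simps)
  have "p * ?w = ?u * p" using eq[of 0] by (simp add: er ev_pz shift_def pcompose_idR)
  moreover have w: "?w = ?u + [:\<epsilon>:]" by simp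
  ultimately have "p * ?u + p * [:\<epsilon>:] = p * ?u" by (simp only: w distrib_left mult.commute[of ?u p])
  then have "p * [:\<epsilon>:] = 0" by (simp only: add_cancel_left_right)
  then have p: "p = 0" using e by simp
  have "Polynomial.smult c ((a \<circ>\<^sub>p shift (- 1)) * ?w) = (?u \<circ>\<^sub>p shift (- 1)) * Polynomial.smult c (a \<circ>\<^sub>p shift (- 1))"
    using eq[of "- 1"] by (simp add: er ev_pz)
  then have "(a \<circ>\<^sub>p shift (- 1)) * Polynomial.smult c ?w = (a \<circ>\<^sub>p shift (- 1)) * Polynomial.smult c (?u \<circ>\<^sub>p shift (- 1))"
    unfolding mult_smult_right mult.commute[of "?u \<circ>\<^sub>p shift (- 1)" "a \<circ>\<^sub>p shift (- 1)"] .
  then have "Polynomial.smult c ?w = Polynomial.smult c (?u \<circ>\<^sub>p shift (- 1))" using a0 mult_left_cancel by blast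
  then have "c * \<beta> = c * (\<beta> - \<epsilon> - \<alpha>)" by (simp add: shift_def pcompose_pCons)
  then have "c * (\<epsilon> + \<alpha>) = 0" by (simp add: algebra_simps)
  then have 2: "c = 0 \<or> \<alpha> = - \<epsilon>" by (auto simp: add_eq_0_iff)
  have ne: "\<epsilon> \<noteq> - \<epsilon>" using e by (simp add: eq_neg_iff_add_eq_0 flip: mult_2)
  have z0: "0 \<odot>\<^bsub>R\<^esub> g v = \<zero>\<^bsub>R\<^esub>" for v by (rule R.sm_zero[OF gc])
  show ?thesis
  proof (cases "b = 0")
    case True
    then have rr: "r = c \<odot>\<^bsub>R\<^esub> g Y" using f p by (simp add: z0 pz_0)
    then have "c \<noteq> 0" using r(2) z0 by auto
    then show ?thesis using 2 rr by blast
  next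
    case False
    then have "\<alpha> = \<epsilon>" using 1 by blast
    then have "c = 0" using 2 ne by auto
    then have "r = b \<odot>\<^bsub>R\<^esub> g X" using f p by (simp add: z0 pz_0)
    then show ?thesis using False \<open>\<alpha> = \<epsilon>\<close> by blast
  qed
qed

text \<open>The relation \<open>y x = a\<close> leaves only the maps \<open>\<Theta>\<^sub>\<lambda>\<close> and, in the reflective case, \<open>\<Omega> \<Theta>\<^sub>\<lambda>\<close>.\<close>

lemma classification:
  assumes \<phi>: "\<phi> \<in> carrier A"
  shows "(\<exists>b. b \<noteq> 0 \<and> \<phi> = Theta a b) \<or>
    (\<exists>\<rho> c. c \<noteq> 0 \<and> reflective_at a \<rho> \<and> \<phi> = Omega a \<rho> \<otimes>\<^bsub>A\<^esub> Theta a c \<and> \<phi> (g X) = c \<odot>\<^bsub>R\<^esub> g Y \<and>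
      \<phi> (g Y) = ((-1) ^ n * inverse c) \<odot>\<^bsub>R\<^esub> g X \<and> \<phi> (g Z) = pz a [:1 + \<rho>, -1:])"
proof -
  have al: "alghom \<phi>" and inj: "inj_on \<phi> (carrier R)" and ext: "\<phi> \<in> extensional (carrier R)"
    using \<phi> by (auto simp: A_carrier Bij_def bij_betw_def)
  note D = alghomD[OF al]
  have nz: "\<phi> (g v) \<noteq> \<zero>\<^bsub>R\<^esub>" if "v \<noteq> Z" for v
  proof -
    have "ev a (g v) \<noteq> ev a \<zero>\<^bsub>R\<^esub>"
    proof (cases v)
      case X
      have "ev a (g X) 1 \<noteq> ev a \<zero>\<^bsub>R\<^esub> 1" by (simp add: ev_gens ev_zero)
      then show ?thesis using X by auto
    next
      case Y
      have "ev a (g Y) (- 1) \<noteq> ev a \<zero>\<^bsub>R\<^esub> (- 1)"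
        using monic pcompose_shift_nz[of a "- 1"] by (auto simp: ev_gens ev_zero)
      then show ?thesis using Y by auto
    qed (use that in simp)
    then have "g v \<noteq> \<zero>\<^bsub>R\<^esub>" by auto
    then show ?thesis using inj_on_eq_iff[OF inj gc R.zero_closed, of v] D(6) by simp
  qed
  have XF: "\<phi> (g X) \<in> F (int n)" "\<phi> (g Y) \<in> F (int n)" "\<phi> (g Z) \<in> F 2"
    using A_filt[OF \<phi> gc] gens_F(3-5) by blast+
  obtain \<alpha> \<beta> where Zf: "\<phi> (g Z) = pz a [:\<beta>, \<alpha>:]" by (rule F2_form[OF XF(3)])
  note pzf = alghom_pz[OF al Zf]
  have relX: "\<phi> (g X) \<otimes>\<^bsub>R\<^esub> pz a [:\<beta>, \<alpha>:] = pz a [:\<beta> - 1, \<alpha>:] \<otimes>\<^bsub>R\<^esub> \<phi> (g X)"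
    using arg_cong[OF rel(3)[of "[:0, 1:]"], of \<phi>] by (simp add: D pzf sigma_def pcompose_pCons)
  have relY: "\<phi> (g Y) \<otimes>\<^bsub>R\<^esub> pz a [:\<beta>, \<alpha>:] = pz a [:\<beta> - (- 1), \<alpha>:] \<otimes>\<^bsub>R\<^esub> \<phi> (g Y)"
    using arg_cong[OF rel(4)[of "[:0, 1:]"], of \<phi>] by (simp add: D pzf sigma_inv_def pcompose_pCons add.commute)
  have relA: "\<phi> (g Y) \<otimes>\<^bsub>R\<^esub> \<phi> (g X) = pz a (a \<circ>\<^sub>p [:\<beta>, \<alpha>:])"
    using arg_cong[OF rel(2), of \<phi>] by (simp add: D pzf)
  have eX: "\<alpha> = 1 \<and> (\<exists>b. b \<noteq> 0 \<and> \<phi> (g X) = b \<odot>\<^bsub>R\<^esub> g X) \<or> \<alpha> = - 1 \<and> (\<exists>c. c \<noteq> 0 \<and> \<phi> (g X) = c \<odot>\<^bsub>R\<^esub> g Y)"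
    by (rule eigen_form[OF XF(1) nz _ relX]) simp_all
  have eY: "\<alpha> = - 1 \<and> (\<exists>b. b \<noteq> 0 \<and> \<phi> (g Y) = b \<odot>\<^bsub>R\<^esub> g X) \<or> \<alpha> = - (- 1) \<and> (\<exists>c. c \<noteq> 0 \<and> \<phi> (g Y) = c \<odot>\<^bsub>R\<^esub> g Y)"
    by (rule eigen_form[OF XF(2) nz _ relY]) simp_all
  have ne: "(1 :: 'k) \<noteq> - 1" by simp
  from eX show ?thesis
  proof (elim disjE conjE exE)
    fix b assume al1: "\<alpha> = 1" and b: "b \<noteq> 0" "\<phi> (g X) = b \<odot>\<^bsub>R\<^esub> g X"
    then obtain c where c: "\<phi> (g Y) = c \<odot>\<^bsub>R\<^esub> g Y" using eY ne by auto
    have "pz a (Polynomial.smult (c * b) a) = pz a (a \<circ>\<^sub>p [:\<beta>, 1:])"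
      using relA by (simp add: al1 b(2) c R.sm_l R.sm_r sm_sm rel pz_smult mult.commute[of c b])
    then have eq: "Polynomial.smult (c * b) a = a \<circ>\<^sub>p [:\<beta>, 1:]" by (rule pz_inj)
    have "lead_coeff (a \<circ>\<^sub>p [:\<beta>, 1:]) = 1" using lead_coeff_comp[of "[:\<beta>, 1:]" a] monic by simp
    then have cb: "c * b = 1" using arg_cong[OF eq, of lead_coeff] monic by (simp only: lead_coeff_smult) simp
    then have "\<beta> = 0" using shift_invariant[of \<beta>] eq by simp
    have "c = inverse b" using cb b(1) by (simp add: field_simps)
    have "\<phi> r = Theta a b r" if "r \<in> carrier R" for r
    proof (rule alghom_eq[OF al Theta_hom(1)[OF b(1)] _ that])
      show "\<phi> (g v) = Theta a b (g v)" for v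
        using Zf by (cases v) (simp_all add: Theta_hom[OF b(1)] b(2) c \<open>c = inverse b\<close> al1 \<open>\<beta> = 0\<close> pz_Z)
    qed
    then have "\<phi> = Theta a b"
      by (intro extensionalityI[OF ext]) (simp_all add: Theta_def gwa_map_def)
    then show ?thesis using b(1) by blast
  next
    fix c assume al1: "\<alpha> = - 1" and c: "c \<noteq> 0" "\<phi> (g X) = c \<odot>\<^bsub>R\<^esub> g Y"
    then obtain b where b: "\<phi> (g Y) = b \<odot>\<^bsub>R\<^esub> g X" using eY ne by auto
    have "pz a (Polynomial.smult (b * c) (sigma a)) = pz a (a \<circ>\<^sub>p [:\<beta>, -1:])"
      using relA by (simp add: al1 b c(2) R.sm_l R.sm_r sm_sm rel pz_smult mult.commute)
    then have "Polynomial.smult (b * c) (sigma a) = a \<circ>\<^sub>p [:\<beta>, -1:]" by (rule pz_inj)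
    then have "Polynomial.smult (b * c) (sigma a) \<circ>\<^sub>p [:1, 1:] = (a \<circ>\<^sub>p [:\<beta>, -1:]) \<circ>\<^sub>p [:1, 1:]" by simp
    then have eq: "Polynomial.smult (b * c) a = a \<circ>\<^sub>p [:\<beta> - 1, -1:]"
      by (simp add: sigma_def pcompose_smult pcompose_assoc[symmetric] pcompose_pCons pcompose_idR)
    have "lead_coeff (a \<circ>\<^sub>p [:\<beta> - 1, -1:]) = (-1) ^ n" using lead_coeff_comp[of "[:\<beta> - 1, -1:]" a] monic by simp
    then have bc: "b * c = (-1) ^ n" using arg_cong[OF eq, of lead_coeff] monic by (simp only: lead_coeff_smult) simp
    define \<rho> where "\<rho> = \<beta> - 1"
    have refl: "reflective_at a \<rho>" using eq bc by (simp add: reflective_at_def \<rho>_def)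
    have bb: "b = (-1) ^ n * inverse c" using bc c(1) by (simp add: field_simps)
    have zz: "\<phi> (g Z) = pz a [:1 + \<rho>, -1:]" using Zf by (simp add: al1 \<rho>_def)
    note O = Omega_hom[OF refl] and T = Theta_hom[OF c(1)]
    have "\<phi> r = compose (carrier R) (Omega a \<rho>) (Theta a c) r" if "r \<in> carrier R" for r
    proof (rule alghom_eq[OF al alghom_comp[OF O(1) T(1)] _ that])
      show "\<phi> (g v) = compose (carrier R) (Omega a \<rho>) (Theta a c) (g v)" for v
        by (cases v) (simp_all add: compose_eq O(2-4) T(2-4) alghomD(4)[OF O(1)] b c(2) bb zz sm_sm mult.commute)
    qed
    then have "\<phi> = compose (carrier R) (Omega a \<rho>) (Theta a c)"
      by (intro extensionalityI[OF ext]) (simp_all add: compose_def)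
    then have "\<phi> = Omega a \<rho> \<otimes>\<^bsub>A\<^esub> Theta a c" using A_mult[OF Omega_A[OF refl] Theta_A[OF c(1)]] by simp
    then show ?thesis using c refl b zz unfolding bb by blast
  qed
qed

lemma sy_gen: "sy (int (gen_weight n v)) (g v) = lterm (ge n v) 1"
  using sy_word[of "[v]"] by simp

lemma hdet_A:
  assumes \<phi>: "\<phi> \<in> carrier A"
  shows "hdet_fl R F \<phi> = 1"
proof -
  have hom: "\<phi> \<in> ring_hom R R" and lin: "\<And>c r. r \<in> carrier R \<Longrightarrow> \<phi> (c \<odot>\<^bsub>R\<^esub> r) = c \<odot>\<^bsub>R\<^esub> \<phi> r"
    and surj: "\<phi> ` carrier R = carrier R"
    using \<phi> by (auto simp: A_carrier alghom_def Bij_def bij_betw_def)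
  note H = hdet_monomial[OF lin hom A_filt[OF \<phi>] surj]
  have syX: "sy (int n) (c \<odot>\<^bsub>R\<^esub> g X) = lterm (0, int n) c" and syY: "sy (int n) (c \<odot>\<^bsub>R\<^esub> g Y) = lterm (int n, 0) c"
    and syZ: "sy 2 (g Z) = lterm (1, 1) 1" for c
    using sy_smult[OF gens_F(3), of c] sy_smult[OF gens_F(4), of c] sy_gen[of X] sy_gen[of Y] sy_gen[of Z]
    by (simp_all add: ge_def mult_single)
  have nn: "(- int n) div int n = - 1" "int n div int n = 1" using n0 by (simp_all add: zdiv_zminus1_eq_if)
  from classification[OF \<phi>] show ?thesis
  proof (elim disjE conjE exE)
    fix b assume b: "b \<noteq> 0" "\<phi> = Theta a b"
    show ?thesis
    proof (rule H)
      show "monchar n (\<lambda>(p, q). 1 powi p * b powi ((q - p) div int n))" by (rule monchar_power_int) (use b in simp_all)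
      show "(\<lambda>(p, q). 1 powi p * b powi ((q - p) div int n)) (1, 1) = (if False then - 1 else 1)" by simp
      show "sy (int (gen_weight n v)) (\<phi> (g v)) = twist False (\<lambda>(p, q). 1 powi p * b powi ((q - p) div int n)) (lterm (ge n v) 1)" for v
        unfolding twist_term b(2)
        by (cases v) (simp_all add: Theta_hom[OF b(1)] syX syY syZ ge_def kap_def nn power_int_minus)
    qed
  next
    fix \<rho> c assume c: "c \<noteq> 0" "\<phi> (g X) = c \<odot>\<^bsub>R\<^esub> g Y" "\<phi> (g Y) = ((-1) ^ n * inverse c) \<odot>\<^bsub>R\<^esub> g X" "\<phi> (g Z) = pz a [:1 + \<rho>, -1:]"
    let ?\<chi> = "\<lambda>(p, q). (- 1 :: 'k) powi p * c powi ((q - p) div int n)"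
    have "sy 2 (pz a [:1 + \<rho>, -1:]) = lterm (1, 1) (- 1)"
    proof -
      have F0: "\<one>\<^bsub>R\<^esub> \<in> F 0" using F_word[of "[]" 0 1] by (simp add: R.sm_one)
      have 1: "(1 + \<rho>) \<odot>\<^bsub>R\<^esub> \<one>\<^bsub>R\<^esub> \<in> F 1" "(1 + \<rho>) \<odot>\<^bsub>R\<^esub> \<one>\<^bsub>R\<^esub> \<in> F 2"
        using F_smult[OF F0, of "1 + \<rho>"] F_mono[of 0 1] F_mono[of 0 2] by auto
      then have "sy 2 ((1 + \<rho>) \<odot>\<^bsub>R\<^esub> \<one>\<^bsub>R\<^esub>) = 0" using sy_zero_iff[OF 1(2)] by simp
      then show ?thesis
        unfolding pz_reflect F_minus(2)[OF 1(2) gens_F(5)] syZ by (simp add: single_uminus)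
    qed
    note syR = this
    show ?thesis
    proof (rule H)
      show "monchar n ?\<chi>" by (rule monchar_power_int) (use c in simp_all)
      show "?\<chi> (1, 1) = (if True then - 1 else 1)" by simp
      show "sy (int (gen_weight n v)) (\<phi> (g v)) = twist True ?\<chi> (lterm (ge n v) 1)" for v
        unfolding twist_term
        by (cases v) (simp_all add: c(2-4) syX syY syR ge_def kap_def nn power_int_minus)
    qed
  qed
qed

lemma generators:
  shows "\<not> reflective a \<Longrightarrow> carrier A = generate A {Theta a l | l. l \<noteq> 0}"
    and "reflective_at a \<rho> \<Longrightarrow> carrier A = generate A ({Omega a \<rho>} \<union> {Theta a l | l. l \<noteq> 0})"
proof -
  interpret A: group A by (rule A_group)
  assume nr: "\<not> reflective a"
  show "carrier A = generate A {Theta a l | l. l \<noteq> 0}"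
  proof (intro equalityI subsetI)
    fix \<phi> assume "\<phi> \<in> carrier A"
    from classification[OF this] nr obtain b where "b \<noteq> 0" "\<phi> = Theta a b" unfolding reflective_def by blast
    then show "\<phi> \<in> generate A {Theta a l | l. l \<noteq> 0}" by (auto intro: generate.incl)
  next
    fix \<phi> assume "\<phi> \<in> generate A {Theta a l | l. l \<noteq> 0}"
    then show "\<phi> \<in> carrier A" using A.generate_incl[of "{Theta a l | l. l \<noteq> 0}"] Theta_A by blast
  qed
next
  interpret A: group A by (rule A_group)
  assume refl: "reflective_at a \<rho>"
  let ?S = "{Omega a \<rho>} \<union> {Theta a l | l. l \<noteq> 0}"
  show "carrier A = generate A ?S"
  proof (intro equalityI subsetI)
    fix \<phi> assume "\<phi> \<in> carrier A"
    from classification[OF this] show "\<phi> \<in> generate A ?S"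
    proof (elim disjE exE conjE)
      fix b assume "b \<noteq> 0" "\<phi> = Theta a b"
      then show ?thesis by (auto intro: generate.incl)
    next
      fix \<rho>' c assume h: "c \<noteq> 0" "reflective_at a \<rho>'" "\<phi> = Omega a \<rho>' \<otimes>\<^bsub>A\<^esub> Theta a c"
      have "Theta a c \<in> generate A ?S" "Omega a \<rho> \<in> generate A ?S" using h(1) by (auto intro: generate.incl)
      then show ?thesis unfolding h(3) reflective_at_unique[OF h(2) refl] by (intro generate.eng)
    qed
  next
    fix \<phi> assume "\<phi> \<in> generate A ?S"
    moreover have "?S \<subseteq> carrier A" using Theta_A Omega_A[OF refl] by blast
    ultimately show "\<phi> \<in> carrier A" using A.generate_incl[of ?S] by blast
  qed
qed

end

theorem theorem2p4:
  fixes a :: "'k::{alg_closed_field, field_char_0} poly"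
  assumes "lead_coeff a = 1" and "poly a 0 = 0" and "Polynomial.degree a > 2"
  shows "(\<not> reflective a \<longrightarrow>
            carrier (Aut_fl (gwa a) (std_filtration a)) =
            generate (Aut_fl (gwa a) (std_filtration a)) {Theta a l | l. l \<noteq> 0}) \<and>
         (\<forall>\<rho>. reflective_at a \<rho> \<longrightarrow>
            carrier (Aut_fl (gwa a) (std_filtration a)) =
            generate (Aut_fl (gwa a) (std_filtration a)) ({Omega a \<rho>} \<union> {Theta a l | l. l \<noteq> 0})) \<and>
         (\<forall>g\<in>carrier (Aut_fl (gwa a) (std_filtration a)).
            hdet_fl (gwa a) (std_filtration a) g = 1)"
proof -
  interpret classical_gwa a using assms by unfold_locales
  show ?thesis using generators hdet_A by blast
qed

end
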